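(* Let $\mathcal{U}_0$ denote one of the sets $\mathcal{U}_{\mathbf v_0,\mathbf g_0}$, $\mathcal{U}_{\mathbf v_0}$ or $\mathcal{U}_{\mathbf g_0}$. For every $\varepsilon\in(0,1)$ and $\beta>0$, the functional $\mathcal{F}_{\varepsilon,\beta}:\mathcal U\to(-\infty,+\infty]$ has an absolute minimizer in $\mathcal{U}_0$. Moreover, every minimizer $\mathbf v=(v_1,\dots,v_k)$ of $\mathcal{F}_{\varepsilon,\beta}$ in $\mathcal{U}_0$ satisfies $0\le v_i\le 1$ a.e. in $\Omega\times\mathbb{R}^+$, for every $i=1,\dots,k$.
   Context: $\Omega\subset\mathbb{R}^N$ is a bounded domain with smooth boundary, $\mathbb{R}^+=(0,+\infty)$, $k\ge 2$, and $A=(a_{ij})$ is a symmetric $k\times k$ matrix with $a_{ii}=0$ and $a_{ij}>0$ for $i\ne j$. The functions $F_i:\mathbb{R}\to\mathbb{R}$, $i=1,\dots,k$, are continuous on $\mathbb{R}$, differentiable in $[0,1)$, non-decreasing in $(-\infty,0)$, non-increasing in $(1,+\infty)$, and satisfy $F_i'(0)=0$. For $\mathbf v=(v_1,\dots,v_k)$ write $|\partial_t\mathbf v|^2=\sum_i|\partial_t v_i|^2$, $|\nabla\mathbf v|^2=\sum_i|\nabla v_i|^2$ ($\nabla$ is the gradient in $x$), $\langle\mathbf v^2,A\mathbf v^2\rangle=\sum_{i,j=1}^k a_{ij}v_i^2v_j^2$, $F(\mathbf v)=\sum_i F_i(v_i)$. Let $\mathcal{U}=\bigcap_{T>0}H^1(\Omega\times(0,T))^k$.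 For $\varepsilon,\beta>0$ define $\mathcal{F}_{\varepsilon,\beta}:\mathcal{U}\to(-\infty,+\infty]$ by $$\mathcal{F}_{\varepsilon,\beta}(\mathbf v)=\int_0^\infty\!\!\int_\Omega\frac{e^{-t/\varepsilon}}{\varepsilon}\Big\{\varepsilon|\partial_t\mathbf v|^2+|\nabla\mathbf v|^2-2F(\mathbf v)+\frac{\beta}{2}\langle\mathbf v^2,A\mathbf v^2\rangle\Big\}\,dx\,dt .$$ The datum $\mathbf v_0=(v_{01},\dots,v_{0k})\in H^1(\Omega)^k$ satisfies $0\le v_{0i}\le1$ for all $i$ and $v_{0i}v_{0j}=0$ a.e. in $\Omega$ for all $i\neq j$; $\mathbf g_0\in H^{1/2}(\partial\Omega)^k$ is the trace of $\mathbf v_0$ on $\partial\Omega$. In the sense of traces, $\mathcal{U}_{\mathbf v_0}=\{\mathbf v\in\mathcal{U}:\mathbf v(\cdot,0)=\mathbf v_0\}$, $\mathcal{U}_{\mathbf g_0}=\{\mathbf v\in\mathcal{U}:\mathbf v(\cdot,t)=\mathbf g_0\text{ on }\partial\Omega\text{ for a.e. }t>0\}$, and $\mathcal{U}_{\mathbf v_0,\mathbf g_0}=\mathcal{U}_{\mathbf v_0}\cap\mathcal{U}_{\mathbf g_0}$. *)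

theory Defs
  imports "HOL-Analysis.Analysis"
begin

section \<open>Smooth functions and smooth domains\<close>

primrec Ck_on :: "nat \<Rightarrow> 'a::euclidean_space set \<Rightarrow> ('a \<Rightarrow> real) \<Rightarrow> bool" where
  "Ck_on 0 S f \<longleftrightarrow> continuous_on S f"
| "Ck_on (Suc n) S f \<longleftrightarrow>
     (\<forall>x\<in>S. f differentiable (at x)) \<and>
     (\<forall>h. Ck_on n S (\<lambda>x. frechet_derivative f (at x) h))"

definition smooth :: "('a::euclidean_space \<Rightarrow> real) \<Rightarrow> bool" where
  "smooth f \<longleftrightarrow> (\<forall>n. Ck_on n UNIV f)"

definition test_function :: "'a::euclidean_space set \<Rightarrow> ('a \<Rightarrow> real) \<Rightarrow> bool" where
  "test_function U \<phi> \<longleftrightarrow>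
     smooth \<phi> \<and> compact (closure {x. \<phi> x \<noteq> 0}) \<and> closure {x. \<phi> x \<noteq> 0} \<subseteq> U"

text \<open>Near each boundary point, and in suitable orthonormal coordinates with last axis \<open>e\<close>, the
  set is the region strictly above the graph of a smooth function. The function \<open>\<gamma>\<close> is only
  evaluated at the orthogonal projection of \<open>x\<close> onto the hyperplane normal to \<open>e\<close>, so it
  represents a function of the remaining \<open>N - 1\<close> coordinates.\<close>

definition smooth_boundary :: "'a::euclidean_space set \<Rightarrow> bool" where
  "smooth_boundary \<Omega> \<longleftrightarrow>
     (\<forall>p\<in>frontier \<Omega>. \<exists>r>0. \<exists>e \<gamma>. norm e = 1 \<and> smooth \<gamma> \<and>
        \<Omega> \<inter> ball p r = {x \<in> ball p r. \<gamma> (x - (x \<bullet> e) *\<^sub>R e) < x \<bullet> e})"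

definition bounded_smooth_domain :: "'a::euclidean_space set \<Rightarrow> bool" where
  "bounded_smooth_domain \<Omega> \<longleftrightarrow>
     open \<Omega> \<and> connected \<Omega> \<and> \<Omega> \<noteq> {} \<and> bounded \<Omega> \<and> smooth_boundary \<Omega>"

section \<open>Surface measure\<close>

text \<open>The \<open>d\<close>-dimensional Hausdorff measure, normalised so that a set of diameter \<open>\<rho>\<close> is charged
  the volume of the \<open>d\<close>-dimensional ball of radius \<open>\<rho> / 2\<close>. The empty set is treated separately
  because \<open>0 ^ 0 = 1\<close>; with this, \<open>d = 0\<close> gives the counting measure.\<close>

definition hausdorff_gauge :: "nat \<Rightarrow> 'a::euclidean_space set \<Rightarrow> ennreal" where
  "hausdorff_gauge d C =
     (if C = {} then 0 else ennreal (unit_ball_vol (real d) * (diameter C / 2) ^ d))"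

definition hausdorff_pre :: "nat \<Rightarrow> real \<Rightarrow> 'a::euclidean_space set \<Rightarrow> ennreal" where
  "hausdorff_pre d \<delta> X =
     (INF C \<in> {C :: nat \<Rightarrow> 'a set. X \<subseteq> (\<Union>n. C n) \<and> (\<forall>n. bounded (C n) \<and> diameter (C n) \<le> \<delta>)}.
        \<Sum>n. hausdorff_gauge d (C n))"

definition hausdorff_outer :: "nat \<Rightarrow> 'a::euclidean_space set \<Rightarrow> ennreal" where
  "hausdorff_outer d X = (SUP \<delta>\<in>{0<..}. hausdorff_pre d \<delta> X)"

text \<open>Surface measure on \<open>\<partial>\<Omega>\<close>: the restriction of the outer measure above, with \<open>d = N - 1\<close>, to its
  Caratheodory-measurable subsets of \<open>\<partial>\<Omega>\<close>.\<close>

definition surface_measure :: "'a::euclidean_space set \<Rightarrow> 'a measure" where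
  "surface_measure \<Omega> =
     measure_of (frontier \<Omega>)
       (lambda_system (frontier \<Omega>) (Pow (frontier \<Omega>)) (hausdorff_outer (DIM('a) - 1)))
       (hausdorff_outer (DIM('a) - 1))"

text \<open>The measure axioms that \<^const>\<open>measure_of\<close> requires are satisfied, so
  \<^const>\<open>surface_measure\<close> really takes the values of the outer measure.\<close>

lemma hausdorff_pre_subadditive:
  fixes X :: "nat \<Rightarrow> 'a::euclidean_space set"
  shows "hausdorff_pre d \<delta> (\<Union>i. X i) \<le> (\<Sum>i. hausdorff_pre d \<delta> (X i))"
proof (rule ennreal_le_epsilon)
  fix e :: real
  assume e: "0 < e" and fin: "(\<Sum>i. hausdorff_pre d \<delta> (X i)) < top"
  have "\<exists>C. X i \<subseteq> (\<Union>n. C n) \<and> (\<forall>n. bounded (C n) \<and> diameter (C n) \<le> \<delta>) \<and>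
          (\<Sum>n. hausdorff_gauge d (C n)) \<le> hausdorff_pre d \<delta> (X i) + ennreal (e * (1/2) ^ Suc i)" for i
  proof -
    have "hausdorff_pre d \<delta> (X i) < top"
      using fin ennreal_suminf_lessD by blast
    then have "hausdorff_pre d \<delta> (X i) < hausdorff_pre d \<delta> (X i) + ennreal (e * (1/2) ^ Suc i)"
      using e by (cases "hausdorff_pre d \<delta> (X i)") (auto simp: ennreal_plus[symmetric] ennreal_less_iff
          simp del: ennreal_plus)
    then show ?thesis
      unfolding hausdorff_pre_def[of d \<delta> "X i"] INF_less_iff
      by (auto simp: hausdorff_pre_def[symmetric] intro: less_imp_le)
  qed
  then obtain C where C: "\<And>i. X i \<subseteq> (\<Union>n. C i n)"
      "\<And>i n. bounded (C i n)" "\<And>i n. diameter (C i n) \<le> \<delta>"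
      "\<And>i. (\<Sum>n. hausdorff_gauge d (C i n))
            \<le> hausdorff_pre d \<delta> (X i) + ennreal (e * (1/2) ^ Suc i)"
    by metis
  define D where "D m = case_prod C (prod_decode m)" for m
  have "(\<Union>i. X i) \<subseteq> (\<Union>m. D m)"
  proof
    fix x assume "x \<in> (\<Union>i. X i)"
    then obtain i n where "x \<in> C i n" using C(1) by blast
    then have "x \<in> D (prod_encode (i, n))" by (simp add: D_def)
    then show "x \<in> (\<Union>m. D m)" by blast
  qed
  moreover have "bounded (D m) \<and> diameter (D m) \<le> \<delta>" for m
    using C(2,3) by (simp add: D_def split: prod.split)
  ultimately have "hausdorff_pre d \<delta> (\<Union>i. X i) \<le> (\<Sum>m. hausdorff_gauge d (D m))"
    unfolding hausdorff_pre_def by (intro INF_lower) auto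
  also have "\<dots> = (\<Sum>i. \<Sum>n. hausdorff_gauge d (C i n))"
    unfolding D_def
    using suminf_ennreal_2dimen[of "\<lambda>i. \<Sum>n. hausdorff_gauge d (C i n)"
        "\<lambda>p. hausdorff_gauge d (case_prod C p)"]
    by simp
  also have "\<dots> \<le> (\<Sum>i. hausdorff_pre d \<delta> (X i) + ennreal (e * (1/2) ^ Suc i))"
    by (intro suminf_le C(4)) auto
  also have "\<dots> = (\<Sum>i. hausdorff_pre d \<delta> (X i)) + (\<Sum>i. ennreal (e * (1/2) ^ Suc i))"
    by (intro suminf_add[symmetric]) auto
  also have "(\<Sum>i. ennreal (e * (1/2) ^ Suc i)) = ennreal e"
    using e power_half_series sums_mult[OF power_half_series, of e]
    by (intro suminf_ennreal_eq) auto
  finally show "hausdorff_pre d \<delta> (\<Union>i. X i) \<le> (\<Sum>i. hausdorff_pre d \<delta> (X i)) + ennreal e" .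
qed

lemma outer_measure_space_hausdorff:
  fixes S :: "'a::euclidean_space set"
  shows "outer_measure_space (Pow S) (hausdorff_outer d)"
  unfolding outer_measure_space_def
proof (intro conjI)
  have "hausdorff_pre d \<delta> ({} :: 'a set) = 0" if "\<delta> > 0" for \<delta>
  proof -
    have "hausdorff_pre d \<delta> ({} :: 'a set) \<le> (\<Sum>n. hausdorff_gauge d ((\<lambda>_. {}) n :: 'a set))"
      unfolding hausdorff_pre_def using that by (intro INF_lower) auto
    then show ?thesis by (simp add: hausdorff_gauge_def)
  qed
  then have "hausdorff_outer d ({} :: 'a set) = 0"
    unfolding hausdorff_outer_def
    by (metis (mono_tags, lifting) SUP_least greaterThan_iff le_zero_eq order_refl)
  then show "positive (Pow S) (hausdorff_outer d)"
    by (simp add: positive_def)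
  show "increasing (Pow S) (hausdorff_outer d)"
    unfolding increasing_def hausdorff_outer_def hausdorff_pre_def
    by (intro ballI impI SUP_mono' INF_superset_mono) auto
  show "countably_subadditive (Pow S) (hausdorff_outer d)"
    unfolding countably_subadditive_def
  proof (intro allI impI)
    fix X :: "nat \<Rightarrow> 'a set"
    have "hausdorff_pre d \<delta> (\<Union>i. X i) \<le> (\<Sum>i. hausdorff_outer d (X i))" if "\<delta> > 0" for \<delta>
    proof -
      have "hausdorff_pre d \<delta> (\<Union>i. X i) \<le> (\<Sum>i. hausdorff_pre d \<delta> (X i))"
        by (rule hausdorff_pre_subadditive)
      also have "\<dots> \<le> (\<Sum>i. hausdorff_outer d (X i))"
        unfolding hausdorff_outer_def using that by (intro suminf_le SUP_upper) auto
      finally show ?thesis .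
    qed
    then show "hausdorff_outer d (\<Union>i. X i) \<le> (\<Sum>i. hausdorff_outer d (X i))"
      unfolding hausdorff_outer_def[of d "\<Union>i. X i"] by (intro SUP_least) auto
  qed
qed

lemma
  fixes \<Omega> :: "'a::euclidean_space set"
  defines "L \<equiv> lambda_system (frontier \<Omega>) (Pow (frontier \<Omega>)) (hausdorff_outer (DIM('a) - 1))"
  shows space_surface_measure: "space (surface_measure \<Omega>) = frontier \<Omega>"
    and sets_surface_measure: "sets (surface_measure \<Omega>) = L"
    and emeasure_surface_measure:
      "X \<in> L \<Longrightarrow> emeasure (surface_measure \<Omega>) X = hausdorff_outer (DIM('a) - 1) X"
proof -
  have ms: "measure_space (frontier \<Omega>) L (hausdorff_outer (DIM('a) - 1))"
    unfolding L_def
    by (intro sigma_algebra.caratheodory_lemma sigma_algebra_Pow outer_measure_space_hausdorff)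
  then interpret sigma_algebra "frontier \<Omega>" L
    by (simp add: measure_space_def)
  have sm: "surface_measure \<Omega> = measure_of (frontier \<Omega>) L (hausdorff_outer (DIM('a) - 1))"
    by (simp add: surface_measure_def L_def)
  show "space (surface_measure \<Omega>) = frontier \<Omega>" "sets (surface_measure \<Omega>) = L"
    by (simp_all add: sm)
  show "emeasure (surface_measure \<Omega>) X = hausdorff_outer (DIM('a) - 1) X" if "X \<in> L"
    using ms that by (simp add: sm emeasure_measure_of_sigma measure_space_def sigma_algebra_axioms)
qed

section \<open>Sobolev functions and traces\<close>

text \<open>Elements of function spaces are everywhere defined representatives; only their values on the
  set under consideration matter.\<close>

definition L2_space :: "'a measure \<Rightarrow> ('a \<Rightarrow> real) set" where
  "L2_space M = {u \<in> borel_measurable M. integrable M (\<lambda>x. (u x)\<^sup>2)}"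

definition has_weak_deriv ::
  "'a::euclidean_space set \<Rightarrow> 'a \<Rightarrow> ('a \<Rightarrow> real) \<Rightarrow> ('a \<Rightarrow> real) \<Rightarrow> bool" where
  "has_weak_deriv U b u g \<longleftrightarrow>
     (\<forall>K. compact K \<and> K \<subseteq> U \<longrightarrow> u absolutely_integrable_on K \<and> g absolutely_integrable_on K) \<and>
     (\<forall>\<phi>. test_function U \<phi> \<longrightarrow>
        (\<integral>x. u x * frechet_derivative \<phi> (at x) b \<partial>lebesgue_on U) = - (\<integral>x. g x * \<phi> x \<partial>lebesgue_on U))"

text \<open>Weak derivatives are unique up to null sets, so the choice is immaterial.\<close>

definition weak_deriv :: "'a::euclidean_space set \<Rightarrow> 'a \<Rightarrow> ('a \<Rightarrow> real) \<Rightarrow> 'a \<Rightarrow> real" where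
  "weak_deriv U b u = (SOME g. has_weak_deriv U b u g)"

definition H1_space :: "'a::euclidean_space set \<Rightarrow> ('a \<Rightarrow> real) set" where
  "H1_space U = {u \<in> L2_space (lebesgue_on U).
     \<forall>b\<in>Basis. \<exists>g\<in>L2_space (lebesgue_on U). has_weak_deriv U b u g}"

definition H1_norm :: "'a::euclidean_space set \<Rightarrow> ('a \<Rightarrow> real) \<Rightarrow> real" where
  "H1_norm U u = sqrt ((\<integral>x. (u x)\<^sup>2 \<partial>lebesgue_on U) +
     (\<Sum>b\<in>Basis. \<integral>x. (weak_deriv U b u x)\<^sup>2 \<partial>lebesgue_on U))"

text \<open>The trace operator is the bounded linear extension to \<open>H\<^sup>1(U)\<close> of the restriction map
  \<open>w \<mapsto> w|\<^bsub>\<Gamma>\<^esub>\<close>, defined for \<open>w \<in> H\<^sup>1(U) \<inter> C(closure U)\<close>, with values in \<open>L\<^sup>2(\<Gamma>)\<close>. The part \<open>\<Gamma>\<close> of the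
  boundary is given by a measure \<open>M\<close> and a map \<open>j\<close> from the space of \<open>M\<close> onto \<open>\<Gamma>\<close>.\<close>

definition has_trace ::
  "'a::euclidean_space set \<Rightarrow> 'b measure \<Rightarrow> ('b \<Rightarrow> 'a) \<Rightarrow> ('a \<Rightarrow> real) \<Rightarrow> ('b \<Rightarrow> real) \<Rightarrow> bool" where
  "has_trace U M j u g \<longleftrightarrow> u \<in> H1_space U \<and> g \<in> L2_space M \<and>
     (\<exists>w. (\<forall>n. w n \<in> H1_space U \<and> continuous_on (closure U) (w n) \<and> w n \<circ> j \<in> L2_space M) \<and>
          (\<lambda>n::nat. H1_norm U (\<lambda>x. w n x - u x)) \<longlonglongrightarrow> 0 \<and>
          (\<lambda>n. \<integral>y. (w n (j y) - g y)\<^sup>2 \<partial>M) \<longlonglongrightarrow> 0)"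

text \<open>The trace space \<open>H\<^sup>1\<^sup>/\<^sup>2(\<partial>\<Omega>)\<close> is the range of the trace operator on \<open>\<partial>\<Omega>\<close>, so
  \<open>g\<close> below belongs to it by definition.\<close>

definition boundary_trace :: "'a::euclidean_space set \<Rightarrow> ('a \<Rightarrow> real) \<Rightarrow> ('a \<Rightarrow> real) \<Rightarrow> bool" where
  "boundary_trace \<Omega> u g \<longleftrightarrow> has_trace \<Omega> (surface_measure \<Omega>) (\<lambda>x. x) u g"

definition initial_trace ::
  "'a::euclidean_space set \<Rightarrow> real \<Rightarrow> ('a \<times> real \<Rightarrow> real) \<Rightarrow> ('a \<Rightarrow> real) \<Rightarrow> bool" where
  "initial_trace \<Omega> T v g \<longleftrightarrow> has_trace (\<Omega> \<times> {0<..<T}) (lebesgue_on \<Omega>) (\<lambda>x. (x, 0)) v g"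

section \<open>The functional and the admissible classes\<close>

text \<open>Space-time points are pairs \<open>(x, t)\<close>, and a vector-valued function \<open>v\<close> is given by its components
  \<open>v i\<close>, where \<open>i\<close> ranges over a type with \<open>k\<close> elements.\<close>

definition \<U> :: "'a::euclidean_space set \<Rightarrow> ('k \<Rightarrow> 'a \<times> real \<Rightarrow> real) set" where
  "\<U> \<Omega> = {v. \<forall>T>0. \<forall>i. v i \<in> H1_space (\<Omega> \<times> {0<..<T})}"

definition \<U>_initial ::
  "'a::euclidean_space set \<Rightarrow> ('k \<Rightarrow> 'a \<Rightarrow> real) \<Rightarrow> ('k \<Rightarrow> 'a \<times> real \<Rightarrow> real) set" where
  "\<U>_initial \<Omega> v0 = {v \<in> \<U> \<Omega>. \<forall>T>0. \<forall>i. initial_trace \<Omega> T (v i) (v0 i)}"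

definition \<U>_boundary ::
  "'a::euclidean_space set \<Rightarrow> ('k \<Rightarrow> 'a \<Rightarrow> real) \<Rightarrow> ('k \<Rightarrow> 'a \<times> real \<Rightarrow> real) set" where
  "\<U>_boundary \<Omega> g0 =
     {v \<in> \<U> \<Omega>. AE t in lebesgue. t > 0 \<longrightarrow> (\<forall>i. boundary_trace \<Omega> (\<lambda>x. v i (x, t)) (g0 i))}"

definition time_deriv :: "'a::euclidean_space set \<Rightarrow> ('a \<times> real \<Rightarrow> real) \<Rightarrow> 'a \<times> real \<Rightarrow> real" where
  "time_deriv \<Omega> u = weak_deriv (\<Omega> \<times> {0<..}) (0, 1) u"

definition grad_sq :: "'a::euclidean_space set \<Rightarrow> ('a \<times> real \<Rightarrow> real) \<Rightarrow> 'a \<times> real \<Rightarrow> real" where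
  "grad_sq \<Omega> u p = (\<Sum>b\<in>Basis. (weak_deriv (\<Omega> \<times> {0<..}) (b, 0) u p)\<^sup>2)"

definition energy_integrand ::
  "'a::euclidean_space set \<Rightarrow> real^'k^'k \<Rightarrow> ('k::finite \<Rightarrow> real \<Rightarrow> real) \<Rightarrow> real \<Rightarrow> real \<Rightarrow>
   ('k \<Rightarrow> 'a \<times> real \<Rightarrow> real) \<Rightarrow> 'a \<times> real \<Rightarrow> real" where
  "energy_integrand \<Omega> A F \<epsilon> \<beta> v p =
     exp (- snd p / \<epsilon>) / \<epsilon> *
       (\<epsilon> * (\<Sum>i\<in>UNIV. (time_deriv \<Omega> (v i) p)\<^sup>2)
        + (\<Sum>i\<in>UNIV. grad_sq \<Omega> (v i) p)
        - 2 * (\<Sum>i\<in>UNIV. F i (v i p))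
        + \<beta> / 2 * (\<Sum>i\<in>UNIV. \<Sum>j\<in>UNIV. A $ i $ j * (v i p)\<^sup>2 * (v j p)\<^sup>2))"

text \<open>Each \<open>F i\<close> is bounded above, so the negative part of the integrand has finite integral and the
  difference below is never of the form \<open>\<infinity> - \<infinity>\<close>.\<close>

definition energy ::
  "'a::euclidean_space set \<Rightarrow> real^'k^'k \<Rightarrow> ('k::finite \<Rightarrow> real \<Rightarrow> real) \<Rightarrow> real \<Rightarrow> real \<Rightarrow>
   ('k \<Rightarrow> 'a \<times> real \<Rightarrow> real) \<Rightarrow> ereal" where
  "energy \<Omega> A F \<epsilon> \<beta> v =
     enn2ereal (\<integral>\<^sup>+p. ennreal (energy_integrand \<Omega> A F \<epsilon> \<beta> v p) \<partial>lebesgue_on (\<Omega> \<times> {0<..}))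
     - enn2ereal (\<integral>\<^sup>+p. ennreal (- energy_integrand \<Omega> A F \<epsilon> \<beta> v p) \<partial>lebesgue_on (\<Omega> \<times> {0<..}))"

end

theory Submission imports Defs "HOL-Library.Diagonal_Subsequence" begin

text \<open>Since \<open>F i s \<le> F i (clamp01 s)\<close> and \<open>A\<close> has nonnegative entries, truncating a competitor to \<open>[0, 1]\<close> does not increase any term of the energy, and truncation preserves the three
  classes. Hence there is a minimizing sequence with values in \<open>[0, 1]\<close>. Rellich's theorem gives an a.e.
  convergent subsequence, along which the potential part of the energy converges by dominated
  convergence. The remaining part is quadratic: by the parallelogram identity, near-minimizers among the
  iterated midpoints of the tails of the sequence form a Cauchy sequence (Mazur's lemma), hence they
  converge strongly to the same limit, which therefore is admissible and minimizing. Conversely, a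
  minimizer \<open>v\<close> and its truncation have the same energy, so \<open>w = v - clamp01 v\<close> has gradient zero. It also
  has trace zero on the initial or lateral boundary, and following a straight line to that boundary
  shows \<open>w = 0\<close>.

  All facts about Sobolev functions rest on the identity
  \<open>u (x + e) - u x = \<integral>\<^sub>0\<^sup>1 g (x + s e) ds\<close> for a.e. \<open>x\<close>, which characterizes the weak derivative \<open>g\<close> of \<open>u\<close> in
  direction \<open>e\<close>.\<close>

text \<open>The potential is not convex, so the direct method cannot be run on the energy as a
  whole, and potentials of midpoints are never compared. If the minimizing sequence
  \<open>v n\<close> tends a.e. to \<open>V\<close>, its quadratic parts are asymptotically at most
  \<open>m - pot_energy V\<close>, where \<open>m\<close> is the infimum. Near-minimal midpoints of
  the tails obey the same bound and still tend a.e. to \<open>V\<close>; their strong limit passes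
  the bound to \<open>V\<close> itself. Strong convergence matters because a trace is a limit of
  restrictions of continuous functions, a relation that passes to norm limits by a diagonal choice.
  For the same reason truncation of traces and the case of zero trace are proved on the
  approximating functions. The weight \<open>exp (- t / \<epsilon>) / \<epsilon>\<close> has finite
  integral over the half cylinder since \<Omega> is bounded, so the lower bound of the potential
  costs only a constant. For times below \<open>T\<close> the weight is at least
  \<open>exp (- T / \<epsilon>)\<close> because \<epsilon> < 1, so weighted convergence gives
  convergence in \<open>H1\<close> of every bounded cylinder, which is where admissibility is
  tested.\<close>

section \<open>Smooth functions and flat cut-offs\<close>

lemma Ck_on_Suc_imp: "Ck_on (Suc n) UNIV f \<Longrightarrow> Ck_on n UNIV f"
proof (induction n arbitrary: f)
  case 0
  then show ?case
    by (auto simp: continuous_on_eq_continuous_at intro!: differentiable_imp_continuous_within)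
next
  case (Suc n)
  then show ?case by (metis Ck_on.simps(2))
qed

lemma Ck_on_add:
  "Ck_on n UNIV f \<Longrightarrow> Ck_on n UNIV g \<Longrightarrow> Ck_on n UNIV (\<lambda>x. f x + g x)"
proof (induction n arbitrary: f g)
  case 0
  then show ?case by (auto intro: continuous_on_add)
next
  case (Suc n)
  have "((\<lambda>x. f x + g x) has_derivative
      (\<lambda>h. frechet_derivative f (at x) h + frechet_derivative g (at x) h)) (at x)" for x
    using Suc.prems by (intro has_derivative_add) (auto simp: frechet_derivative_works[symmetric])
  from frechet_derivative_at[OF this]
  have "frechet_derivative (\<lambda>x. f x + g x) (at x) h =
      frechet_derivative f (at x) h + frechet_derivative g (at x) h" for x h
    by metis
  then show ?case using Suc by auto
qed

lemma Ck_on_mult: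
  "Ck_on n UNIV f \<Longrightarrow> Ck_on n UNIV g \<Longrightarrow> Ck_on n UNIV (\<lambda>x. f x * g x)"
proof (induction n arbitrary: f g)
  case 0
  then show ?case by (auto intro: continuous_on_mult)
next
  case (Suc n)
  have d: "f differentiable (at x)" "g differentiable (at x)" for x
    using Suc.prems by auto
  have "((\<lambda>x. f x * g x) has_derivative
      (\<lambda>h. f x * frechet_derivative g (at x) h + frechet_derivative f (at x) h * g x)) (at x)" for x
    using d by (intro has_derivative_mult) (auto simp: frechet_derivative_works[symmetric])
  from frechet_derivative_at[OF this]
  have "frechet_derivative (\<lambda>x. f x * g x) (at x) h =
      f x * frechet_derivative g (at x) h + frechet_derivative f (at x) h * g x" for x h
    by (metis)
  moreover have "Ck_on n UNIV f" "Ck_on n UNIV g"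
    using Suc.prems Ck_on_Suc_imp by blast+
  ultimately show ?case using Suc by (auto intro!: Ck_on_add differentiable_mult)
qed

lemma has_derivative_translate:
  fixes f :: "'a::euclidean_space \<Rightarrow> real"
  assumes "f differentiable (at (x + z))"
  shows "((\<lambda>x. f (x + z)) has_derivative frechet_derivative f (at (x + z))) (at x)"
proof -
  have "(f has_derivative frechet_derivative f (at (x + z))) (at (x + z))"
    using assms by (simp add: frechet_derivative_works[symmetric])
  moreover have "((\<lambda>x. x + z) has_derivative (\<lambda>h. h)) (at x)"
    by (auto intro!: derivative_eq_intros)
  ultimately show ?thesis
    using diff_chain_at[of "\<lambda>x. x + z" "\<lambda>h. h" x f] by (simp add: o_def)
qed

lemma frechet_derivative_translate:
  fixes f :: "'a::euclidean_space \<Rightarrow> real"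
  assumes "f differentiable (at (x + z))"
  shows "frechet_derivative (\<lambda>x. f (x + z)) (at x) = frechet_derivative f (at (x + z))"
  using frechet_derivative_at[OF has_derivative_translate[OF assms]] by simp

lemma Ck_on_translate:
  "Ck_on n UNIV f \<Longrightarrow> Ck_on n UNIV (\<lambda>x. f (x + z))"
proof (induction n arbitrary: f)
  case 0
  then show ?case by (auto intro!: continuous_on_compose2[of UNIV f] continuous_intros)
next
  case (Suc n)
  have d: "((\<lambda>x. f (x + z)) has_derivative frechet_derivative f (at (x + z))) (at x)" for x
    using Suc.prems by (intro has_derivative_translate) auto
  have "Ck_on n UNIV (\<lambda>x. frechet_derivative f (at (x + z)) h)" for h
    using Suc.IH[of "\<lambda>x. frechet_derivative f (at x) h"] Suc.prems by simp
  then show ?case using d frechet_derivative_at[OF d, symmetric] by (auto simp: differentiable_def)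
qed

lemma Ck_on_const: "Ck_on n UNIV (\<lambda>x. c)"
  by (induction n arbitrary: c) auto

text \<open>The family \<open>r\<close> lists a function with all its derivatives. Differentiating
  in direction \<open>h\<close> turns \<open>m\<close> into \<open>Suc m\<close> and produces the
  constant factor \<open>h \<bullet> b\<close>; the free constant \<open>c\<close> absorbs it, so
  the induction closes.\<close>

lemma Ck_on_affine_compose:
  fixes r :: "nat \<Rightarrow> real \<Rightarrow> real" and b :: "'a::euclidean_space"
  assumes r: "\<And>n t. (r n has_real_derivative r (Suc n) t) (at t)"
  shows "Ck_on n UNIV (\<lambda>x. c * r m (x \<bullet> b + a))"
proof (induction n arbitrary: c m)
  case 0
  have "continuous_on UNIV (r m)"
    using r by (meson DERIV_continuous continuous_at_imp_continuous_on)
  then show ?case by (auto intro!: continuous_intros continuous_on_compose2[of UNIV "r m"])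
next
  case (Suc n)
  have d: "((\<lambda>x. c * r m (x \<bullet> b + a)) has_derivative (\<lambda>h. c * (h \<bullet> b) * r (Suc m) (x \<bullet> b + a))) (at x)" for x
  proof -
    have "((\<lambda>x. x \<bullet> b + a) has_derivative (\<lambda>h. h \<bullet> b)) (at x)"
      by (auto intro!: derivative_eq_intros)
    from has_derivative_compose[OF this, of "r m" "\<lambda>h. h * r (Suc m) (x \<bullet> b + a)"] r[of m "x \<bullet> b + a"]
    have "((\<lambda>x. r m (x \<bullet> b + a)) has_derivative (\<lambda>h. (h \<bullet> b) * r (Suc m) (x \<bullet> b + a))) (at x)"
      by (metis (no_types, lifting) ext has_field_derivative_def mult.commute)
    from has_derivative_mult_right[OF this, of c] show ?thesis by (simp add: mult.assoc)
  qed
  show ?case using Suc[of _ "Suc m"] frechet_derivative_at[OF d, symmetric] d by (auto simp: differentiable_def)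
qed

text \<open>\<open>flat n\<close> is the \<open>n\<close>-th derivative of \<open>exp (- 1 / t)\<close>, extended by \<open>0\<close> to \<open>t \<le> 0\<close>.\<close>

primrec flat_poly :: "nat \<Rightarrow> real poly" where
  "flat_poly 0 = 1"
| "flat_poly (Suc n) = [:0, 0, 1:] * (flat_poly n - pderiv (flat_poly n))"

definition flat :: "nat \<Rightarrow> real \<Rightarrow> real" where
  "flat n t = (if t > 0 then poly (flat_poly n) (inverse t) * exp (- inverse t) else 0)"

lemma poly_times_exp_minus_tendsto_0:
  "((\<lambda>s::real. poly Q s * exp (- s)) \<longlongrightarrow> 0) at_top"
proof -
  have "((\<lambda>s. \<Sum>i\<le>degree Q. coeff Q i * (s ^ i / exp s)) \<longlongrightarrow> (\<Sum>i\<le>degree Q. coeff Q i * 0)) at_top"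
    by (intro tendsto_sum tendsto_mult tendsto_const tendsto_power_div_exp_0)
  then show ?thesis
    by (simp add: poly_altdef sum_distrib_right exp_minus divide_inverse mult.assoc)
qed

lemma flat_has_real_derivative: "(flat n has_real_derivative flat (Suc n) t) (at t)"
proof -
  consider "t > 0" | "t < 0" | "t = 0" by linarith
  then show ?thesis
  proof cases
    case 1
    \<comment> \<open>With s = 1/t and ' the derivative in s, the t-derivative of P(s) exp(-s) is
      s^2 (P(s) - P'(s)) exp(-s), which is the recursion of \<open>flat_poly\<close>.\<close>
    have "((\<lambda>t. poly (flat_poly n) (inverse t) * exp (- inverse t)) has_real_derivative flat (Suc n) t) (at t)"
      using 1 by (auto intro!: derivative_eq_intros simp: flat_def field_simps power2_eq_square)
    moreover have "\<forall>\<^sub>F s in nhds t. poly (flat_poly n) (inverse s) * exp (- inverse s) = flat n s"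
      using eventually_nhds_in_open[of "{0<..}" t] 1
      by (auto simp: flat_def elim!: eventually_mono)
    ultimately show ?thesis by (subst DERIV_cong_ev[OF refl _ refl]) (auto simp: eventually_nhds_conv_at elim: eventually_mono)
  next
    case 2
    have "\<forall>\<^sub>F s in nhds t. 0 = flat n s"
      using eventually_nhds_in_open[of "{..<0}" t] 2
      by (auto simp: flat_def elim!: eventually_mono)
    moreover have "((\<lambda>t. 0) has_real_derivative flat (Suc n) t) (at t)"
      using 2 by (auto simp: flat_def)
    ultimately show ?thesis by (subst DERIV_cong_ev[OF refl _ refl, of _ "\<lambda>_. 0"]) (auto elim: eventually_mono)
  next
    case 3
    \<comment> \<open>The difference quotient at 0 divides by \<open>s\<close>, that is, it
      multiplies the polynomial in 1/s by one more power of its variable; exponential decay still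
      wins.\<close>
    have "((\<lambda>s. poly ([:0, 1:] * flat_poly n) (inverse s) * exp (- inverse s)) \<longlongrightarrow> 0) (at_right 0)"
      using filterlim_compose[OF poly_times_exp_minus_tendsto_0 filterlim_inverse_at_top_right] .
    moreover have "\<forall>\<^sub>F s in at_right (0::real). s > 0" by (simp add: eventually_at_right_less)
    ultimately have "((\<lambda>s. (flat n s - flat n 0) / (s - 0)) \<longlongrightarrow> 0) (at_right 0)"
      by (elim Lim_transform_eventually) (auto elim!: eventually_mono simp: flat_def field_simps)
    moreover have "((\<lambda>s. (flat n s - flat n 0) / (s - 0)) \<longlongrightarrow> 0) (at_left 0)"
      by (rule tendsto_eventually) (auto simp: eventually_at_filter flat_def)
    ultimately show ?thesis using 3
      by (simp add: has_field_derivative_iff filterlim_at_split) (simp add: flat_def)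
  qed
qed

lemma smooth_mult: "smooth f \<Longrightarrow> smooth g \<Longrightarrow> smooth (\<lambda>x. f x * g x)"
  by (simp add: smooth_def Ck_on_mult)

lemma smooth_prod:
  "finite I \<Longrightarrow> (\<And>i. i \<in> I \<Longrightarrow> smooth (f i)) \<Longrightarrow> smooth (\<lambda>x. \<Prod>i\<in>I. f i x)"
  by (induction I rule: finite_induct) (auto intro: smooth_mult, simp add: smooth_def Ck_on_const)

lemma smooth_flat: "smooth (\<lambda>x. flat 0 (x \<bullet> b + a))"
  using Ck_on_affine_compose[of flat _ 1 0 b a] flat_has_real_derivative by (simp add: smooth_def)

lemma flat_bounds: "0 \<le> flat 0 t" "flat 0 t \<le> 1" "flat 0 t = 0 \<longleftrightarrow> t \<le> 0"
  by (auto simp: flat_def)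

lemma flat_scaled_tendsto: "(\<lambda>k. flat 0 (real (Suc k) * t)) \<longlonglongrightarrow> indicator {0<..} t"
proof (cases "t > 0")
  case True
  have "(\<lambda>k. exp (- (inverse (real (Suc k)) * inverse t))) \<longlonglongrightarrow> exp (- (0 * inverse t))"
    by (intro tendsto_intros LIMSEQ_inverse_real_of_nat)
  then show ?thesis using True by (simp add: flat_def)
next
  case False
  then have "flat 0 (real (Suc k) * t) = 0" for k by (simp add: flat_bounds mult_nonneg_nonpos)
  then show ?thesis using False by simp
qed

text \<open>Smooth functions increasing to the indicator of a box separate locally integrable functions.\<close>

lemma ex_test_functions_box:
  fixes a b :: "'a::euclidean_space"
  assumes "cbox a b \<subseteq> U"
  obtains \<phi> where "\<And>k. test_function U (\<phi> k)" "\<And>k x. 0 \<le> \<phi> k x \<and> \<phi> k x \<le> 1"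
    "\<And>x. (\<lambda>k::nat. \<phi> k x) \<longlonglongrightarrow> indicator (box a b) x" "\<And>k x. x \<notin> box a b \<Longrightarrow> \<phi> k x = 0"
proof
  \<comment> \<open>One factor per face of the box: \<open>flat 0\<close> at \<open>Suc k\<close>
    times the signed distance to the face is 0 outside and tends to 1 inside.\<close>
  define \<phi> where "\<phi> k x = (\<Prod>i\<in>Basis. flat 0 (real (Suc k) * (x \<bullet> i - a \<bullet> i)) * flat 0 (real (Suc k) * (b \<bullet> i - x \<bullet> i)))"
    for k and x :: 'a
  show "0 \<le> \<phi> k x \<and> \<phi> k x \<le> 1" for k x
    unfolding \<phi>_def by (auto intro!: prod_nonneg prod_le_1 mult_le_one simp: flat_bounds)
  show lim: "(\<lambda>k. \<phi> k x) \<longlonglongrightarrow> indicator (box a b) x" for x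
  proof -
    have "(\<lambda>k. \<phi> k x) \<longlonglongrightarrow> (\<Prod>i\<in>Basis. indicator {0<..} (x \<bullet> i - a \<bullet> i) * indicator {0<..} (b \<bullet> i - x \<bullet> i))"
      unfolding \<phi>_def by (intro tendsto_prod tendsto_mult flat_scaled_tendsto)
    also have "(\<Prod>i\<in>Basis. indicator {0<..} (x \<bullet> i - a \<bullet> i) * indicator {0<..} (b \<bullet> i - x \<bullet> i)) = (indicator (box a b) x :: real)"
      by (auto simp: indicator_def mem_box prod_zero_iff)
    finally show ?thesis .
  qed
  show zero: "\<phi> k x = 0" if "x \<notin> box a b" for k x
  proof -
    from that obtain i where "i \<in> Basis" "x \<bullet> i \<le> a \<bullet> i \<or> b \<bullet> i \<le> x \<bullet> i"
      by (force simp: mem_box)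
    then have "\<exists>i\<in>Basis. flat 0 (real (Suc k) * (x \<bullet> i - a \<bullet> i)) * flat 0 (real (Suc k) * (b \<bullet> i - x \<bullet> i)) = 0"
      by (intro bexI[of _ i]) (auto simp: flat_bounds mult_nonneg_nonpos)
    then show ?thesis unfolding \<phi>_def by (simp add: prod_zero_iff)
  qed
  show "test_function U (\<phi> k)" for k
  proof -
    have "smooth (\<phi> k)"
    proof -
      have "smooth (\<lambda>x. flat 0 (x \<bullet> (real (Suc k) *\<^sub>R i) + - (real (Suc k) * (a \<bullet> i))))" for i :: 'a
        by (rule smooth_flat)
      moreover have "smooth (\<lambda>x. flat 0 (x \<bullet> (- real (Suc k) *\<^sub>R i) + (real (Suc k) * (b \<bullet> i))))" for i :: 'a
        by (rule smooth_flat)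
      ultimately show ?thesis
        unfolding \<phi>_def by (intro smooth_prod smooth_mult) (simp_all add: algebra_simps)
    qed
    \<comment> \<open>The support may reach the faces, which is why the closed box has to lie in
      \<open>U\<close>.\<close>
    moreover have "closure {x. \<phi> k x \<noteq> 0} \<subseteq> cbox a b"
      using zero box_subset_cbox[of a b] by (intro closure_minimal) (auto intro: closed_cbox)
    ultimately show ?thesis using assms unfolding test_function_def
      by (metis bounded_cbox bounded_subset closed_closure compact_eq_bounded_closed subset_trans)
  qed
qed

section \<open>Supports, translates and bounds of test functions\<close>

lemma test_function_mono: "test_function U \<phi> \<Longrightarrow> U \<subseteq> V \<Longrightarrow> test_function V \<phi>"
  by (auto simp: test_function_def)

lemma test_function_translate:
  assumes "test_function U \<phi>" "\<And>x. x \<in> closure {x. \<phi> x \<noteq> 0} \<Longrightarrow> x - z \<in> V"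
  shows "test_function V (\<lambda>x. \<phi> (x + z))"
proof -
  have "{x. \<phi> (x + z) \<noteq> 0} = (+) (- z) ` {x. \<phi> x \<noteq> 0}"
    by (force simp: image_iff algebra_simps)
  then have "closure {x. \<phi> (x + z) \<noteq> 0} = (+) (- z) ` closure {x. \<phi> x \<noteq> 0}"
    using closure_translation[of "- z" "{x. \<phi> x \<noteq> 0}"] by simp
  then show ?thesis using assms
    unfolding test_function_def smooth_def
    by (auto simp: Ck_on_translate compact_translation_subtract simp del: compact_closure)
qed

lemma test_function_has_derivative:
  assumes "test_function U \<phi>"
  shows "(\<phi> has_derivative frechet_derivative \<phi> (at x)) (at x)"
proof -
  have "Ck_on (Suc 0) UNIV \<phi>" using assms unfolding test_function_def smooth_def by blast
  then show ?thesis by (simp add: frechet_derivative_works[symmetric])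
qed

lemma test_function_deriv_continuous:
  assumes "test_function U \<phi>"
  shows "continuous_on UNIV \<phi>" "continuous_on UNIV (\<lambda>x. frechet_derivative \<phi> (at x) e)"
proof -
  have "Ck_on (Suc 0) UNIV \<phi>" "Ck_on 0 UNIV \<phi>"
    using assms unfolding test_function_def smooth_def by blast+
  then show "continuous_on UNIV \<phi>" "continuous_on UNIV (\<lambda>x. frechet_derivative \<phi> (at x) e)" by auto
qed

lemma test_function_support:
  assumes "test_function U \<phi>"
  obtains K where "compact K" "K \<subseteq> U" "\<And>x. x \<notin> K \<Longrightarrow> \<phi> x = 0"
    "\<And>x e. x \<notin> K \<Longrightarrow> frechet_derivative \<phi> (at x) e = 0"
proof
  let ?K = "closure {x. \<phi> x \<noteq> 0}"
  show "compact ?K" "?K \<subseteq> U" using assms by (auto simp: test_function_def)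
  show "\<phi> x = 0" if "x \<notin> ?K" for x using that closure_subset[of "{x. \<phi> x \<noteq> 0}"] by auto
  show "frechet_derivative \<phi> (at x) e = 0" if x: "x \<notin> ?K" for x e
  proof -
    have "\<forall>\<^sub>F y in nhds x. y \<in> - ?K"
      using x by (intro eventually_nhds_in_open) auto
    then have "\<forall>\<^sub>F y in nhds x. \<phi> y = 0"
      using closure_subset[of "{x. \<phi> x \<noteq> 0}"] by (auto elim!: eventually_mono)
    then have "(\<phi> has_derivative (\<lambda>_. 0)) (at x)"
      by (intro has_derivative_transform_eventually[OF has_derivative_const[of 0]])
         (auto dest: eventually_nhds_x_imp_x elim: eventually_mono simp: eventually_at_filter)
    then show ?thesis using frechet_derivative_at by metis
  qed
qed

lemma test_function_bounded:
  assumes "test_function U \<phi>"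
  obtains B where "B \<ge> 0" "\<And>x. \<bar>\<phi> x\<bar> \<le> B" "\<And>x. \<bar>frechet_derivative \<phi> (at x) e\<bar> \<le> B"
proof -
  obtain K where K: "compact K" "\<And>x. x \<notin> K \<Longrightarrow> \<phi> x = 0"
    "\<And>x e. x \<notin> K \<Longrightarrow> frechet_derivative \<phi> (at x) e = 0"
    using test_function_support[OF assms] by metis
  have "\<exists>B. \<forall>x\<in>K. \<bar>f x\<bar> \<le> B" if "continuous_on UNIV f" for f :: "'a \<Rightarrow> real"
    using compact_continuous_image[OF continuous_on_subset[OF that] K(1)]
    by (auto dest!: compact_imp_bounded simp: bounded_iff)
  then obtain B1 B2 where B: "\<And>x. x \<in> K \<Longrightarrow> \<bar>\<phi> x\<bar> \<le> B1" "\<And>x. x \<in> K \<Longrightarrow> \<bar>frechet_derivative \<phi> (at x) e\<bar> \<le> B2"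
    using test_function_deriv_continuous[OF assms] by metis
  show ?thesis
  proof
    show "0 \<le> max 0 (max B1 B2)" by simp
    show "\<bar>\<phi> x\<bar> \<le> max 0 (max B1 B2)" "\<bar>frechet_derivative \<phi> (at x) e\<bar> \<le> max 0 (max B1 B2)" for x
      using B[of x] K(2,3)[of x] by (cases "x \<in> K"; force)+
  qed
qed

subsection \<open>Translations\<close>

lemma integrable_translate:
  fixes f :: "'a::euclidean_space \<Rightarrow> real"
  assumes "integrable lborel f"
  shows "integrable lborel (\<lambda>x. f (x + z))"
  using assms lborel_distr_plus[of z] integrable_distr_eq[of "(+) z" lborel borel f]
  by (auto simp: add.commute)

lemma integral_translate:
  fixes f :: "'a::euclidean_space \<Rightarrow> real"
  assumes "f \<in> borel_measurable borel"
  shows "(LINT x|lborel. f (x + z)) = (LINT x|lborel. f x)"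
  using assms lborel_distr_plus[of z] integral_distr[of "(+) z" lborel borel f]
  by (simp add: add.commute)

lemma nn_integral_translate:
  fixes f :: "'a::euclidean_space \<Rightarrow> ennreal"
  assumes "f \<in> borel_measurable borel"
  shows "(\<integral>\<^sup>+x. f (x + z) \<partial>lborel) = (\<integral>\<^sup>+x. f x \<partial>lborel)"
  using assms lborel_distr_plus[of z] nn_integral_distr[of "(+) z" lborel borel f]
  by (simp add: add.commute)

lemma AE_translate:
  fixes P :: "'a::euclidean_space \<Rightarrow> bool"
  assumes "AE x in lborel. P x"
  shows "AE x in lborel. P (x + z)"
proof -
  obtain N where N: "N \<in> null_sets lborel" "{x. \<not> P x} \<subseteq> N"
    using assms by (auto simp: eventually_ae_filter)
  have "AE x in lborel. x \<notin> N" using N by (auto intro: AE_not_in)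
  then have "AE x in distr lborel borel ((+) z). x \<notin> N" by (subst lborel_distr_plus)
  then have "AE x in lborel. z + x \<notin> N"
    using N by (subst (asm) AE_distr_iff) auto
  then show ?thesis using N by (auto simp: add.commute elim!: eventually_mono)
qed

text \<open>Continuity of translation in L1 at the zero shift, in sequential form so that dominated
  convergence applies directly.\<close>

definition L1_translation :: "('a::euclidean_space \<Rightarrow> real) \<Rightarrow> bool" where
  "L1_translation f \<longleftrightarrow> (\<forall>z. z \<longlonglongrightarrow> 0 \<longrightarrow> (\<lambda>n::nat. LINT x|lborel. \<bar>f (x + z n) - f x\<bar>) \<longlonglongrightarrow> 0)"

text \<open>The difference of \<open>f\<close> and its translate is split at \<open>h\<close> into
  three terms. Two of them have the same integral, since Lebesgue measure is translation invariant,
  and the third is small by the property of \<open>h\<close>.\<close>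

lemma L1_translation_approx:
  assumes f: "integrable lborel f"
    and h: "\<And>e. e > 0 \<Longrightarrow> \<exists>h. integrable lborel h \<and> L1_translation h \<and> (LINT x|lborel. \<bar>f x - h x\<bar>) < e"
  shows "L1_translation f"
  unfolding L1_translation_def
proof (intro allI impI LIMSEQ_I)
  fix z :: "nat \<Rightarrow> 'a" and r :: real assume z: "z \<longlonglongrightarrow> 0" and r: "0 < r"
  obtain h where h: "integrable lborel h" "L1_translation h" "(LINT x|lborel. \<bar>f x - h x\<bar>) < r / 3"
    using h[of "r / 3"] r by auto
  have "(\<lambda>n. LINT x|lborel. \<bar>h (x + z n) - h x\<bar>) \<longlonglongrightarrow> 0"
    using h z by (auto simp: L1_translation_def)
  from LIMSEQ_D[OF this, of "r / 3"] obtain N where N: "\<And>n. n \<ge> N \<Longrightarrow> (LINT x|lborel. \<bar>h (x + z n) - h x\<bar>) < r / 3"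
    using r by force
  have "(LINT x|lborel. \<bar>f (x + z n) - f x\<bar>) < r" if n: "n \<ge> N" for n
  proof -
    note [simp] = integrable_translate[OF f] integrable_translate[OF h(1)] f h(1)
    have "(LINT x|lborel. \<bar>f (x + z n) - f x\<bar>) \<le>
        (LINT x|lborel. \<bar>f (x + z n) - h (x + z n)\<bar> + \<bar>h (x + z n) - h x\<bar> + \<bar>f x - h x\<bar>)"
      by (intro integral_mono) auto
    also have "\<dots> = (LINT x|lborel. \<bar>f (x + z n) - h (x + z n)\<bar>) + (LINT x|lborel. \<bar>h (x + z n) - h x\<bar>) + (LINT x|lborel. \<bar>f x - h x\<bar>)"
      by (simp add: integrable_abs)
    also have "(LINT x|lborel. \<bar>f (x + z n) - h (x + z n)\<bar>) = (LINT x|lborel. \<bar>f x - h x\<bar>)"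
      using borel_measurable_integrable[OF f] borel_measurable_integrable[OF h(1)]
      by (intro integral_translate[of "\<lambda>x. \<bar>f x - h x\<bar>"]) auto
    finally show ?thesis using N[OF n] h(3) by linarith
  qed
  then show "\<exists>no. \<forall>n\<ge>no. norm ((LINT x|lborel. \<bar>f (x + z n) - f x\<bar>) - 0) < r"
    by (intro exI[of _ N]) (auto simp: integral_nonneg_AE)
qed

text \<open>A point of \<open>V\<close> stays in \<open>V\<close> under small shifts, so the
  positive part of the difference tends to 0 pointwise and is dominated by the indicator of
  \<open>V\<close>. The negative part has no such fixed bound, but \<open>V\<close> and its
  translates have equal measure, so both parts have the same integral; this is the factor 2.\<close>

lemma L1_translation_open:
  fixes V :: "'a::euclidean_space set"
  assumes V: "open V" and fin: "emeasure lborel V < \<infinity>"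
  shows "L1_translation (indicator V)"
  unfolding L1_translation_def
proof (intro allI impI)
  fix z :: "nat \<Rightarrow> 'a" assume z: "z \<longlonglongrightarrow> 0"
  have [measurable]: "V \<in> sets borel" using V by auto
  have int: "integrable lborel (indicator V :: 'a \<Rightarrow> real)" using fin by (auto intro: integrable_real_indicator)
  note int' = integrable_translate[OF int]
  have "(LINT x|lborel. \<bar>indicat_real V (x + z n) - indicat_real V x\<bar>)
      = 2 * (LINT x|lborel. max 0 (indicat_real V x - indicat_real V (x + z n)))" for n
  proof -
    have "(LINT x|lborel. \<bar>indicat_real V (x + z n) - indicat_real V x\<bar>)
      = (LINT x|lborel. 2 * max 0 (indicat_real V x - indicat_real V (x + z n)) + (indicat_real V (x + z n) - indicat_real V x))"
      by (intro Bochner_Integration.integral_cong refl) (auto simp: max_def split: split_indicator)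
    also have "\<dots> = 2 * (LINT x|lborel. max 0 (indicat_real V x - indicat_real V (x + z n))) + ((LINT x|lborel. indicator V (x + z n)) - (LINT x|lborel. indicator V x))"
      using int int' by (subst Bochner_Integration.integral_add) (auto intro!: Bochner_Integration.integrable_diff)
    finally show ?thesis using integral_translate[of "indicator V :: 'a \<Rightarrow> real" "z n"] by simp
  qed
  moreover have "(\<lambda>n. LINT x|lborel. max 0 (indicat_real V x - indicat_real V (x + z n))) \<longlonglongrightarrow> (LINT x|(lborel :: 'a measure). (0::real))"
  proof (rule integral_dominated_convergence[where w = "indicator V"])
    show "AE x in lborel. (\<lambda>n. max 0 (indicat_real V x - indicat_real V (x + z n))) \<longlonglongrightarrow> 0"
    proof (intro AE_I2)
      fix x
      show "(\<lambda>n. max 0 (indicat_real V x - indicat_real V (x + z n))) \<longlonglongrightarrow> 0"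
      proof (cases "x \<in> V")
        case True
        have "(\<lambda>n. x + z n) \<longlonglongrightarrow> x" using tendsto_add[OF tendsto_const z, of x] by simp
        then have "\<forall>\<^sub>F n in sequentially. x + z n \<in> V" using V True by (rule topological_tendstoD)
        then show ?thesis by (intro tendsto_eventually) (auto elim!: eventually_mono)
      qed auto
    qed
  qed (use int in \<open>auto split: split_indicator\<close>)
  ultimately show "(\<lambda>n. LINT x|lborel. \<bar>indicat_real V (x + z n) - indicat_real V x\<bar>) \<longlonglongrightarrow> 0"
    by (simp add: tendsto_mult_right_zero)
qed

lemma L1_translation_scale: "L1_translation f \<Longrightarrow> L1_translation (\<lambda>x. f x * c)"
proof -
  assume f: "L1_translation f"
  have "\<bar>f (x + z) * c - f x * c\<bar> = \<bar>f (x + z) - f x\<bar> * \<bar>c\<bar>" for x z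
    by (simp add: left_diff_distrib[symmetric] abs_mult)
  then show ?thesis using f by (auto simp: L1_translation_def intro!: tendsto_mult_left_zero)
qed

lemma L1_translation_add:
  assumes f: "integrable lborel f" "L1_translation f" and g: "integrable lborel g" "L1_translation g"
  shows "L1_translation (\<lambda>x. f x + g x)"
  unfolding L1_translation_def
proof (intro allI impI)
  fix z :: "nat \<Rightarrow> 'a" assume z: "z \<longlonglongrightarrow> 0"
  note [simp] = integrable_translate[OF f(1)] integrable_translate[OF g(1)] f(1) g(1)
  have "(\<lambda>n. (LINT x|lborel. \<bar>f (x + z n) - f x\<bar>) + (LINT x|lborel. \<bar>g (x + z n) - g x\<bar>)) \<longlonglongrightarrow> 0 + 0"
    using z f g by (intro tendsto_add) (auto simp: L1_translation_def)
  then have lim: "(\<lambda>n. (LINT x|lborel. \<bar>f (x + z n) - f x\<bar>) + (LINT x|lborel. \<bar>g (x + z n) - g x\<bar>)) \<longlonglongrightarrow> 0"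
    by simp
  show "(\<lambda>n. LINT x|lborel. \<bar>f (x + z n) + g (x + z n) - (f x + g x)\<bar>) \<longlonglongrightarrow> 0"
  proof (rule Lim_null_comparison[OF always_eventually[OF allI] lim])
    fix n
    have "(LINT x|lborel. \<bar>f (x + z n) + g (x + z n) - (f x + g x)\<bar>) \<le> (LINT x|lborel. \<bar>f (x + z n) - f x\<bar> + \<bar>g (x + z n) - g x\<bar>)"
      by (intro integral_mono) auto
    also have "\<dots> = (LINT x|lborel. \<bar>f (x + z n) - f x\<bar>) + (LINT x|lborel. \<bar>g (x + z n) - g x\<bar>)"
      by simp
    finally show "norm (LINT x|lborel. \<bar>f (x + z n) + g (x + z n) - (f x + g x)\<bar>) \<le> (LINT x|lborel. \<bar>f (x + z n) - f x\<bar>) + (LINT x|lborel. \<bar>g (x + z n) - g x\<bar>)"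
      by (simp add: abs_of_nonneg integral_nonneg_AE)
  qed
qed

text \<open>Outer regularity passes from open sets to measurable sets of finite measure; sums and
  dominated limits then reach every integrable function.\<close>

lemma integrable_L1_translation:
  fixes f :: "'a::euclidean_space \<Rightarrow> real"
  assumes "integrable lborel f"
  shows "L1_translation f"
  using assms
proof (induction rule: integrable_induct)
  case (base A c)
  then have A: "A \<in> sets borel" "emeasure lborel A < \<infinity>" by auto
  have "L1_translation (indicator A :: 'a \<Rightarrow> real)"
  proof (rule L1_translation_approx)
    show "integrable lborel (indicator A :: 'a \<Rightarrow> real)" using A by (auto intro: integrable_real_indicator)
    fix e :: real assume e: "0 < e"
    obtain V where V: "open V" "A \<subseteq> V" "emeasure lborel (V - A) < ennreal e"
      using outer_regular_lborel[OF A(1) e] by auto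
    have [measurable]: "V \<in> sets borel" "A \<in> sets borel" using V A by auto
    have "emeasure lborel V = emeasure lborel A + emeasure lborel (V - A)"
      using V by (subst plus_emeasure) (auto simp: Un_absorb1)
    also have "\<dots> < \<infinity>" using A V by (auto simp: less_top[symmetric] dest: less_trans[OF _ ennreal_less_top])
    finally have fin: "emeasure lborel V < \<infinity>" .
    have "(LINT x|lborel. \<bar>indicator A x - indicator V x :: real\<bar>) = (LINT x|lborel. indicator (V - A) x)"
      using V by (intro Bochner_Integration.integral_cong) (auto split: split_indicator)
    also have "\<dots> = measure lborel (V - A)" by simp
    also have "\<dots> < e" using V e
      by (simp add: measure_def) (metis enn2real_less_iff ennreal_less_top order_less_trans ennreal_enn2real less_top enn2real_nonneg ennreal_less_iff)
    finally show "\<exists>h. integrable lborel h \<and> L1_translation h \<and> (LINT x|lborel. \<bar>indicator A x - h x\<bar>) < e"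
      using L1_translation_open[OF V(1) fin] fin by (intro exI[of _ "indicator V"]) (auto intro: integrable_real_indicator)
  qed
  then show ?case using L1_translation_scale by simp
next
  case (add f g)
  then show ?case by (auto intro: L1_translation_add)
next
  case (lim f s)
  show ?case
  proof (rule L1_translation_approx[OF lim.hyps(4)])
    fix e :: real assume e: "0 < e"
    have "(\<lambda>i. LINT x|lborel. \<bar>f x - s i x\<bar>) \<longlonglongrightarrow> (LINT x|(lborel :: 'a measure). (0::real))"
    \<comment> \<open>The approximants satisfy |s i| \<le> 2 |f|, hence the factor 3 for the
      difference.\<close>
    proof (rule integral_dominated_convergence[where w = "\<lambda>x. 3 * \<bar>f x\<bar>"])
      show "(\<lambda>x. \<bar>f x - s i x\<bar>) \<in> borel_measurable lborel" for i using lim.hyps(1)[of i] lim.hyps(4) by auto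
      show "AE x in lborel. (\<lambda>i. \<bar>f x - s i x\<bar>) \<longlonglongrightarrow> 0"
      proof (intro AE_I2 tendsto_rabs_zero)
        fix x have "(\<lambda>i. f x - s i x) \<longlonglongrightarrow> f x - f x" using lim.hyps(2)[of x] by (intro tendsto_diff) auto
        then show "(\<lambda>i. f x - s i x) \<longlonglongrightarrow> 0" by simp
      qed
      show "AE x in lborel. norm \<bar>f x - s i x\<bar> \<le> 3 * \<bar>f x\<bar>" for i
      proof (intro AE_I2)
        fix x show "norm \<bar>f x - s i x\<bar> \<le> 3 * \<bar>f x\<bar>" using lim.hyps(3)[of x i] by (auto simp: abs_if split: if_splits)
      qed
    qed (use lim.hyps(4) in auto)
    from LIMSEQ_D[OF this, of e] e obtain i where "(LINT x|lborel. \<bar>f x - s i x\<bar>) < e" by auto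
    then show "\<exists>h. integrable lborel h \<and> L1_translation h \<and> (LINT x|lborel. \<bar>f x - h x\<bar>) < e"
      using lim.hyps(1) lim.IH by blast
  qed
qed

subsection \<open>The fundamental lemma of the calculus of variations\<close>

text \<open>Borel measurability is built in, rather than Lebesgue measurability, because Borel
  functions can be composed with shifts and with projections of a product before Fubini is
  applied.\<close>

definition loc_int :: "'a::euclidean_space set \<Rightarrow> ('a \<Rightarrow> real) \<Rightarrow> bool" where
  "loc_int U f \<longleftrightarrow> f \<in> borel_measurable borel \<and>
     (\<forall>K. compact K \<longrightarrow> K \<subseteq> U \<longrightarrow> set_integrable lborel K f)"

lemma loc_int_measurable [measurable_dest]: "loc_int U f \<Longrightarrow> f \<in> borel_measurable borel"
  by (simp add: loc_int_def)

lemma integrable_mult_bounded: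
  fixes f g :: "'a \<Rightarrow> real"
  assumes f: "integrable M f" and g: "g \<in> borel_measurable M" "\<And>x. \<bar>g x\<bar> \<le> B"
  shows "integrable M (\<lambda>x. f x * g x)"
proof (rule Bochner_Integration.integrable_bound[OF integrable_mult_right[OF f, of B]])
  show "(\<lambda>x. f x * g x) \<in> borel_measurable M" using f g(1) by (intro borel_measurable_times) auto
  have "\<bar>f x\<bar> * \<bar>g x\<bar> \<le> \<bar>f x\<bar> * \<bar>B\<bar>" for x using g(2)[of x] by (intro mult_left_mono) auto
  then show "AE x in M. norm (f x * g x) \<le> norm (B * f x)" by (simp add: abs_mult mult.commute)
qed

lemma integrable_indicator_compact:
  assumes "compact K" shows "integrable lborel (indicator K :: 'a::euclidean_space \<Rightarrow> real)"
  using emeasure_compact_finite[OF assms] borel_compact[OF assms] by (intro integrable_real_indicator) auto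

lemma abs_le_one_plus_sq: "\<bar>s\<bar> \<le> 1 + (s::real)\<^sup>2"
  using sum_squares_bound[of "\<bar>s\<bar>" 1] by simp

lemma loc_int_mult_integrable:
  assumes f: "loc_int U f" and K: "compact K" "K \<subseteq> U"
    and \<phi>: "\<phi> \<in> borel_measurable borel" "\<And>x. x \<notin> K \<Longrightarrow> \<phi> x = 0" "\<And>x. \<bar>\<phi> x\<bar> \<le> B"
  shows "integrable lborel (\<lambda>x. f x * \<phi> x)"
proof -
  have "integrable lborel (\<lambda>x. (indicator K x *\<^sub>R f x) * \<phi> x)"
    using f K \<phi> by (intro integrable_mult_bounded) (auto simp: loc_int_def set_integrable_def)
  moreover have "(indicator K x *\<^sub>R f x) * \<phi> x = f x * \<phi> x" for x using \<phi>(2) by (cases "x \<in> K") auto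
  ultimately show ?thesis by (simp only:)
qed

lemma loc_int_test_integrable:
  assumes f: "loc_int U f" and \<phi>: "test_function U \<phi>"
  shows "integrable lborel (\<lambda>x. f x * \<phi> x)"
    "integrable lborel (\<lambda>x. f x * frechet_derivative \<phi> (at x) e)"
proof -
  obtain K where K: "compact K" "K \<subseteq> U" "\<And>x. x \<notin> K \<Longrightarrow> \<phi> x = 0"
    "\<And>x e. x \<notin> K \<Longrightarrow> frechet_derivative \<phi> (at x) e = 0"
    using test_function_support[OF \<phi>] by metis
  obtain B where B: "\<And>x. \<bar>\<phi> x\<bar> \<le> B" "\<And>x. \<bar>frechet_derivative \<phi> (at x) e\<bar> \<le> B"
    using test_function_bounded[OF \<phi>, of e] by metis
  note m = test_function_deriv_continuous[OF \<phi>, THEN borel_measurable_continuous_onI]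
  show "integrable lborel (\<lambda>x. f x * \<phi> x)"
    by (rule loc_int_mult_integrable[OF f K(1,2) m(1) K(3) B(1)])
  show "integrable lborel (\<lambda>x. f x * frechet_derivative \<phi> (at x) e)"
    by (rule loc_int_mult_integrable[OF f K(1,2) m(2) K(4) B(2)])
qed

lemma AE_lborel_cbox_box: "AE x in lborel. x \<notin> cbox a b - box a b"
  by (intro AE_not_in)
    (auto simp: null_sets_def emeasure_Diff box_subset_cbox emeasure_lborel_box_eq emeasure_lborel_cbox_eq)

text \<open>Lebesgue differentiation: almost every value \<open>h x\<close> is the limit of averages
  over cubes with corner \<open>x\<close>, and all these averages are 0.\<close>

lemma integrable_AE_zero_if_boxes:
  fixes h :: "'a::euclidean_space \<Rightarrow> real"
  assumes h: "integrable lborel h" and 0: "\<And>a b. (LINT x|lborel. indicator (box a b) x * h x) = 0"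
  shows "AE x in lborel. h x = 0"
proof -
  have si: "set_integrable lborel (cbox a b) h" for a b
    using h unfolding set_integrable_def by (intro integrable_mult_indicator) auto
  have "h integrable_on cbox a b" for a b
    using set_borel_integral_eq_integral[OF si] by auto
  from integrable_ccontinuous_explicit[OF this] obtain N where N: "negligible N"
    "\<And>x e. \<lbrakk>x \<notin> N; 0 < e\<rbrakk> \<Longrightarrow> \<exists>d>0. \<forall>t. 0 < t \<and> t < d \<longrightarrow>
       norm (integral (cbox x (x + t *\<^sub>R One)) h /\<^sub>R t ^ DIM('a) - h x) < e"
    by blast
  have c0: "integral (cbox a b) h = 0" for a b
  proof -
    have "integral (cbox a b) h = (LINT x:cbox a b|lborel. h x)"
      using set_borel_integral_eq_integral(2)[OF si] by simp
    also have "\<dots> = (LINT x|lborel. indicator (box a b) x * h x)"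
      unfolding set_lebesgue_integral_def
    proof (rule integral_cong_AE)
      from AE_lborel_cbox_box[of a b] show "AE x in lborel. indicator (cbox a b) x *\<^sub>R h x = indicator (box a b) x * h x"
        by eventually_elim (use box_subset_cbox[of a b] in \<open>auto split: split_indicator\<close>)
    qed (use h in auto)
    finally show ?thesis by (simp add: 0)
  qed
  have "h x = 0" if "x \<notin> N" for x
  proof (rule ccontr)
    assume "h x \<noteq> 0"
    with N(2)[OF that, of "\<bar>h x\<bar>"] obtain d where "d > 0"
      "\<forall>t. 0 < t \<and> t < d \<longrightarrow> norm (integral (cbox x (x + t *\<^sub>R One)) h /\<^sub>R t ^ DIM('a) - h x) < \<bar>h x\<bar>"
      by auto
    then show False using c0 by (auto dest: spec[of _ "d / 2"])
  qed
  moreover have "AE x in lborel. x \<notin> N"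
    using AE_not_in[of N lebesgue] N(1) by (simp add: negligible_iff_null_sets AE_completion_iff)
  ultimately show ?thesis by (auto elim!: eventually_mono)
qed

text \<open>The cut-offs of the box take values between 0 and 1 and vanish off the box, so |f| on
  the closed box dominates the products, and the limit may be taken under the integral.\<close>

lemma test_function_box_integral_zero:
  assumes f: "loc_int W f" and 0: "\<And>\<phi>. test_function W \<phi> \<Longrightarrow> (LINT x|lborel. f x * \<phi> x) = 0"
    and ab: "cbox a b \<subseteq> W"
  shows "(LINT x|lborel. indicator (box a b) x * f x) = 0"
proof -
  obtain \<phi> where \<phi>: "\<And>k. test_function W (\<phi> k)" "\<And>k x. 0 \<le> \<phi> k x \<and> \<phi> k x \<le> 1"
    "\<And>x. (\<lambda>k::nat. \<phi> k x) \<longlonglongrightarrow> indicator (box a b) x" "\<And>k x. x \<notin> box a b \<Longrightarrow> \<phi> k x = 0"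
    using ex_test_functions_box[OF ab] by metis
  have [measurable]: "f \<in> borel_measurable borel" using f by (rule loc_int_measurable)
  have "(\<lambda>k. LINT x|lborel. f x * \<phi> k x) \<longlonglongrightarrow> (LINT x|lborel. f x * indicator (box a b) x)"
  proof (rule integral_dominated_convergence[where w = "\<lambda>x. \<bar>indicator (cbox a b) x *\<^sub>R f x\<bar>"])
    show "integrable lborel (\<lambda>x. \<bar>indicator (cbox a b) x *\<^sub>R f x\<bar>)"
      using f ab by (auto simp: loc_int_def set_integrable_def)
    show "(\<lambda>x. f x * \<phi> k x) \<in> borel_measurable lborel" for k
      using loc_int_test_integrable(1)[OF f \<phi>(1)] by auto
    show "AE x in lborel. norm (f x * \<phi> k x) \<le> \<bar>indicator (cbox a b) x *\<^sub>R f x\<bar>" for k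
    proof (intro AE_I2)
      fix x show "norm (f x * \<phi> k x) \<le> \<bar>indicator (cbox a b) x *\<^sub>R f x\<bar>"
        using \<phi>(2)[of k x] \<phi>(4)[of x k] box_subset_cbox[of a b]
        by (cases "x \<in> box a b") (auto simp: abs_mult mult_left_le)
    qed
    show "AE x in lborel. (\<lambda>k. f x * \<phi> k x) \<longlonglongrightarrow> f x * indicator (box a b) x"
      using \<phi>(3) by (auto intro!: tendsto_mult)
  qed auto
  then show ?thesis using 0[OF \<phi>(1)] by (simp add: LIMSEQ_const_iff mult.commute)
qed

text \<open>After multiplication by the indicator of one box, \<open>f\<close> is integrable on the
  whole space, and its integral over any box is an integral over an intersection, again a box with
  closure inside \<open>W\<close>. Countably many closed boxes exhaust \<open>W\<close>, and their
  faces are null sets.\<close>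

lemma fundamental_lemma:
  fixes f :: "'a::euclidean_space \<Rightarrow> real"
  assumes W: "open W" and f: "loc_int W f"
    and 0: "\<And>\<phi>. test_function W \<phi> \<Longrightarrow> (LINT x|lborel. f x * \<phi> x) = 0"
  shows "AE x in lborel. x \<in> W \<longrightarrow> f x = 0"
proof -
  have [measurable]: "f \<in> borel_measurable borel" using f by (rule loc_int_measurable)
  have box: "AE x in lborel. x \<in> box c d \<longrightarrow> f x = 0" if cd: "cbox c d \<subseteq> W" for c d
  proof -
    have "AE x in lborel. indicator (box c d) x * f x = 0"
    proof (rule integrable_AE_zero_if_boxes[where h = "\<lambda>x. indicator (box c d) x * f x"])
      have "integrable lborel (\<lambda>x. indicator (cbox c d) x *\<^sub>R f x)"
        using f cd by (auto simp: loc_int_def set_integrable_def)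
      then have "integrable lborel (\<lambda>x. indicator (box c d) x *\<^sub>R (indicator (cbox c d) x *\<^sub>R f x))"
        by (rule integrable_mult_indicator[rotated]) auto
      moreover have "(\<lambda>x. indicat_real (box c d) x *\<^sub>R (indicat_real (cbox c d) x *\<^sub>R f x)) = (\<lambda>x. indicator (box c d) x * f x)"
        using box_subset_cbox[of c d] by (intro ext) (auto split: split_indicator)
      ultimately show "integrable lborel (\<lambda>x. indicator (box c d) x * f x)" by (rule subst[rotated])
      show "(LINT x|lborel. indicator (box a b) x * (indicator (box c d) x * f x)) = 0" for a b
      proof -
        obtain p q where pq: "box a b \<inter> box c d = box p q" using box_Int_box[of a b c d] by blast
        have eq: "indicator (box a b) x * (indicator (box c d) x * f x) = indicator (box p q) x * f x" for x
          using pq by (auto split: split_indicator)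
        show ?thesis
        proof (cases "box p q = {}")
          case True
          then show ?thesis unfolding eq by simp
        next
          case False
          then have "cbox p q = closure (box p q)" by simp
          also have "\<dots> \<subseteq> closure (box c d)" using pq by (intro closure_mono) auto
          also have "\<dots> \<subseteq> cbox c d" by (intro closure_minimal box_subset_cbox closed_cbox)
          finally have "cbox p q \<subseteq> W" using cd by auto
          then show ?thesis unfolding eq using test_function_box_integral_zero[OF f 0] by simp
        qed
      qed
    qed
    then show ?thesis by eventually_elim (auto split: split_indicator)
  qed
  obtain \<D> where \<D>: "countable \<D>" "\<D> \<subseteq> Pow W" "\<And>X. X \<in> \<D> \<Longrightarrow> \<exists>a b. X = cbox a b" "\<Union>\<D> = W"
    using open_countable_Union_open_cbox[OF W] by metis
  have "AE x in lborel. x \<in> X \<longrightarrow> f x = 0" if X: "X \<in> \<D>" for X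
  proof -
    obtain a b where ab: "X = cbox a b" "cbox a b \<subseteq> W" using \<D>(2,3) X by blast
    from box[OF ab(2)] AE_lborel_cbox_box[of a b] show ?thesis
      by eventually_elim (use ab in auto)
  qed
  then have "AE x in lborel. \<forall>X\<in>\<D>. x \<in> X \<longrightarrow> f x = 0"
    using \<D>(1) by (subst AE_ball_countable) auto
  then show ?thesis by eventually_elim (use \<D>(4) in blast)
qed

subsection \<open>Borel representatives of weak derivatives\<close>

abbreviation ae_eq :: "'a::euclidean_space set \<Rightarrow> ('a \<Rightarrow> real) \<Rightarrow> ('a \<Rightarrow> real) \<Rightarrow> bool" where
  "ae_eq U f g \<equiv> AE x in lborel. x \<in> U \<longrightarrow> f x = g x"

lemma AE_lebesgue_on_iff:
  assumes "U \<in> sets lebesgue"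
  shows "(AE x in lebesgue_on U. P x) \<longleftrightarrow> (AE x in lborel. x \<in> U \<longrightarrow> P x)"
  using assms by (simp add: AE_restrict_space_iff AE_completion_iff)

lemma lebesgue_on_borel_rep:
  fixes f :: "'a::euclidean_space \<Rightarrow> real"
  assumes U: "U \<in> sets borel" and f: "f \<in> borel_measurable (lebesgue_on U)"
  obtains f' where "f' \<in> borel_measurable borel" "ae_eq U f f'" "\<And>x. x \<notin> U \<Longrightarrow> f' x = 0"
proof -
  have "(\<lambda>x. if x \<in> U then f x else 0) \<in> borel_measurable lebesgue"
    using f by (simp add: borel_measurable_if_I U)
  then obtain h where h: "h \<in> borel_measurable lborel" "AE x in lborel. (if x \<in> U then f x else 0) = h x"
    using completion_ex_borel_measurable_real by blast
  show thesis
  proof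
    show "(\<lambda>x. if x \<in> U then h x else 0) \<in> borel_measurable borel"
      using h U by (intro measurable_If_set) auto
    show "AE x in lborel. x \<in> U \<longrightarrow> f x = (if x \<in> U then h x else 0)"
      using h(2) by eventually_elim auto
  qed auto
qed

lemma lebesgue_measurable_cong_AE:
  fixes f f' :: "'a::euclidean_space \<Rightarrow> real"
  assumes f': "f' \<in> borel_measurable borel" and ae: "AE x in lborel. f x = f' x"
  shows "f \<in> borel_measurable lebesgue"
proof (rule measurableI)
  fix A :: "real set" assume A: "A \<in> sets borel"
  have "AE x in lebesgue. x \<in> f' -` A \<longleftrightarrow> x \<in> f -` A"
    using ae unfolding AE_completion_iff by eventually_elim auto
  moreover have "f' -` A \<in> sets lebesgue" using measurable_sets[OF f' A] by auto
  ultimately have "f -` A \<in> sets lebesgue"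
    by (rule completion.in_sets_AE) auto
  then show "f -` A \<inter> space lebesgue \<in> sets lebesgue" by simp
qed simp

lemma lebesgue_on_measurable_cong_AE:
  fixes f f' :: "'a::euclidean_space \<Rightarrow> real"
  assumes U: "U \<in> sets borel" and f': "f' \<in> borel_measurable borel"
    and ae: "ae_eq U f f'"
  shows "f \<in> borel_measurable (lebesgue_on U)"
proof -
  have "(\<lambda>x. if x \<in> U then f x else 0) \<in> borel_measurable lebesgue"
  proof (rule lebesgue_measurable_cong_AE)
    show "(\<lambda>x. if x \<in> U then f' x else 0) \<in> borel_measurable borel"
      using f' U by (intro measurable_If_set) auto
    show "AE x in lborel. (if x \<in> U then f x else 0) = (if x \<in> U then f' x else 0)"
      using ae by eventually_elim auto
  qed
  then show ?thesis using U by (simp add: borel_measurable_if)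
qed

lemma
  fixes f f' :: "'a::euclidean_space \<Rightarrow> real"
  assumes U: "U \<in> sets borel" and f': "f' \<in> borel_measurable borel"
    and ae: "ae_eq U f f'"
  shows integrable_lebesgue_on_iff: "integrable (lebesgue_on U) f \<longleftrightarrow> integrable lborel (\<lambda>x. indicator U x * f' x)"
    and integral_lebesgue_on_eq: "integral\<^sup>L (lebesgue_on U) f = (LINT x|lborel. indicator U x * f' x)"
proof -
  have f: "f \<in> borel_measurable (lebesgue_on U)" by (rule lebesgue_on_measurable_cong_AE[OF assms])
  have f'': "f' \<in> borel_measurable (lebesgue_on U)"
    using f' by (rule lebesgue_on_measurable_cong_AE[OF U]) auto
  have ae': "AE x in lebesgue_on U. f x = f' x" using U ae by (simp add: AE_lebesgue_on_iff)
  have m: "(\<lambda>x. indicator U x * f' x) \<in> borel_measurable lborel" using U f' by auto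
  have "integrable (lebesgue_on U) f \<longleftrightarrow> integrable (lebesgue_on U) f'"
    using f f'' ae' by (rule integrable_cong_AE)
  also have "\<dots> \<longleftrightarrow> integrable lebesgue (\<lambda>x. indicator U x * f' x)"
    using U by (simp add: integrable_restrict_space)
  also have "\<dots> \<longleftrightarrow> integrable lborel (\<lambda>x. indicator U x * f' x)"
    by (rule integrable_completion[OF m])
  finally show "integrable (lebesgue_on U) f \<longleftrightarrow> integrable lborel (\<lambda>x. indicator U x * f' x)" .
  have "integral\<^sup>L (lebesgue_on U) f = integral\<^sup>L (lebesgue_on U) f'"
    using f f'' ae' by (rule integral_cong_AE)
  also have "\<dots> = (LINT x|lebesgue. indicator U x * f' x)"
    using U by (simp add: integral_restrict_space)
  also have "\<dots> = (LINT x|lborel. indicator U x * f' x)"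
    by (rule integral_completion[OF m])
  finally show "integral\<^sup>L (lebesgue_on U) f = (LINT x|lborel. indicator U x * f' x)" .
qed

text \<open>Counterpart of \<open>has_weak_deriv\<close> for Borel functions on the whole space. The
  integrals run over the whole space, which is harmless because test functions vanish off
  \<open>U\<close>. The direction \<open>e\<close> is an arbitrary vector, so segments of any length
  and direction are covered.\<close>

definition wderiv :: "'a::euclidean_space set \<Rightarrow> 'a \<Rightarrow> ('a \<Rightarrow> real) \<Rightarrow> ('a \<Rightarrow> real) \<Rightarrow> bool" where
  "wderiv U e u g \<longleftrightarrow> loc_int U u \<and> loc_int U g \<and>
     (\<forall>\<phi>. test_function U \<phi> \<longrightarrow>
        (LINT x|lborel. u x * frechet_derivative \<phi> (at x) e) = - (LINT x|lborel. g x * \<phi> x))"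

lemma loc_int_iff:
  assumes U: "open U" and f': "f' \<in> borel_measurable borel"
    and ae: "ae_eq U f f'"
  shows "(\<forall>K. compact K \<and> K \<subseteq> U \<longrightarrow> f absolutely_integrable_on K) \<longleftrightarrow> loc_int U f'"
proof -
  have "f absolutely_integrable_on K \<longleftrightarrow> set_integrable lborel K f'" if K: "compact K" "K \<subseteq> U" for K
  proof -
    have Kb: "K \<in> sets borel" using K compact_imp_closed by (intro borel_closed)
    have aeK: "ae_eq K f f'" using ae by eventually_elim (use K in auto)
    have "f absolutely_integrable_on K \<longleftrightarrow> integrable (lebesgue_on K) f"
      using Kb by (simp add: set_integrable_def integrable_restrict_space)
    also have "\<dots> \<longleftrightarrow> set_integrable lborel K f'"
      using integrable_lebesgue_on_iff[OF Kb f' aeK] by (simp add: set_integrable_def)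
    finally show ?thesis .
  qed
  then show ?thesis using f' by (auto simp: loc_int_def)
qed

text \<open>The bridge between the two notions: facts are proved for Borel representatives and
  carried back. The values of \<open>u'\<close> and \<open>g'\<close> off \<open>U\<close> are
  arbitrary, since every integrand contains a test function of \<open>U\<close> or its
  derivative.\<close>

lemma has_weak_deriv_iff_wderiv:
  assumes U: "open U" and m: "u' \<in> borel_measurable borel" "g' \<in> borel_measurable borel"
    and u: "ae_eq U u u'" and g: "ae_eq U g g'"
  shows "has_weak_deriv U e u g \<longleftrightarrow> wderiv U e u' g'"
proof -
  have Ub: "U \<in> sets borel" using U by auto
  have "(LINT x|lebesgue_on U. u x * frechet_derivative \<phi> (at x) e) = (LINT x|lborel. u' x * frechet_derivative \<phi> (at x) e)"
    "(LINT x|lebesgue_on U. g x * \<phi> x) = (LINT x|lborel. g' x * \<phi> x)" if \<phi>: "test_function U \<phi>" for \<phi>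
  proof -
    note c = test_function_deriv_continuous[OF \<phi>, THEN borel_measurable_continuous_onI]
    obtain K where K: "K \<subseteq> U" "\<And>x. x \<notin> K \<Longrightarrow> \<phi> x = 0" "\<And>x e. x \<notin> K \<Longrightarrow> frechet_derivative \<phi> (at x) e = 0"
      using test_function_support[OF \<phi>] by metis
    have "(LINT x|lebesgue_on U. u x * frechet_derivative \<phi> (at x) e) = (LINT x|lborel. indicator U x * (u' x * frechet_derivative \<phi> (at x) e))"
    proof (rule integral_lebesgue_on_eq[OF Ub])
      show "(\<lambda>x. u' x * frechet_derivative \<phi> (at x) e) \<in> borel_measurable borel" using m c(2)[of e] by measurable
      show "AE x in lborel. x \<in> U \<longrightarrow> u x * frechet_derivative \<phi> (at x) e = u' x * frechet_derivative \<phi> (at x) e"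
        using u by eventually_elim auto
    qed
    also have "\<dots> = (LINT x|lborel. u' x * frechet_derivative \<phi> (at x) e)"
      using K by (intro Bochner_Integration.integral_cong refl) (auto split: split_indicator)
    finally show "(LINT x|lebesgue_on U. u x * frechet_derivative \<phi> (at x) e) = (LINT x|lborel. u' x * frechet_derivative \<phi> (at x) e)" .
    have "(LINT x|lebesgue_on U. g x * \<phi> x) = (LINT x|lborel. indicator U x * (g' x * \<phi> x))"
    proof (rule integral_lebesgue_on_eq[OF Ub])
      show "(\<lambda>x. g' x * \<phi> x) \<in> borel_measurable borel" using m c(1) by measurable
      show "AE x in lborel. x \<in> U \<longrightarrow> g x * \<phi> x = g' x * \<phi> x"
        using g by eventually_elim auto
    qed
    also have "\<dots> = (LINT x|lborel. g' x * \<phi> x)"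
      using K by (intro Bochner_Integration.integral_cong refl) (auto split: split_indicator)
    finally show "(LINT x|lebesgue_on U. g x * \<phi> x) = (LINT x|lborel. g' x * \<phi> x)" .
  qed
  then show ?thesis
    unfolding has_weak_deriv_def wderiv_def
    using loc_int_iff[OF U m(1) u] loc_int_iff[OF U m(2) g] by (auto cong: imp_cong)
qed

lemma locally_abs_integrable_measurable:
  fixes f :: "'a::euclidean_space \<Rightarrow> real"
  assumes U: "open U" and f: "\<And>K. compact K \<Longrightarrow> K \<subseteq> U \<Longrightarrow> f absolutely_integrable_on K"
  shows "f \<in> borel_measurable (lebesgue_on U)"
proof -
  obtain C where C: "\<And>n. compact (C n)" "\<And>n. C n \<subseteq> U" "\<And>n. C n \<subseteq> interior (C (Suc n))"
     "\<Union>(range C) = U" "\<And>K. compact K \<Longrightarrow> K \<subseteq> U \<Longrightarrow> \<exists>N::nat. \<forall>n\<ge>N. K \<subseteq> C n"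
    using open_Union_compact_subsets[OF U] by metis
  have "(\<lambda>x. if x \<in> U then f x else 0) \<in> borel_measurable lebesgue"
  proof (rule borel_measurable_LIMSEQ_real)
    show "(\<lambda>x. indicator (C n) x *\<^sub>R f x) \<in> borel_measurable lebesgue" for n
      using f[OF C(1,2)[of n]] by (auto simp: set_integrable_def)
    fix x
    show "(\<lambda>n. indicator (C n) x *\<^sub>R f x) \<longlonglongrightarrow> (if x \<in> U then f x else 0)"
    proof (cases "x \<in> U")
      case True
      then obtain N where "\<forall>n\<ge>N. {x} \<subseteq> C n" using C(5)[of "{x}"] by auto
      then show ?thesis using True
        by (intro tendsto_eventually) (auto simp: eventually_sequentially intro!: exI[of _ N])
    next
      case False
      then have "x \<notin> C n" for n using C(2) by auto
      then show ?thesis using False by simp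
    qed
  qed
  then show ?thesis using U by (simp add: borel_measurable_if)
qed

lemma has_weak_deriv_borel:
  assumes U: "open U" and w: "has_weak_deriv U e u g"
  obtains u' g' where "wderiv U e u' g'" "ae_eq U u u'" "ae_eq U g g'"
proof -
  have Ub: "U \<in> sets borel" using U by auto
  have m: "u \<in> borel_measurable (lebesgue_on U)" "g \<in> borel_measurable (lebesgue_on U)"
    using w by (auto simp: has_weak_deriv_def intro!: locally_abs_integrable_measurable[OF U])
  obtain u' where u': "u' \<in> borel_measurable borel" "ae_eq U u u'"
    using lebesgue_on_borel_rep[OF Ub m(1)] by blast
  obtain g' where g': "g' \<in> borel_measurable borel" "ae_eq U g g'"
    using lebesgue_on_borel_rep[OF Ub m(2)] by blast
  show ?thesis
    using that[OF _ u'(2) g'(2)] w has_weak_deriv_iff_wderiv[OF U u'(1) g'(1) u'(2) g'(2)] by blast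
qed

lemma wderiv_has_weak_deriv: "open U \<Longrightarrow> wderiv U e u g \<Longrightarrow> has_weak_deriv U e u g"
  by (subst has_weak_deriv_iff_wderiv[where u' = u and g' = g]) (auto simp: wderiv_def loc_int_def)

lemma loc_int_lin:
  assumes "loc_int U f" "loc_int U g" shows "loc_int U (\<lambda>x. a * f x + b * g x)"
  using assms unfolding loc_int_def set_integrable_def
  by (auto simp: distrib_left mult.left_commute[of _ a] mult.left_commute[of _ b])

lemma wderiv_lin:
  assumes u: "wderiv U e u g" and v: "wderiv U e v h"
  shows "wderiv U e (\<lambda>x. a * u x + b * v x) (\<lambda>x. a * g x + b * h x)"
  unfolding wderiv_def
proof (intro conjI allI impI loc_int_lin)
  fix \<phi> assume \<phi>: "test_function U \<phi>"
  have l: "loc_int U u" "loc_int U v" "loc_int U g" "loc_int U h" using u v by (auto simp: wderiv_def)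
  note [simp] = loc_int_test_integrable(1)[OF l(3) \<phi>] loc_int_test_integrable(1)[OF l(4) \<phi>]
     loc_int_test_integrable(2)[OF l(1) \<phi>] loc_int_test_integrable(2)[OF l(2) \<phi>]
  show "(LINT x|lborel. (a * u x + b * v x) * frechet_derivative \<phi> (at x) e) = - (LINT x|lborel. (a * g x + b * h x) * \<phi> x)"
    using u v \<phi> by (simp add: wderiv_def distrib_right mult.assoc)
qed (use u v in \<open>auto simp: wderiv_def\<close>)

lemma wderiv_lin_dir:
  assumes u: "wderiv U e u g" and v: "wderiv U e' u h"
  shows "wderiv U (a *\<^sub>R e + b *\<^sub>R e') u (\<lambda>x. a * g x + b * h x)"
  unfolding wderiv_def
proof (intro conjI allI impI loc_int_lin)
  fix \<phi> assume \<phi>: "test_function U \<phi>"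
  have l: "loc_int U u" "loc_int U g" "loc_int U h" using u v by (auto simp: wderiv_def)
  note [simp] = loc_int_test_integrable(1)[OF l(2) \<phi>] loc_int_test_integrable(1)[OF l(3) \<phi>]
     loc_int_test_integrable(2)[OF l(1) \<phi>]
  have "linear (frechet_derivative \<phi> (at x))" for x
    using test_function_has_derivative[OF \<phi>] has_derivative_linear by blast
  then have eq: "u x * frechet_derivative \<phi> (at x) (a *\<^sub>R e + b *\<^sub>R e')
      = a * (u x * frechet_derivative \<phi> (at x) e) + b * (u x * frechet_derivative \<phi> (at x) e')" for x
    by (simp add: linear_add linear_scale distrib_left)
  show "(LINT x|lborel. u x * frechet_derivative \<phi> (at x) (a *\<^sub>R e + b *\<^sub>R e')) = - (LINT x|lborel. (a * g x + b * h x) * \<phi> x)"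
    unfolding eq using u v \<phi> by (simp add: wderiv_def distrib_right mult.assoc)
qed (use u v in \<open>auto simp: wderiv_def\<close>)

lemma wderiv_unique:
  assumes U: "open U" and g: "wderiv U e u g" "wderiv U e u h"
  shows "ae_eq U g h"
proof -
  have l: "loc_int U g" "loc_int U h" using g by (auto simp: wderiv_def)
  have "AE x in lborel. x \<in> U \<longrightarrow> 1 * g x + (-1) * h x = 0"
  proof (rule fundamental_lemma[OF U loc_int_lin[OF l]])
    fix \<phi> assume \<phi>: "test_function U \<phi>"
    show "(LINT x|lborel. (1 * g x + (-1) * h x) * \<phi> x) = 0"
      using g \<phi> loc_int_test_integrable(1)[OF l(1) \<phi>] loc_int_test_integrable(1)[OF l(2) \<phi>]
      by (simp add: wderiv_def left_diff_distrib)
  qed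
  then show ?thesis by eventually_elim auto
qed

subsection \<open>Weak derivatives along segments\<close>

lemma borel_measurable_compose_continuous:
  fixes f :: "'a::topological_space \<Rightarrow> 'b::topological_space"
  assumes "g \<in> borel_measurable borel" "continuous_on UNIV f"
  shows "(\<lambda>x. g (f x)) \<in> borel_measurable borel"
  using measurable_compose[OF borel_measurable_continuous_onI[OF assms(2)] assms(1)] .

lemma measurable_shift_strip:
  assumes "g \<in> borel_measurable borel"
  shows "(\<lambda>p :: 'a::euclidean_space \<times> real. g (fst p + (snd p * c) *\<^sub>R e) :: real) \<in> borel_measurable borel"
  by (rule borel_measurable_compose_continuous[OF assms]) (auto intro!: continuous_intros)

lemma integrable_strip:
  fixes \<Phi> :: "'a::euclidean_space \<times> real \<Rightarrow> real"
  assumes m: "\<Phi> \<in> borel_measurable borel"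
    and b: "\<And>s. (\<integral>\<^sup>+x. ennreal \<bar>\<Phi> (x, s)\<bar> \<partial>lborel) \<le> ennreal C * indicator {0..1} s"
  shows "integrable lborel \<Phi>"
proof (rule integrableI_bounded)
  have m': "(\<lambda>p. ennreal \<bar>\<Phi> p\<bar>) \<in> borel_measurable (lborel \<Otimes>\<^sub>M lborel)"
    using m unfolding lborel_prod by measurable
  have "(\<integral>\<^sup>+p. ennreal (norm (\<Phi> p)) \<partial>lborel) = (\<integral>\<^sup>+s. \<integral>\<^sup>+x. ennreal \<bar>\<Phi> (x, s)\<bar> \<partial>lborel \<partial>lborel)"
    using lborel_pair.nn_integral_snd[OF m'] by (simp add: lborel_prod)
  also have "\<dots> \<le> (\<integral>\<^sup>+s. ennreal C * indicator {0..1::real} s \<partial>lborel)"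
    by (intro nn_integral_mono b)
  also have "\<dots> < \<infinity>" by (simp add: nn_integral_cmult)
  finally show "(\<integral>\<^sup>+p. ennreal (norm (\<Phi> p)) \<partial>lborel) < \<infinity>" .
qed (use m in simp)

lemma strip_Fubini:
  fixes \<Phi> :: "'a::euclidean_space \<times> real \<Rightarrow> real"
  assumes "integrable lborel \<Phi>"
  shows "(LINT x|lborel. LINT s|lborel. \<Phi> (x, s)) = (LINT s|lborel. LINT x|lborel. \<Phi> (x, s))"
    "integrable lborel (\<lambda>x. LINT s|lborel. \<Phi> (x, s))"
    "integrable lborel (\<lambda>s. LINT x|lborel. \<Phi> (x, s))"
    "AE x in lborel. integrable lborel (\<lambda>s. \<Phi> (x, s))"
proof -
  have i: "integrable (lborel \<Otimes>\<^sub>M lborel) (\<lambda>(x, s). \<Phi> (x, s))"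
    using assms by (simp add: lborel_prod case_prod_beta')
  show "(LINT x|lborel. LINT s|lborel. \<Phi> (x, s)) = (LINT s|lborel. LINT x|lborel. \<Phi> (x, s))"
    using lborel_pair.Fubini_integral[OF i] by simp
  show "integrable lborel (\<lambda>x. LINT s|lborel. \<Phi> (x, s))"
    using lborel_pair.integrable_fst[OF i] by simp
  show "integrable lborel (\<lambda>s. LINT x|lborel. \<Phi> (x, s))"
    using lborel_pair.integrable_snd[OF i] by simp
  show "AE x in lborel. integrable lborel (\<lambda>s. \<Phi> (x, s))"
    using lborel_pair.AE_integrable_fst[OF i] by simp
qed

text \<open>All slices in \<open>s\<close> have the same L1 norm by translation invariance. The
  speed \<open>c\<close> is 1 for a unit segment, 0 for the unshifted function on the same strip,
  and a length when a longer segment is traversed.\<close>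

lemma integrable_shift_strip:
  fixes h :: "'a::euclidean_space \<Rightarrow> real"
  assumes h: "integrable lborel h"
  shows "integrable lborel (\<lambda>(x, s). indicator {0..1} s * h (x + (s * c) *\<^sub>R e))"
proof (rule integrable_strip[where C = "LINT x|lborel. \<bar>h x\<bar>"])
  have [measurable]: "h \<in> borel_measurable borel" using h by auto
  have "(\<lambda>p :: 'a \<times> real. indicator {0..1} (snd p) :: real) \<in> borel_measurable borel"
    by (rule borel_measurable_compose_continuous) (auto intro!: continuous_intros)
  with measurable_shift_strip[of h c e]
  show "(\<lambda>(x, s). indicator {0..1} s * h (x + (s * c) *\<^sub>R e)) \<in> borel_measurable borel"
    by (simp add: case_prod_beta')
  fix s :: real
  have "(\<integral>\<^sup>+x. ennreal \<bar>case (x, s) of (x, s) \<Rightarrow> indicator {0..1} s * h (x + (s * c) *\<^sub>R e)\<bar> \<partial>lborel)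
     = (\<integral>\<^sup>+x. ennreal \<bar>h (x + (s * c) *\<^sub>R e)\<bar> * indicator {0..1} s \<partial>lborel)"
    by (intro nn_integral_cong) (auto split: split_indicator)
  also have "\<dots> = (\<integral>\<^sup>+x. ennreal \<bar>h (x + (s * c) *\<^sub>R e)\<bar> \<partial>lborel) * indicator {0..1} s"
    by (intro nn_integral_multc) auto
  also have "(\<integral>\<^sup>+x. ennreal \<bar>h (x + (s * c) *\<^sub>R e)\<bar> \<partial>lborel) = (\<integral>\<^sup>+x. ennreal \<bar>h x\<bar> \<partial>lborel)"
    by (rule nn_integral_translate) auto
  also have "\<dots> = ennreal (LINT x|lborel. \<bar>h x\<bar>)"
    using h by (intro nn_integral_eq_integral) auto
  finally show "(\<integral>\<^sup>+x. ennreal \<bar>case (x, s) of (x, s) \<Rightarrow> indicator {0..1} s * h (x + (s * c) *\<^sub>R e)\<bar> \<partial>lborel)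
      \<le> ennreal (LINT x|lborel. \<bar>h x\<bar>) * indicator {0..1} s" by simp
qed

text \<open>The mean of \<open>g\<close> over the segment from \<open>x\<close> to
  \<open>x + e\<close>. The length of \<open>e\<close> enters through the derivative in direction
  \<open>e\<close> and not through this integral.\<close>

definition line_int :: "('a::euclidean_space \<Rightarrow> real) \<Rightarrow> 'a \<Rightarrow> 'a \<Rightarrow> real" where
  "line_int g e x = (LINT s|lborel. indicator {0..1} s * g (x + s *\<^sub>R e))"

lemma closed_segment_shift: "closed_segment x (x + e) = (\<lambda>s. x + s *\<^sub>R e) ` {0..1}"
  by (auto simp: closed_segment_def algebra_simps)

text \<open>The union of the segments that start in \<open>K\<close>. It is compact when
  \<open>K\<close> is, so local integrability on \<open>U\<close> controls every function met while
  shifting points of \<open>K\<close>.\<close>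

definition sweep :: "'a::euclidean_space set \<Rightarrow> 'a \<Rightarrow> 'a set" where
  "sweep K e = (\<lambda>(x, s). x + s *\<^sub>R e) ` (K \<times> {0..1::real})"

lemma compact_sweep: "compact K \<Longrightarrow> compact (sweep K e)"
  unfolding sweep_def
  by (intro compact_continuous_image compact_Times) (auto simp: case_prod_beta' intro!: continuous_intros)

lemma sweepI: "x \<in> K \<Longrightarrow> 0 \<le> s \<Longrightarrow> s \<le> 1 \<Longrightarrow> x + s *\<^sub>R e \<in> sweep K e"
  by (force simp: sweep_def)

lemma sweep_endpoints: "x \<in> K \<Longrightarrow> x \<in> sweep K e" "x \<in> K \<Longrightarrow> x + e \<in> sweep K e"
  using sweepI[of x K 0 e] sweepI[of x K 1 e] by auto

lemma sweep_subset: "sweep K e \<subseteq> U \<longleftrightarrow> (\<forall>x\<in>K. closed_segment x (x + e) \<subseteq> U)"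
  unfolding closed_segment_shift sweep_def by force

text \<open>A compact segment inside the open set has a uniform distance to the complement, and
  parallel translates by less than this distance stay inside.\<close>

lemma open_segment_set:
  fixes U :: "'a::euclidean_space set"
  assumes U: "open U"
  shows "open {x. closed_segment x (x + e) \<subseteq> U}"
proof (rule openI)
  fix x assume "x \<in> {x. closed_segment x (x + e) \<subseteq> U}"
  then have *: "closed_segment x (x + e) \<subseteq> U" by simp
  then obtain d where d: "d > 0" "\<And>y. y \<in> closed_segment x (x + e) \<Longrightarrow> ball y d \<subseteq> U"
    using Heine_Borel_lemma[of "closed_segment x (x + e)" "{U}"] U
    by (auto intro: compact_segment)
  have "closed_segment y (y + e) \<subseteq> U" if y: "y \<in> ball x d" for y
  proof
    fix p assume "p \<in> closed_segment y (y + e)"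
    then obtain s where s: "0 \<le> s" "s \<le> 1" "p = y + s *\<^sub>R e" by (auto simp: closed_segment_shift)
    then have "p \<in> ball (x + s *\<^sub>R e) d" using y by (simp add: dist_norm)
    moreover have "x + s *\<^sub>R e \<in> closed_segment x (x + e)" using s by (auto simp: closed_segment_shift)
    ultimately show "p \<in> U" using d(2) by blast
  qed
  then show "\<exists>T>0. ball x T \<subseteq> {x. closed_segment x (x + e) \<subseteq> U}" using d(1) by blast
qed

lemma test_function_FTC:
  assumes \<phi>: "test_function U \<phi>"
  shows "(LINT s|lborel. indicator {0..1} s * frechet_derivative \<phi> (at (y - s *\<^sub>R e)) e) = \<phi> y - \<phi> (y - e)"
proof -
  have "((\<lambda>s. - \<phi> (y - s *\<^sub>R e)) has_real_derivative frechet_derivative \<phi> (at (y - s *\<^sub>R e)) e) (at s)" for s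
  proof -
    let ?D = "frechet_derivative \<phi> (at (y - s *\<^sub>R e))"
    have lin: "linear ?D"
      using test_function_has_derivative[OF \<phi>] has_derivative_linear by blast
    have "((\<lambda>s. y - s *\<^sub>R e) has_derivative (\<lambda>h. - (h *\<^sub>R e))) (at s)"
      by (auto intro!: derivative_eq_intros)
    from has_derivative_compose[OF this test_function_has_derivative[OF \<phi>]]
    have "((\<lambda>s. - \<phi> (y - s *\<^sub>R e)) has_derivative (\<lambda>h. - ?D (- (h *\<^sub>R e)))) (at s)"
      by (rule has_derivative_minus)
    moreover have "(\<lambda>h. - ?D (- (h *\<^sub>R e))) = (*) (?D e)"
      using lin by (auto simp: linear_neg linear_scale)
    ultimately show ?thesis by (simp add: has_field_derivative_def)
  qed
  moreover have "isCont (\<lambda>s. frechet_derivative \<phi> (at (y - s *\<^sub>R e)) e) s" for s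
  proof -
    have "continuous_on UNIV (\<lambda>s. frechet_derivative \<phi> (at (y - s *\<^sub>R e)) e)"
      by (rule continuous_on_compose2[OF test_function_deriv_continuous(2)[OF \<phi>]]) (auto intro!: continuous_intros)
    then show ?thesis by (simp add: continuous_on_eq_continuous_at)
  qed
  ultimately have "(LINT s|lborel. frechet_derivative \<phi> (at (y - s *\<^sub>R e)) e * indicator {0..1} s) = - \<phi> (y - 1 *\<^sub>R e) - (- \<phi> (y - 0 *\<^sub>R e))"
    by (intro integral_FTC_Icc_real) auto
  then show ?thesis by (simp add: mult.commute)
qed

lemma loc_int_restrict:
  assumes "loc_int U g" "compact K" "K \<subseteq> U"
  shows "integrable lborel (\<lambda>x. indicator K x * g x)"
  using assms by (auto simp: loc_int_def set_integrable_def)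

lemma line_int_restrict:
  assumes "x \<in> K"
  shows "line_int (\<lambda>y. indicator (sweep K e) y * g y) e x = line_int g e x"
  unfolding line_int_def
  by (intro Bochner_Integration.integral_cong refl) (use assms in \<open>auto split: split_indicator dest: sweepI\<close>)

lemma integrable_line_int:
  assumes "integrable lborel h" shows "integrable lborel (line_int h e)"
  using strip_Fubini(2)[OF integrable_shift_strip[OF assms, of 1 e]] unfolding line_int_def by simp

lemma line_int_measurable [measurable]:
  assumes g: "g \<in> borel_measurable borel" shows "line_int g e \<in> borel_measurable borel"
proof -
  have "(\<lambda>p. indicator {0..1} (snd p) * g (fst p + (snd p * 1) *\<^sub>R e)) \<in> borel_measurable borel"
    using measurable_shift_strip[OF g, of 1 e]
    by (intro borel_measurable_times borel_measurable_compose_continuous[of "indicator {0..1}" snd])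
      (auto intro!: continuous_intros)
  then have "(\<lambda>(x, s). indicator {0..1} s * g (x + s *\<^sub>R e)) \<in> borel_measurable (lborel \<Otimes>\<^sub>M lborel)"
    unfolding lborel_prod by (simp add: case_prod_beta')
  from lborel.borel_measurable_lebesgue_integral[OF this]
  show ?thesis unfolding line_int_def[abs_def] by simp
qed

text \<open>Tested against \<phi>, the mean of \<open>g\<close> over shifts becomes, by translation
  invariance, a mean of integrals of \<open>g\<close> against translates of \<phi>. There the
  definition of the weak derivative moves \<open>g\<close> to \<open>u\<close>, and integrating the
  derivative of \<phi> along the segment leaves the difference \<phi>(y) - \<phi>(y - e). Shifting
  back yields the difference of \<open>u\<close>, and the fundamental lemma removes \<phi>.\<close>

lemma wderiv_line:
  assumes U: "open U" and w: "wderiv U e u g"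
  shows "AE x in lborel. closed_segment x (x + e) \<subseteq> U \<longrightarrow> u (x + e) - u x = line_int g e x"
proof -
  define W where "W = {x. closed_segment x (x + e) \<subseteq> U}"
  have lu: "loc_int U u" and lg: "loc_int U g" using w by (auto simp: wderiv_def)
  have m[measurable]: "u \<in> borel_measurable borel" "g \<in> borel_measurable borel"
    using lu lg by (auto simp: loc_int_def)
  have K': "compact (sweep K e)" "sweep K e \<subseteq> U" if "compact K" "K \<subseteq> W" for K
    using that compact_sweep[of K e] by (auto simp: W_def sweep_subset)
  have "AE x in lborel. x \<in> W \<longrightarrow> u (x + e) - u x - line_int g e x = 0"
  proof (rule fundamental_lemma)
    show "open W" unfolding W_def by (rule open_segment_set[OF U])
    show loc: "loc_int W (\<lambda>x. u (x + e) - u x - line_int g e x)"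
      unfolding loc_int_def
    proof (intro conjI allI impI)
      show "(\<lambda>x. u (x + e) - u x - line_int g e x) \<in> borel_measurable borel" by measurable
      fix K assume K: "compact K" "K \<subseteq> W"
      let ?h = "\<lambda>x. indicator (sweep K e) x * g x" and ?k = "\<lambda>x. indicator (sweep K e) x * u x"
      have i: "integrable lborel ?h" "integrable lborel ?k"
        using loc_int_restrict[OF lg K'[OF K]] loc_int_restrict[OF lu K'[OF K]] by auto
      have "integrable lborel (\<lambda>x. indicator K x *\<^sub>R (?k (x + e) - ?k x - line_int ?h e x))"
        using i integrable_line_int[OF i(1)] integrable_translate[OF i(2), of e] compact_imp_closed[OF K(1)]
        by (intro integrable_mult_indicator Bochner_Integration.integrable_diff) auto
      moreover have "(\<lambda>x. indicator K x *\<^sub>R (?k (x + e) - ?k x - line_int ?h e x)) = (\<lambda>x. indicator K x *\<^sub>R (u (x + e) - u x - line_int g e x))"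
        using line_int_restrict[of _ K e g] sweep_endpoints[of _ K e] by (intro ext) (auto split: split_indicator)
      ultimately show "set_integrable lborel K (\<lambda>x. u (x + e) - u x - line_int g e x)"
        unfolding set_integrable_def by (rule subst[rotated])
    qed
    fix \<phi> assume \<phi>: "test_function W \<phi>"
    obtain K where K: "compact K" "K \<subseteq> W" and Kout: "\<And>x. x \<notin> K \<Longrightarrow> \<phi> x = 0"
      and Kout': "\<And>x e. x \<notin> K \<Longrightarrow> frechet_derivative \<phi> (at x) e = 0"
      using test_function_support[OF \<phi>] by metis
    have clK: "closure {x. \<phi> x \<noteq> 0} \<subseteq> K" using Kout compact_imp_closed[OF K(1)] by (intro closure_minimal) auto
    \<comment> \<open>Every segment starting in the support of \<phi> stays in \<open>S\<close>.
      Cutting \<open>u\<close> and \<open>g\<close> off outside \<open>S\<close> makes them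
      integrable, as Fubini requires, without changing any integrand below.\<close>
    define S where "S = sweep K e"
    have S: "compact S" "S \<subseteq> U" using K'[OF K] by (auto simp: S_def)
    have inS: "x + s *\<^sub>R e \<in> S" if "x \<in> K" "0 \<le> s" "s \<le> 1" for x s
      using that sweepI S_def by blast
    let ?h = "\<lambda>x. indicator S x * g x" and ?k = "\<lambda>x. indicator S x * u x"
    have ih: "integrable lborel ?h" and ik: "integrable lborel ?k"
      using loc_int_restrict[OF lg S] loc_int_restrict[OF lu S] by auto
    obtain B where B: "B \<ge> 0" "\<And>x. \<bar>\<phi> x\<bar> \<le> B" "\<And>x. \<bar>frechet_derivative \<phi> (at x) e\<bar> \<le> B"
      using test_function_bounded[OF \<phi>, of e] by metis
    note c = test_function_deriv_continuous[OF \<phi>]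
    have cm[measurable]: "\<phi> \<in> borel_measurable borel" "(\<lambda>x. frechet_derivative \<phi> (at x) e) \<in> borel_measurable borel"
      using c by (auto intro: borel_measurable_continuous_onI)
    have Smeas[measurable]: "S \<in> sets borel" using compact_imp_closed[OF S(1)] by (rule borel_closed)
    have transl: "test_function U (\<lambda>y. \<phi> (y - s *\<^sub>R e))" if "0 \<le> s" "s \<le> 1" for s
    proof -
      have "test_function U (\<lambda>x. \<phi> (x + - (s *\<^sub>R e)))"
      proof (rule test_function_translate[OF \<phi>])
        fix x assume "x \<in> closure {x. \<phi> x \<noteq> 0}"
        then show "x - - (s *\<^sub>R e) \<in> U" using inS[of x s] that S clK by auto
      qed
      then show ?thesis by simp
    qed
    \<comment> \<open>For a fixed \<open>s\<close> the translate of \<phi> by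
      \<open>s *\<^sub>R e\<close> is again a test function of \<open>U\<close>, so the definition
      of the weak derivative may be used with it.\<close>
    have step: "(LINT x|lborel. ?h (x + s *\<^sub>R e) * \<phi> x) = - (LINT y|lborel. ?k y * frechet_derivative \<phi> (at (y - s *\<^sub>R e)) e)"
      if s: "0 \<le> s" "s \<le> 1" for s
    proof -
      have "(LINT x|lborel. ?h (x + s *\<^sub>R e) * \<phi> x) = (LINT x|lborel. g (x + s *\<^sub>R e) * \<phi> (x + s *\<^sub>R e - s *\<^sub>R e))"
        using inS[OF _ s] Kout by (intro Bochner_Integration.integral_cong refl) (auto split: split_indicator)
      also have "\<dots> = (LINT y|lborel. g y * \<phi> (y - s *\<^sub>R e))"
        by (rule integral_translate[of "\<lambda>y. g y * \<phi> (y - s *\<^sub>R e)"]) measurable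
      also have "\<dots> = - (LINT y|lborel. u y * frechet_derivative (\<lambda>y. \<phi> (y - s *\<^sub>R e)) (at y) e)"
        using w transl[OF s] by (simp add: wderiv_def)
      also have "(\<lambda>y. u y * frechet_derivative (\<lambda>y. \<phi> (y - s *\<^sub>R e)) (at y) e) = (\<lambda>y. ?k y * frechet_derivative \<phi> (at (y - s *\<^sub>R e)) e)"
      proof
        fix y
        have "\<phi> differentiable (at (y + - (s *\<^sub>R e)))"
          using test_function_has_derivative[OF \<phi>] differentiable_def by blast
        from frechet_derivative_translate[OF this]
        have "frechet_derivative (\<lambda>y. \<phi> (y - s *\<^sub>R e)) (at y) e = frechet_derivative \<phi> (at (y - s *\<^sub>R e)) e" by simp
        moreover have "y \<in> S" if "y - s *\<^sub>R e \<in> K" using inS[OF that s] by simp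
        ultimately show "u y * frechet_derivative (\<lambda>y. \<phi> (y - s *\<^sub>R e)) (at y) e = ?k y * frechet_derivative \<phi> (at (y - s *\<^sub>R e)) e"
          using Kout'[of "y - s *\<^sub>R e"] by (auto split: split_indicator)
      qed
      finally show ?thesis .
    qed
    have int1: "integrable lborel (\<lambda>(x, s). indicator {0..1::real} s * ?h (x + (s * 1) *\<^sub>R e) * \<phi> x)"
    proof -
      have "(\<lambda>p :: 'a \<times> real. \<phi> (fst p)) \<in> borel_measurable lborel"
        using c(1) by (auto intro!: borel_measurable_continuous_onI continuous_intros continuous_on_compose2[OF c(1)])
      from integrable_mult_bounded[OF integrable_shift_strip[OF ih, of 1 e] this B(2)] show ?thesis by (simp add: case_prod_beta')
    qed
    have int2: "integrable lborel (\<lambda>(y, s). indicator {0..1::real} s * ?k y * frechet_derivative \<phi> (at (y - s *\<^sub>R e)) e)"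
    proof -
      have "(\<lambda>p :: 'a \<times> real. frechet_derivative \<phi> (at (fst p - snd p *\<^sub>R e)) e) \<in> borel_measurable lborel"
        by (auto intro!: borel_measurable_continuous_onI continuous_intros continuous_on_compose2[OF c(2)])
      from integrable_mult_bounded[OF integrable_shift_strip[OF ik, of 0 e] this B(3)] show ?thesis by (simp add: case_prod_beta')
    qed
    have "(LINT x|lborel. line_int g e x * \<phi> x) = (LINT x|lborel. LINT s|lborel. indicator {0..1::real} s * ?h (x + s *\<^sub>R e) * \<phi> x)"
    proof (intro Bochner_Integration.integral_cong refl)
      fix x
      have "line_int g e x * \<phi> x = line_int ?h e x * \<phi> x"
        using line_int_restrict[of x K e g] Kout[of x] by (cases "x \<in> K") (auto simp: S_def)
      then show "line_int g e x * \<phi> x = (LINT s|lborel. indicator {0..1::real} s * ?h (x + s *\<^sub>R e) * \<phi> x)"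
        by (simp add: line_int_def)
    qed
    also have "\<dots> = (LINT s|lborel. LINT x|lborel. indicator {0..1::real} s * ?h (x + s *\<^sub>R e) * \<phi> x)"
      using strip_Fubini(1)[OF int1] by simp
    also have "\<dots> = (LINT s|lborel. - (LINT y|lborel. indicator {0..1::real} s * ?k y * frechet_derivative \<phi> (at (y - s *\<^sub>R e)) e))"
    proof (intro Bochner_Integration.integral_cong refl)
      fix s :: real
      show "(LINT x|lborel. indicator {0..1::real} s * ?h (x + s *\<^sub>R e) * \<phi> x) = - (LINT y|lborel. indicator {0..1::real} s * ?k y * frechet_derivative \<phi> (at (y - s *\<^sub>R e)) e)"
        using step[of s] by (cases "s \<in> {0..1}") auto
    qed
    also have "\<dots> = - (LINT s|lborel. LINT y|lborel. indicator {0..1::real} s * ?k y * frechet_derivative \<phi> (at (y - s *\<^sub>R e)) e)"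
      by simp
    also have "\<dots> = - (LINT y|lborel. LINT s|lborel. indicator {0..1::real} s * ?k y * frechet_derivative \<phi> (at (y - s *\<^sub>R e)) e)"
      using strip_Fubini(1)[OF int2] by simp
    also have "\<dots> = - (LINT y|lborel. ?k y * (\<phi> y - \<phi> (y - e)))"
    proof -
      have "(LINT s|lborel. indicator {0..1::real} s * ?k y * frechet_derivative \<phi> (at (y - s *\<^sub>R e)) e) = ?k y * (\<phi> y - \<phi> (y - e))" for y
        unfolding test_function_FTC[OF \<phi>, symmetric] integral_mult_right_zero[symmetric]
        by (intro Bochner_Integration.integral_cong refl) (simp add: mult_ac)
      then show ?thesis by simp
    qed
    also have "\<dots> = - (LINT y|lborel. u y * \<phi> y - u y * \<phi> (y - e))"
    proof -
      \<comment> \<open>Off \<open>S\<close> both values of \<phi> vanish: \<open>y\<close> and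
        \<open>y - e\<close> are then outside \<open>K\<close>, because the segment from a point of
        \<open>K\<close> has both endpoints in \<open>S\<close>.\<close>
      have *: "?k y * (\<phi> y - \<phi> (y - e)) = u y * \<phi> y - u y * \<phi> (y - e)" for y
      proof (cases "y \<in> S")
        case False
        then have "\<phi> y = 0" "\<phi> (y - e) = 0"
          using Kout[of y] Kout[of "y - e"] inS[of y 0] inS[of "y - e" 1] by force+
        then show ?thesis by simp
      qed (simp add: right_diff_distrib)
      show ?thesis unfolding * ..
    qed
    finally have main: "(LINT x|lborel. line_int g e x * \<phi> x) = - (LINT y|lborel. u y * \<phi> y - u y * \<phi> (y - e))" .
    have t0: "test_function U \<phi>" "test_function U (\<lambda>y. \<phi> (y - e))" using transl[of 0] transl[of 1] by auto
    have ii: "integrable lborel (\<lambda>y. u y * \<phi> y)" "integrable lborel (\<lambda>y. u y * \<phi> (y - e))"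
      using loc_int_test_integrable(1)[OF lu t0(1)] loc_int_test_integrable(1)[OF lu t0(2)] by auto
    have ii': "integrable lborel (\<lambda>x. u (x + e) * \<phi> x)" using integrable_translate[OF ii(2), of e] by simp
    have eq': "(LINT x|lborel. u (x + e) * \<phi> x) = (LINT y|lborel. u y * \<phi> (y - e))"
      using integral_translate[of "\<lambda>y. u y * \<phi> (y - e)" e] by simp
    have "integrable lborel (\<lambda>x. (u (x + e) - u x - line_int g e x) * \<phi> x)"
      by (rule loc_int_test_integrable(1)[OF loc \<phi>])
    from Bochner_Integration.integrable_diff[OF Bochner_Integration.integrable_diff[OF ii' ii(1)] this]
    have iii: "integrable lborel (\<lambda>x. line_int g e x * \<phi> x)" by (simp add: algebra_simps)
    show "(LINT x|lborel. (u (x + e) - u x - line_int g e x) * \<phi> x) = 0"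
      using ii ii' iii main eq' by (simp add: left_diff_distrib)
  qed
  then show ?thesis by (simp add: W_def)
qed

subsection \<open>Difference quotients\<close>

lemma compact_neighbourhood:
  fixes K :: "'a::euclidean_space set"
  assumes "open U" "compact K" "K \<subseteq> U"
  obtains d K' where "d > 0" "compact K'" "K' \<subseteq> U" "\<And>x z. x \<in> K \<Longrightarrow> norm z \<le> d \<Longrightarrow> x + z \<in> K'"
proof -
  obtain r where r: "r > 0" "\<And>y. y \<in> K \<Longrightarrow> ball y r \<subseteq> U"
    using Heine_Borel_lemma[of K "{U}"] assms by auto
  let ?K = "{x + z |x z. x \<in> K \<and> z \<in> cball 0 (r / 2)}"
  show thesis
  proof
    show "r / 2 > 0" using r by simp
    show "compact ?K" by (intro compact_sums assms compact_cball)
    show "?K \<subseteq> U"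
    proof
      fix p assume "p \<in> ?K"
      then obtain x z where "x \<in> K" "norm z \<le> r / 2" "p = x + z" by auto
      then have "p \<in> ball x r" using r by (simp add: dist_norm)
      then show "p \<in> U" using r(2) \<open>x \<in> K\<close> by blast
    qed
  qed auto
qed

lemma integral_line_int:
  assumes h: "integrable lborel h"
  shows "(LINT x|lborel. line_int h e x) = (LINT x|lborel. h x)"
proof -
  have [measurable]: "h \<in> borel_measurable borel" using h by auto
  have "(LINT x|lborel. line_int h e x) = (LINT s|lborel. LINT x|lborel. indicator {0..1} s * h (x + s *\<^sub>R e))"
    using strip_Fubini(1)[OF integrable_shift_strip[OF h, of 1 e]] by (simp add: line_int_def)
  also have "\<dots> = (LINT s|lborel. indicator {0..1::real} s * (LINT x|lborel. h x))"
    by (simp add: integral_translate)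
  finally show ?thesis by simp
qed

text \<open>The L1 distance of a mean of translates to \<open>h\<close> is at most the mean over
  \<open>s\<close> of the distances of the translates. Each of these tends to 0 by continuity of
  translation and is bounded by twice the norm of \<open>h\<close>.\<close>

lemma line_int_tendsto:
  fixes h :: "'a::euclidean_space \<Rightarrow> real"
  assumes h: "integrable lborel h" and z: "z \<longlonglongrightarrow> 0"
  shows "(\<lambda>k. LINT x|lborel. \<bar>line_int h (z k) x - h x\<bar>) \<longlonglongrightarrow> 0"
proof -
  have [measurable]: "h \<in> borel_measurable borel" using h by auto
  define m where "m k s = indicator {0..1::real} s * (LINT x|lborel. \<bar>h (x + s *\<^sub>R z k) - h x\<bar>)" for k :: nat and s
  have i: "integrable lborel (\<lambda>p :: 'a \<times> real. \<bar>(case p of (x, s) \<Rightarrow> indicator {0..1} s * h (x + (s * 1) *\<^sub>R z k)) - (case p of (x, s) \<Rightarrow> indicator {0..1} s * h (x + (s * 0) *\<^sub>R z k))\<bar>)" for k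
    by (intro integrable_abs Bochner_Integration.integrable_diff integrable_shift_strip h)
  have eq: "\<bar>(case (x, s) of (x, s) \<Rightarrow> indicator {0..1} s * h (x + (s * 1) *\<^sub>R z k)) - (case (x, s) of (x, s) \<Rightarrow> indicator {0..1::real} s * h (x + (s * 0) *\<^sub>R z k))\<bar>
     = indicator {0..1} s * \<bar>h (x + s *\<^sub>R z k) - h x\<bar>" for x s k
    by (auto split: split_indicator)
  note F = strip_Fubini[OF i, unfolded eq]
  have im: "integrable lborel (m k)" for k
    using F(3)[of k] by (simp add: m_def[abs_def])
  have le: "(LINT x|lborel. \<bar>line_int h (z k) x - h x\<bar>) \<le> (LINT s|lborel. m k s)" for k
  proof -
    have "(LINT x|lborel. \<bar>line_int h (z k) x - h x\<bar>) \<le> (LINT x|lborel. LINT s|lborel. indicator {0..1} s * \<bar>h (x + s *\<^sub>R z k) - h x\<bar>)"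
    proof (rule integral_mono_AE)
      show "integrable lborel (\<lambda>x. \<bar>line_int h (z k) x - h x\<bar>)"
        using h integrable_line_int[OF h] by auto
      show "integrable lborel (\<lambda>x. LINT s|lborel. indicator {0..1} s * \<bar>h (x + s *\<^sub>R z k) - h x\<bar>)" by (rule F(2))
      have "AE x in lborel. integrable lborel (\<lambda>s. indicator {0..1} s * h (x + (s * 1) *\<^sub>R z k))"
        using strip_Fubini(4)[OF integrable_shift_strip[OF h, of 1 "z k"]] by simp
      then show "AE x in lborel. \<bar>line_int h (z k) x - h x\<bar> \<le> (LINT s|lborel. indicator {0..1} s * \<bar>h (x + s *\<^sub>R z k) - h x\<bar>)"
      proof eventually_elim
        case (elim x)
        have "line_int h (z k) x - h x = (LINT s|lborel. indicator {0..1} s * h (x + s *\<^sub>R z k) - indicator {0..1} s * h x)"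
          using elim by (subst Bochner_Integration.integral_diff) (simp_all add: line_int_def)
        also have "\<bar>\<dots>\<bar> \<le> (LINT s|lborel. \<bar>indicator {0..1} s * h (x + s *\<^sub>R z k) - indicator {0..1} s * h x\<bar>)"
          by (rule integral_abs_bound)
        also have "\<dots> = (LINT s|lborel. indicator {0..1} s * \<bar>h (x + s *\<^sub>R z k) - h x\<bar>)"
          by (intro Bochner_Integration.integral_cong refl) (auto split: split_indicator)
        finally show ?case .
      qed
    qed
    also have "\<dots> = (LINT s|lborel. m k s)" using F(1)[of k] by (simp add: m_def)
    finally show ?thesis .
  qed
  have "(\<lambda>k. LINT s|lborel. m k s) \<longlonglongrightarrow> (LINT s|(lborel :: real measure). (0::real))"
  proof (rule integral_dominated_convergence[where w = "\<lambda>s. indicator {0..1} s * (2 * (LINT x|lborel. \<bar>h x\<bar>))"])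
    show "AE s in lborel. (\<lambda>k. m k s) \<longlonglongrightarrow> 0"
    proof (intro AE_I2)
      fix s :: real
      have "(\<lambda>k. s *\<^sub>R z k) \<longlonglongrightarrow> 0" using z by (rule tendsto_scaleR[OF tendsto_const, of _ 0 _ s, simplified])
      then have "(\<lambda>k. LINT x|lborel. \<bar>h (x + s *\<^sub>R z k) - h x\<bar>) \<longlonglongrightarrow> 0"
        using integrable_L1_translation[OF h] unfolding L1_translation_def by blast
      then show "(\<lambda>k. m k s) \<longlonglongrightarrow> 0" unfolding m_def by (rule tendsto_mult_right_zero)
    qed
    show "AE s in lborel. norm (m k s) \<le> indicator {0..1} s * (2 * (LINT x|lborel. \<bar>h x\<bar>))" for k
    proof (intro AE_I2)
      fix s :: real
      note ih = integrable_translate[OF h, of "s *\<^sub>R z k"]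
      have "(LINT x|lborel. \<bar>h (x + s *\<^sub>R z k) - h x\<bar>) \<le> (LINT x|lborel. \<bar>h (x + s *\<^sub>R z k)\<bar> + \<bar>h x\<bar>)"
        using h ih by (intro integral_mono) auto
      also have "\<dots> = (LINT x|lborel. \<bar>h (x + s *\<^sub>R z k)\<bar>) + (LINT x|lborel. \<bar>h x\<bar>)"
        using h ih by (intro Bochner_Integration.integral_add) auto
      also have "\<dots> = 2 * (LINT x|lborel. \<bar>h x\<bar>)"
        using integral_translate[of "\<lambda>x. \<bar>h x\<bar>" "s *\<^sub>R z k"] by simp
      finally show "norm (m k s) \<le> indicator {0..1} s * (2 * (LINT x|lborel. \<bar>h x\<bar>))"
        by (auto simp: m_def abs_mult integral_nonneg_AE split: split_indicator)
    qed
  qed (use im in auto)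
  then have "(\<lambda>k. LINT s|lborel. m k s) \<longlonglongrightarrow> 0" by simp
  then show ?thesis
    by (rule Lim_null_comparison[rotated]) (auto simp: le integral_nonneg_AE)
qed

text \<open>Assumption \<open>line\<close> says that the difference quotient with step
  \<open>\<tau> k\<close> is a mean of \<open>g\<close> over a short segment. Near \<open>K\<close>
  the function \<open>g\<close> may be replaced by its restriction to a compact neighbourhood, which
  is integrable, and such means converge in L1.\<close>

lemma quotient_L1:
  fixes U :: "'a::euclidean_space set"
  assumes U: "open U" and u: "u \<in> borel_measurable borel" and g: "loc_int U g"
    and line: "\<And>k::nat. AE x in lborel. closed_segment x (x + \<tau> k *\<^sub>R e) \<subseteq> U \<longrightarrow>
        u (x + \<tau> k *\<^sub>R e) - u x = \<tau> k * line_int g (\<tau> k *\<^sub>R e) x"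
    and \<tau>: "\<tau> \<longlonglongrightarrow> 0" "\<And>k. \<tau> k \<noteq> 0" and K: "compact K" "K \<subseteq> U"
  defines "q \<equiv> \<lambda>k x. indicator K x * ((u (x + \<tau> k *\<^sub>R e) - u x) / \<tau> k - g x)"
  shows "\<forall>\<^sub>F k in sequentially. integrable lborel (q k)" "(\<lambda>k. LINT x|lborel. \<bar>q k x\<bar>) \<longlonglongrightarrow> 0"
proof -
  obtain d K' where dK: "d > 0" "compact K'" "K' \<subseteq> U" "\<And>x z. x \<in> K \<Longrightarrow> norm z \<le> d \<Longrightarrow> x + z \<in> K'"
    using compact_neighbourhood[OF U K] by metis
  have Km[measurable]: "K \<in> sets borel" using compact_imp_closed[OF K(1)] by (rule borel_closed)
  have [measurable]: "u \<in> borel_measurable borel" "g \<in> borel_measurable borel"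
    using u g by (auto simp: loc_int_def)
  define h where "h x = indicator K' x * g x" for x
  have h: "integrable lborel h" using loc_int_restrict[OF g dK(2,3)] by (simp add: h_def[abs_def])
  have z: "(\<lambda>k. \<tau> k *\<^sub>R e) \<longlonglongrightarrow> 0" using \<tau>(1) by (intro tendsto_eq_intros) auto
  have "\<forall>\<^sub>F k in sequentially. norm (\<tau> k *\<^sub>R e) < d"
    using tendstoD[OF z dK(1)] by (simp add: dist_norm)
  moreover have q: "AE x in lborel. q k x = indicator K x * (line_int h (\<tau> k *\<^sub>R e) x - h x)"
    if k: "norm (\<tau> k *\<^sub>R e) < d" for k
  proof -
    show ?thesis using line[of k]
    proof eventually_elim
      case (elim x)
      show ?case
      proof (cases "x \<in> K")
        case True
        have seg: "x + s *\<^sub>R \<tau> k *\<^sub>R e \<in> K'" if "0 \<le> s" "s \<le> 1" for s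
        proof (rule dK(4)[OF True])
          have "norm (s *\<^sub>R \<tau> k *\<^sub>R e) = s * norm (\<tau> k *\<^sub>R e)" using that by (simp add: abs_mult)
          also have "\<dots> \<le> 1 * norm (\<tau> k *\<^sub>R e)" using that by (intro mult_right_mono) auto
          finally show "norm (s *\<^sub>R \<tau> k *\<^sub>R e) \<le> d" using k by simp
        qed
        then have "closed_segment x (x + \<tau> k *\<^sub>R e) \<subseteq> U" using dK(3) unfolding closed_segment_shift by auto
        with elim have "u (x + \<tau> k *\<^sub>R e) - u x = \<tau> k * line_int g (\<tau> k *\<^sub>R e) x" by blast
        moreover have "line_int g (\<tau> k *\<^sub>R e) x = line_int h (\<tau> k *\<^sub>R e) x"
          unfolding line_int_def h_def using seg
          by (intro Bochner_Integration.integral_cong refl) (auto split: split_indicator)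
        moreover have "h x = g x" using seg[of 0] by (simp add: h_def)
        ultimately show ?thesis using \<tau>(2)[of k] True by (simp add: q_def)
      qed (simp add: q_def)
    qed
  qed
  have ih: "integrable lborel (\<lambda>x. indicator K x * (line_int h (\<tau> k *\<^sub>R e) x - h x))" for k
    using integrable_mult_indicator[of K lborel "\<lambda>x. line_int h (\<tau> k *\<^sub>R e) x - h x"] h integrable_line_int[OF h] by simp
  have hm[measurable]: "h \<in> borel_measurable borel" using h by auto
  have qm: "q k \<in> borel_measurable lborel" for k
    unfolding q_def by (simp add: borel_measurable_compose_continuous[OF u] continuous_intros)
  have iq: "integrable lborel (q k)" if k: "norm (\<tau> k *\<^sub>R e) < d" for k
    by (subst integrable_cong_AE[OF qm _ q[OF k]]) (use ih in auto)
  show "\<forall>\<^sub>F k in sequentially. integrable lborel (q k)"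
    using calculation iq by (auto elim: eventually_mono)
  have "\<forall>\<^sub>F k in sequentially. norm (LINT x|lborel. \<bar>q k x\<bar>) \<le> (LINT x|lborel. \<bar>line_int h (\<tau> k *\<^sub>R e) x - h x\<bar>)"
    using calculation
  proof eventually_elim
    case (elim k)
    have "(LINT x|lborel. \<bar>q k x\<bar>) \<le> (LINT x|lborel. \<bar>line_int h (\<tau> k *\<^sub>R e) x - h x\<bar>)"
    proof (rule integral_mono_AE)
      show "AE x in lborel. \<bar>q k x\<bar> \<le> \<bar>line_int h (\<tau> k *\<^sub>R e) x - h x\<bar>"
        using q[OF elim] by eventually_elim (auto split: split_indicator)
    qed (use iq[OF elim] h integrable_line_int[OF h] in auto)
    then show ?case by (simp add: integral_nonneg_AE)
  qed
  then show "(\<lambda>k. LINT x|lborel. \<bar>q k x\<bar>) \<longlonglongrightarrow> 0"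
    by (rule Lim_null_comparison[OF _ line_int_tendsto[OF h z]])
qed

lemma test_function_lipschitz:
  assumes \<phi>: "test_function U \<phi>" and B: "\<And>x. \<bar>frechet_derivative \<phi> (at x) e\<bar> \<le> B"
  shows "\<bar>\<phi> y - \<phi> (y - t *\<^sub>R e)\<bar> \<le> B * \<bar>t\<bar>"
proof -
  have lin: "linear (frechet_derivative \<phi> (at x))" for x
    using test_function_has_derivative[OF \<phi>] has_derivative_linear by blast
  have "\<phi> y - \<phi> (y - t *\<^sub>R e) = (LINT s|lborel. indicator {0..1} s * frechet_derivative \<phi> (at (y - s *\<^sub>R t *\<^sub>R e)) (t *\<^sub>R e))"
    by (rule test_function_FTC[OF \<phi>, symmetric])
  also have "\<bar>\<dots>\<bar> \<le> (LINT s|lborel. \<bar>indicator {0..1} s * frechet_derivative \<phi> (at (y - s *\<^sub>R t *\<^sub>R e)) (t *\<^sub>R e)\<bar>)"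
    by (rule integral_abs_bound)
  also have "\<dots> \<le> (LINT s|lborel. indicator {0..1::real} s * (B * \<bar>t\<bar>))"
  proof (rule integral_mono_AE')
    show "AE s in lborel. \<bar>indicator {0..1} s * frechet_derivative \<phi> (at (y - s *\<^sub>R t *\<^sub>R e)) (t *\<^sub>R e)\<bar> \<le> indicator {0..1} s * (B * \<bar>t\<bar>)"
    proof (intro AE_I2)
    fix s
    show "\<bar>indicator {0..1} s * frechet_derivative \<phi> (at (y - s *\<^sub>R t *\<^sub>R e)) (t *\<^sub>R e)\<bar> \<le> indicator {0..1} s * (B * \<bar>t\<bar>)"
      using mult_left_mono[OF B[of "y - s *\<^sub>R t *\<^sub>R e"], of "\<bar>t\<bar>"]
      by (auto simp: linear_scale[OF lin] abs_mult mult.commute split: split_indicator)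
    qed
    have "0 \<le> B" using B[of 0] by linarith
    then show "AE s in lborel. 0 \<le> indicator {0..1} s * (B * \<bar>t\<bar>)" by auto
  qed auto
  finally show ?thesis by simp
qed

text \<open>Discrete integration by parts puts the difference quotient on \<phi>, where it is
  bounded by a Lipschitz constant, supported in one compact set and convergent to minus the
  derivative. The steps \<tau> may depend on \<phi>; this freedom is used for positive parts, where
  a subsequence is extracted on the support of each \<phi>.\<close>

lemma wderiv_from_quotients:
  fixes U :: "'a::euclidean_space set"
  assumes U: "open U" and u: "loc_int U u" and G: "loc_int U G"
    and lim: "\<And>\<phi>. test_function U \<phi> \<Longrightarrow> \<exists>\<tau>. \<tau> \<longlonglongrightarrow> 0 \<and> (\<forall>k::nat. \<tau> k \<noteq> 0) \<and>
        (\<lambda>k. LINT x|lborel. (u (x + \<tau> k *\<^sub>R e) - u x) / \<tau> k * \<phi> x) \<longlonglongrightarrow> (LINT x|lborel. G x * \<phi> x)"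
  shows "wderiv U e u G"
  unfolding wderiv_def
proof (intro conjI allI impI)
  fix \<phi> assume \<phi>: "test_function U \<phi>"
  obtain \<tau> where \<tau>0: "\<tau> \<longlonglongrightarrow> 0" "\<And>k::nat. \<tau> k \<noteq> 0"
    "(\<lambda>k. LINT x|lborel. (u (x + \<tau> k *\<^sub>R e) - u x) / \<tau> k * \<phi> x) \<longlonglongrightarrow> (LINT x|lborel. G x * \<phi> x)"
    using lim[OF \<phi>] by blast
  define K where "K = closure {x. \<phi> x \<noteq> 0}"
  have K: "compact K" "K \<subseteq> U" using \<phi> by (auto simp: test_function_def K_def)
  have Kout: "\<phi> x = 0" if "x \<notin> K" for x
    using that closure_subset[of "{x. \<phi> x \<noteq> 0}"] by (auto simp: K_def)
  obtain d K' where dK: "d > 0" "compact K'" "K' \<subseteq> U" "\<And>x z. x \<in> K \<Longrightarrow> norm z \<le> d \<Longrightarrow> x + z \<in> K'"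
    using compact_neighbourhood[OF U K] by metis
  have "(\<lambda>k. \<tau> k *\<^sub>R e) \<longlonglongrightarrow> 0" using \<tau>0(1) by (intro tendsto_eq_intros) auto
  from tendstoD[OF this dK(1)] obtain N where N: "\<And>k. k \<ge> N \<Longrightarrow> norm (\<tau> k *\<^sub>R e) < d"
    by (auto simp: eventually_sequentially)
  define t where "t k = \<tau> (k + N)" for k
  \<comment> \<open>Dropping the first \<open>N\<close> steps keeps all shifts of the support of
    \<phi> inside the compact neighbourhood \<open>K'\<close>.\<close>
  have t: "t \<longlonglongrightarrow> 0" "\<And>k. t k \<noteq> 0" "\<And>k. norm (t k *\<^sub>R e) \<le> d"
    using LIMSEQ_ignore_initial_segment[OF \<tau>0(1), of N] \<tau>0(2) N by (auto simp: t_def[abs_def] less_imp_le)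
  have limt: "(\<lambda>k. LINT x|lborel. (u (x + t k *\<^sub>R e) - u x) / t k * \<phi> x) \<longlonglongrightarrow> (LINT x|lborel. G x * \<phi> x)"
    using LIMSEQ_ignore_initial_segment[OF \<tau>0(3), of N] by (simp add: t_def)
  have um: "u \<in> borel_measurable borel" using u by (simp add: loc_int_def)
  have [measurable]: "\<phi> \<in> borel_measurable borel"
    using test_function_deriv_continuous(1)[OF \<phi>] by (rule borel_measurable_continuous_onI)
  have transl: "test_function U (\<lambda>y. \<phi> (y - t k *\<^sub>R e))" for k
  proof -
    have "test_function U (\<lambda>x. \<phi> (x + - (t k *\<^sub>R e)))"
    proof (rule test_function_translate[OF \<phi>])
      fix x assume "x \<in> closure {x. \<phi> x \<noteq> 0}"
      then show "x - - (t k *\<^sub>R e) \<in> U" using dK(4)[OF _ t(3)[of k], of x] dK(3) by (auto simp: K_def)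
    qed
    then show ?thesis by simp
  qed
  have eq: "(LINT x|lborel. (u (x + t k *\<^sub>R e) - u x) / t k * \<phi> x) = (LINT y|lborel. u y * ((\<phi> (y - t k *\<^sub>R e) - \<phi> y) / t k))" for k
  proof -
    have i: "integrable lborel (\<lambda>y. u y * \<phi> y)" "integrable lborel (\<lambda>y. u y * \<phi> (y - t k *\<^sub>R e))"
      using loc_int_test_integrable(1)[OF u \<phi>] loc_int_test_integrable(1)[OF u transl] by auto
    have i': "integrable lborel (\<lambda>x. u (x + t k *\<^sub>R e) * \<phi> x)" using integrable_translate[OF i(2), of "t k *\<^sub>R e"] by simp
    have tr: "(LINT x|lborel. u (x + t k *\<^sub>R e) * \<phi> x) = (LINT y|lborel. u y * \<phi> (y - t k *\<^sub>R e))"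
      using integral_translate[of "\<lambda>y. u y * \<phi> (y - t k *\<^sub>R e)" "t k *\<^sub>R e"] borel_measurable_integrable[OF i(2)] by simp
    have "(LINT x|lborel. (u (x + t k *\<^sub>R e) - u x) / t k * \<phi> x) = (LINT x|lborel. (u (x + t k *\<^sub>R e) * \<phi> x - u x * \<phi> x) / t k)"
      by (simp add: left_diff_distrib)
    also have "\<dots> = ((LINT x|lborel. u (x + t k *\<^sub>R e) * \<phi> x) - (LINT x|lborel. u x * \<phi> x)) / t k"
      using i i' by simp
    also have "\<dots> = (LINT x|lborel. (u x * \<phi> (x - t k *\<^sub>R e) - u x * \<phi> x) / t k)"
      using i tr by simp
    finally show ?thesis by (simp add: right_diff_distrib)
  qed
  obtain B where B: "B \<ge> 0" "\<And>x. \<bar>frechet_derivative \<phi> (at x) e\<bar> \<le> B"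
    using test_function_bounded[OF \<phi>, of e] by metis
  have "(\<lambda>k. LINT y|lborel. u y * ((\<phi> (y - t k *\<^sub>R e) - \<phi> y) / t k)) \<longlonglongrightarrow> (LINT y|lborel. u y * (- frechet_derivative \<phi> (at y) e))"
  proof (rule integral_dominated_convergence[where w = "\<lambda>y. B * \<bar>indicator K' y * u y\<bar>"])
    show "integrable lborel (\<lambda>y. B * \<bar>indicator K' y * u y\<bar>)"
      using loc_int_restrict[OF u dK(2,3)] by auto
    show "(\<lambda>y. u y * (- frechet_derivative \<phi> (at y) e)) \<in> borel_measurable lborel"
      using borel_measurable_integrable[OF loc_int_test_integrable(2)[OF u \<phi>, of e]] by simp
    show "(\<lambda>y. u y * ((\<phi> (y - t k *\<^sub>R e) - \<phi> y) / t k)) \<in> borel_measurable lborel" for k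
      using um by measurable
    show "AE y in lborel. (\<lambda>k. u y * ((\<phi> (y - t k *\<^sub>R e) - \<phi> y) / t k)) \<longlonglongrightarrow> u y * (- frechet_derivative \<phi> (at y) e)"
    proof (intro AE_I2 tendsto_mult tendsto_const)
      fix y
      let ?D = "frechet_derivative \<phi> (at y)"
      have lin: "linear ?D"
        using test_function_has_derivative[OF \<phi>] has_derivative_linear by blast
      have "((\<lambda>s. y - s *\<^sub>R e) has_derivative (\<lambda>h. - (h *\<^sub>R e))) (at (0::real))"
        by (auto intro!: derivative_eq_intros)
      from has_derivative_compose[OF this, of \<phi> ?D] test_function_has_derivative[OF \<phi>, of y]
      have "((\<lambda>s. \<phi> (y - s *\<^sub>R e)) has_derivative (\<lambda>h. ?D (- (h *\<^sub>R e)))) (at 0)" by simp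
      moreover have "(\<lambda>h. ?D (- (h *\<^sub>R e))) = (*) (- ?D e)"
        using lin by (auto simp: linear_neg linear_scale)
      ultimately have "((\<lambda>s. \<phi> (y - s *\<^sub>R e)) has_real_derivative - ?D e) (at 0)"
        by (simp add: has_field_derivative_def)
      then have "((\<lambda>s. (\<phi> (y - s *\<^sub>R e) - \<phi> y) / s) \<longlongrightarrow> - ?D e) (at 0)"
        by (simp add: has_field_derivative_iff)
      moreover have "filterlim t (at 0) sequentially" using t(1,2) by (simp add: filterlim_at)
      ultimately show "(\<lambda>k. (\<phi> (y - t k *\<^sub>R e) - \<phi> y) / t k) \<longlonglongrightarrow> - ?D e"
        by (rule filterlim_compose)
    qed
    show "AE y in lborel. norm (u y * ((\<phi> (y - t k *\<^sub>R e) - \<phi> y) / t k)) \<le> B * \<bar>indicator K' y * u y\<bar>" for k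
    proof (intro AE_I2)
      fix y
      have "\<bar>(\<phi> (y - t k *\<^sub>R e) - \<phi> y) / t k\<bar> \<le> B"
        using test_function_lipschitz[OF \<phi> B(2), of y "t k"] t(2)[of k] by (simp add: abs_minus_commute divide_le_eq)
      moreover have "(\<phi> (y - t k *\<^sub>R e) - \<phi> y) / t k = 0" if "y \<notin> K'"
        using that dK(4)[of y 0] dK(4)[OF _ t(3)[of k], of "y - t k *\<^sub>R e"] dK(1) Kout[of y] Kout[of "y - t k *\<^sub>R e"] by force
      ultimately show "norm (u y * ((\<phi> (y - t k *\<^sub>R e) - \<phi> y) / t k)) \<le> B * \<bar>indicator K' y * u y\<bar>"
        using mult_left_mono[of "\<bar>(\<phi> (y - t k *\<^sub>R e) - \<phi> y) / t k\<bar>" B "\<bar>u y\<bar>"]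
        by (cases "y \<in> K'") (simp_all only: norm_mult real_norm_def abs_mult indicator_simps mult.commute[of B], simp_all add: t(2))
    qed
  qed
  then have "(LINT x|lborel. G x * \<phi> x) = (LINT y|lborel. u y * (- frechet_derivative \<phi> (at y) e))"
    using limt unfolding eq by (rule LIMSEQ_unique[rotated])
  then show "(LINT x|lborel. u x * frechet_derivative \<phi> (at x) e) = - (LINT x|lborel. G x * \<phi> x)"
    by simp
qed (use u G in auto)

lemma wderiv_scale_dir: "wderiv U e u g \<Longrightarrow> wderiv U (a *\<^sub>R e) u (\<lambda>x. a * g x)"
  using wderiv_lin_dir[of U e u g e g a 0] by simp

lemma line_int_scale: "line_int (\<lambda>x. a * g x) e x = a * line_int g e x"
  unfolding line_int_def by (simp add: mult.left_commute)

lemma wderiv_line_scaled: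
  assumes "open U" "wderiv U e u g"
  shows "AE x in lborel. closed_segment x (x + a *\<^sub>R e) \<subseteq> U \<longrightarrow>
    u (x + a *\<^sub>R e) - u x = a * line_int g (a *\<^sub>R e) x"
  using wderiv_line[OF assms(1) wderiv_scale_dir[OF assms(2), of a]] by (simp add: line_int_scale)

text \<open>Converse of \<open>wderiv_line_scaled\<close>: the line identity along one null sequence
  of steps characterizes the derivative. As only countably many steps occur, the identity survives
  the passage to slices.\<close>

lemma wderiv_from_lines:
  fixes U :: "'a::euclidean_space set"
  assumes U: "open U" and u: "loc_int U u" and g: "loc_int U g"
    and line: "\<And>k::nat. AE x in lborel. closed_segment x (x + \<tau> k *\<^sub>R e) \<subseteq> U \<longrightarrow>
        u (x + \<tau> k *\<^sub>R e) - u x = \<tau> k * line_int g (\<tau> k *\<^sub>R e) x"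
    and \<tau>: "\<tau> \<longlonglongrightarrow> 0" "\<And>k. \<tau> k \<noteq> 0"
  shows "wderiv U e u g"
proof (rule wderiv_from_quotients[OF U u g], intro exI conjI allI)
  fix \<phi> assume \<phi>: "test_function U \<phi>"
  obtain K where K: "compact K" "K \<subseteq> U" "\<And>x. x \<notin> K \<Longrightarrow> \<phi> x = 0"
    using test_function_support[OF \<phi>] by metis
  obtain B where B: "B \<ge> 0" "\<And>x. \<bar>\<phi> x\<bar> \<le> B"
    using test_function_bounded[OF \<phi>] by metis
  have um: "u \<in> borel_measurable borel" using u by (simp add: loc_int_def)
  let ?q = "\<lambda>k x. indicator K x * ((u (x + \<tau> k *\<^sub>R e) - u x) / \<tau> k - g x)"
  note q = quotient_L1[OF U um g line \<tau> K(1,2)]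
  have ig: "integrable lborel (\<lambda>x. g x * \<phi> x)" by (rule loc_int_test_integrable(1)[OF g \<phi>])
  have m[measurable]: "\<phi> \<in> borel_measurable borel"
    using test_function_deriv_continuous(1)[OF \<phi>] by (rule borel_measurable_continuous_onI)
  have "\<forall>\<^sub>F k in sequentially. norm ((LINT x|lborel. (u (x + \<tau> k *\<^sub>R e) - u x) / \<tau> k * \<phi> x) - (LINT x|lborel. g x * \<phi> x)) \<le> B * (LINT x|lborel. \<bar>?q k x\<bar>)"
    using q(1)
  proof eventually_elim
    case (elim k)
    have i: "integrable lborel (\<lambda>x. ?q k x * \<phi> x)"
      using elim m B(2) by (intro integrable_mult_bounded[of lborel "?q k"]) auto
    have "(u (x + \<tau> k *\<^sub>R e) - u x) / \<tau> k * \<phi> x = ?q k x * \<phi> x + g x * \<phi> x" for x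
      using K(3)[of x] by (cases "x \<in> K") (auto simp: algebra_simps)
    then have "(LINT x|lborel. (u (x + \<tau> k *\<^sub>R e) - u x) / \<tau> k * \<phi> x) - (LINT x|lborel. g x * \<phi> x) = (LINT x|lborel. ?q k x * \<phi> x)"
      using i ig by simp
    also have "\<bar>\<dots>\<bar> \<le> (LINT x|lborel. \<bar>?q k x * \<phi> x\<bar>)" by (rule integral_abs_bound)
    also have "\<dots> \<le> (LINT x|lborel. B * \<bar>?q k x\<bar>)"
    proof (rule integral_mono)
      fix x show "\<bar>?q k x * \<phi> x\<bar> \<le> B * \<bar>?q k x\<bar>"
        using mult_left_mono[OF B(2)[of x] abs_ge_zero[of "?q k x"]] by (simp only: abs_mult mult.commute[of B])
    qed (use i elim in auto)
    finally show ?case by simp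
  qed
  moreover have "(\<lambda>k. B * (LINT x|lborel. \<bar>?q k x\<bar>)) \<longlonglongrightarrow> 0" using q(2) by (rule tendsto_mult_right_zero)
  ultimately have "(\<lambda>k. (LINT x|lborel. (u (x + \<tau> k *\<^sub>R e) - u x) / \<tau> k * \<phi> x) - (LINT x|lborel. g x * \<phi> x)) \<longlonglongrightarrow> 0"
    by (rule Lim_null_comparison)
  then show "(\<lambda>k. LINT x|lborel. (u (x + \<tau> k *\<^sub>R e) - u x) / \<tau> k * \<phi> x) \<longlonglongrightarrow> (LINT x|lborel. g x * \<phi> x)"
    by (rule LIM_zero_cancel)
qed (use \<tau> in auto)

text \<open>By \<open>wderiv_line\<close> the increment is at most a mean of |g| over the segment.
  Integration over the starting point and translation invariance turn this mean into an integral of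
  |g| over \<open>K'\<close>.\<close>

lemma wderiv_shift_estimate:
  assumes U: "open U" and w: "wderiv U e u g" and K: "compact K"
    and K': "compact K'" "K' \<subseteq> U" "\<And>x s. x \<in> K \<Longrightarrow> 0 \<le> s \<Longrightarrow> s \<le> 1 \<Longrightarrow> x + s *\<^sub>R e \<in> K'"
  shows "(LINT x|lborel. indicator K x * \<bar>u (x + e) - u x\<bar>) \<le> (LINT x|lborel. indicator K' x * \<bar>g x\<bar>)"
proof -
  have g: "loc_int U g" using w by (simp add: wderiv_def)
  define h where "h x = \<bar>indicator K' x * g x\<bar>" for x
  have h: "integrable lborel h" using loc_int_restrict[OF g K'(1,2)] by (auto simp: h_def[abs_def])
  have "(LINT x|lborel. indicator K x * \<bar>u (x + e) - u x\<bar>) \<le> (LINT x|lborel. line_int h e x)"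
  proof (rule integral_mono_AE')
    show "integrable lborel (line_int h e)" by (rule integrable_line_int[OF h])
    have nn: "0 \<le> line_int h e x" for x
      unfolding line_int_def h_def by (intro integral_nonneg_AE) auto
    then show "AE x in lborel. 0 \<le> line_int h e x" by auto
    show "AE x in lborel. indicator K x * \<bar>u (x + e) - u x\<bar> \<le> line_int h e x"
      using wderiv_line[OF U w]
    proof eventually_elim
      case (elim x)
      show ?case
      proof (cases "x \<in> K")
        case True
        then have "closed_segment x (x + e) \<subseteq> U" using K' unfolding closed_segment_shift by auto
        with elim have "\<bar>u (x + e) - u x\<bar> = \<bar>line_int g e x\<bar>" by simp
        also have "\<dots> \<le> (LINT s|lborel. \<bar>indicator {0..1} s * g (x + s *\<^sub>R e)\<bar>)"
          unfolding line_int_def by (rule integral_abs_bound)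
        also have "\<dots> = line_int h e x"
          unfolding line_int_def h_def using K'(3)[OF True]
          by (intro Bochner_Integration.integral_cong refl) (auto split: split_indicator)
        finally show ?thesis using True by simp
      qed (simp add: nn)
    qed
  qed
  also have "\<dots> = (LINT x|lborel. h x)" by (rule integral_line_int[OF h])
  also have "\<dots> = (LINT x|lborel. indicator K' x * \<bar>g x\<bar>)" by (simp add: h_def abs_mult)
  finally show ?thesis .
qed

subsection \<open>Positive parts\<close>

text \<open>Dominated convergence with a moving majorant: \<open>d k\<close> tends to 0 in L1. The
  excess of |f k| over \<open>d k\<close> is dominated by the fixed function |w|, and the rest is at
  most \<open>d k\<close>.\<close>

lemma L1_tendsto_dominated:
  fixes f d :: "nat \<Rightarrow> 'a \<Rightarrow> real"
  assumes [measurable]: "\<And>k. f k \<in> borel_measurable M"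
    and d: "\<And>k. integrable M (d k)" "(\<lambda>k. LINT x|M. d k x) \<longlonglongrightarrow> 0"
    and w: "integrable M w" and b: "\<And>k. AE x in M. \<bar>f k x\<bar> \<le> d k x + w x" "\<And>k. AE x in M. 0 \<le> d k x"
    and lim: "AE x in M. (\<lambda>k. f k x) \<longlonglongrightarrow> 0"
  shows "\<And>k. integrable M (f k)" "(\<lambda>k. LINT x|M. \<bar>f k x\<bar>) \<longlonglongrightarrow> 0"
proof -
  show i: "integrable M (f k)" for k
  proof (rule Bochner_Integration.integrable_bound)
    show "integrable M (\<lambda>x. d k x + w x)" using d w by auto
    show "AE x in M. norm (f k x) \<le> norm (d k x + w x)" using b(1)[of k] by eventually_elim auto
  qed simp
  have [measurable]: "w \<in> borel_measurable M" "\<And>k. d k \<in> borel_measurable M" using w d by auto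
  have "(\<lambda>k. LINT x|M. max 0 (\<bar>f k x\<bar> - d k x)) \<longlonglongrightarrow> (LINT x|M. (0::real))"
  proof (rule integral_dominated_convergence[where w = "\<lambda>x. \<bar>w x\<bar>"])
    show "AE x in M. norm (max 0 (\<bar>f k x\<bar> - d k x)) \<le> \<bar>w x\<bar>" for k
      using b(1)[of k] by eventually_elim auto
    have "AE x in M. \<forall>k. 0 \<le> d k x" using b(2) by (simp add: AE_all_countable)
    with lim show "AE x in M. (\<lambda>k. max 0 (\<bar>f k x\<bar> - d k x)) \<longlonglongrightarrow> 0"
    proof eventually_elim
      case (elim x)
      have *: "(\<lambda>k. \<bar>f k x\<bar>) \<longlonglongrightarrow> 0" using elim(1) by (rule tendsto_rabs_zero)
      show ?case by (rule Lim_null_comparison[OF _ *]) (use elim(2) in \<open>auto simp: max_def\<close>)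
    qed
  qed (use w in auto)
  then have "(\<lambda>k. (LINT x|M. max 0 (\<bar>f k x\<bar> - d k x)) + (LINT x|M. d k x)) \<longlonglongrightarrow> 0 + 0"
    using d(2) by (intro tendsto_add) auto
  then have lim0: "(\<lambda>k. (LINT x|M. max 0 (\<bar>f k x\<bar> - d k x)) + (LINT x|M. d k x)) \<longlonglongrightarrow> 0" by simp
  show "(\<lambda>k. LINT x|M. \<bar>f k x\<bar>) \<longlonglongrightarrow> 0"
  proof (rule Lim_null_comparison[OF always_eventually[OF allI] lim0])
    fix k
    have im: "integrable M (\<lambda>x. max 0 (\<bar>f k x\<bar> - d k x))" using i d by auto
    have "(LINT x|M. \<bar>f k x\<bar>) \<le> (LINT x|M. max 0 (\<bar>f k x\<bar> - d k x) + d k x)"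
      using i im d by (intro integral_mono) auto
    also have "\<dots> = (LINT x|M. max 0 (\<bar>f k x\<bar> - d k x)) + (LINT x|M. d k x)"
      using im d by simp
    finally show "norm (LINT x|M. \<bar>f k x\<bar>) \<le> (LINT x|M. max 0 (\<bar>f k x\<bar> - d k x)) + (LINT x|M. d k x)"
      by (simp add: integral_nonneg_AE)
  qed
qed

lemma loc_int_bound:
  assumes "loc_int U g" "f \<in> borel_measurable borel" "\<And>x. \<bar>f x\<bar> \<le> \<bar>g x\<bar>"
  shows "loc_int U f"
  unfolding loc_int_def set_integrable_def
proof (intro conjI allI impI assms(2))
  fix K assume K: "compact K" "K \<subseteq> U"
  show "integrable lborel (\<lambda>x. indicator K x *\<^sub>R f x)"
  proof (rule Bochner_Integration.integrable_bound)
    show "integrable lborel (\<lambda>x. indicator K x *\<^sub>R g x)"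
      using assms(1) K by (auto simp: loc_int_def set_integrable_def)
    show "(\<lambda>x. indicator K x *\<^sub>R f x) \<in> borel_measurable lborel"
      using assms(2) borel_closed[OF compact_imp_closed[OF K(1)]] by auto
  qed (use assms(3) in \<open>auto split: split_indicator\<close>)
qed

lemma wderiv_cong_AE:
  assumes U: "open U" and w: "wderiv U e u g" and m: "u' \<in> borel_measurable borel" "g' \<in> borel_measurable borel"
    and ae: "ae_eq U u u'" "ae_eq U g g'"
  shows "wderiv U e u' g'"
  using has_weak_deriv_iff_wderiv[OF U m ae] wderiv_has_weak_deriv[OF U w] by blast

text \<open>All steps have the sign \<sigma>. This matters only at \<open>a = 0\<close>, where the
  positive part has a corner and its quotient is \<sigma> max(0, \<sigma> q), so that the limit
  depends on \<sigma>.\<close>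

lemma tendsto_max_0_quotient:
  fixes q \<tau> :: "nat \<Rightarrow> real"
  assumes q: "q \<longlonglongrightarrow> g" and \<tau>: "\<tau> \<longlonglongrightarrow> 0" "\<And>k. \<tau> k = \<sigma> * \<bar>\<tau> k\<bar>" "\<And>k. \<tau> k \<noteq> 0" and \<sigma>: "\<sigma> = 1 \<or> \<sigma> = -1"
  shows "(\<lambda>k. (max 0 (a + \<tau> k * q k) - max 0 a) / \<tau> k) \<longlonglongrightarrow>
     (if a > 0 then g else if a = 0 \<and> \<sigma> * g > 0 then g else 0)"
proof -
  have *: "(\<lambda>k. a + \<tau> k * q k) \<longlonglongrightarrow> a + 0 * g" using q \<tau>(1) by (intro tendsto_intros)
  consider "a > 0" | "a < 0" | "a = 0" by linarith
  then show ?thesis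
  proof cases
    case 1
    then have "\<forall>\<^sub>F k in sequentially. a + \<tau> k * q k > 0" using order_tendstoD(1)[OF *, of 0] by simp
    then have "\<forall>\<^sub>F k in sequentially. q k = (max 0 (a + \<tau> k * q k) - max 0 a) / \<tau> k"
      by eventually_elim (use 1 \<tau>(3) in auto)
    from Lim_transform_eventually[OF q this] show ?thesis using 1 by simp
  next
    case 2
    then have "\<forall>\<^sub>F k in sequentially. a + \<tau> k * q k < 0" using order_tendstoD(2)[OF *, of 0] by simp
    then have "\<forall>\<^sub>F k in sequentially. (max 0 (a + \<tau> k * q k) - max 0 a) / \<tau> k = 0"
      by eventually_elim (use 2 in auto)
    then show ?thesis using 2 by (simp add: tendsto_eventually)
  next
    case 3
    have "max 0 (\<tau> k * q k) / \<tau> k = \<sigma> * max 0 (\<sigma> * q k)" for k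
    proof -
      define t where "t = \<bar>\<tau> k\<bar>"
      have t: "t > 0" "\<tau> k = \<sigma> * t" using \<tau>(2,3)[of k] by (auto simp: t_def)
      then show ?thesis using \<sigma> by (auto simp: max_def zero_le_mult_iff mult_le_0_iff divide_simps)
    qed
    moreover have "(\<lambda>k. \<sigma> * max 0 (\<sigma> * q k)) \<longlonglongrightarrow> \<sigma> * max 0 (\<sigma> * g)" using q by (intro tendsto_intros)
    moreover have "\<sigma> * max 0 (\<sigma> * g) = (if \<sigma> * g > 0 then g else 0)" using \<sigma> by auto
    ultimately show ?thesis using 3 by simp
  qed
qed

text \<open>Quotients of the positive part are bounded by those of \<open>u\<close>, which converge
  in L1 near the support of each test function. Taking all steps of sign \<sigma> fixes the limit on
  the zero set of \<open>u\<close>. Having the result for both signs is the point: comparing them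
  determines the derivative there.\<close>

lemma wderiv_pos_part_onesided:
  fixes U :: "'a::euclidean_space set"
  assumes U: "open U" and w: "wderiv U e u g" and \<sigma>: "\<sigma> = 1 \<or> \<sigma> = (-1::real)"
  shows "wderiv U e (\<lambda>x. max 0 (u x)) (\<lambda>x. if u x > 0 then g x else if u x = 0 \<and> \<sigma> * g x > 0 then g x else 0)"
proof -
  have lu: "loc_int U u" and lg: "loc_int U g" using w by (auto simp: wderiv_def)
  have m[measurable]: "u \<in> borel_measurable borel" "g \<in> borel_measurable borel" using lu lg by (auto simp: loc_int_def)
  define G where "G x = (if u x > 0 then g x else if u x = 0 \<and> \<sigma> * g x > 0 then g x else 0)" for x
  have Gm[measurable]: "G \<in> borel_measurable borel" unfolding G_def by measurable
  have lG: "loc_int U G" by (rule loc_int_bound[OF lg]) (auto simp: G_def)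
  have lu': "loc_int U (\<lambda>x. max 0 (u x))" by (rule loc_int_bound[OF lu]) auto
  have "wderiv U e (\<lambda>x. max 0 (u x)) G"
  proof (rule wderiv_from_quotients[OF U lu' lG])
    fix \<phi> assume \<phi>: "test_function U \<phi>"
    obtain K where K: "compact K" "K \<subseteq> U" "\<And>x. x \<notin> K \<Longrightarrow> \<phi> x = 0"
      using test_function_support[OF \<phi>] by metis
    have Km[measurable]: "K \<in> sets borel" using compact_imp_closed[OF K(1)] by (rule borel_closed)
    have [measurable]: "\<phi> \<in> borel_measurable borel"
      using test_function_deriv_continuous(1)[OF \<phi>] by (rule borel_measurable_continuous_onI)
    obtain B where B: "B \<ge> 0" "\<And>x. \<bar>\<phi> x\<bar> \<le> B"
      using test_function_bounded[OF \<phi>] by metis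
    define \<tau>0 where "\<tau>0 k = \<sigma> * inverse (real (Suc k))" for k
    have \<tau>0: "\<tau>0 \<longlonglongrightarrow> 0" "\<And>k. \<tau>0 k \<noteq> 0"
      using tendsto_mult_right_zero[OF LIMSEQ_inverse_real_of_nat, of \<sigma>] \<sigma> by (auto simp: \<tau>0_def[abs_def])
    define q where "q t x = (u (x + t *\<^sub>R e) - u x) / t" for t x
    have q: "\<forall>\<^sub>F k in sequentially. integrable lborel (\<lambda>x. indicator K x * (q (\<tau>0 k) x - g x))"
       "(\<lambda>k. LINT x|lborel. \<bar>indicator K x * (q (\<tau>0 k) x - g x)\<bar>) \<longlonglongrightarrow> 0"
      using quotient_L1[OF U m(1) lg wderiv_line_scaled[OF U w] \<tau>0 K(1,2)] unfolding q_def by auto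
    obtain N where N: "\<And>k. integrable lborel (\<lambda>x. indicator K x * (q (\<tau>0 (k + N)) x - g x))"
      using q(1) unfolding eventually_sequentially by (metis le_add2)
    have "(\<lambda>k. LINT x|lborel. norm (indicator K x * (q (\<tau>0 (k + N)) x - g x))) \<longlonglongrightarrow> 0"
      using LIMSEQ_ignore_initial_segment[OF q(2), of N] by simp
    \<comment> \<open>L1 convergence gives pointwise convergence only along a subsequence, and it
      depends on \<phi> through \<open>K\<close>.\<close>
    from tendsto_L1_AE_subseq[OF N this] obtain r where r: "strict_mono r"
      "AE x in lborel. (\<lambda>n. indicator K x * (q (\<tau>0 (r n + N)) x - g x)) \<longlonglongrightarrow> 0" by blast
    define \<tau> where "\<tau> n = \<tau>0 (r n + N)" for n
    have sub: "filterlim (\<lambda>n. r n + N) sequentially sequentially"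
      using filterlim_subseq[OF r(1)] by (rule filterlim_at_top_mono) (auto intro!: always_eventually)
    have \<tau>: "\<tau> \<longlonglongrightarrow> 0" "\<And>k. \<tau> k \<noteq> 0" "\<And>k. \<tau> k = \<sigma> * \<bar>\<tau> k\<bar>"
      using filterlim_compose[OF \<tau>0(1) sub] \<tau>0(2) \<sigma> by (auto simp: \<tau>_def[abs_def] \<tau>0_def)
    define Q where "Q k x = (max 0 (u (x + \<tau> k *\<^sub>R e)) - max 0 (u x)) / \<tau> k" for k x
    have Qm[measurable]: "Q k \<in> borel_measurable borel" for k
      unfolding Q_def using borel_measurable_compose_continuous[OF m(1), of "\<lambda>x. x + \<tau> k *\<^sub>R e"]
      by (simp add: continuous_intros)
    define f where "f k x = indicator K x * (Q k x - G x)" for k x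
    have uq: "u (x + \<tau> k *\<^sub>R e) = u x + \<tau> k * q (\<tau> k) x" for k x
      using \<tau>(2)[of k] by (simp add: q_def)
    have Qq: "\<bar>Q k x\<bar> \<le> \<bar>q (\<tau> k) x\<bar>" for k x
    proof -
      have "\<bar>max 0 (u (x + \<tau> k *\<^sub>R e)) - max 0 (u x)\<bar> \<le> \<bar>u (x + \<tau> k *\<^sub>R e) - u x\<bar>" by linarith
      then show ?thesis by (simp add: Q_def q_def abs_divide divide_right_mono)
    qed
    have flc: "(\<forall>k. integrable lborel (f k)) \<and> (\<lambda>k. LINT x|lborel. \<bar>f k x\<bar>) \<longlonglongrightarrow> 0"
    proof -
      let ?d = "\<lambda>k x. \<bar>indicator K x * (q (\<tau> k) x - g x)\<bar>" and ?w = "\<lambda>x. 2 * \<bar>indicator K x * g x\<bar>"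
      have d: "integrable lborel (?d k)" for k using N[of "r k"] by (intro integrable_abs) (simp add: \<tau>_def)
      have d0: "(\<lambda>k. LINT x|lborel. ?d k x) \<longlonglongrightarrow> 0"
        using filterlim_compose[OF q(2) sub] by (simp add: \<tau>_def)
      have w: "integrable lborel ?w"
        using loc_int_restrict[OF lg K(1,2)] by (intro integrable_mult_right integrable_abs)
      have b: "AE x in lborel. \<bar>f k x\<bar> \<le> ?d k x + ?w x" for k
      proof (intro AE_I2)
        fix x
        have "\<bar>G x\<bar> \<le> \<bar>g x\<bar>" by (simp add: G_def)
        then have "\<bar>Q k x - G x\<bar> \<le> \<bar>q (\<tau> k) x - g x\<bar> + 2 * \<bar>g x\<bar>" using Qq[of k x] by linarith
        then show "\<bar>f k x\<bar> \<le> ?d k x + ?w x" by (simp add: f_def split: split_indicator)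
      qed
      have lim: "AE x in lborel. (\<lambda>k. f k x) \<longlonglongrightarrow> 0"
        using r(2)
      proof eventually_elim
        case (elim x)
        show ?case
        proof (cases "x \<in> K")
          case True
          then have "(\<lambda>k. q (\<tau> k) x - g x) \<longlonglongrightarrow> 0" using elim by (simp add: \<tau>_def)
          then have "(\<lambda>k. q (\<tau> k) x) \<longlonglongrightarrow> g x" by (rule LIM_zero_cancel)
          from tendsto_max_0_quotient[OF this \<tau>(1,3,2) \<sigma>, of "u x"]
          have "(\<lambda>k. Q k x) \<longlonglongrightarrow> G x" by (simp add: Q_def uq G_def)
          then show ?thesis using True by (simp add: f_def LIM_zero)
        qed (simp add: f_def)
      qed
      have fm: "f k \<in> borel_measurable lborel" for k unfolding f_def by measurable
      show ?thesis
        using L1_tendsto_dominated[where f = f and d = ?d and w = ?w, OF fm d d0 w b _ lim] by simp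
    qed
    then have fl: "\<And>k. integrable lborel (f k)" "(\<lambda>k. LINT x|lborel. \<bar>f k x\<bar>) \<longlonglongrightarrow> 0" by auto
    have iG: "integrable lborel (\<lambda>x. G x * \<phi> x)" by (rule loc_int_test_integrable(1)[OF lG \<phi>])
    have bd: "norm ((LINT x|lborel. Q k x * \<phi> x) - (LINT x|lborel. G x * \<phi> x)) \<le> B * (LINT x|lborel. \<bar>f k x\<bar>)" for k
    proof -
      have ff: "norm (f k x * \<phi> x) \<le> B * \<bar>f k x\<bar>" for x
        using mult_left_mono[OF B(2)[of x], of "\<bar>f k x\<bar>"] by (simp add: abs_mult mult.commute)
      have i: "integrable lborel (\<lambda>x. f k x * \<phi> x)"
        by (rule integrable_mult_bounded[OF fl(1) _ B(2)]) measurable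
      have "Q k x * \<phi> x = f k x * \<phi> x + G x * \<phi> x" for x
        using K(3)[of x] by (cases "x \<in> K") (auto simp: f_def algebra_simps)
      then have "(LINT x|lborel. Q k x * \<phi> x) - (LINT x|lborel. G x * \<phi> x) = (LINT x|lborel. f k x * \<phi> x)"
        using i iG by simp
      also have "norm \<dots> \<le> (LINT x|lborel. norm (f k x * \<phi> x))" by (rule integral_norm_bound)
      also have "\<dots> \<le> (LINT x|lborel. B * \<bar>f k x\<bar>)"
        using ff i fl(1)[of k] by (intro integral_mono) auto
      finally show ?thesis by simp
    qed
    have "(\<lambda>k. B * (LINT x|lborel. \<bar>f k x\<bar>)) \<longlonglongrightarrow> 0" using fl(2) by (rule tendsto_mult_right_zero)
    then have "(\<lambda>k. (LINT x|lborel. Q k x * \<phi> x) - (LINT x|lborel. G x * \<phi> x)) \<longlonglongrightarrow> 0"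
      by (rule Lim_null_comparison[rotated]) (use bd in auto)
    then have "(\<lambda>k. LINT x|lborel. Q k x * \<phi> x) \<longlonglongrightarrow> (LINT x|lborel. G x * \<phi> x)"
      by (rule LIM_zero_cancel)
    then show "\<exists>\<tau>. \<tau> \<longlonglongrightarrow> 0 \<and> (\<forall>k::nat. \<tau> k \<noteq> 0) \<and>
        (\<lambda>k. LINT x|lborel. (max 0 (u (x + \<tau> k *\<^sub>R e)) - max 0 (u x)) / \<tau> k * \<phi> x) \<longlonglongrightarrow> (LINT x|lborel. G x * \<phi> x)"
      using \<tau> by (intro exI[of _ \<tau>]) (simp add: Q_def)
  qed
  then show ?thesis by (simp add: G_def[abs_def])
qed

text \<open>Both one-sided quotients of the positive part converge, so their limits agree; on the zero
  set this forces the derivative to vanish.\<close>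

lemma wderiv_zero_set:
  assumes U: "open U" and w: "wderiv U e u g"
  shows "AE x in lborel. x \<in> U \<longrightarrow> u x = 0 \<longrightarrow> g x = 0"
  using wderiv_unique[OF U wderiv_pos_part_onesided[OF U w, of 1] wderiv_pos_part_onesided[OF U w, of "-1"]]
  by (simp, elim eventually_mono) (auto split: if_splits)

lemma wderiv_pos_part:
  assumes U: "open U" and w: "wderiv U e u g"
  shows "wderiv U e (\<lambda>x. max 0 (u x)) (\<lambda>x. if u x > 0 then g x else 0)"
proof (rule wderiv_cong_AE[OF U wderiv_pos_part_onesided[OF U w, of 1]])
  have [measurable]: "u \<in> borel_measurable borel" "g \<in> borel_measurable borel"
    using w by (auto simp: wderiv_def loc_int_def)
  show "(\<lambda>x. max 0 (u x)) \<in> borel_measurable borel" "(\<lambda>x. if u x > 0 then g x else 0) \<in> borel_measurable borel"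
    by measurable
  show "AE x in lborel. x \<in> U \<longrightarrow> (if 0 < u x then g x else if u x = 0 \<and> 0 < 1 * g x then g x else 0) = (if 0 < u x then g x else 0)"
    using wderiv_zero_set[OF U w] by eventually_elim auto
qed auto

definition clamp01 :: "real \<Rightarrow> real" where
  "clamp01 s = max 0 (min s 1)"

lemma clamp01_eq: "clamp01 s = 1 * max 0 s + (-1) * max 0 (s - 1)"
  by (auto simp: clamp01_def)

lemma wderiv_const:
  fixes U :: "'a::euclidean_space set"
  assumes "open U" shows "wderiv U e (\<lambda>x. c) (\<lambda>x. 0)"
proof (rule wderiv_from_lines[OF assms, where \<tau> = "\<lambda>k. inverse (real (Suc k))"])
  show "loc_int U (\<lambda>x. c)"
    unfolding loc_int_def set_integrable_def
  proof (intro conjI allI impI)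
    fix K :: "'a set" assume K: "compact K"
    have "integrable lborel (indicator K :: 'a \<Rightarrow> real)"
      using emeasure_compact_finite[OF K] compact_imp_closed[OF K]
      by (auto intro!: integrable_real_indicator borel_closed)
    then have "integrable lborel (\<lambda>x. indicator K x * c)" by (rule integrable_mult_left)
    then show "integrable lborel (\<lambda>x. indicator K x *\<^sub>R c)" by simp
  qed simp
  show "loc_int U (\<lambda>x. 0)" by (simp add: loc_int_def set_integrable_def)
  show "(\<lambda>k. inverse (real (Suc k))) \<longlonglongrightarrow> 0" by (rule LIMSEQ_inverse_real_of_nat)
qed (auto simp: line_int_def)

text \<open>Truncation is the difference of the positive parts of \<open>u\<close> and of
  \<open>u - 1\<close>. This yields \<open>g\<close> on the set where 0 < u \<le> 1; the level set
  of 1 is removed because the derivative vanishes a.e. on it.\<close>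

lemma wderiv_clamp01:
  assumes U: "open U" and w: "wderiv U e u g"
  shows "wderiv U e (\<lambda>x. clamp01 (u x)) (\<lambda>x. if 0 < u x \<and> u x < 1 then g x else 0)"
proof -
  have m[measurable]: "u \<in> borel_measurable borel" "g \<in> borel_measurable borel"
    using w by (auto simp: wderiv_def loc_int_def)
  have w1: "wderiv U e (\<lambda>x. u x - 1) g"
    using wderiv_lin[OF w wderiv_const[OF U, of e "-1"], of 1 1] by simp
  have "wderiv U e (\<lambda>x. clamp01 (u x)) (\<lambda>x. 1 * (if u x > 0 then g x else 0) + (-1) * (if u x - 1 > 0 then g x else 0))"
    unfolding clamp01_eq by (rule wderiv_lin[OF wderiv_pos_part[OF U w] wderiv_pos_part[OF U w1]])
  then show ?thesis
  proof (rule wderiv_cong_AE[OF U])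
    show "(\<lambda>x. clamp01 (u x)) \<in> borel_measurable borel" unfolding clamp01_def by measurable
    show "(\<lambda>x. if 0 < u x \<and> u x < 1 then g x else 0) \<in> borel_measurable borel" by measurable
    show "AE x in lborel. x \<in> U \<longrightarrow> 1 * (if u x > 0 then g x else 0) + (-1) * (if u x - 1 > 0 then g x else 0) = (if 0 < u x \<and> u x < 1 then g x else 0)"
      using wderiv_zero_set[OF U w1] by eventually_elim auto
  qed auto
qed

subsection \<open>Calculus of weak derivatives\<close>

lemma has_weak_deriv_measurable:
  assumes "open U" "has_weak_deriv U e u g"
  shows "u \<in> borel_measurable (lebesgue_on U)" "g \<in> borel_measurable (lebesgue_on U)"
  using assms by (auto simp: has_weak_deriv_def intro!: locally_abs_integrable_measurable)

lemma AE_lebesgue_on_open: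
  fixes U :: "'a::euclidean_space set"
  shows "open U \<Longrightarrow> (AE x in lebesgue_on U. P x) \<longleftrightarrow> (AE x in lborel. x \<in> U \<longrightarrow> P x)"
  by (intro AE_lebesgue_on_iff) auto

lemma has_weak_deriv_unique:
  assumes U: "open U" and "has_weak_deriv U e u g" "has_weak_deriv U e u h"
  shows "AE x in lebesgue_on U. g x = h x"
proof -
  obtain u1 g1 where 1: "wderiv U e u1 g1" "ae_eq U u u1" "ae_eq U g g1"
    using has_weak_deriv_borel[OF U assms(2)] by blast
  obtain u2 g2 where 2: "wderiv U e u2 g2" "ae_eq U u u2" "ae_eq U h g2"
    using has_weak_deriv_borel[OF U assms(3)] by blast
  have m: "u1 \<in> borel_measurable borel" "g2 \<in> borel_measurable borel"
    using 1(1) 2(1) by (auto simp: wderiv_def loc_int_def)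
  have "ae_eq U u2 u1" using 1(2) 2(2) by eventually_elim auto
  then have "wderiv U e u1 g2" by (rule wderiv_cong_AE[OF U 2(1) m]) auto
  from wderiv_unique[OF U 1(1) this] 1(3) 2(3) show ?thesis
    unfolding AE_lebesgue_on_open[OF U] by eventually_elim auto
qed

lemma has_weak_deriv_cong:
  assumes U: "open U" and w: "has_weak_deriv U e u g"
    and "AE x in lebesgue_on U. u x = u' x" "AE x in lebesgue_on U. g x = g' x"
  shows "has_weak_deriv U e u' g'"
proof -
  obtain u1 g1 where 1: "wderiv U e u1 g1" "ae_eq U u u1" "ae_eq U g g1"
    using has_weak_deriv_borel[OF U w] by blast
  have m: "u1 \<in> borel_measurable borel" "g1 \<in> borel_measurable borel"
    using 1(1) by (auto simp: wderiv_def loc_int_def)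
  have "ae_eq U u' u1" "ae_eq U g' g1"
    using assms(3,4) 1(2,3) unfolding AE_lebesgue_on_open[OF U] by (eventually_elim, auto)+
  then show ?thesis using has_weak_deriv_iff_wderiv[OF U m] 1(1) by blast
qed

lemma has_weak_deriv_lin:
  assumes U: "open U" and "has_weak_deriv U e u g" "has_weak_deriv U e v h"
  shows "has_weak_deriv U e (\<lambda>x. a * u x + b * v x) (\<lambda>x. a * g x + b * h x)"
proof -
  obtain u1 g1 where 1: "wderiv U e u1 g1" "ae_eq U u u1" "ae_eq U g g1"
    using has_weak_deriv_borel[OF U assms(2)] by blast
  obtain u2 g2 where 2: "wderiv U e u2 g2" "ae_eq U v u2" "ae_eq U h g2"
    using has_weak_deriv_borel[OF U assms(3)] by blast
  show ?thesis
  proof (rule has_weak_deriv_cong[OF U wderiv_has_weak_deriv[OF U wderiv_lin[OF 1(1) 2(1), of a b]]])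
    show "AE x in lebesgue_on U. a * u1 x + b * u2 x = a * u x + b * v x"
      using 1(2) 2(2) unfolding AE_lebesgue_on_open[OF U] by eventually_elim auto
    show "AE x in lebesgue_on U. a * g1 x + b * g2 x = a * g x + b * h x"
      using 1(3) 2(3) unfolding AE_lebesgue_on_open[OF U] by eventually_elim auto
  qed
qed

lemma has_weak_deriv_diff:
  assumes "open U" "has_weak_deriv U e u g" "has_weak_deriv U e v h"
  shows "has_weak_deriv U e (\<lambda>x. u x - v x) (\<lambda>x. g x - h x)"
  using has_weak_deriv_lin[OF assms, of 1 "-1"] by simp

lemma has_weak_deriv_clamp01:
  assumes U: "open U" and w: "has_weak_deriv U e u g"
  shows "has_weak_deriv U e (\<lambda>x. clamp01 (u x)) (\<lambda>x. if 0 < u x \<and> u x < 1 then g x else 0)"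
proof -
  obtain u1 g1 where 1: "wderiv U e u1 g1" "ae_eq U u u1" "ae_eq U g g1"
    using has_weak_deriv_borel[OF U w] by blast
  show ?thesis
  proof (rule has_weak_deriv_cong[OF U wderiv_has_weak_deriv[OF U wderiv_clamp01[OF U 1(1)]]])
    show "AE x in lebesgue_on U. clamp01 (u1 x) = clamp01 (u x)"
      using 1(2) unfolding AE_lebesgue_on_open[OF U] by eventually_elim auto
    show "AE x in lebesgue_on U. (if 0 < u1 x \<and> u1 x < 1 then g1 x else 0) = (if 0 < u x \<and> u x < 1 then g x else 0)"
      using 1(2,3) unfolding AE_lebesgue_on_open[OF U] by eventually_elim auto
  qed
qed

lemma has_weak_deriv_level_set:
  assumes U: "open U" and w: "has_weak_deriv U e u g"
  shows "AE x in lebesgue_on U. u x = c \<longrightarrow> g x = 0"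
proof -
  obtain u1 g1 where 1: "wderiv U e u1 g1" "ae_eq U u u1" "ae_eq U g g1"
    using has_weak_deriv_borel[OF U w] by blast
  have "wderiv U e (\<lambda>x. u1 x - c) g1"
    using wderiv_lin[OF 1(1) wderiv_const[OF U, of e "-c"], of 1 1] by simp
  from wderiv_zero_set[OF U this] 1(2,3) show ?thesis
    unfolding AE_lebesgue_on_open[OF U] by eventually_elim auto
qed

lemma has_weak_deriv_subset:
  assumes U: "open U" "open V" "V \<subseteq> U" and w: "has_weak_deriv U e u g"
  shows "has_weak_deriv V e u g"
proof -
  obtain u1 g1 where 1: "wderiv U e u1 g1" "ae_eq U u u1" "ae_eq U g g1"
    using has_weak_deriv_borel[OF U(1) w] by blast
  have "wderiv V e u1 g1"
    using 1(1) U(3) test_function_mono[of V _ U] unfolding wderiv_def loc_int_def by blast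
  from wderiv_has_weak_deriv[OF U(2) this] show ?thesis
    by (rule has_weak_deriv_cong[OF U(2)])
      (use 1(2,3) U(3) in \<open>unfold AE_lebesgue_on_open[OF U(2)], (eventually_elim, auto)+\<close>)
qed

subsection \<open>Square integrable functions\<close>

lemma L2_D:
  assumes "f \<in> L2_space M" shows "f \<in> borel_measurable M" "integrable M (\<lambda>x. (f x)\<^sup>2)"
  using assms by (auto simp: L2_space_def)

lemma sq_add_le: "((a::real) + b)\<^sup>2 \<le> 2 * a\<^sup>2 + 2 * b\<^sup>2"
  using sum_squares_bound[of a b] by (simp add: power2_sum)

lemma L2_bound:
  assumes "g \<in> L2_space M" "f \<in> borel_measurable M" "AE x in M. \<bar>f x\<bar> \<le> \<bar>g x\<bar>"
  shows "f \<in> L2_space M"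
  unfolding L2_space_def
proof (intro CollectI conjI assms(2))
  show "integrable M (\<lambda>x. (f x)\<^sup>2)"
  proof (rule Bochner_Integration.integrable_bound[OF L2_D(2)[OF assms(1)]])
    show "AE x in M. norm ((f x)\<^sup>2) \<le> norm ((g x)\<^sup>2)"
      using assms(3) by eventually_elim (simp add: abs_le_square_iff)
  qed (use assms(2) in simp)
qed

lemma L2_lin:
  assumes "f \<in> L2_space M" "g \<in> L2_space M"
  shows "(\<lambda>x. a * f x + b * g x) \<in> L2_space M"
  unfolding L2_space_def
proof (intro CollectI conjI)
  have [measurable]: "f \<in> borel_measurable M" "g \<in> borel_measurable M" using assms by (auto dest: L2_D)
  show "(\<lambda>x. a * f x + b * g x) \<in> borel_measurable M" by measurable
  show "integrable M (\<lambda>x. (a * f x + b * g x)\<^sup>2)"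
  proof (rule Bochner_Integration.integrable_bound)
    show "integrable M (\<lambda>x. 2 * a\<^sup>2 * (f x)\<^sup>2 + 2 * b\<^sup>2 * (g x)\<^sup>2)"
      using assms[THEN L2_D(2)] by auto
    show "AE x in M. norm ((a * f x + b * g x)\<^sup>2) \<le> norm (2 * a\<^sup>2 * (f x)\<^sup>2 + 2 * b\<^sup>2 * (g x)\<^sup>2)"
      using sq_add_le[of "a * f _" "b * g _"] by (intro AE_I2) (simp add: power_mult_distrib mult.assoc)
  qed measurable
qed

lemma L2_diff: "f \<in> L2_space M \<Longrightarrow> g \<in> L2_space M \<Longrightarrow> (\<lambda>x. f x - g x) \<in> L2_space M"
  using L2_lin[of f M g 1 "-1"] by simp

lemma L2_cong_AE:
  assumes "f \<in> L2_space M" "g \<in> borel_measurable M" "AE x in M. f x = g x"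
  shows "g \<in> L2_space M"
  by (rule L2_bound[OF assms(1,2)]) (use assms(3) in eventually_elim, auto)

text \<open>The squared L2 distance. Only convergence to 0 and the Cauchy property are used, for
  which the triangle inequality with factor 2 suffices, so no square roots appear.\<close>

definition l2d :: "'a measure \<Rightarrow> ('a \<Rightarrow> real) \<Rightarrow> ('a \<Rightarrow> real) \<Rightarrow> real" where
  "l2d M f g = (LINT x|M. (f x - g x)\<^sup>2)"

lemma l2d_nonneg: "0 \<le> l2d M f g" by (simp add: l2d_def)

lemma l2d_refl [simp]: "l2d M f f = 0" by (simp add: l2d_def)

lemma l2d_cong_AE:
  assumes "f \<in> borel_measurable M" "g \<in> borel_measurable M" "f' \<in> borel_measurable M" "g' \<in> borel_measurable M"
    "AE x in M. f x = f' x" "AE x in M. g x = g' x"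
  shows "l2d M f g = l2d M f' g'"
  unfolding l2d_def
  by (rule integral_cong_AE) (use assms in \<open>auto elim: eventually_elim2\<close>)

lemma l2d_triangle:
  assumes f: "f \<in> L2_space M" and g: "g \<in> L2_space M" and h: "h \<in> L2_space M"
  shows "l2d M f h \<le> 2 * l2d M f g + 2 * l2d M g h"
proof -
  note i = L2_D(2)[OF L2_diff[OF f h]] L2_D(2)[OF L2_diff[OF f g]] L2_D(2)[OF L2_diff[OF g h]]
  have "(f x - h x)\<^sup>2 \<le> 2 * (f x - g x)\<^sup>2 + 2 * (g x - h x)\<^sup>2" for x
    using sq_add_le[of "f x - g x" "g x - h x"] by simp
  then have "l2d M f h \<le> (LINT x|M. 2 * (f x - g x)\<^sup>2 + 2 * (g x - h x)\<^sup>2)"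
    unfolding l2d_def using i by (intro integral_mono) auto
  also have "\<dots> = 2 * l2d M f g + 2 * l2d M g h" unfolding l2d_def using i by simp
  finally show ?thesis .
qed

lemma l2d_lin_le:
  assumes "f \<in> L2_space M" "f' \<in> L2_space M" "g \<in> L2_space M" "g' \<in> L2_space M"
  shows "l2d M (\<lambda>x. a * f x + b * g x) (\<lambda>x. a * f' x + b * g' x) \<le> 2 * a\<^sup>2 * l2d M f f' + 2 * b\<^sup>2 * l2d M g g'"
proof -
  note i = L2_D(2)[OF L2_diff[OF assms(1,2)]] L2_D(2)[OF L2_diff[OF assms(3,4)]]
     L2_D(2)[OF L2_diff[OF L2_lin[OF assms(1,3), of a b] L2_lin[OF assms(2,4), of a b]]]
  have "(a * f x + b * g x - (a * f' x + b * g' x))\<^sup>2 \<le> 2 * a\<^sup>2 * (f x - f' x)\<^sup>2 + 2 * b\<^sup>2 * (g x - g' x)\<^sup>2" for x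
  proof -
    have "a * f x + b * g x - (a * f' x + b * g' x) = a * (f x - f' x) + b * (g x - g' x)"
      by (simp add: algebra_simps)
    then show ?thesis
      using sq_add_le[of "a * (f x - f' x)" "b * (g x - g' x)"] by (simp add: power_mult_distrib)
  qed
  then have "l2d M (\<lambda>x. a * f x + b * g x) (\<lambda>x. a * f' x + b * g' x) \<le> (LINT x|M. 2 * a\<^sup>2 * (f x - f' x)\<^sup>2 + 2 * b\<^sup>2 * (g x - g' x)\<^sup>2)"
    unfolding l2d_def using i by (intro integral_mono) auto
  also have "\<dots> = 2 * a\<^sup>2 * l2d M f f' + 2 * b\<^sup>2 * l2d M g g'" unfolding l2d_def using i by simp
  finally show ?thesis .
qed

lemma l2d_AE_subseq:
  assumes f: "\<And>n. f n \<in> L2_space M" "h \<in> L2_space M" and lim: "(\<lambda>n::nat. l2d M (f n) h) \<longlonglongrightarrow> 0"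
  obtains r where "strict_mono r" "AE x in M. (\<lambda>n. f (r n) x) \<longlonglongrightarrow> h x"
proof -
  have i: "integrable M (\<lambda>x. (f n x - h x)\<^sup>2)" for n using L2_D(2)[OF L2_diff[OF f]] .
  have "(\<lambda>n. LINT x|M. norm ((f n x - h x)\<^sup>2)) \<longlonglongrightarrow> 0" using lim by (simp add: l2d_def)
  from tendsto_L1_AE_subseq[of M "\<lambda>n x. (f n x - h x)\<^sup>2", OF i this]
  obtain r where r: "strict_mono r" "AE x in M. (\<lambda>n. (f (r n) x - h x)\<^sup>2) \<longlonglongrightarrow> 0"
    by blast
  have "AE x in M. (\<lambda>n. f (r n) x) \<longlonglongrightarrow> h x"
    using r(2)
  proof eventually_elim
    case (elim x)
    have "(\<lambda>n. sqrt ((f (r n) x - h x)\<^sup>2)) \<longlonglongrightarrow> sqrt 0" using elim by (rule tendsto_real_sqrt)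
    then have "(\<lambda>n. f (r n) x - h x) \<longlonglongrightarrow> 0" by (simp add: tendsto_rabs_zero_iff)
    then show ?case by (rule LIM_zero_cancel)
  qed
  with r(1) show ?thesis by (rule that)
qed

lemma tendsto_squeeze_0:
  fixes f g :: "nat \<Rightarrow> real"
  shows "g \<longlonglongrightarrow> 0 \<Longrightarrow> (\<And>n. 0 \<le> f n) \<Longrightarrow> (\<And>n. f n \<le> g n) \<Longrightarrow> f \<longlonglongrightarrow> 0"
  by (rule Lim_null_comparison[where g = g]) auto

lemma L2_borel_iff:
  fixes f f' :: "'a::euclidean_space \<Rightarrow> real"
  assumes U: "U \<in> sets borel" and f': "f' \<in> borel_measurable borel" and ae: "ae_eq U f f'"
  shows "f \<in> L2_space (lebesgue_on U) \<longleftrightarrow> integrable lborel (\<lambda>x. indicator U x * (f' x)\<^sup>2)"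
    "(LINT x|lebesgue_on U. (f x)\<^sup>2) = (LINT x|lborel. indicator U x * (f' x)\<^sup>2)"
proof -
  have m: "(\<lambda>x. (f' x)\<^sup>2) \<in> borel_measurable borel" using f' by simp
  have ae': "AE x in lborel. x \<in> U \<longrightarrow> (f x)\<^sup>2 = (f' x)\<^sup>2" using ae by eventually_elim auto
  show "f \<in> L2_space (lebesgue_on U) \<longleftrightarrow> integrable lborel (\<lambda>x. indicator U x * (f' x)\<^sup>2)"
    using integrable_lebesgue_on_iff[OF U m ae'] lebesgue_on_measurable_cong_AE[OF U f' ae] by (auto simp: L2_space_def)
  show "(LINT x|lebesgue_on U. (f x)\<^sup>2) = (LINT x|lborel. indicator U x * (f' x)\<^sup>2)"
    by (rule integral_lebesgue_on_eq[OF U m ae'])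
qed

lemma L2_loc_int:
  fixes f :: "'a::euclidean_space \<Rightarrow> real"
  assumes f: "f \<in> borel_measurable borel" and i: "integrable lborel (\<lambda>x. indicator U x * (f x)\<^sup>2)"
  shows "loc_int U f"
  unfolding loc_int_def set_integrable_def
proof (intro conjI allI impI f)
  fix K assume K: "compact K" "K \<subseteq> U"
  have Kb: "K \<in> sets borel" using compact_imp_closed[OF K(1)] by (rule borel_closed)
  show "integrable lborel (\<lambda>x. indicator K x *\<^sub>R f x)"
  proof (rule Bochner_Integration.integrable_bound[OF Bochner_Integration.integrable_add[OF integrable_indicator_compact[OF K(1)] i]])
    show "(\<lambda>x. indicator K x *\<^sub>R f x) \<in> borel_measurable lborel" using f Kb by simp
    show "AE x in lborel. norm (indicator K x *\<^sub>R f x) \<le> norm (indicator K x + indicator U x * (f x)\<^sup>2)"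
      using K abs_le_one_plus_sq[of "f _"] by (intro AE_I2) (auto split: split_indicator)
  qed
qed

text \<open>With d = f n - h, the cross term 2 |d h| is at most t h^2 + d^2 / t. The choice of
  \<open>t\<close> as the root of the squared distance plus 1/(n+1) makes both parts tend to 0; the
  second summand keeps \<open>t\<close> positive when the distance is 0.\<close>

lemma L2_norm_tendsto:
  assumes f: "\<And>n. f n \<in> L2_space M" and h: "h \<in> L2_space M" and lim: "(\<lambda>n::nat. l2d M (f n) h) \<longlonglongrightarrow> 0"
  shows "(\<lambda>n. LINT x|M. (f n x)\<^sup>2) \<longlonglongrightarrow> (LINT x|M. (h x)\<^sup>2)"
proof (rule LIM_zero_cancel, rule Lim_null_comparison)
  let ?l = "\<lambda>n. l2d M (f n) h" and ?H = "LINT x|M. (h x)\<^sup>2"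
  let ?t = "\<lambda>n. sqrt (?l n) + inverse (real (Suc n))"
  have "(\<lambda>n. ?l n + (?t n * ?H + sqrt (?l n))) \<longlonglongrightarrow> 0 + ((sqrt 0 + 0) * ?H + sqrt 0)"
    by (intro tendsto_intros lim LIMSEQ_inverse_real_of_nat)
  then show "(\<lambda>n. ?l n + (?t n * ?H + sqrt (?l n))) \<longlonglongrightarrow> 0" by simp
  show "\<forall>\<^sub>F n in sequentially. norm ((LINT x|M. (f n x)\<^sup>2) - ?H) \<le> ?l n + (?t n * ?H + sqrt (?l n))"
  proof (intro always_eventually allI)
    fix n
    have t: "0 < ?t n" using l2d_nonneg[of M "f n" h] by (simp add: add_nonneg_pos)
    note i = L2_D(2)[OF f[of n]] L2_D(2)[OF h] L2_D(2)[OF L2_diff[OF f[of n] h]]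
    have pw: "\<bar>(f n x)\<^sup>2 - (h x)\<^sup>2\<bar> \<le> (f n x - h x)\<^sup>2 + (?t n * (h x)\<^sup>2 + (f n x - h x)\<^sup>2 / ?t n)" for x
    proof -
      define d b where "d = f n x - h x" and "b = h x"
      have "2 * \<bar>d * b\<bar> \<le> ?t n * b\<^sup>2 + d\<^sup>2 / ?t n"
      proof -
        have "0 \<le> (sqrt (?t n) * \<bar>b\<bar> - \<bar>d\<bar> / sqrt (?t n))\<^sup>2" by simp
        also have "\<dots> = ?t n * b\<^sup>2 - 2 * \<bar>d * b\<bar> + d\<^sup>2 / ?t n"
          using t by (simp add: power2_diff power_mult_distrib power_divide abs_mult)
        finally show ?thesis by simp
      qed
      moreover have "(f n x)\<^sup>2 - (h x)\<^sup>2 = d\<^sup>2 + 2 * (d * b)" by (simp add: d_def b_def power2_eq_square algebra_simps)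
      moreover have "0 \<le> d\<^sup>2" by simp
      ultimately show ?thesis unfolding d_def[symmetric] unfolding b_def[symmetric] by linarith
    qed
    have "norm ((LINT x|M. (f n x)\<^sup>2) - ?H) = \<bar>LINT x|M. (f n x)\<^sup>2 - (h x)\<^sup>2\<bar>" using i by simp
    also have "\<dots> \<le> (LINT x|M. \<bar>(f n x)\<^sup>2 - (h x)\<^sup>2\<bar>)" by (rule integral_abs_bound)
    also have "\<dots> \<le> (LINT x|M. (f n x - h x)\<^sup>2 + (?t n * (h x)\<^sup>2 + (f n x - h x)\<^sup>2 / ?t n))"
      using i pw by (intro integral_mono) auto
    also have "\<dots> = ?l n + (?t n * ?H + ?l n / ?t n)" using i by (simp add: l2d_def)
    also have "\<dots> \<le> ?l n + (?t n * ?H + sqrt (?l n))"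
    proof -
      have "?l n = sqrt (?l n) * sqrt (?l n)" using l2d_nonneg[of M "f n" h] by simp
      also have "\<dots> \<le> sqrt (?l n) * ?t n" by (intro mult_left_mono) (simp_all add: l2d_nonneg)
      finally have "?l n / ?t n \<le> sqrt (?l n)" using t by (simp add: divide_le_eq)
      then show ?thesis by simp
    qed
    finally show "norm ((LINT x|M. (f n x)\<^sup>2) - ?H) \<le> ?l n + (?t n * ?H + sqrt (?l n))" .
  qed
qed

text \<open>Polarisation expresses the inner product by squared norms, whose convergence is already
  known.\<close>

lemma L2_inner_tendsto:
  assumes f: "\<And>n::nat. f n \<in> L2_space M" and k: "k \<in> L2_space M" and lim: "(\<lambda>n. l2d M (f n) k) \<longlonglongrightarrow> 0"
    and \<psi>: "\<psi> \<in> L2_space M"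
  shows "(\<lambda>n. LINT x|M. f n x * \<psi> x) \<longlonglongrightarrow> (LINT x|M. k x * \<psi> x)"
proof -
  have e: "(LINT x|M. h x * \<psi> x) = ((LINT x|M. (1 * h x + 1 * \<psi> x)\<^sup>2) - (LINT x|M. (h x)\<^sup>2) - (LINT x|M. (\<psi> x)\<^sup>2)) / 2"
    if h: "h \<in> L2_space M" for h
  proof -
    have "(LINT x|M. h x * \<psi> x) = (LINT x|M. ((1 * h x + 1 * \<psi> x)\<^sup>2 - (h x)\<^sup>2 - (\<psi> x)\<^sup>2) / 2)"
      by (simp add: power2_sum)
    then show ?thesis using L2_D(2)[OF h] L2_D(2)[OF \<psi>] L2_D(2)[OF L2_lin[OF h \<psi>, of 1 1]] by simp
  qed
  have "(\<lambda>n. l2d M (\<lambda>x. 1 * f n x + 1 * \<psi> x) (\<lambda>x. 1 * k x + 1 * \<psi> x)) \<longlonglongrightarrow> 0" using lim by (simp add: l2d_def)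
  note l = L2_norm_tendsto[OF L2_lin[OF f \<psi>] L2_lin[OF k \<psi>] this] L2_norm_tendsto[OF f k lim]
  show ?thesis unfolding e[OF f] e[OF k] by (intro tendsto_intros l) simp
qed

text \<open>A test function and its derivative are continuous with compact support, hence square
  integrable, so both sides of the defining identity are inner products and pass to the
  limit.\<close>

lemma has_weak_deriv_closed:
  fixes U :: "'a::euclidean_space set"
  assumes U: "open U" and w: "\<And>n::nat. has_weak_deriv U e (u n) (g n)"
    and L2: "\<And>n. u n \<in> L2_space (lebesgue_on U)" "\<And>n. g n \<in> L2_space (lebesgue_on U)"
      "v \<in> L2_space (lebesgue_on U)" "h \<in> L2_space (lebesgue_on U)"
    and lim: "(\<lambda>n. l2d (lebesgue_on U) (u n) v) \<longlonglongrightarrow> 0" "(\<lambda>n. l2d (lebesgue_on U) (g n) h) \<longlonglongrightarrow> 0"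
  shows "has_weak_deriv U e v h"
  unfolding has_weak_deriv_def
proof (intro conjI allI impI)
  have ab: "f absolutely_integrable_on K" if f: "f \<in> L2_space (lebesgue_on U)" and K: "compact K \<and> K \<subseteq> U" for f K
  proof -
    have Ub: "U \<in> sets borel" using U by auto
    obtain f' where f': "f' \<in> borel_measurable borel" "ae_eq U f f'"
      using lebesgue_on_borel_rep[OF Ub L2_D(1)[OF f]] by blast
    have "loc_int U f'" using L2_borel_iff(1)[OF Ub f'] f by (intro L2_loc_int[OF f'(1)]) simp
    then show ?thesis using loc_int_iff[OF U f'] K by blast
  qed
  show "\<And>K. compact K \<and> K \<subseteq> U \<Longrightarrow> v absolutely_integrable_on K" "\<And>K. compact K \<and> K \<subseteq> U \<Longrightarrow> h absolutely_integrable_on K"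
    using ab L2(3,4) by blast+
  fix \<phi> assume \<phi>: "test_function U \<phi>"
  have cL2: "\<psi> \<in> L2_space (lebesgue_on U)" if c: "continuous_on UNIV \<psi>" and K: "compact K" "\<And>x. x \<notin> K \<Longrightarrow> \<psi> x = 0" for \<psi> :: "'a \<Rightarrow> real" and K
    unfolding L2_space_def
  proof (intro CollectI conjI)
    have m: "\<psi> \<in> borel_measurable borel" using c by (rule borel_measurable_continuous_onI)
    have Ub: "U \<in> sets borel" using U by auto
    have "set_integrable lborel K (\<lambda>x. (\<psi> x)\<^sup>2)"
      unfolding set_integrable_def using K c by (intro borel_integrable_compact) (auto intro!: continuous_intros elim: continuous_on_subset)
    then have "integrable lborel (\<lambda>x. indicator U x *\<^sub>R (indicator K x *\<^sub>R (\<psi> x)\<^sup>2))"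
      unfolding set_integrable_def by (rule integrable_mult_indicator[rotated]) (use Ub in simp)
    moreover have "(\<lambda>x. indicator U x *\<^sub>R (indicator K x *\<^sub>R (\<psi> x)\<^sup>2)) = (\<lambda>x. indicator U x * (\<psi> x)\<^sup>2)"
      using K(2) by (intro ext) (auto split: split_indicator)
    ultimately show "integrable (lebesgue_on U) (\<lambda>x. (\<psi> x)\<^sup>2)"
      using integrable_lebesgue_on_iff[OF Ub, of "\<lambda>x. (\<psi> x)\<^sup>2" "\<lambda>x. (\<psi> x)\<^sup>2"] m by simp
    show "\<psi> \<in> borel_measurable (lebesgue_on U)"
      by (rule lebesgue_on_measurable_cong_AE[OF Ub m]) auto
  qed
  obtain K where K: "compact K" "\<And>x. x \<notin> K \<Longrightarrow> \<phi> x = 0" "\<And>x e. x \<notin> K \<Longrightarrow> frechet_derivative \<phi> (at x) e = 0"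
    using test_function_support[OF \<phi>] by metis
  note c = test_function_deriv_continuous[OF \<phi>]
  have "(\<lambda>n. LINT x|lebesgue_on U. u n x * frechet_derivative \<phi> (at x) e) \<longlonglongrightarrow> (LINT x|lebesgue_on U. v x * frechet_derivative \<phi> (at x) e)"
    by (rule L2_inner_tendsto[OF L2(1,3) lim(1) cL2[OF c(2) K(1,3)]])
  moreover have "(\<lambda>n. - (LINT x|lebesgue_on U. g n x * \<phi> x)) \<longlonglongrightarrow> - (LINT x|lebesgue_on U. h x * \<phi> x)"
    by (intro tendsto_minus L2_inner_tendsto[OF L2(2,4) lim(2) cL2[OF c(1) K(1,2)]])
  moreover have "(LINT x|lebesgue_on U. u n x * frechet_derivative \<phi> (at x) e) = - (LINT x|lebesgue_on U. g n x * \<phi> x)" for n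
    using w[of n] \<phi> by (simp add: has_weak_deriv_def)
  ultimately show "(LINT x|lebesgue_on U. v x * frechet_derivative \<phi> (at x) e) = - (LINT x|lebesgue_on U. h x * \<phi> x)"
    using LIMSEQ_unique by auto
qed

subsection \<open>Sobolev functions and traces\<close>

lemma weak_deriv_works:
  assumes U: "open U" and w: "has_weak_deriv U e u g"
  shows "has_weak_deriv U e u (weak_deriv U e u)" "AE x in lebesgue_on U. weak_deriv U e u x = g x"
proof -
  show *: "has_weak_deriv U e u (weak_deriv U e u)"
    unfolding weak_deriv_def using w by (rule someI[of "has_weak_deriv U e u"])
  show "AE x in lebesgue_on U. weak_deriv U e u x = g x"
    by (rule has_weak_deriv_unique[OF U * w])
qed

lemma weak_deriv_L2:
  assumes U: "open U" and w: "has_weak_deriv U e u g" and g: "g \<in> L2_space (lebesgue_on U)"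
  shows "weak_deriv U e u \<in> L2_space (lebesgue_on U)"
proof (rule L2_cong_AE[OF g])
  show "weak_deriv U e u \<in> borel_measurable (lebesgue_on U)"
    by (rule has_weak_deriv_measurable[OF U weak_deriv_works(1)[OF U w]])
  show "AE x in lebesgue_on U. g x = weak_deriv U e u x"
    using weak_deriv_works(2)[OF U w] by eventually_elim simp
qed

lemma H1_D:
  assumes U: "open U" and u: "u \<in> H1_space U"
  shows "u \<in> L2_space (lebesgue_on U)"
    "b \<in> Basis \<Longrightarrow> has_weak_deriv U b u (weak_deriv U b u)"
    "b \<in> Basis \<Longrightarrow> weak_deriv U b u \<in> L2_space (lebesgue_on U)"
  using u weak_deriv_works(1)[OF U, of b u] weak_deriv_L2[OF U, of b u] by (auto simp: H1_space_def)

lemma H1_I: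
  assumes "u \<in> L2_space (lebesgue_on U)" "\<And>b. b \<in> Basis \<Longrightarrow> has_weak_deriv U b u (G b)"
    "\<And>b. b \<in> Basis \<Longrightarrow> G b \<in> L2_space (lebesgue_on U)"
  shows "u \<in> H1_space U"
  using assms by (auto simp: H1_space_def)

lemma H1_lin:
  assumes U: "open U" and "u \<in> H1_space U" "v \<in> H1_space U"
  shows "(\<lambda>x. a * u x + b * v x) \<in> H1_space U"
    "d \<in> Basis \<Longrightarrow> AE x in lebesgue_on U. weak_deriv U d (\<lambda>x. a * u x + b * v x) x = a * weak_deriv U d u x + b * weak_deriv U d v x"
proof -
  note u = H1_D[OF U assms(2)] and v = H1_D[OF U assms(3)]
  show "(\<lambda>x. a * u x + b * v x) \<in> H1_space U"
    by (rule H1_I[OF L2_lin[OF u(1) v(1)] has_weak_deriv_lin[OF U u(2) v(2)] L2_lin[OF u(3) v(3)]])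
  show "d \<in> Basis \<Longrightarrow> AE x in lebesgue_on U. weak_deriv U d (\<lambda>x. a * u x + b * v x) x = a * weak_deriv U d u x + b * weak_deriv U d v x"
    by (rule weak_deriv_works(2)[OF U has_weak_deriv_lin[OF U u(2) v(2)]])
qed

lemma H1_cong:
  assumes U: "open U" and u: "u \<in> H1_space U" and ae: "AE x in lebesgue_on U. u x = v x"
  shows "v \<in> H1_space U" "b \<in> Basis \<Longrightarrow> AE x in lebesgue_on U. weak_deriv U b u x = weak_deriv U b v x"
proof -
  have w: "has_weak_deriv U b v (weak_deriv U b u)" if "b \<in> Basis" for b
    by (rule has_weak_deriv_cong[OF U H1_D(2)[OF U u that] ae]) simp
  obtain b :: 'a where b: "b \<in> Basis" using nonempty_Basis by blast
  have "v \<in> L2_space (lebesgue_on U)"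
    by (rule L2_cong_AE[OF H1_D(1)[OF U u] has_weak_deriv_measurable(1)[OF U w[OF b]] ae])
  then show "v \<in> H1_space U" by (rule H1_I[OF _ w H1_D(3)[OF U u]])
  show "AE x in lebesgue_on U. weak_deriv U b u x = weak_deriv U b v x" if "b \<in> Basis" for b
    using weak_deriv_works(2)[OF U w[OF that]] by eventually_elim simp
qed

text \<open>The squared H1 distance, with the derivatives of the two functions compared separately.
  \<open>H1_norm_diff\<close> identifies it with the squared norm of the difference.\<close>

definition h1d :: "'a::euclidean_space set \<Rightarrow> ('a \<Rightarrow> real) \<Rightarrow> ('a \<Rightarrow> real) \<Rightarrow> real" where
  "h1d U u v = l2d (lebesgue_on U) u v + (\<Sum>b\<in>Basis. l2d (lebesgue_on U) (weak_deriv U b u) (weak_deriv U b v))"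

lemma h1d_nonneg: "0 \<le> h1d U u v"
  by (simp add: h1d_def l2d_nonneg sum_nonneg)

lemma l2d_le_h1d: "l2d (lebesgue_on U) u v \<le> h1d U u v"
  "b \<in> Basis \<Longrightarrow> l2d (lebesgue_on U) (weak_deriv U b u) (weak_deriv U b v) \<le> h1d U u v"
proof -
  show "l2d (lebesgue_on U) u v \<le> h1d U u v"
    by (simp add: h1d_def l2d_nonneg sum_nonneg)
  assume "b \<in> Basis"
  then have "l2d (lebesgue_on U) (weak_deriv U b u) (weak_deriv U b v) \<le> (\<Sum>b\<in>Basis. l2d (lebesgue_on U) (weak_deriv U b u) (weak_deriv U b v))"
    by (intro member_le_sum) (auto simp: l2d_nonneg)
  then show "l2d (lebesgue_on U) (weak_deriv U b u) (weak_deriv U b v) \<le> h1d U u v"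
    by (simp add: h1d_def l2d_nonneg add_increasing)
qed

text \<open>The operator \<open>weak_deriv\<close> is a choice; this allows any concrete derivatives
  to be inserted in its place.\<close>

lemma h1d_eq:
  assumes U: "open U" and "\<And>b. b \<in> Basis \<Longrightarrow> has_weak_deriv U b u (G b)" "\<And>b. b \<in> Basis \<Longrightarrow> has_weak_deriv U b v (H b)"
  shows "h1d U u v = l2d (lebesgue_on U) u v + (\<Sum>b\<in>Basis. l2d (lebesgue_on U) (G b) (H b))"
proof -
  have "l2d (lebesgue_on U) (weak_deriv U b u) (weak_deriv U b v) = l2d (lebesgue_on U) (G b) (H b)" if b: "b \<in> Basis" for b
    by (rule l2d_cong_AE)
      (use assms(2,3)[OF b] weak_deriv_works[OF U assms(2)[OF b]] weak_deriv_works[OF U assms(3)[OF b]] in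
        \<open>auto intro: has_weak_deriv_measurable(2)[OF U]\<close>)
  then show ?thesis by (simp add: h1d_def)
qed

lemma H1_norm_diff:
  assumes U: "open U" and u: "u \<in> H1_space U" and v: "v \<in> H1_space U"
  shows "H1_norm U (\<lambda>x. u x - v x) = sqrt (h1d U u v)"
proof -
  have "(LINT x|lebesgue_on U. (weak_deriv U b (\<lambda>x. u x - v x) x)\<^sup>2) = l2d (lebesgue_on U) (weak_deriv U b u) (weak_deriv U b v)" if b: "b \<in> Basis" for b
    unfolding l2d_def
  proof (rule integral_cong_AE)
    note w = has_weak_deriv_diff[OF U H1_D(2)[OF U u b] H1_D(2)[OF U v b]]
    show "(\<lambda>x. (weak_deriv U b (\<lambda>x. u x - v x) x)\<^sup>2) \<in> borel_measurable (lebesgue_on U)"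
      using has_weak_deriv_measurable(2)[OF U weak_deriv_works(1)[OF U w]] by simp
    show "(\<lambda>x. (weak_deriv U b u x - weak_deriv U b v x)\<^sup>2) \<in> borel_measurable (lebesgue_on U)"
      using has_weak_deriv_measurable(2)[OF U w] by simp
    show "AE x in lebesgue_on U. (weak_deriv U b (\<lambda>x. u x - v x) x)\<^sup>2 = (weak_deriv U b u x - weak_deriv U b v x)\<^sup>2"
      using weak_deriv_works(2)[OF U w] by eventually_elim simp
  qed
  then show ?thesis by (simp add: H1_norm_def h1d_def l2d_def)
qed

lemma h1d_triangle:
  assumes U: "open U" and "u \<in> H1_space U" "v \<in> H1_space U" "w \<in> H1_space U"
  shows "h1d U u w \<le> 2 * h1d U u v + 2 * h1d U v w"
proof -
  note u = H1_D[OF U assms(2)] and v = H1_D[OF U assms(3)] and w = H1_D[OF U assms(4)]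
  have "(\<Sum>b\<in>Basis. l2d (lebesgue_on U) (weak_deriv U b u) (weak_deriv U b w)) \<le>
    (\<Sum>b\<in>Basis. 2 * l2d (lebesgue_on U) (weak_deriv U b u) (weak_deriv U b v) + 2 * l2d (lebesgue_on U) (weak_deriv U b v) (weak_deriv U b w))"
    by (intro sum_mono l2d_triangle u v w)
  then show ?thesis using l2d_triangle[OF u(1) v(1) w(1)]
    by (simp add: h1d_def sum.distrib sum_distrib_left)
qed

lemma h1d_lin_le:
  assumes U: "open U" and "u \<in> H1_space U" "u' \<in> H1_space U" "v \<in> H1_space U" "v' \<in> H1_space U"
  shows "h1d U (\<lambda>x. a * u x + b * v x) (\<lambda>x. a * u' x + b * v' x) \<le> 2 * a\<^sup>2 * h1d U u u' + 2 * b\<^sup>2 * h1d U v v'"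
proof -
  note u = H1_D[OF U assms(2)] and u' = H1_D[OF U assms(3)] and v = H1_D[OF U assms(4)] and v' = H1_D[OF U assms(5)]
  have "(\<Sum>d\<in>Basis. l2d (lebesgue_on U) (\<lambda>x. a * weak_deriv U d u x + b * weak_deriv U d v x) (\<lambda>x. a * weak_deriv U d u' x + b * weak_deriv U d v' x)) \<le>
    (\<Sum>d\<in>Basis. 2 * a\<^sup>2 * l2d (lebesgue_on U) (weak_deriv U d u) (weak_deriv U d u') + 2 * b\<^sup>2 * l2d (lebesgue_on U) (weak_deriv U d v) (weak_deriv U d v'))"
    by (intro sum_mono l2d_lin_le u u' v v')
  moreover have "h1d U (\<lambda>x. a * u x + b * v x) (\<lambda>x. a * u' x + b * v' x) = l2d (lebesgue_on U) (\<lambda>x. a * u x + b * v x) (\<lambda>x. a * u' x + b * v' x)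
    + (\<Sum>d\<in>Basis. l2d (lebesgue_on U) (\<lambda>x. a * weak_deriv U d u x + b * weak_deriv U d v x) (\<lambda>x. a * weak_deriv U d u' x + b * weak_deriv U d v' x))"
    by (rule h1d_eq[OF U has_weak_deriv_lin[OF U u(2) v(2)] has_weak_deriv_lin[OF U u'(2) v'(2)]])
  ultimately show ?thesis using l2d_lin_le[OF u(1) u'(1) v(1) v'(1), of a b]
    by (simp add: h1d_def sum.distrib sum_distrib_left distrib_left)
qed

lemma h1d_cong:
  assumes U: "open U" and u: "u \<in> H1_space U" and v: "v \<in> H1_space U" and ae: "AE x in lebesgue_on U. v x = v' x"
  shows "h1d U u v = h1d U u v'"
proof -
  note v' = H1_cong(1)[OF U v ae]
  note m = L2_D(1)[OF H1_D(1)[OF U u]] L2_D(1)[OF H1_D(1)[OF U v]] L2_D(1)[OF H1_D(1)[OF U v']]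
  note md = L2_D(1)[OF H1_D(3)[OF U u]] L2_D(1)[OF H1_D(3)[OF U v]] L2_D(1)[OF H1_D(3)[OF U v']]
  have "l2d (lebesgue_on U) (weak_deriv U b u) (weak_deriv U b v) = l2d (lebesgue_on U) (weak_deriv U b u) (weak_deriv U b v')" if b: "b \<in> Basis" for b
    by (rule l2d_cong_AE[OF md(1)[OF b] md(2)[OF b] md(1)[OF b] md(3)[OF b] _ H1_cong(2)[OF U v ae b]]) simp
  moreover have "l2d (lebesgue_on U) u v = l2d (lebesgue_on U) u v'"
    by (rule l2d_cong_AE[OF m(1,2,1,3) _ ae]) simp
  ultimately show ?thesis by (simp add: h1d_def)
qed

lemma has_trace_iff:
  assumes U: "open U"
  shows "has_trace U M j u g \<longleftrightarrow> u \<in> H1_space U \<and> g \<in> L2_space M \<and>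
     (\<exists>w. (\<forall>n. w n \<in> H1_space U \<and> continuous_on (closure U) (w n) \<and> (\<lambda>y. w n (j y)) \<in> L2_space M) \<and>
          (\<lambda>n::nat. h1d U (w n) u) \<longlonglongrightarrow> 0 \<and> (\<lambda>n. l2d M (\<lambda>y. w n (j y)) g) \<longlonglongrightarrow> 0)"
proof -
  have "(\<lambda>n. sqrt (h1d U (w n) u)) \<longlonglongrightarrow> 0 \<longleftrightarrow> (\<lambda>n. h1d U (w n) u) \<longlonglongrightarrow> 0" for w :: "nat \<Rightarrow> 'a \<Rightarrow> real"
  proof
    assume "(\<lambda>n. sqrt (h1d U (w n) u)) \<longlonglongrightarrow> 0"
    from tendsto_power[OF this, of 2] show "(\<lambda>n. h1d U (w n) u) \<longlonglongrightarrow> 0" by (simp add: h1d_nonneg)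
  next
    assume "(\<lambda>n. h1d U (w n) u) \<longlonglongrightarrow> 0"
    from tendsto_real_sqrt[OF this] show "(\<lambda>n. sqrt (h1d U (w n) u)) \<longlonglongrightarrow> 0" by simp
  qed
  then show ?thesis
    unfolding has_trace_def l2d_def o_def by (auto simp: H1_norm_diff[OF U])
qed

lemma has_traceE:
  assumes "open U" "has_trace U M j u g"
  obtains w where "u \<in> H1_space U" "g \<in> L2_space M"
    "\<And>n. w n \<in> H1_space U" "\<And>n. continuous_on (closure U) (w n)" "\<And>n. (\<lambda>y. w n (j y)) \<in> L2_space M"
    "(\<lambda>n::nat. h1d U (w n) u) \<longlonglongrightarrow> 0" "(\<lambda>n. l2d M (\<lambda>y. w n (j y)) g) \<longlonglongrightarrow> 0"
  using assms has_trace_iff by metis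

lemma has_traceI:
  assumes "open U" "u \<in> H1_space U" "g \<in> L2_space M"
    "\<And>n. w n \<in> H1_space U" "\<And>n. continuous_on (closure U) (w n)" "\<And>n. (\<lambda>y. w n (j y)) \<in> L2_space M"
    "(\<lambda>n::nat. h1d U (w n) u) \<longlonglongrightarrow> 0" "(\<lambda>n. l2d M (\<lambda>y. w n (j y)) g) \<longlonglongrightarrow> 0"
  shows "has_trace U M j u g"
  using assms has_trace_iff by metis

lemma has_trace_lin:
  assumes U: "open U" and 1: "has_trace U M j u g" and 2: "has_trace U M j v h"
  shows "has_trace U M j (\<lambda>x. a * u x + b * v x) (\<lambda>y. a * g y + b * h y)"
proof -
  obtain w where w: "u \<in> H1_space U" "g \<in> L2_space M"
    "\<And>n. w n \<in> H1_space U" "\<And>n. continuous_on (closure U) (w n)" "\<And>n. (\<lambda>y. w n (j y)) \<in> L2_space M"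
    "(\<lambda>n::nat. h1d U (w n) u) \<longlonglongrightarrow> 0" "(\<lambda>n. l2d M (\<lambda>y. w n (j y)) g) \<longlonglongrightarrow> 0"
    using has_traceE[OF U 1] by metis
  obtain z where z: "v \<in> H1_space U" "h \<in> L2_space M"
    "\<And>n. z n \<in> H1_space U" "\<And>n. continuous_on (closure U) (z n)" "\<And>n. (\<lambda>y. z n (j y)) \<in> L2_space M"
    "(\<lambda>n::nat. h1d U (z n) v) \<longlonglongrightarrow> 0" "(\<lambda>n. l2d M (\<lambda>y. z n (j y)) h) \<longlonglongrightarrow> 0"
    using has_traceE[OF U 2] by metis
  show ?thesis
  proof (rule has_traceI[OF U H1_lin(1)[OF U w(1) z(1)] L2_lin[OF w(2) z(2)], of "\<lambda>n x. a * w n x + b * z n x"])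
    show "(\<lambda>x. a * w n x + b * z n x) \<in> H1_space U" for n by (rule H1_lin(1)[OF U w(3) z(3)])
    show "continuous_on (closure U) (\<lambda>x. a * w n x + b * z n x)" for n by (intro continuous_intros w z)
    show "(\<lambda>y. a * w n (j y) + b * z n (j y)) \<in> L2_space M" for n by (rule L2_lin[OF w(5) z(5)])
    have "(\<lambda>n. 2 * a\<^sup>2 * h1d U (w n) u + 2 * b\<^sup>2 * h1d U (z n) v) \<longlonglongrightarrow> 2 * a\<^sup>2 * 0 + 2 * b\<^sup>2 * 0"
      by (intro tendsto_intros w z)
    then have "(\<lambda>n. 2 * a\<^sup>2 * h1d U (w n) u + 2 * b\<^sup>2 * h1d U (z n) v) \<longlonglongrightarrow> 0" by simp
    then show "(\<lambda>n. h1d U (\<lambda>x. a * w n x + b * z n x) (\<lambda>x. a * u x + b * v x)) \<longlonglongrightarrow> 0"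
      by (rule tendsto_squeeze_0[OF _ h1d_nonneg h1d_lin_le[OF U w(3,1) z(3,1)]])
    have "(\<lambda>n. 2 * a\<^sup>2 * l2d M (\<lambda>y. w n (j y)) g + 2 * b\<^sup>2 * l2d M (\<lambda>y. z n (j y)) h) \<longlonglongrightarrow> 2 * a\<^sup>2 * 0 + 2 * b\<^sup>2 * 0"
      by (intro tendsto_intros w z)
    then have "(\<lambda>n. 2 * a\<^sup>2 * l2d M (\<lambda>y. w n (j y)) g + 2 * b\<^sup>2 * l2d M (\<lambda>y. z n (j y)) h) \<longlonglongrightarrow> 0" by simp
    then show "(\<lambda>n. l2d M (\<lambda>y. a * w n (j y) + b * z n (j y)) (\<lambda>y. a * g y + b * h y)) \<longlonglongrightarrow> 0"
      by (rule tendsto_squeeze_0[OF _ l2d_nonneg l2d_lin_le[OF w(5,2) z(5,2)]])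
  qed
qed

lemma has_trace_cong:
  assumes U: "open U" and 1: "has_trace U M j u g"
    and ae: "AE x in lebesgue_on U. u x = u' x" "g' \<in> borel_measurable M" "AE y in M. g y = g' y"
  shows "has_trace U M j u' g'"
proof -
  obtain w where w: "u \<in> H1_space U" "g \<in> L2_space M"
    "\<And>n. w n \<in> H1_space U" "\<And>n. continuous_on (closure U) (w n)" "\<And>n. (\<lambda>y. w n (j y)) \<in> L2_space M"
    "(\<lambda>n::nat. h1d U (w n) u) \<longlonglongrightarrow> 0" "(\<lambda>n. l2d M (\<lambda>y. w n (j y)) g) \<longlonglongrightarrow> 0"
    using has_traceE[OF U 1] by metis
  have "l2d M (\<lambda>y. w n (j y)) g = l2d M (\<lambda>y. w n (j y)) g'" for n
    by (rule l2d_cong_AE) (use L2_D(1)[OF w(5)] L2_D(1)[OF w(2)] ae(2,3) in auto)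
  then show ?thesis
    using w h1d_cong[OF U w(3) w(1) ae(1)]
    by (intro has_traceI[OF U H1_cong(1)[OF U w(1) ae(1)] L2_cong_AE[OF w(2) ae(2,3)], of w]) auto
qed

text \<open>Diagonal choice: for each \<open>n\<close> take a continuous function within 1/(n+1)
  both of \<open>v n\<close> in H1 and of the common trace \<open>g\<close>.\<close>

lemma has_trace_closed:
  assumes U: "open U" and t: "\<And>n::nat. has_trace U M j (v n) g" and u: "u \<in> H1_space U"
    and lim: "(\<lambda>n. h1d U (v n) u) \<longlonglongrightarrow> 0"
  shows "has_trace U M j u g"
proof -
  have "\<exists>w. w \<in> H1_space U \<and> continuous_on (closure U) w \<and> (\<lambda>y. w (j y)) \<in> L2_space M \<and>
    h1d U w (v n) < inverse (real (Suc n)) \<and> l2d M (\<lambda>y. w (j y)) g < inverse (real (Suc n))" for n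
  proof -
    obtain w where w: "\<And>m. w m \<in> H1_space U" "\<And>m. continuous_on (closure U) (w m)" "\<And>m. (\<lambda>y. w m (j y)) \<in> L2_space M"
    "(\<lambda>m::nat. h1d U (w m) (v n)) \<longlonglongrightarrow> 0" "(\<lambda>m. l2d M (\<lambda>y. w m (j y)) g) \<longlonglongrightarrow> 0"
      using has_traceE[OF U t[of n]] by metis
    have "\<forall>\<^sub>F m in sequentially. h1d U (w m) (v n) < inverse (real (Suc n)) \<and> l2d M (\<lambda>y. w m (j y)) g < inverse (real (Suc n))"
      using order_tendstoD(2)[OF w(4)] order_tendstoD(2)[OF w(5)] by (intro eventually_conj) auto
    then obtain m where "h1d U (w m) (v n) < inverse (real (Suc n)) \<and> l2d M (\<lambda>y. w m (j y)) g < inverse (real (Suc n))"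
      by (auto simp: eventually_sequentially)
    then show ?thesis using w by blast
  qed
  then obtain w where w: "\<And>n. w n \<in> H1_space U" "\<And>n. continuous_on (closure U) (w n)" "\<And>n. (\<lambda>y. w n (j y)) \<in> L2_space M"
    "\<And>n. h1d U (w n) (v n) < inverse (real (Suc n))" "\<And>n. l2d M (\<lambda>y. w n (j y)) g < inverse (real (Suc n))"
    by metis
  have v: "v n \<in> H1_space U" and g: "g \<in> L2_space M" for n using t[of n] by (auto simp: has_trace_def)
  show ?thesis
  proof (rule has_traceI[OF U u g w(1-3)])
    have "(\<lambda>n. 2 * inverse (real (Suc n)) + 2 * h1d U (v n) u) \<longlonglongrightarrow> 2 * 0 + 2 * 0"
      by (intro tendsto_intros lim LIMSEQ_inverse_real_of_nat)
    then have 0: "(\<lambda>n. 2 * inverse (real (Suc n)) + 2 * h1d U (v n) u) \<longlonglongrightarrow> 0" by simp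
    show "(\<lambda>n. h1d U (w n) u) \<longlonglongrightarrow> 0"
    proof (rule tendsto_squeeze_0[OF 0 h1d_nonneg])
      fix n show "h1d U (w n) u \<le> 2 * inverse (real (Suc n)) + 2 * h1d U (v n) u"
        using h1d_triangle[OF U w(1)[of n] v[of n] u] w(4)[of n] by linarith
    qed
    show "(\<lambda>n. l2d M (\<lambda>y. w n (j y)) g) \<longlonglongrightarrow> 0"
      by (rule tendsto_squeeze_0[OF LIMSEQ_inverse_real_of_nat l2d_nonneg]) (use w(5) in \<open>auto intro: less_imp_le\<close>)
  qed
qed

lemma abs_clamp01_le: "\<bar>clamp01 s\<bar> \<le> \<bar>s\<bar>" "\<bar>clamp01 s - clamp01 t\<bar> \<le> \<bar>s - t\<bar>"
  by (auto simp: clamp01_def)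

lemma clamp01_measurable [measurable]: "clamp01 \<in> borel_measurable borel"
  unfolding clamp01_def[abs_def] by measurable

lemma continuous_on_clamp01: "continuous_on S f \<Longrightarrow> continuous_on S (\<lambda>x. clamp01 (f x))"
  unfolding clamp01_def by (intro continuous_intros)

lemma L2_clamp01: "f \<in> L2_space M \<Longrightarrow> (\<lambda>x. clamp01 (f x)) \<in> L2_space M"
  by (rule L2_bound[of f]) (auto simp: abs_clamp01_le dest: L2_D(1))

lemma l2d_clamp01_le:
  assumes "f \<in> L2_space M" "g \<in> L2_space M"
  shows "l2d M (\<lambda>x. clamp01 (f x)) (\<lambda>x. clamp01 (g x)) \<le> l2d M f g"
  unfolding l2d_def
proof (rule integral_mono)
  fix x show "(clamp01 (f x) - clamp01 (g x))\<^sup>2 \<le> (f x - g x)\<^sup>2"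
    using abs_clamp01_le(2)[of "f x" "g x"] by (simp add: abs_le_square_iff)
qed (use L2_D(2)[OF L2_diff[OF assms]] L2_D(2)[OF L2_diff[OF assms[THEN L2_clamp01]]] in auto)

lemma H1_clamp01:
  assumes U: "open U" and u: "u \<in> H1_space U"
  shows "(\<lambda>x. clamp01 (u x)) \<in> H1_space U"
    "b \<in> Basis \<Longrightarrow> has_weak_deriv U b (\<lambda>x. clamp01 (u x)) (\<lambda>x. if 0 < u x \<and> u x < 1 then weak_deriv U b u x else 0)"
    "b \<in> Basis \<Longrightarrow> (\<lambda>x. if 0 < u x \<and> u x < 1 then weak_deriv U b u x else 0) \<in> L2_space (lebesgue_on U)"
proof -
  note u' = H1_D[OF U u]
  show w: "has_weak_deriv U b (\<lambda>x. clamp01 (u x)) (\<lambda>x. if 0 < u x \<and> u x < 1 then weak_deriv U b u x else 0)" if "b \<in> Basis" for b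
    by (rule has_weak_deriv_clamp01[OF U u'(2)[OF that]])
  show l: "(\<lambda>x. if 0 < u x \<and> u x < 1 then weak_deriv U b u x else 0) \<in> L2_space (lebesgue_on U)" if "b \<in> Basis" for b
    by (rule L2_bound[OF u'(3)[OF that] has_weak_deriv_measurable(2)[OF U w[OF that]]]) auto
  show "(\<lambda>x. clamp01 (u x)) \<in> H1_space U" by (rule H1_I[OF L2_clamp01[OF u'(1)] w l])
qed

text \<open>The derivative of a truncation contains the discontinuous indicator of 0 < w < 1. Along
  an a.e. convergent subsequence these indicators converge except where \<open>u\<close> is 0 or 1,
  and there the derivative of \<open>u\<close> vanishes a.e.\<close>

lemma h1d_clamp01_subseq:
  assumes U: "open U" and w: "\<And>n. w n \<in> H1_space U" and u: "u \<in> H1_space U"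
    and lim: "(\<lambda>n::nat. h1d U (w n) u) \<longlonglongrightarrow> 0"
  obtains r where "strict_mono r" "(\<lambda>n. h1d U (\<lambda>x. clamp01 (w (r n) x)) (\<lambda>x. clamp01 (u x))) \<longlonglongrightarrow> 0"
proof -
  let ?M = "lebesgue_on U"
  have l0: "(\<lambda>n. l2d ?M (w n) u) \<longlonglongrightarrow> 0" by (rule tendsto_squeeze_0[OF lim l2d_nonneg l2d_le_h1d(1)])
  have lb: "(\<lambda>n. l2d ?M (weak_deriv U b (w n)) (weak_deriv U b u)) \<longlonglongrightarrow> 0" if "b \<in> Basis" for b
    by (rule tendsto_squeeze_0[OF lim l2d_nonneg l2d_le_h1d(2)[OF that]])
  obtain r where r: "strict_mono r" "AE x in ?M. (\<lambda>n. w (r n) x) \<longlonglongrightarrow> u x"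
    using l2d_AE_subseq[OF H1_D(1)[OF U w] H1_D(1)[OF U u] l0] by metis
  have sub: "(\<lambda>n. f (r n)) \<longlonglongrightarrow> 0" if "f \<longlonglongrightarrow> 0" for f :: "nat \<Rightarrow> real"
    using LIMSEQ_subseq_LIMSEQ[OF that r(1)] by (simp add: o_def)
  let ?G = "\<lambda>n b x. if 0 < w (r n) x \<and> w (r n) x < 1 then weak_deriv U b (w (r n)) x else 0"
  let ?H = "\<lambda>b x. if 0 < u x \<and> u x < 1 then weak_deriv U b u x else 0"
  have bound: "(\<lambda>n. l2d ?M (?G n b) (?H b)) \<longlonglongrightarrow> 0" if b: "b \<in> Basis" for b
  proof -
    \<comment> \<open>The intermediate function has the derivative of the limit but the indicator of
      the approximant. Its distance to \<open>?G\<close> is bounded by the distance of the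
      derivatives, and its distance to \<open>?H\<close> tends to 0 by dominated
      convergence.\<close>
    let ?J = "\<lambda>n x. if 0 < w (r n) x \<and> w (r n) x < 1 then weak_deriv U b u x else 0"
    have [measurable]: "w n \<in> borel_measurable ?M" "u \<in> borel_measurable ?M" "weak_deriv U b u \<in> borel_measurable ?M" "weak_deriv U b (w n) \<in> borel_measurable ?M" for n
      using L2_D(1)[OF H1_D(1)[OF U w]] L2_D(1)[OF H1_D(1)[OF U u]] L2_D(1)[OF H1_D(3)[OF U u b]] L2_D(1)[OF H1_D(3)[OF U w b]] by auto
    have J: "?J n \<in> L2_space ?M" for n
    proof (rule L2_bound[OF H1_D(3)[OF U u b]])
      show "?J n \<in> borel_measurable ?M" by measurable
    qed auto
    have G: "?G n b \<in> L2_space ?M" for n by (rule H1_clamp01(3)[OF U w b])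
    have H: "?H b \<in> L2_space ?M" by (rule H1_clamp01(3)[OF U u b])
    have GJ: "l2d ?M (?G n b) (?J n) \<le> l2d ?M (weak_deriv U b (w (r n))) (weak_deriv U b u)" for n
      unfolding l2d_def
      by (rule integral_mono[OF L2_D(2)[OF L2_diff[OF G J]] L2_D(2)[OF L2_diff[OF H1_D(3)[OF U w b] H1_D(3)[OF U u b]]]]) auto
    have JH: "(\<lambda>n. l2d ?M (?J n) (?H b)) \<longlonglongrightarrow> (LINT x|?M. 0)"
      unfolding l2d_def
    proof (rule integral_dominated_convergence[where w = "\<lambda>x. (weak_deriv U b u x)\<^sup>2"])
      show "AE x in ?M. (\<lambda>n. (?J n x - ?H b x)\<^sup>2) \<longlonglongrightarrow> 0"
        using r(2) has_weak_deriv_level_set[OF U H1_D(2)[OF U u b], of 0] has_weak_deriv_level_set[OF U H1_D(2)[OF U u b], of 1]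
      proof eventually_elim
        case (elim x)
        consider "u x < 0" | "u x > 1" | "0 < u x" "u x < 1" | "weak_deriv U b u x = 0" using elim by (metis linorder_neqE_linordered_idom)
        then have "\<forall>\<^sub>F n in sequentially. ?J n x = ?H b x"
        proof cases
          case 1
          from order_tendstoD(2)[OF elim(1) this] show ?thesis by eventually_elim (use 1 in auto)
        next
          case 2
          from order_tendstoD(1)[OF elim(1) this] show ?thesis by eventually_elim (use 2 in auto)
        next
          case 3
          from order_tendstoD(1)[OF elim(1) 3(1)] order_tendstoD(2)[OF elim(1) 3(2)] show ?thesis by eventually_elim (use 3 in auto)
        next
          case 4
          then show ?thesis by simp
        qed
        then have "\<forall>\<^sub>F n in sequentially. (?J n x - ?H b x)\<^sup>2 = 0" by eventually_elim simp
        then show ?case by (rule tendsto_eventually)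
      qed
      show "integrable ?M (\<lambda>x. (weak_deriv U b u x)\<^sup>2)" by (rule L2_D(2)[OF H1_D(3)[OF U u b]])
    qed auto
    then have JH: "(\<lambda>n. l2d ?M (?J n) (?H b)) \<longlonglongrightarrow> 0" by simp
    have "(\<lambda>n. 2 * l2d ?M (weak_deriv U b (w (r n))) (weak_deriv U b u) + 2 * l2d ?M (?J n) (?H b)) \<longlonglongrightarrow> 2 * 0 + 2 * 0"
      by (intro tendsto_intros sub[OF lb[OF b]] JH)
    then have 0: "(\<lambda>n. 2 * l2d ?M (weak_deriv U b (w (r n))) (weak_deriv U b u) + 2 * l2d ?M (?J n) (?H b)) \<longlonglongrightarrow> 0" by simp
    show ?thesis
    proof (rule tendsto_squeeze_0[OF 0 l2d_nonneg])
      fix n show "l2d ?M (?G n b) (?H b) \<le> 2 * l2d ?M (weak_deriv U b (w (r n))) (weak_deriv U b u) + 2 * l2d ?M (?J n) (?H b)"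
        using l2d_triangle[OF G[of n] J[of n] H] GJ[of n] by linarith
    qed
  qed
  have eq: "h1d U (\<lambda>x. clamp01 (w (r n) x)) (\<lambda>x. clamp01 (u x)) = l2d ?M (\<lambda>x. clamp01 (w (r n) x)) (\<lambda>x. clamp01 (u x)) + (\<Sum>b\<in>Basis. l2d ?M (?G n b) (?H b))" for n
    by (rule h1d_eq[OF U H1_clamp01(2)[OF U w] H1_clamp01(2)[OF U u]])
  have "(\<lambda>n. l2d ?M (w (r n)) u + (\<Sum>b\<in>Basis. l2d ?M (?G n b) (?H b))) \<longlonglongrightarrow> 0 + (\<Sum>b\<in>(Basis :: 'a set). 0)"
    by (intro tendsto_add tendsto_sum bound sub[OF l0])
  then have 0: "(\<lambda>n. l2d ?M (w (r n)) u + (\<Sum>b\<in>Basis. l2d ?M (?G n b) (?H b))) \<longlonglongrightarrow> 0" by simp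
  have "(\<lambda>n. h1d U (\<lambda>x. clamp01 (w (r n) x)) (\<lambda>x. clamp01 (u x))) \<longlonglongrightarrow> 0"
    by (rule tendsto_squeeze_0[OF 0 h1d_nonneg])
      (use l2d_clamp01_le[OF H1_D(1)[OF U w] H1_D(1)[OF U u]] in \<open>simp add: eq\<close>)
  with r(1) show ?thesis by (rule that)
qed

text \<open>Truncating the approximating functions keeps them continuous and does not increase their
  L2 distance on the boundary; a subsequence takes care of the derivatives.\<close>

lemma has_trace_clamp01:
  assumes U: "open U" and t: "has_trace U M j u g"
  shows "has_trace U M j (\<lambda>x. clamp01 (u x)) (\<lambda>y. clamp01 (g y))"
proof -
  obtain w where w: "u \<in> H1_space U" "g \<in> L2_space M"
    "\<And>n. w n \<in> H1_space U" "\<And>n. continuous_on (closure U) (w n)" "\<And>n. (\<lambda>y. w n (j y)) \<in> L2_space M"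
    "(\<lambda>n::nat. h1d U (w n) u) \<longlonglongrightarrow> 0" "(\<lambda>n. l2d M (\<lambda>y. w n (j y)) g) \<longlonglongrightarrow> 0"
    using has_traceE[OF U t] by metis
  obtain r where r: "strict_mono r" "(\<lambda>n. h1d U (\<lambda>x. clamp01 (w (r n) x)) (\<lambda>x. clamp01 (u x))) \<longlonglongrightarrow> 0"
    using h1d_clamp01_subseq[OF U w(3,1,6)] by metis
  show ?thesis
  proof (rule has_traceI[OF U H1_clamp01(1)[OF U w(1)] L2_clamp01[OF w(2)] _ _ _ r(2)])
    show "(\<lambda>x. clamp01 (w (r n) x)) \<in> H1_space U" for n by (rule H1_clamp01(1)[OF U w(3)])
    show "continuous_on (closure U) (\<lambda>x. clamp01 (w (r n) x))" for n by (rule continuous_on_clamp01[OF w(4)])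
    show "(\<lambda>y. clamp01 (w (r n) (j y))) \<in> L2_space M" for n by (rule L2_clamp01[OF w(5)])
    have "(\<lambda>n. l2d M (\<lambda>y. w (r n) (j y)) g) \<longlonglongrightarrow> 0"
      using LIMSEQ_subseq_LIMSEQ[OF w(7) r(1)] by (simp add: o_def)
    then show "(\<lambda>n. l2d M (\<lambda>y. clamp01 (w (r n) (j y))) (\<lambda>y. clamp01 (g y))) \<longlonglongrightarrow> 0"
      by (rule tendsto_squeeze_0[OF _ l2d_nonneg l2d_clamp01_le[OF w(5,2)]])
  qed
qed

text \<open>If some function with values in \<open>[0, 1]\<close> has trace \<open>g\<close>, truncation does not change the trace
  \<open>g\<close>. No trace inequality is needed: the defect \<open>g - clamp01 \<circ> g\<close> is itself a trace of \<open>0\<close>.\<close>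

lemma has_trace_clamp01_same:
  assumes U: "open U" and t: "has_trace U M j u g" and t0: "has_trace U M j u0 g"
    and u0: "AE x in lebesgue_on U. 0 \<le> u0 x \<and> u0 x \<le> 1"
  shows "has_trace U M j (\<lambda>x. clamp01 (u x)) g" "has_trace U M j (\<lambda>x. u x - clamp01 (u x)) (\<lambda>_. 0)"
proof -
  have "has_trace U M j (\<lambda>x. 1 * u0 x + (-1) * clamp01 (u0 x)) (\<lambda>y. 1 * g y + (-1) * clamp01 (g y))"
    by (rule has_trace_lin[OF U t0 has_trace_clamp01[OF U t0]])
  \<comment> \<open>Adding the defect restores the trace \<open>g\<close>, while the function added,
    \<open>u0 - clamp01 u0\<close>, is 0 a.e.\<close>
  from has_trace_lin[OF U has_trace_clamp01[OF U t] this, of 1 1]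
  have 1: "has_trace U M j (\<lambda>x. clamp01 (u x) + (u0 x - clamp01 (u0 x))) g"
    by simp
  have m: "g \<in> borel_measurable M" using t by (auto simp: has_trace_def dest: L2_D(1))
  show 2: "has_trace U M j (\<lambda>x. clamp01 (u x)) g"
    by (rule has_trace_cong[OF U 1 _ m]) (use u0 in \<open>auto simp: clamp01_def elim: eventually_mono\<close>)
  show "has_trace U M j (\<lambda>x. u x - clamp01 (u x)) (\<lambda>_. 0)"
    using has_trace_lin[OF U t 2, of 1 "-1"] by simp
qed

subsection \<open>Compactness\<close>

lemma AE_summable_geometric:
  fixes h :: "nat \<Rightarrow> 'a \<Rightarrow> real"
  assumes [measurable]: "\<And>j. h j \<in> borel_measurable M" and nn: "\<And>j x. 0 \<le> h j x"
    and b: "\<And>j. (\<integral>\<^sup>+x. ennreal (h j x) \<partial>M) \<le> ennreal ((1/2) ^ j)"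
  shows "AE x in M. summable (\<lambda>j. h j x)"
proof -
  have "(\<integral>\<^sup>+x. (\<Sum>j. ennreal (h j x)) \<partial>M) = (\<Sum>j. \<integral>\<^sup>+x. ennreal (h j x) \<partial>M)"
    by (rule nn_integral_suminf) measurable
  also have "\<dots> \<le> (\<Sum>j. ennreal ((1/2) ^ j))"
    by (intro suminf_le b) auto
  also have "\<dots> = ennreal (\<Sum>j. (1/2) ^ j)"
    by (intro suminf_ennreal2) auto
  also have "\<dots> < \<infinity>" by simp
  finally have "(\<integral>\<^sup>+x. (\<Sum>j. ennreal (h j x)) \<partial>M) \<noteq> \<infinity>" by simp
  then have "AE x in M. (\<Sum>j. ennreal (h j x)) \<noteq> \<infinity>"
    by (intro nn_integral_noteq_infinite) measurable
  then show ?thesis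
    by eventually_elim (use nn in \<open>auto intro!: summable_suminf_not_top\<close>)
qed

lemma convergent_if_summable_diff:
  fixes f :: "nat \<Rightarrow> real"
  assumes "summable (\<lambda>j. \<bar>f (Suc j) - f j\<bar>)"
  shows "convergent f"
proof -
  have "convergent (\<lambda>n. \<Sum>j<n. f (Suc j) - f j)"
    using summable_rabs_cancel[OF assms] by (simp add: summable_iff_convergent)
  then have "convergent (\<lambda>n. f n - f 0)" by (simp add: sum_lessThan_telescope)
  then show ?thesis by (simp add: convergent_diff_const_right_iff)
qed

lemma ex_subseq_thresholds:
  fixes N :: "nat \<Rightarrow> nat"
  obtains s where "strict_mono s" "\<And>j. N j \<le> s j"
proof
  let ?s = "\<lambda>j. j + (\<Sum>i\<le>j. N i)"
  show "strict_mono ?s" by (rule strict_monoI_Suc) simp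
  show "N j \<le> ?s j" for j
    using member_le_sum[of j "{..j}" N] by simp
qed

text \<open>Riesz-Fischer: a rapidly Cauchy subsequence converges a.e., and Fatou's lemma bounds the
  distance of every late term to its limit, so that the whole sequence converges.\<close>

lemma L2_complete:
  fixes f :: "nat \<Rightarrow> 'a \<Rightarrow> real"
  assumes f: "\<And>n. f n \<in> L2_space M"
    and cauchy: "\<And>e. e > 0 \<Longrightarrow> \<exists>N. \<forall>k\<ge>N. \<forall>l\<ge>N. l2d M (f k) (f l) < e"
  obtains h where "h \<in> L2_space M" "(\<lambda>n. l2d M (f n) h) \<longlonglongrightarrow> 0"
proof -
  have [measurable]: "f n \<in> borel_measurable M" for n using L2_D(1)[OF f] .
  \<comment> \<open>Squared distances below 4^(-j) remain summable after multiplication by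
    2^j.\<close>
  have "\<exists>N. \<forall>k\<ge>N. \<forall>l\<ge>N. l2d M (f k) (f l) < (1/2) ^ j * (1/2) ^ j" for j :: nat by (rule cauchy) simp
  then obtain N where N: "\<And>j k l. k \<ge> N j \<Longrightarrow> l \<ge> N j \<Longrightarrow> l2d M (f k) (f l) < (1/2) ^ j * (1/2) ^ j"
    by metis
  obtain s where s: "strict_mono s" "\<And>j. N j \<le> s j" using ex_subseq_thresholds by metis
  have s': "N j \<le> s (Suc j)" for j using s(2)[of j] strict_monoD[OF s(1), of j "Suc j"] by simp
  have "AE x in M. summable (\<lambda>j. 2 ^ j * (f (s (Suc j)) x - f (s j) x)\<^sup>2)"
  proof (rule AE_summable_geometric)
    fix j
    have "(\<integral>\<^sup>+x. ennreal (2 ^ j * (f (s (Suc j)) x - f (s j) x)\<^sup>2) \<partial>M) = ennreal (LINT x|M. 2 ^ j * (f (s (Suc j)) x - f (s j) x)\<^sup>2)"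
      using L2_D(2)[OF L2_diff[OF f f]] by (intro nn_integral_eq_integral) auto
    also have "(LINT x|M. 2 ^ j * (f (s (Suc j)) x - f (s j) x)\<^sup>2) = 2 ^ j * l2d M (f (s (Suc j))) (f (s j))"
      by (simp add: l2d_def)
    also have "\<dots> \<le> 2 ^ j * ((1/2) ^ j * (1/2) ^ j)"
      using N[OF s'[of j] s(2)[of j]] by (intro mult_left_mono) auto
    also have "\<dots> = (1/2) ^ j" by (simp add: power_one_over)
    finally show "(\<integral>\<^sup>+x. ennreal (2 ^ j * (f (s (Suc j)) x - f (s j) x)\<^sup>2) \<partial>M) \<le> ennreal ((1/2) ^ j)"
      by (simp add: ennreal_leI)
  qed auto
  then have conv: "AE x in M. (\<lambda>j. f (s j) x) \<longlonglongrightarrow> lim (\<lambda>j. f (s j) x)"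
  proof eventually_elim
    case (elim x)
    have sg: "summable (\<lambda>j. (1/2 :: real) ^ j)" by (rule summable_geometric) simp
    have "summable (\<lambda>j. \<bar>f (s (Suc j)) x - f (s j) x\<bar>)"
    proof (rule summable_comparison_test'[OF summable_add[OF sg elim], of 0])
      fix j
      let ?d = "\<bar>f (s (Suc j)) x - f (s j) x\<bar>" and ?t = "(1/2 :: real) ^ j"
      \<comment> \<open>The arithmetic-geometric mean inequality in the form 2 d \<le> 2^(-j) + 2^j
        d^2, multiplied by 2^j; it turns summability of weighted squares into absolute
        summability.\<close>
      have "2 * 1 * (2 ^ j * ?d) \<le> 1\<^sup>2 + (2 ^ j * ?d)\<^sup>2" by (rule sum_squares_bound)
      moreover have "(f (s (Suc j)) x - f (s j) x)\<^sup>2 = ?d * ?d" by (simp add: power2_eq_square)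
      moreover have "(2 :: real) ^ j * ?t = 1" by (simp add: power_one_over)
      ultimately have "2 ^ j * (2 * ?d) \<le> 2 ^ j * (?t + 2 ^ j * (f (s (Suc j)) x - f (s j) x)\<^sup>2)"
        by (simp only: distrib_left power2_eq_square mult_ac mult_1)
      then have "2 * ?d \<le> ?t + 2 ^ j * (f (s (Suc j)) x - f (s j) x)\<^sup>2" by simp
      moreover have "2 * a \<le> b \<Longrightarrow> 0 \<le> a \<Longrightarrow> a \<le> b" for a b :: real by linarith
      ultimately have "?d \<le> ?t + 2 ^ j * (f (s (Suc j)) x - f (s j) x)\<^sup>2" using abs_ge_zero by blast
      then show "norm ?d \<le> ?t + 2 ^ j * (f (s (Suc j)) x - f (s j) x)\<^sup>2" by simp
    qed
    then show ?case using convergent_if_summable_diff[of "\<lambda>j. f (s j) x"] by (simp add: convergent_LIMSEQ_iff)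
  qed
  define h where "h x = lim (\<lambda>j. f (s j) x)" for x
  have hm[measurable]: "h \<in> borel_measurable M" unfolding h_def by measurable
  \<comment> \<open>Fatou along the subsequence: its terms are eventually beyond \<open>K\<close>,
    where all squared distances to \<open>f n\<close> are below \<open>e\<close>.\<close>
  have fat: "(\<integral>\<^sup>+x. ennreal ((f n x - h x)\<^sup>2) \<partial>M) \<le> ennreal e" if e: "e > 0" and K: "\<forall>k\<ge>K. \<forall>l\<ge>K. l2d M (f k) (f l) < e" and n: "n \<ge> K" for e K n
  proof -
    have "(\<integral>\<^sup>+x. ennreal ((f n x - h x)\<^sup>2) \<partial>M) = (\<integral>\<^sup>+x. liminf (\<lambda>j. ennreal ((f n x - f (s j) x)\<^sup>2)) \<partial>M)"
    proof (rule nn_integral_cong_AE)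
      show "AE x in M. ennreal ((f n x - h x)\<^sup>2) = liminf (\<lambda>j. ennreal ((f n x - f (s j) x)\<^sup>2))"
        using conv
      proof eventually_elim
        case (elim x)
        have "(\<lambda>j. ennreal ((f n x - f (s j) x)\<^sup>2)) \<longlonglongrightarrow> ennreal ((f n x - h x)\<^sup>2)"
          unfolding h_def by (intro tendsto_ennrealI tendsto_intros elim)
        then show ?case by (rule lim_imp_Liminf[OF trivial_limit_sequentially, symmetric])
      qed
    qed
    also have "\<dots> \<le> liminf (\<lambda>j. \<integral>\<^sup>+x. ennreal ((f n x - f (s j) x)\<^sup>2) \<partial>M)"
      by (rule nn_integral_liminf) measurable
    also have "\<dots> \<le> ennreal e"
    proof (rule Liminf_le)
      have "\<forall>\<^sub>F j in sequentially. s j \<ge> K"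
        using filterlim_subseq[OF s(1)] by (simp add: filterlim_at_top)
      then show "\<forall>\<^sub>F j in sequentially. (\<integral>\<^sup>+x. ennreal ((f n x - f (s j) x)\<^sup>2) \<partial>M) \<le> ennreal e"
      proof eventually_elim
        case (elim j)
        have "(\<integral>\<^sup>+x. ennreal ((f n x - f (s j) x)\<^sup>2) \<partial>M) = ennreal (l2d M (f n) (f (s j)))"
          unfolding l2d_def using L2_D(2)[OF L2_diff[OF f f]] by (intro nn_integral_eq_integral) auto
        then show ?case using K n elim by (simp add: ennreal_leI less_imp_le)
      qed
    qed simp
    finally show ?thesis .
  qed
  have hf: "(\<lambda>x. f n x - h x) \<in> L2_space M" if e: "e > 0" and K: "\<forall>k\<ge>K. \<forall>l\<ge>K. l2d M (f k) (f l) < e" and n: "n \<ge> K" for e K n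
    unfolding L2_space_def
  proof (intro CollectI conjI integrableI_bounded)
    show "(\<integral>\<^sup>+x. ennreal (norm ((f n x - h x)\<^sup>2)) \<partial>M) < \<infinity>"
      using fat[OF e K n] by (auto intro: le_less_trans)
  qed measurable
  obtain K1 where K1: "\<forall>k\<ge>K1. \<forall>l\<ge>K1. l2d M (f k) (f l) < 1" using cauchy[of 1] by auto
  have h: "h \<in> L2_space M"
    using L2_diff[OF f[of K1] hf[OF zero_less_one K1 order_refl]] by simp
  moreover have "(\<lambda>n. l2d M (f n) h) \<longlonglongrightarrow> 0"
  proof (rule LIMSEQ_I)
    fix e :: real assume e: "e > 0"
    obtain K where K: "\<forall>k\<ge>K. \<forall>l\<ge>K. l2d M (f k) (f l) < e / 2" using cauchy[of "e / 2"] e by auto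
    have "l2d M (f n) h < e" if n: "n \<ge> K" for n
    proof -
      have e2: "e / 2 > 0" using e by simp
      have "ennreal (l2d M (f n) h) = (\<integral>\<^sup>+x. ennreal ((f n x - h x)\<^sup>2) \<partial>M)"
        unfolding l2d_def using L2_D(2)[OF L2_diff[OF f h]] by (intro nn_integral_eq_integral[symmetric]) auto
      also have "\<dots> \<le> ennreal (e / 2)" by (rule fat[OF e2 K n])
      finally show ?thesis using e by (simp add: l2d_nonneg)
    qed
    then show "\<exists>no. \<forall>n\<ge>no. norm (l2d M (f n) h - 0) < e" by (auto simp: l2d_nonneg)
  qed
  ultimately show ?thesis by (rule that)
qed

text \<open>Bolzano-Weierstrass for each index and a diagonal subsequence. The diagonal is a
  subsequence of the one chosen for \<open>i\<close> only after its first \<open>Suc i\<close>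
  terms, which do not affect convergence.\<close>

lemma bounded_family_convergent_subseq:
  fixes f :: "nat \<Rightarrow> nat \<Rightarrow> real"
  assumes "\<And>n i. \<bar>f n i\<bar> \<le> B i"
  obtains r where "strict_mono r" "\<And>i. convergent (\<lambda>k. f (r k) i)"
proof -
  interpret subseqs "\<lambda>i s. convergent (\<lambda>k. f (s k) i)"
  proof
    fix i and s :: "nat \<Rightarrow> nat" assume "strict_mono s"
    have "bounded (range (\<lambda>k. f (s k) i))" using assms by (auto simp: bounded_iff)
    then obtain l r where "strict_mono r" "((\<lambda>k. f (s k) i) \<circ> r) \<longlonglongrightarrow> l"
      using bounded_imp_convergent_subsequence by blast
    then show "\<exists>r. strict_mono r \<and> convergent (\<lambda>k. f ((s \<circ> r) k) i)"
      by (auto simp: convergent_def o_def)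
  qed
  have "convergent (\<lambda>k. f (diagseq k) i)" for i
  proof -
    have "convergent (\<lambda>k. f ((diagseq \<circ> (+) (Suc i)) k) i)"
    proof (rule diagseq_holds)
      fix r s :: "nat \<Rightarrow> nat" and n assume "strict_mono r" "convergent (\<lambda>k. f (s k) n)"
      then show "convergent (\<lambda>k. f ((s \<circ> r) k) n)"
        using convergent_subseq_convergent[of "\<lambda>k. f (s k) n" r] by (simp add: o_def)
    qed
    then have "convergent (\<lambda>k. f (diagseq (k + Suc i)) i)" by (simp add: add.commute)
    then show ?thesis by (simp only: convergent_ignore_initial_segment[of "\<lambda>k. f (diagseq k) i"])
  qed
  with subseq_diagseq show ?thesis by (rule that)
qed

section \<open>Local Rellich theorem by averages over balls\<close>

lemma wderiv_direction:
  fixes z :: "'a::euclidean_space"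
  assumes "\<And>b. b \<in> Basis \<Longrightarrow> wderiv U b u (g b)"
  shows "wderiv U z u (\<lambda>x. \<Sum>b\<in>Basis. (z \<bullet> b) * g b x)"
proof -
  have "wderiv U (\<Sum>b\<in>S. (z \<bullet> b) *\<^sub>R b) u (\<lambda>x. \<Sum>b\<in>S. (z \<bullet> b) * g b x)" if "finite S" "S \<subseteq> Basis" for S
    using that
  proof (induction S rule: finite_induct)
    case empty
    obtain b :: 'a where "b \<in> Basis" using nonempty_Basis by blast
    from wderiv_scale_dir[OF assms[OF this], of 0] show ?case by simp
  next
    case (insert b S)
    then have "wderiv U ((z \<bullet> b) *\<^sub>R b + 1 *\<^sub>R (\<Sum>b\<in>S. (z \<bullet> b) *\<^sub>R b)) u (\<lambda>x. (z \<bullet> b) * g b x + 1 * (\<Sum>b\<in>S. (z \<bullet> b) * g b x))"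
      by (intro wderiv_lin_dir assms) auto
    with insert show ?case by simp
  qed
  from this[of Basis] show ?thesis by (simp add: euclidean_representation)
qed

text \<open>Convolution with the normalised indicator of a ball. It acts as a mollifier here: for a
  small radius it is close to functions with bounded derivatives, and for a fixed radius it is
  equicontinuous on functions with values in [0, 1].\<close>

definition ball_avg :: "real \<Rightarrow> ('a::euclidean_space \<Rightarrow> real) \<Rightarrow> 'a \<Rightarrow> real" where
  "ball_avg h u x = (LINT z|lborel. indicator (ball 0 h) z * u (x + z)) / measure lborel (ball (0::'a) h)"

lemma ball_indicator_measurable: "indicat_real (ball x h) \<in> borel_measurable borel"
  by (intro borel_measurable_indicator borel_open open_ball)

lemma integrable_ball_mult:
  fixes u :: "'a::euclidean_space \<Rightarrow> real"
  assumes u: "u \<in> borel_measurable borel" "\<And>x. \<bar>u x\<bar> \<le> B"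
  shows "integrable lborel (\<lambda>z. indicator (ball 0 h) z * u z)"
proof (rule Bochner_Integration.integrable_bound)
  show "integrable lborel (\<lambda>z. indicator (ball (0::'a) h) z * B)"
    using emeasure_bounded_finite[of "ball (0::'a) h"]
    by (intro integrable_mult_left integrable_real_indicator) auto
  show "AE z in lborel. norm (indicator (ball 0 h) z * u z) \<le> norm (indicator (ball (0::'a) h) z * B)"
    using order_trans[OF u(2) abs_ge_self] by (intro AE_I2) (auto split: split_indicator)
qed (use borel_measurable_times[OF ball_indicator_measurable u(1)] in simp)

lemma ball_avg_bounds:
  fixes u :: "'a::euclidean_space \<Rightarrow> real"
  assumes u: "u \<in> borel_measurable borel" "\<And>x. 0 \<le> u x \<and> u x \<le> 1" and h: "h > 0"
  shows "0 \<le> ball_avg h u x" "ball_avg h u x \<le> 1"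
proof -
  have pos: "measure lborel (ball (0::'a) h) > 0" using content_ball_pos[OF h, of "0::'a"] by simp
  have um: "(\<lambda>z. u (x + z)) \<in> borel_measurable borel"
    by (rule borel_measurable_compose_continuous[OF u(1)]) (auto intro!: continuous_intros)
  show "0 \<le> ball_avg h u x" unfolding ball_avg_def
    using u(2) by (intro divide_nonneg_nonneg integral_nonneg_AE) auto
  have "(LINT z|lborel. indicator (ball 0 h) z * u (x + z)) \<le> (LINT z|lborel. indicator (ball (0::'a) h) z * 1)"
  proof (rule integral_mono)
    show "integrable lborel (\<lambda>z. indicator (ball 0 h) z * u (x + z))"
      using u(2) by (intro integrable_ball_mult[OF um, of 1]) auto
    show "integrable lborel (\<lambda>z. indicator (ball (0::'a) h) z * (1::real))" by (rule integrable_ball_mult[of _ 1]) auto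
  qed (use u(2) in \<open>auto split: split_indicator\<close>)
  then show "ball_avg h u x \<le> 1" using pos by (simp add: ball_avg_def divide_le_eq)
qed

lemma ball_avg_measurable [measurable]:
  fixes u :: "'a::euclidean_space \<Rightarrow> real"
  assumes u: "u \<in> borel_measurable borel"
  shows "ball_avg h u \<in> borel_measurable borel"
proof -
  have "(\<lambda>p :: 'a \<times> 'a. indicator (ball 0 h) (snd p) * u (fst p + snd p)) \<in> borel_measurable borel"
    by (intro borel_measurable_times borel_measurable_compose_continuous[of "indicator (ball 0 h)" snd] borel_measurable_compose_continuous[OF u] ball_indicator_measurable)
      (auto intro!: continuous_intros)
  then have "(\<lambda>(x, z). indicator (ball 0 h) z * u (x + z)) \<in> borel_measurable (lborel \<Otimes>\<^sub>M lborel)"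
    unfolding lborel_prod by (simp add: case_prod_beta')
  from lborel.borel_measurable_lebesgue_integral[OF this]
  show ?thesis unfolding ball_avg_def[abs_def] by simp
qed

text \<open>Averages at \<open>x\<close> and at \<open>p\<close> differ by at most the L1 distance
  of the two ball indicators divided by the volume, uniformly in \<open>n\<close>. Convergence on a
  dense set therefore spreads to all points.\<close>

lemma ball_avg_convergent:
  fixes u :: "nat \<Rightarrow> 'a::euclidean_space \<Rightarrow> real"
  assumes u: "\<And>n. u n \<in> borel_measurable borel" "\<And>n x. 0 \<le> u n x \<and> u n x \<le> 1"
    and D: "\<And>p. p \<in> D \<Longrightarrow> convergent (\<lambda>n. ball_avg h (u n) p)" and dense: "closure D = UNIV" and h: "h > 0"
  shows "convergent (\<lambda>n. ball_avg h (u n) x)"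
proof -
  define c where "c = measure lborel (ball (0::'a) h)"
  have c: "c > 0" using content_ball_pos[OF h, of "0::'a"] by (simp add: c_def)
  let ?f = "indicator (ball 0 h) :: 'a \<Rightarrow> real"
  have f: "integrable lborel ?f"
    using emeasure_bounded_finite[of "ball (0::'a) h"] by (intro integrable_real_indicator) auto
  obtain p where p: "\<And>j. p j \<in> D" "p \<longlonglongrightarrow> x"
    using dense closure_sequential[of x D] by auto
  have z: "(\<lambda>j. p j - x) \<longlonglongrightarrow> 0" using tendsto_diff[OF p(2) tendsto_const[of x]] by simp
  define \<delta> where "\<delta> j = (LINT y|lborel. \<bar>?f (y + (p j - x)) - ?f y\<bar>)" for j
  have \<delta>: "\<delta> \<longlonglongrightarrow> 0"
    unfolding \<delta>_def using integrable_L1_translation[OF f] z by (simp add: L1_translation_def)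
  \<comment> \<open>Moving the centre from \<open>u n\<close> into the indicator makes the
    dependence on the centre uniform in \<open>n\<close>.\<close>
  have avg: "ball_avg h (u n) q = (LINT y|lborel. ?f (y + - q) * u n y) / c" for n q
  proof -
    have fm: "(\<lambda>y. ?f (y + - q)) \<in> borel_measurable borel"
      by (rule borel_measurable_compose_continuous[OF ball_indicator_measurable]) (auto intro!: continuous_intros)
    have "(LINT z|lborel. ?f z * u n (q + z)) = (LINT z|lborel. ?f (z + q + - q) * u n (z + q))" by (simp add: add.commute)
    also have "\<dots> = (LINT y|lborel. ?f (y + - q) * u n y)"
      using u(1)[of n] fm
      by (intro integral_translate[of "\<lambda>y. ?f (y + - q) * u n y" q] borel_measurable_times) auto
    finally show ?thesis by (simp add: ball_avg_def c_def)
  qed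
  have est: "\<bar>ball_avg h (u n) x - ball_avg h (u n) (p j)\<bar> \<le> \<delta> j / c" for n j
  proof -
    have i: "integrable lborel (\<lambda>y. ?f (y + - q) * u n y)" for q
      using u by (intro integrable_mult_bounded[OF integrable_translate[OF f], of _ 1]) auto
    have "\<bar>(LINT y|lborel. ?f (y + - x) * u n y) - (LINT y|lborel. ?f (y + - p j) * u n y)\<bar> = \<bar>LINT y|lborel. ?f (y + - x) * u n y - ?f (y + - p j) * u n y\<bar>"
      using i by simp
    also have "\<dots> \<le> (LINT y|lborel. \<bar>?f (y + - x) * u n y - ?f (y + - p j) * u n y\<bar>)" by (rule integral_abs_bound)
    also have "\<dots> \<le> (LINT y|lborel. \<bar>?f (y + - x) - ?f (y + - p j)\<bar>)"
    proof (rule integral_mono)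
      show "integrable lborel (\<lambda>y. \<bar>?f (y + - x) * u n y - ?f (y + - p j) * u n y\<bar>)" using i by auto
      show "integrable lborel (\<lambda>y. \<bar>?f (y + - x) - ?f (y + - p j)\<bar>)"
        using integrable_translate[OF f, of "- x"] integrable_translate[OF f, of "- p j"] by auto
      fix y
      show "\<bar>?f (y + - x) * u n y - ?f (y + - p j) * u n y\<bar> \<le> \<bar>?f (y + - x) - ?f (y + - p j)\<bar>"
        unfolding left_diff_distrib[symmetric] abs_mult using u(2)[of n y] by (intro mult_left_le) auto
    qed
    also have "\<dots> = (LINT y|lborel. \<bar>?f (y + - p j + (p j - x)) - ?f (y + - p j)\<bar>)" by (simp add: add.assoc)
    also have "\<dots> = \<delta> j"
      unfolding \<delta>_def using integral_translate[of "\<lambda>y. \<bar>?f (y + (p j - x)) - ?f y\<bar>" "- p j"]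
        borel_measurable_integrable[OF integrable_translate[OF f, of "p j - x"]] borel_measurable_integrable[OF f] by simp
    finally show ?thesis unfolding avg diff_divide_distrib[symmetric] using c by (simp add: abs_divide divide_right_mono)
  qed
  have "Cauchy (\<lambda>n. ball_avg h (u n) x)"
  proof (rule metric_CauchyI)
    fix e :: real assume e: "e > 0"
    have "(\<lambda>j. \<delta> j / c) \<longlonglongrightarrow> 0 / c" by (intro tendsto_intros \<delta>) (use c in simp)
    from order_tendstoD(2)[OF this, of "e / 4"] e have "\<forall>\<^sub>F j in sequentially. \<delta> j / c < e / 4" by simp
    then obtain j where j: "\<delta> j / c < e / 4" by (auto simp: eventually_sequentially)
    have "Cauchy (\<lambda>n. ball_avg h (u n) (p j))" using D[OF p(1)] by (rule convergent_Cauchy)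
    from metric_CauchyD[OF this, of "e / 4"] e obtain M where M: "\<And>m n. m \<ge> M \<Longrightarrow> n \<ge> M \<Longrightarrow> dist (ball_avg h (u m) (p j)) (ball_avg h (u n) (p j)) < e / 4"
      by auto
    have "dist (ball_avg h (u m) x) (ball_avg h (u n) x) < e" if "m \<ge> M" "n \<ge> M" for m n
      using est[of m j] est[of n j] M[OF that] j unfolding dist_real_def by linarith
    then show "\<exists>M. \<forall>m\<ge>M. \<forall>n\<ge>M. dist (ball_avg h (u m) x) (ball_avg h (u n) x) < e" by blast
  qed
  then show ?thesis by (simp add: Cauchy_convergent_iff)
qed

lemma loc_int_bounded_dist:
  fixes u v :: "'a::euclidean_space \<Rightarrow> real"
  assumes K: "compact K" and m: "u \<in> borel_measurable borel" "v \<in> borel_measurable borel"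
    and b: "\<And>x. 0 \<le> u x \<and> u x \<le> 1" "\<And>x. 0 \<le> v x \<and> v x \<le> 1"
  shows "integrable lborel (\<lambda>x. indicator K x * \<bar>u x - v x\<bar>)"
proof (rule integrable_mult_bounded[OF integrable_indicator_compact[OF K]])
  show "\<bar>\<bar>u x - v x\<bar>\<bar> \<le> 1" for x using b[of x] by (simp add: abs_le_iff)
qed (use m in simp)

text \<open>The average differs from \<open>u x\<close> by at most the mean of |u (x + z) - u x|
  over |z| < h. Fubini integrates over \<open>x\<close> first, and the shift estimate bounds each
  \<open>z\<close> by \<open>h\<close> times the L1 norms of the DIM('a) partial
  derivatives.\<close>

lemma ball_avg_L1:
  fixes U :: "'a::euclidean_space set" and h C :: real
  assumes U: "open U" and w: "\<And>b. b \<in> Basis \<Longrightarrow> wderiv U b u (g b)" and u: "\<And>x. 0 \<le> u x \<and> u x \<le> 1"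
    and K: "compact K" and K': "compact K'" "K' \<subseteq> U" "\<And>x z. x \<in> K \<Longrightarrow> norm z \<le> h \<Longrightarrow> x + z \<in> K'"
    and C: "\<And>b. b \<in> Basis \<Longrightarrow> (LINT x|lborel. indicator K' x * \<bar>g b x\<bar>) \<le> C" and h: "h > 0"
  shows "(LINT x|lborel. indicator K x * \<bar>ball_avg h u x - u x\<bar>) \<le> h * (DIM('a) * C)"
proof -
  define c where "c = measure lborel (ball (0::'a) h)"
  have c: "c > 0" using content_ball_pos[OF h, of "0::'a"] by (simp add: c_def)
  have lg: "loc_int U (g b)" if "b \<in> Basis" for b using w[OF that] by (simp add: wderiv_def)
  obtain b0 :: 'a where "b0 \<in> Basis" using nonempty_Basis by blast
  then have um[measurable]: "u \<in> borel_measurable borel" using w by (auto simp: wderiv_def loc_int_def)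
  have Kb[measurable]: "K \<in> sets borel" using compact_imp_closed[OF K] by (rule borel_closed)
  have ig: "integrable lborel (\<lambda>x. indicator K' x * \<bar>g b x\<bar>)" if "b \<in> Basis" for b
    using integrable_abs[OF loc_int_restrict[OF lg[OF that] K'(1,2)]] by (simp add: abs_mult)
  have shift: "(LINT x|lborel. indicator K x * \<bar>u (x + z) - u x\<bar>) \<le> h * (DIM('a) * C)" if z: "norm z < h" for z
  proof -
    have "(LINT x|lborel. indicator K x * \<bar>u (x + z) - u x\<bar>) \<le> (LINT x|lborel. indicator K' x * \<bar>\<Sum>b\<in>Basis. (z \<bullet> b) * g b x\<bar>)"
    proof (rule wderiv_shift_estimate[OF U wderiv_direction[OF w] K K'(1,2)])
      fix x and s :: real assume "x \<in> K" "0 \<le> s" "s \<le> 1"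
      moreover from this have "norm (s *\<^sub>R z) \<le> 1 * norm z" by (simp add: mult_left_le_one_le)
      ultimately show "x + s *\<^sub>R z \<in> K'" using z by (intro K'(3)) auto
    qed auto
    also have "\<dots> \<le> (LINT x|lborel. (\<Sum>b\<in>Basis. h * (indicator K' x * \<bar>g b x\<bar>)))"
    proof (rule integral_mono_AE')
      show "integrable lborel (\<lambda>x. \<Sum>b\<in>Basis. h * (indicator K' x * \<bar>g b x\<bar>))" using ig by auto
      show "AE x in lborel. indicator K' x * \<bar>\<Sum>b\<in>Basis. (z \<bullet> b) * g b x\<bar> \<le> (\<Sum>b\<in>Basis. h * (indicator K' x * \<bar>g b x\<bar>))"
      proof (intro AE_I2)
        fix x
        have "\<bar>\<Sum>b\<in>Basis. (z \<bullet> b) * g b x\<bar> \<le> (\<Sum>b\<in>Basis. \<bar>(z \<bullet> b) * g b x\<bar>)" by (rule sum_abs)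
        also have "\<dots> \<le> (\<Sum>b\<in>Basis. h * \<bar>g b x\<bar>)"
        proof (rule sum_mono)
          fix b :: 'a assume "b \<in> Basis"
          then have "\<bar>z \<bullet> b\<bar> \<le> h" using Basis_le_norm[of b z] z by simp
          then show "\<bar>(z \<bullet> b) * g b x\<bar> \<le> h * \<bar>g b x\<bar>" by (simp add: abs_mult mult_right_mono)
        qed
        finally show "indicator K' x * \<bar>\<Sum>b\<in>Basis. (z \<bullet> b) * g b x\<bar> \<le> (\<Sum>b\<in>Basis. h * (indicator K' x * \<bar>g b x\<bar>))"
          by (auto split: split_indicator)
      qed
      show "AE x in lborel. 0 \<le> (\<Sum>b\<in>Basis. h * (indicator K' x * \<bar>g b x\<bar>))"
        using h by (intro AE_I2 sum_nonneg) auto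
    qed
    also have "\<dots> = (\<Sum>b\<in>Basis. h * (LINT x|lborel. indicator K' x * \<bar>g b x\<bar>))"
      using ig by (subst Bochner_Integration.integral_sum) auto
    also have "\<dots> \<le> (\<Sum>b\<in>(Basis :: 'a set). h * C)"
      using C h by (intro sum_mono mult_left_mono) auto
    finally show ?thesis by (simp add: algebra_simps)
  qed
  have m2: "(\<lambda>p :: 'a \<times> 'a. ennreal (indicator K (fst p) * (indicator (ball 0 h) (snd p) * \<bar>u (fst p + snd p) - u (fst p)\<bar>))) \<in> borel_measurable borel"
    by (intro measurable_compose[OF _ measurable_ennreal] borel_measurable_times borel_measurable_abs borel_measurable_diff
        borel_measurable_compose_continuous[of "indicator K" fst] borel_measurable_compose_continuous[of "indicator (ball 0 h)" snd]
        borel_measurable_compose_continuous[OF um] ball_indicator_measurable borel_measurable_indicator[OF Kb])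
      (auto intro!: continuous_intros)
  have inner: "indicator K x * \<bar>ball_avg h u x - u x\<bar> * c \<le> (LINT z|lborel. indicator K x * (indicator (ball 0 h) z * \<bar>u (x + z) - u x\<bar>))"
    and innerint: "integrable lborel (\<lambda>z. indicator K x * (indicator (ball 0 h) z * \<bar>u (x + z) - u x\<bar>))" for x
  proof -
    have uxm: "(\<lambda>z. u (x + z)) \<in> borel_measurable borel"
      by (rule borel_measurable_compose_continuous[OF um]) (auto intro!: continuous_intros)
    have i1: "integrable lborel (\<lambda>z. indicator (ball 0 h) z * u (x + z))"
      using u by (intro integrable_ball_mult[OF uxm, of 1]) auto
    have i2: "integrable lborel (\<lambda>z. indicator (ball (0::'a) h) z * u x)"
      using u by (intro integrable_ball_mult[of "\<lambda>_. u x" 1]) auto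
    have "\<bar>\<bar>u (x + z) - u x\<bar>\<bar> \<le> 1" for z using u[of x] u[of "x + z"] by (simp add: abs_le_iff)
    then show "integrable lborel (\<lambda>z. indicator K x * (indicator (ball 0 h) z * \<bar>u (x + z) - u x\<bar>))"
      using uxm by (intro integrable_mult_right integrable_ball_mult) auto
    have "(ball_avg h u x - u x) * c = (LINT z|lborel. indicator (ball 0 h) z * u (x + z)) - (LINT z|lborel. indicator (ball (0::'a) h) z * u x)"
      using c by (simp add: ball_avg_def c_def left_diff_distrib)
    also have "\<dots> = (LINT z|lborel. indicator (ball 0 h) z * u (x + z) - indicator (ball 0 h) z * u x)"
      using i1 i2 by simp
    also have "\<bar>\<dots>\<bar> \<le> (LINT z|lborel. \<bar>indicator (ball 0 h) z * u (x + z) - indicator (ball 0 h) z * u x\<bar>)"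
      by (rule integral_abs_bound)
    also have "\<dots> = (LINT z|lborel. indicator (ball 0 h) z * \<bar>u (x + z) - u x\<bar>)"
      by (intro Bochner_Integration.integral_cong refl) (auto split: split_indicator)
    finally have "\<bar>ball_avg h u x - u x\<bar> * c \<le> (LINT z|lborel. indicator (ball 0 h) z * \<bar>u (x + z) - u x\<bar>)"
      using c by (simp add: abs_mult)
    then show "indicator K x * \<bar>ball_avg h u x - u x\<bar> * c \<le> (LINT z|lborel. indicator K x * (indicator (ball 0 h) z * \<bar>u (x + z) - u x\<bar>))"
      by (auto split: split_indicator)
  qed
  have am[measurable]: "ball_avg h u \<in> borel_measurable borel" by (rule ball_avg_measurable[OF um])
  have iA: "integrable lborel (\<lambda>x. indicator K x * \<bar>ball_avg h u x - u x\<bar>)"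
    using u ball_avg_bounds[OF um u h] by (intro loc_int_bounded_dist[OF K am um]) auto
  \<comment> \<open>The shift by 0 has increment 0, so the bound itself is nonnegative.\<close>
  have C0: "0 \<le> h * (DIM('a) * C)"
    using shift[of 0] h by simp
  have "ennreal ((LINT x|lborel. indicator K x * \<bar>ball_avg h u x - u x\<bar>) * c) = (\<integral>\<^sup>+x. ennreal (indicator K x * \<bar>ball_avg h u x - u x\<bar> * c) \<partial>lborel)"
    using iA c by (subst nn_integral_eq_integral) auto
  also have "\<dots> \<le> (\<integral>\<^sup>+x. \<integral>\<^sup>+z. ennreal (indicator K x * (indicator (ball 0 h) z * \<bar>u (x + z) - u x\<bar>)) \<partial>lborel \<partial>lborel)"
  proof (rule nn_integral_mono)
    fix x
    show "ennreal (indicator K x * \<bar>ball_avg h u x - u x\<bar> * c) \<le> (\<integral>\<^sup>+z. ennreal (indicator K x * (indicator (ball 0 h) z * \<bar>u (x + z) - u x\<bar>)) \<partial>lborel)"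
      using inner[of x] by (subst nn_integral_eq_integral[OF innerint]) (auto intro!: ennreal_leI)
  qed
  also have "\<dots> = (\<integral>\<^sup>+z. \<integral>\<^sup>+x. ennreal (indicator K x * (indicator (ball 0 h) z * \<bar>u (x + z) - u x\<bar>)) \<partial>lborel \<partial>lborel)"
  proof -
    have "(\<lambda>(x, z). ennreal (indicator K x * (indicator (ball 0 h) z * \<bar>u (x + z) - u x\<bar>))) \<in> borel_measurable (lborel \<Otimes>\<^sub>M lborel)"
      using m2 unfolding lborel_prod by (simp add: case_prod_beta')
    from lborel_pair.Fubini'[OF this] show ?thesis by simp
  qed
  also have "\<dots> \<le> (\<integral>\<^sup>+z. ennreal (h * (DIM('a) * C)) * indicator (ball (0::'a) h) z \<partial>lborel)"
  proof (rule nn_integral_mono)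
    fix z :: 'a
    show "(\<integral>\<^sup>+x. ennreal (indicator K x * (indicator (ball 0 h) z * \<bar>u (x + z) - u x\<bar>)) \<partial>lborel) \<le> ennreal (h * (DIM('a) * C)) * indicator (ball 0 h) z"
    proof (cases "norm z < h")
      case True
      have uzm: "(\<lambda>x. u (x + z)) \<in> borel_measurable borel"
        by (rule borel_measurable_compose_continuous[OF um]) (auto intro!: continuous_intros)
      have "integrable lborel (\<lambda>x. indicator K x * \<bar>u (x + z) - u x\<bar>)"
        using u by (intro loc_int_bounded_dist[OF K uzm um]) auto
      then have "(\<integral>\<^sup>+x. ennreal (indicator K x * \<bar>u (x + z) - u x\<bar>) \<partial>lborel) = ennreal (LINT x|lborel. indicator K x * \<bar>u (x + z) - u x\<bar>)"
        by (rule nn_integral_eq_integral) auto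
      then show ?thesis using shift[OF True] True by (simp add: ennreal_leI)
    qed simp
  qed
  also have "\<dots> = ennreal (h * (DIM('a) * C)) * emeasure lborel (ball (0::'a) h)"
    by (simp add: nn_integral_cmult_indicator)
  also have "emeasure lborel (ball (0::'a) h) = ennreal c"
    unfolding c_def using emeasure_bounded_finite[of "ball (0::'a) h"] by (intro emeasure_eq_ennreal_measure) auto
  also have "ennreal (h * (DIM('a) * C)) * ennreal c = ennreal (h * (DIM('a) * C) * c)"
    using C0 c by (simp add: ennreal_mult)
  finally have "(LINT x|lborel. indicator K x * \<bar>ball_avg h u x - u x\<bar>) * c \<le> h * (DIM('a) * C) * c"
    using C0 c by (subst (asm) ennreal_le_iff) auto
  then show ?thesis using c by simp
qed

text \<open>The radius is fixed first, so that averaging costs less than e/4 for every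
  \<open>n\<close>; then the averages are within e/4 of their pointwise limit for large
  \<open>n\<close>. Two indices give four such terms. The radius is some 1/(m+1), for which
  convergence of the averages is assumed.\<close>

lemma rellich_cauchy:
  fixes U :: "'a::euclidean_space set" and u :: "nat \<Rightarrow> 'a \<Rightarrow> real"
  assumes U: "open U" and w: "\<And>n b. b \<in> Basis \<Longrightarrow> wderiv U b (u n) (g n b)" and u: "\<And>n x. 0 \<le> u n x \<and> u n x \<le> 1"
    and bnd: "\<And>K. compact K \<Longrightarrow> K \<subseteq> U \<Longrightarrow> \<exists>C. \<forall>n. \<forall>b\<in>Basis. (LINT x|lborel. indicator K x * \<bar>g n b x\<bar>) \<le> C"
    and conv: "\<And>m x. convergent (\<lambda>n. ball_avg (inverse (real (Suc m))) (u n) x)"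
    and K: "compact K" "K \<subseteq> U" and e: "e > 0"
  shows "\<exists>N. \<forall>k\<ge>N. \<forall>l\<ge>N. (LINT x|lborel. indicator K x * \<bar>u k x - u l x\<bar>) < e"
proof -
  obtain d K' where dK: "d > 0" "compact K'" "K' \<subseteq> U" "\<And>x z. x \<in> K \<Longrightarrow> norm z \<le> d \<Longrightarrow> x + z \<in> K'"
    using compact_neighbourhood[OF U K] by metis
  obtain C where C: "\<And>n b. b \<in> Basis \<Longrightarrow> (LINT x|lborel. indicator K' x * \<bar>g n b x\<bar>) \<le> C"
    using bnd[OF dK(2,3)] by blast
  have lim: "(\<lambda>m. inverse (real (Suc m)) * (DIM('a) * C)) \<longlonglongrightarrow> 0"
    by (rule tendsto_mult_left_zero[OF LIMSEQ_inverse_real_of_nat])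
  have "\<forall>\<^sub>F m in sequentially. inverse (real (Suc m)) < d \<and> inverse (real (Suc m)) * (DIM('a) * C) < e / 4"
    using order_tendstoD(2)[OF LIMSEQ_inverse_real_of_nat dK(1)] order_tendstoD(2)[OF lim, of "e / 4"] e
    by (intro eventually_conj) auto
  then obtain m where m: "inverse (real (Suc m)) < d" "inverse (real (Suc m)) * (DIM('a) * C) < e / 4"
    by (auto simp: eventually_sequentially)
  define h where "h = inverse (real (Suc m))"
  have h: "h > 0" "h < d" "h * (DIM('a) * C) < e / 4" using m by (auto simp: h_def)
  obtain b0 :: 'a where "b0 \<in> Basis" using nonempty_Basis by blast
  then have um: "u n \<in> borel_measurable borel" for n using w by (auto simp: wderiv_def loc_int_def)
  note am = ball_avg_measurable[OF um]
  note ab = ball_avg_bounds[OF um u h(1)]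
  have L1: "(LINT x|lborel. indicator K x * \<bar>ball_avg h (u n) x - u n x\<bar>) < e / 4" for n
  proof -
    have "(LINT x|lborel. indicator K x * \<bar>ball_avg h (u n) x - u n x\<bar>) \<le> h * (DIM('a) * C)"
    proof (rule ball_avg_L1[where g = "g n", OF U _ u K(1) dK(2,3) _ _ h(1)])
      show "x + z \<in> K'" if "x \<in> K" "norm z \<le> h" for x z using that dK(4)[of x z] h(2) by simp
    qed (use w C in auto)
    then show ?thesis using h(3) by simp
  qed
  define a where "a x = lim (\<lambda>n. ball_avg h (u n) x)" for x
  have conv': "(\<lambda>n. ball_avg h (u n) x) \<longlonglongrightarrow> a x" for x
    using conv[of m x] by (simp add: a_def h_def convergent_LIMSEQ_iff)
  have abds: "0 \<le> a x \<and> a x \<le> 1" for x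
    using LIMSEQ_le_const[OF conv', of 0 x] LIMSEQ_le_const2[OF conv', of x 1] ab by auto
  have ameas: "a \<in> borel_measurable borel"
    by (rule borel_measurable_LIMSEQ_real[where u = "\<lambda>n. ball_avg h (u n)"]) (use conv' am in auto)
  have iA: "integrable lborel (\<lambda>x. indicator K x * \<bar>ball_avg h (u n) x - a x\<bar>)" for n
    using abds ab by (intro loc_int_bounded_dist[OF K(1) am ameas]) auto
  have "(\<lambda>n. LINT x|lborel. indicator K x * \<bar>ball_avg h (u n) x - a x\<bar>) \<longlonglongrightarrow> (LINT x|(lborel :: 'a measure). 0)"
  proof (rule integral_dominated_convergence[where w = "indicator K"])
    show "integrable lborel (indicator K :: 'a \<Rightarrow> real)" by (rule integrable_indicator_compact[OF K(1)])
    show "AE x in lborel. (\<lambda>n. indicator K x * \<bar>ball_avg h (u n) x - a x\<bar>) \<longlonglongrightarrow> 0"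
      using LIM_zero[OF conv'] by (intro AE_I2 tendsto_mult_right_zero tendsto_rabs_zero)
    show "AE x in lborel. norm (indicator K x * \<bar>ball_avg h (u n) x - a x\<bar>) \<le> indicat_real K x" for n
    proof (intro AE_I2)
      fix x
      have "\<bar>ball_avg h (u n) x - a x\<bar> \<le> 1" using ab(1)[of n x] ab(2)[of n x] abds[of x] by (simp add: abs_le_iff)
      then show "norm (indicator K x * \<bar>ball_avg h (u n) x - a x\<bar>) \<le> indicat_real K x" by (auto split: split_indicator)
    qed
  qed (use iA in auto)
  then have "\<forall>\<^sub>F n in sequentially. (LINT x|lborel. indicator K x * \<bar>ball_avg h (u n) x - a x\<bar>) < e / 4"
    using e by (intro order_tendstoD(2)) auto
  then obtain N where N: "\<And>n. n \<ge> N \<Longrightarrow> (LINT x|lborel. indicator K x * \<bar>ball_avg h (u n) x - a x\<bar>) < e / 4"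
    by (auto simp: eventually_sequentially)
  have "(LINT x|lborel. indicator K x * \<bar>u k x - u l x\<bar>) < e" if "k \<ge> N" "l \<ge> N" for k l
  proof -
    let ?I = "\<lambda>f. LINT x|lborel. indicator K x * f x"
    have i: "integrable lborel (\<lambda>x. indicator K x * \<bar>ball_avg h (u n) x - u n x\<bar>)" for n
      using ab u by (intro loc_int_bounded_dist[OF K(1) am um]) auto
    have "?I (\<lambda>x. \<bar>u k x - u l x\<bar>) \<le> (LINT x|lborel. indicator K x * \<bar>ball_avg h (u k) x - u k x\<bar> + indicator K x * \<bar>ball_avg h (u k) x - a x\<bar>
        + indicator K x * \<bar>ball_avg h (u l) x - a x\<bar> + indicator K x * \<bar>ball_avg h (u l) x - u l x\<bar>)"
    proof (rule integral_mono)
      show "integrable lborel (\<lambda>x. indicator K x * \<bar>u k x - u l x\<bar>)" using u by (intro loc_int_bounded_dist[OF K(1) um um]) auto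
      show "integrable lborel (\<lambda>x. indicator K x * \<bar>ball_avg h (u k) x - u k x\<bar> + indicator K x * \<bar>ball_avg h (u k) x - a x\<bar>
        + indicator K x * \<bar>ball_avg h (u l) x - a x\<bar> + indicator K x * \<bar>ball_avg h (u l) x - u l x\<bar>)"
        by (intro Bochner_Integration.integrable_add i iA)
    qed (auto split: split_indicator)
    also have "\<dots> = ?I (\<lambda>x. \<bar>ball_avg h (u k) x - u k x\<bar>) + ?I (\<lambda>x. \<bar>ball_avg h (u k) x - a x\<bar>)
        + ?I (\<lambda>x. \<bar>ball_avg h (u l) x - a x\<bar>) + ?I (\<lambda>x. \<bar>ball_avg h (u l) x - u l x\<bar>)"
      using i iA by simp
    also have "\<dots> < e" using L1[of k] L1[of l] N[OF that(1)] N[OF that(2)] by linarith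
    finally show ?thesis .
  qed
  then show ?thesis by blast
qed

text \<open>Averages are determined by countably many data, radii 1/(m+1) and centres in a countable
  dense set, so one diagonal subsequence makes all of them converge. The sequence is then Cauchy in
  L1 of each compact set, and errors 2^(-j) on the \<open>j\<close>-th set of an exhaustion give
  convergence a.e.\<close>

lemma rellich:
  fixes U :: "'a::euclidean_space set" and u :: "nat \<Rightarrow> 'a \<Rightarrow> real"
  assumes U: "open U" and w: "\<And>n b. b \<in> Basis \<Longrightarrow> wderiv U b (u n) (g n b)" and u: "\<And>n x. 0 \<le> u n x \<and> u n x \<le> 1"
    and bnd: "\<And>K. compact K \<Longrightarrow> K \<subseteq> U \<Longrightarrow> \<exists>C. \<forall>n. \<forall>b\<in>Basis. (LINT x|lborel. indicator K x * \<bar>g n b x\<bar>) \<le> C"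
  obtains r where "strict_mono r" "AE x in lborel. x \<in> U \<longrightarrow> convergent (\<lambda>k. u (r k) x)"
proof -
  obtain b0 :: 'a where "b0 \<in> Basis" using nonempty_Basis by blast
  then have um: "u n \<in> borel_measurable borel" for n using w by (auto simp: wderiv_def loc_int_def)
  obtain D :: "'a set" where D: "countable D" "UNIV \<subseteq> closure D"
    using separable[of "UNIV :: 'a set"] by metis
  \<comment> \<open>Index \<open>i\<close> encodes a pair of a radius number and a position in the
    enumeration of the dense set.\<close>
  define p where "p i = (case prod_decode i of (m, j) \<Rightarrow> (inverse (real (Suc m)), from_nat_into D j))" for i
  have "\<bar>ball_avg (fst (p i)) (u n) (snd (p i))\<bar> \<le> 1" for n i
  proof -
    have "fst (p i) > 0" by (simp add: p_def split: prod.split)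
    from ball_avg_bounds[OF um u this, of n "snd (p i)"] show ?thesis by simp
  qed
  then obtain r0 where r0: "strict_mono r0" "\<And>i. convergent (\<lambda>k. ball_avg (fst (p i)) (u (r0 k)) (snd (p i)))"
    using bounded_family_convergent_subseq[of "\<lambda>n i. ball_avg (fst (p i)) (u n) (snd (p i))" "\<lambda>_. 1"] by metis
  have convD: "convergent (\<lambda>k. ball_avg (inverse (real (Suc m))) (u (r0 k)) q)" if q: "q \<in> D" for m q
  proof -
    obtain j where "from_nat_into D j = q" using from_nat_into_surj[OF D(1) q] by blast
    then have "p (prod_encode (m, j)) = (inverse (real (Suc m)), q)" by (simp add: p_def)
    with r0(2)[of "prod_encode (m, j)"] show ?thesis by simp
  qed
  have conv: "convergent (\<lambda>k. ball_avg (inverse (real (Suc m))) (u (r0 k)) x)" for m x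
    by (rule ball_avg_convergent[OF um u convD]) (use D(2) in auto)
  have bnd': "\<exists>C. \<forall>n. \<forall>b\<in>Basis. (LINT x|lborel. indicator K x * \<bar>g (r0 n) b x\<bar>) \<le> C" if "compact K" "K \<subseteq> U" for K
    using bnd[OF that] by blast
  obtain X where X: "\<And>n. compact (X n)" "\<And>n. X n \<subseteq> U" "\<And>n. X n \<subseteq> interior (X (Suc n))"
     "\<Union>(range X) = U" "\<And>K. compact K \<Longrightarrow> K \<subseteq> U \<Longrightarrow> \<exists>N::nat. \<forall>n\<ge>N. K \<subseteq> X n"
    using open_Union_compact_subsets[OF U] by metis
  have "\<exists>N. \<forall>k\<ge>N. \<forall>l\<ge>N. (LINT x|lborel. indicator (X j) x * \<bar>u (r0 k) x - u (r0 l) x\<bar>) < (1/2) ^ j" for j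
    by (rule rellich_cauchy[OF U w u bnd' conv X(1,2)]) auto
  then obtain N where N: "\<And>j k l. k \<ge> N j \<Longrightarrow> l \<ge> N j \<Longrightarrow> (LINT x|lborel. indicator (X j) x * \<bar>u (r0 k) x - u (r0 l) x\<bar>) < (1/2) ^ j"
    by metis
  obtain s where s: "strict_mono s" "\<And>j. N j \<le> s j" using ex_subseq_thresholds by metis
  have s': "N j \<le> s (Suc j)" for j using s(2)[of j] strict_monoD[OF s(1), of j "Suc j"] by simp
  define r where "r = r0 \<circ> s"
  have r: "strict_mono r" unfolding r_def by (rule strict_mono_o[OF r0(1) s(1)])
  have Xb: "X j \<in> sets borel" for j using compact_imp_closed[OF X(1)] by (rule borel_closed)
  have "AE x in lborel. summable (\<lambda>j. indicator (X j) x * \<bar>u (r (Suc j)) x - u (r j) x\<bar>)"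
  proof (rule AE_summable_geometric)
    fix j
    show "(\<lambda>x. indicator (X j) x * \<bar>u (r (Suc j)) x - u (r j) x\<bar>) \<in> borel_measurable lborel"
      using um Xb by simp
    have "(\<integral>\<^sup>+x. ennreal (indicator (X j) x * \<bar>u (r (Suc j)) x - u (r j) x\<bar>) \<partial>lborel) = ennreal (LINT x|lborel. indicator (X j) x * \<bar>u (r (Suc j)) x - u (r j) x\<bar>)"
      using u by (intro nn_integral_eq_integral loc_int_bounded_dist[OF X(1) um um]) auto
    also have "\<dots> \<le> ennreal ((1/2) ^ j)"
      using N[OF s'[of j] s(2)[of j]] by (intro ennreal_leI) (simp add: r_def)
    finally show "(\<integral>\<^sup>+x. ennreal (indicator (X j) x * \<bar>u (r (Suc j)) x - u (r j) x\<bar>) \<partial>lborel) \<le> ennreal ((1/2) ^ j)" .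
  qed auto
  then have "AE x in lborel. x \<in> U \<longrightarrow> convergent (\<lambda>k. u (r k) x)"
  proof eventually_elim
    case (elim x)
    show ?case
    proof
      assume "x \<in> U"
      then obtain M where M: "\<forall>n\<ge>M. {x} \<subseteq> X n" using X(5)[of "{x}"] by auto
      have "summable (\<lambda>j. \<bar>u (r (Suc j)) x - u (r j) x\<bar>)"
        by (rule summable_comparison_test'[OF elim, of M]) (use M in auto)
      then show "convergent (\<lambda>k. u (r k) x)" by (rule convergent_if_summable_diff)
    qed
  qed
  with r show ?thesis by (rule that)
qed

text \<open>Transfer to Lebesgue measurable functions. The Borel representatives need to take values
  in [0, 1] everywhere, not just a.e. on \<open>U\<close>; truncating them achieves this and changes
  nothing a.e. on \<open>U\<close>.\<close>

lemma rellich_weak_deriv: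
  fixes U :: "'a::euclidean_space set" and u :: "nat \<Rightarrow> 'a \<Rightarrow> real"
  assumes U: "open U" and w: "\<And>n b. b \<in> Basis \<Longrightarrow> has_weak_deriv U b (u n) (g n b)"
    and u: "\<And>n. AE x in lebesgue_on U. 0 \<le> u n x \<and> u n x \<le> 1"
    and bnd: "\<And>K. compact K \<Longrightarrow> K \<subseteq> U \<Longrightarrow> \<exists>C. \<forall>n. \<forall>b\<in>Basis. (LINT x|lebesgue_on K. \<bar>g n b x\<bar>) \<le> C"
  obtains r where "strict_mono r" "AE x in lebesgue_on U. convergent (\<lambda>k. u (r k) x)"
proof -
  let ?P = "\<lambda>n u' b g'. wderiv U b u' g' \<and> ae_eq U (u n) u' \<and> ae_eq U (g n b) g'"
  \<comment> \<open>A Borel representative of \<open>u n\<close> is obtained separately in each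
    direction; here one of them is made to serve all directions.\<close>
  have "\<exists>u' g'. \<forall>b\<in>Basis. ?P n u' b (g' b)" for n
  proof -
    obtain b0 :: 'a where b0: "b0 \<in> Basis" using nonempty_Basis by blast
    obtain u' g0 where u': "wderiv U b0 u' g0" "ae_eq U (u n) u'"
      using has_weak_deriv_borel[OF U w[OF b0]] by blast
    have um: "u' \<in> borel_measurable borel" using u' by (auto simp: wderiv_def loc_int_def)
    have "\<exists>g'. wderiv U b u' g' \<and> (ae_eq U (g n b) g')" if b: "b \<in> Basis" for b
    proof -
      obtain u1 g' where g': "wderiv U b u1 g'" "ae_eq U (u n) u1" "ae_eq U (g n b) g'"
        using has_weak_deriv_borel[OF U w[OF b]] by blast
      have "ae_eq U u1 u'" using u'(2) g'(2) by eventually_elim auto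
      then have "wderiv U b u' g'"
        using g'(1) by (intro wderiv_cong_AE[OF U g'(1) um]) (auto simp: wderiv_def loc_int_def)
      then show ?thesis using g'(3) by blast
    qed
    then have "\<forall>b\<in>Basis. \<exists>g'. wderiv U b u' g' \<and> (ae_eq U (g n b) g')" by blast
    from bchoice[OF this] obtain g' where "\<forall>b\<in>Basis. wderiv U b u' (g' b) \<and> (ae_eq U (g n b) (g' b))" by blast
    then show ?thesis using u'(2) by blast
  qed
  then have "\<forall>n. \<exists>u' g'. \<forall>b\<in>Basis. ?P n u' b (g' b)" by blast
  from choice[OF this] obtain u' where "\<forall>n. \<exists>g'. \<forall>b\<in>Basis. ?P n (u' n) b (g' b)" by blast
  from choice[OF this] obtain g' where "\<forall>n. \<forall>b\<in>Basis. ?P n (u' n) b (g' n b)" by blast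
  then have ug: "\<And>n b. b \<in> Basis \<Longrightarrow> wderiv U b (u' n) (g' n b)"
     "\<And>n (b :: 'a). b \<in> Basis \<Longrightarrow> ae_eq U (u n) (u' n)"
     "\<And>n b. b \<in> Basis \<Longrightarrow> ae_eq U (g n b) (g' n b)" by simp_all
  have u'eq: "AE x in lborel. x \<in> U \<longrightarrow> u n x = clamp01 (u' n x)" for n
  proof -
    obtain b0 :: 'a where b0: "b0 \<in> Basis" using nonempty_Basis by blast
    show ?thesis using ug(2)[OF b0, of n] u[of n] unfolding AE_lebesgue_on_open[OF U]
      by eventually_elim (auto simp: clamp01_def)
  qed
  obtain r where r: "strict_mono r" "AE x in lborel. x \<in> U \<longrightarrow> convergent (\<lambda>k. clamp01 (u' (r k) x))"
  proof (rule rellich[where u = "\<lambda>n x. clamp01 (u' n x)"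
        and g = "\<lambda>n b x. if 0 < u' n x \<and> u' n x < 1 then g' n b x else 0", OF U wderiv_clamp01[OF U ug(1)]])
    show "0 \<le> clamp01 (u' n x) \<and> clamp01 (u' n x) \<le> 1" for n x by (simp add: clamp01_def)
    fix K assume K: "compact K" "K \<subseteq> U"
    from bnd[OF K] obtain C where "\<forall>n. \<forall>b\<in>Basis. (LINT x|lebesgue_on K. \<bar>g n b x\<bar>) \<le> C" ..
    then have C: "\<And>n b. b \<in> Basis \<Longrightarrow> (LINT x|lebesgue_on K. \<bar>g n b x\<bar>) \<le> C" by simp
    have Kb: "K \<in> sets borel" using compact_imp_closed[OF K(1)] by (rule borel_closed)
    have "(LINT x|lborel. indicator K x * \<bar>if 0 < u' n x \<and> u' n x < 1 then g' n b x else 0\<bar>) \<le> C" if b: "b \<in> Basis" for n b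
    proof -
      have lg: "loc_int U (g' n b)" using ug(1)[OF b, of n] by (simp add: wderiv_def)
      then have gm: "g' n b \<in> borel_measurable borel" by (simp add: loc_int_def)
      have "(LINT x|lborel. indicator K x * \<bar>if 0 < u' n x \<and> u' n x < 1 then g' n b x else 0\<bar>) \<le> (LINT x|lborel. indicator K x * \<bar>g' n b x\<bar>)"
      proof (rule integral_mono_AE')
        show "integrable lborel (\<lambda>x. indicator K x * \<bar>g' n b x\<bar>)"
          using integrable_abs[OF loc_int_restrict[OF lg K]] by (simp add: abs_mult)
      qed (auto split: split_indicator)
      also have "\<dots> = (LINT x|lebesgue_on K. \<bar>g n b x\<bar>)"
      proof (rule integral_lebesgue_on_eq[OF Kb, symmetric])
        show "(\<lambda>x. \<bar>g' n b x\<bar>) \<in> borel_measurable borel" using gm by simp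
        show "AE x in lborel. x \<in> K \<longrightarrow> \<bar>g n b x\<bar> = \<bar>g' n b x\<bar>"
          using ug(3)[OF b, of n] by eventually_elim (use K in auto)
      qed
      also have "\<dots> \<le> C" by (rule C[OF b])
      finally show ?thesis .
    qed
    then show "\<exists>C. \<forall>n. \<forall>b\<in>Basis. (LINT x|lborel. indicator K x * \<bar>if 0 < u' n x \<and> u' n x < 1 then g' n b x else 0\<bar>) \<le> C" by blast
  qed auto
  have "AE x in lborel. \<forall>n. (x \<in> U \<longrightarrow> u n x = clamp01 (u' n x))"
    unfolding AE_all_countable using u'eq by blast
  with r(2) have "AE x in lebesgue_on U. convergent (\<lambda>k. u (r k) x)"
    unfolding AE_lebesgue_on_open[OF U] by eventually_elim auto
  with r(1) show ?thesis by (rule that)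
qed

subsection \<open>Space-time slices\<close>

lemma AE_lborel_slices:
  fixes P :: "'a::euclidean_space \<times> real \<Rightarrow> bool"
  assumes "AE p in lborel. P p"
  shows "AE t in lborel. AE x in lborel. P (x, t)"
proof -
  obtain N where N: "N \<in> null_sets lborel" "{p. \<not> P p} \<subseteq> N"
    using assms by (auto simp: eventually_ae_filter)
  have Nb: "N \<in> sets (lborel \<Otimes>\<^sub>M lborel)" using N unfolding lborel_prod by auto
  have "(\<integral>\<^sup>+t. \<integral>\<^sup>+x. indicator N (x, t) \<partial>lborel \<partial>lborel) = (\<integral>\<^sup>+p. indicator N p \<partial>(lborel \<Otimes>\<^sub>M lborel))"
    using Nb by (intro lborel_pair.nn_integral_snd) simp
  also have "\<dots> = 0" using N Nb by (simp add: lborel_prod null_sets_def)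
  finally have 0: "(\<integral>\<^sup>+t. \<integral>\<^sup>+x. indicator N (x, t) \<partial>lborel \<partial>lborel) = 0" .
  have m: "(\<lambda>t. \<integral>\<^sup>+x. indicator N (x, t) \<partial>lborel) \<in> borel_measurable lborel"
    using lborel.borel_measurable_nn_integral_fst[OF measurable_pair_swap[OF borel_measurable_indicator[OF Nb]]] by simp
  have "AE t in lborel. (\<integral>\<^sup>+x. indicator N (x, t) \<partial>lborel) = 0"
    using 0 by (subst (asm) nn_integral_0_iff_AE[OF m])
  then show ?thesis
  proof eventually_elim
    case (elim t)
    have m': "(\<lambda>x. indicator N (x, t) :: ennreal) \<in> borel_measurable lborel"
    proof -
      have "(indicator N :: 'a \<times> real \<Rightarrow> ennreal) \<in> borel_measurable borel"
        using N by (intro borel_measurable_indicator) auto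
      from borel_measurable_compose_continuous[OF this, of "\<lambda>x. (x, t)"] show ?thesis
        by (simp add: continuous_on_Pair)
    qed
    from elim have "AE x in lborel. indicator N (x, t) = (0 :: ennreal)"
      by (subst (asm) nn_integral_0_iff_AE[OF m'])
    then show ?case by eventually_elim (use N(2) in \<open>auto split: split_indicator_asm\<close>)
  qed
qed

text \<open>Tonelli for the indicator of the exceptional set. In this direction the set must be
  measurable, which is the reason for the first assumption.\<close>

lemma AE_lborel_from_slices:
  fixes P :: "'a::euclidean_space \<times> real \<Rightarrow> bool"
  assumes P: "{p. \<not> P p} \<in> sets borel" and ae: "AE t in lborel. AE x in lborel. P (x, t)"
  shows "AE p in lborel. P p"
proof -
  let ?N = "{p. \<not> P p}"
  have Nb: "?N \<in> sets (lborel \<Otimes>\<^sub>M lborel)" using P unfolding lborel_prod by simp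
  have "(\<integral>\<^sup>+p. indicator ?N p \<partial>(lborel \<Otimes>\<^sub>M lborel)) = (\<integral>\<^sup>+t. \<integral>\<^sup>+x. indicator ?N (x, t) \<partial>lborel \<partial>lborel)"
    using Nb by (intro lborel_pair.nn_integral_snd[symmetric]) simp
  also have "\<dots> = (\<integral>\<^sup>+t. 0 \<partial>(lborel :: real measure))"
  proof (rule nn_integral_cong_AE)
    show "AE t in lborel. (\<integral>\<^sup>+x. indicator ?N (x, t) \<partial>lborel) = 0"
      using ae
    proof eventually_elim
      case (elim t)
      have "(\<integral>\<^sup>+x. indicator ?N (x, t) \<partial>lborel) = (\<integral>\<^sup>+x. 0 \<partial>(lborel :: 'a measure))"
        by (rule nn_integral_cong_AE) (use elim in eventually_elim, auto)
      then show ?case by simp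
    qed
  qed
  finally have "(\<integral>\<^sup>+p. indicator ?N p \<partial>lborel) = 0" by (simp add: lborel_prod)
  then have "emeasure lborel ?N = 0" using P by (subst (asm) nn_integral_indicator) auto
  then have "?N \<in> null_sets lborel" using P by (auto simp: null_sets_def)
  from AE_not_in[OF this] show ?thesis by eventually_elim auto
qed

lemma AE_lborel_fst:
  fixes P :: "'a::euclidean_space \<Rightarrow> bool"
  assumes "AE x in lborel. P x"
  shows "AE p in (lborel :: ('a \<times> real) measure). P (fst p)"
proof -
  obtain N where N: "N \<in> null_sets lborel" "{p. \<not> P p} \<subseteq> N"
    using assms by (auto simp: eventually_ae_filter)
  have "emeasure (lborel \<Otimes>\<^sub>M lborel) (N \<times> (UNIV :: real set)) = emeasure lborel N * emeasure lborel (UNIV :: real set)"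
    using N by (intro lborel.emeasure_pair_measure_Times) auto
  also have "\<dots> = 0" using N by (simp add: null_sets_def)
  finally have "N \<times> UNIV \<in> null_sets (lborel :: ('a \<times> real) measure)"
    using N by (auto simp: lborel_prod null_sets_def borel_Times)
  from AE_not_in[OF this] show ?thesis by eventually_elim (use N(2) in auto)
qed

lemma measurable_slice:
  fixes f :: "'a::euclidean_space \<times> real \<Rightarrow> real"
  assumes "f \<in> borel_measurable borel" shows "(\<lambda>x. f (x, t)) \<in> borel_measurable borel"
  by (rule borel_measurable_compose_continuous[OF assms]) (auto intro!: continuous_intros)

text \<open>The squared norms of slices, defined for almost every \<open>t\<close> in
  \<open>I\<close> only, are packaged as an integrable function on the whole line, to which
  convergence theorems in \<open>t\<close> apply.\<close>

lemma slice_L2: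
  fixes \<Omega> :: "'a::euclidean_space set" and I :: "real set"
  assumes \<Omega>: "open \<Omega>" and I: "open I" and f: "f \<in> L2_space (lebesgue_on (\<Omega> \<times> I))"
  obtains h where "integrable lborel h" "(LINT t|lborel. h t) = (LINT p|lebesgue_on (\<Omega> \<times> I). (f p)\<^sup>2)" "\<And>t. 0 \<le> h t"
    "AE t in lborel. t \<in> I \<longrightarrow> (\<lambda>x. f (x, t)) \<in> L2_space (lebesgue_on \<Omega>) \<and> (LINT x|lebesgue_on \<Omega>. (f (x, t))\<^sup>2) = h t"
proof -
  have Ub: "\<Omega> \<times> I \<in> sets borel" using \<Omega> I by (auto intro: borel_open open_Times)
  have \<Omega>b: "\<Omega> \<in> sets borel" using \<Omega> by auto
  obtain f' where f': "f' \<in> borel_measurable borel" "ae_eq (\<Omega> \<times> I) f f'"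
    using lebesgue_on_borel_rep[OF Ub L2_D(1)[OF f]] by blast
  note i = L2_borel_iff[OF Ub f']
  let ?\<Phi> = "\<lambda>p. indicator (\<Omega> \<times> I) p * (f' p)\<^sup>2"
  have int: "integrable lborel ?\<Phi>" using i(1) f by simp
  then have int': "integrable (lborel \<Otimes>\<^sub>M lborel) (\<lambda>(x, t). ?\<Phi> (x, t))" by (simp add: lborel_prod case_prod_beta')
  define h where "h t = (LINT x|lborel. ?\<Phi> (x, t))" for t
  show thesis
  proof
    show "integrable lborel h" unfolding h_def by (rule strip_Fubini(3)[OF int])
    have "(LINT t|lborel. h t) = (LINT p|lborel. ?\<Phi> p)"
      unfolding h_def using lborel_pair.integral_snd[OF int'] by (simp add: lborel_prod case_prod_beta')
    then show "(LINT t|lborel. h t) = (LINT p|lebesgue_on (\<Omega> \<times> I). (f p)\<^sup>2)" by (simp only: i(2))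
    show "0 \<le> h t" for t unfolding h_def by (intro integral_nonneg_AE) auto
    have "AE t in lborel. integrable lborel (\<lambda>x. ?\<Phi> (x, t))"
      using lborel_pair.AE_integrable_snd[OF int'] by simp
    with AE_lborel_slices[OF f'(2)]
    show "AE t in lborel. t \<in> I \<longrightarrow> (\<lambda>x. f (x, t)) \<in> L2_space (lebesgue_on \<Omega>) \<and> (LINT x|lebesgue_on \<Omega>. (f (x, t))\<^sup>2) = h t"
    proof eventually_elim
      case (elim t)
      show ?case
      proof
        assume t: "t \<in> I"
        have eq: "?\<Phi> (x, t) = indicator \<Omega> x * (f' (x, t))\<^sup>2" for x using t by (auto split: split_indicator)
        have "AE x in lborel. x \<in> \<Omega> \<longrightarrow> f (x, t) = f' (x, t)" using elim(1) by eventually_elim (use t in auto)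
        note j = L2_borel_iff[OF \<Omega>b measurable_slice[OF f'(1)] this]
        show "(\<lambda>x. f (x, t)) \<in> L2_space (lebesgue_on \<Omega>) \<and> (LINT x|lebesgue_on \<Omega>. (f (x, t))\<^sup>2) = h t"
          using j elim(2) unfolding eq h_def by simp
      qed
    qed
  qed
qed

lemma closed_segment_slice:
  fixes x e :: "'a::euclidean_space" and t :: real
  assumes "t \<in> I"
  shows "closed_segment (x, t) ((x, t) + a *\<^sub>R (e, 0)) \<subseteq> \<Omega> \<times> I \<longleftrightarrow> closed_segment x (x + a *\<^sub>R e) \<subseteq> \<Omega>"
  unfolding closed_segment_shift using assms by auto

lemma line_int_slice: "line_int g (a *\<^sub>R (e, 0)) (x, t) = line_int (\<lambda>x. g (x, t)) (a *\<^sub>R e) x"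
  by (simp add: line_int_def)

text \<open>Testing slices directly would give an exceptional set of times for each test function.
  The line identity with the countable family of steps 1/(k+1) has one exceptional set: by Fubini it
  holds on almost every slice for all steps, and \<open>wderiv_from_lines\<close> returns the
  derivative of the slice.\<close>

lemma slice_weak_deriv:
  fixes \<Omega> :: "'a::euclidean_space set" and I :: "real set"
  assumes \<Omega>: "open \<Omega>" and I: "open I"
    and w: "has_weak_deriv (\<Omega> \<times> I) (e, 0) u g"
    and u: "u \<in> L2_space (lebesgue_on (\<Omega> \<times> I))" and g: "g \<in> L2_space (lebesgue_on (\<Omega> \<times> I))"
  shows "AE t in lborel. t \<in> I \<longrightarrow> has_weak_deriv \<Omega> e (\<lambda>x. u (x, t)) (\<lambda>x. g (x, t))"
proof -
  have U: "open (\<Omega> \<times> I)" using \<Omega> I by (rule open_Times)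
  have \<Omega>b: "\<Omega> \<in> sets borel" using \<Omega> by auto
  obtain u' g' where w': "wderiv (\<Omega> \<times> I) (e, 0) u' g'" and ue: "ae_eq (\<Omega> \<times> I) u u'"
    and ge: "ae_eq (\<Omega> \<times> I) g g'"
    using has_weak_deriv_borel[OF U w] by blast
  have m: "u' \<in> borel_measurable borel" "g' \<in> borel_measurable borel" using w' by (auto simp: wderiv_def loc_int_def)
  define \<tau> where "\<tau> k = inverse (real (Suc k))" for k
  have \<tau>: "\<tau> \<longlonglongrightarrow> 0" "\<And>k. \<tau> k \<noteq> 0" unfolding \<tau>_def using LIMSEQ_inverse_real_of_nat by auto
  have "AE p in lborel. \<forall>k. closed_segment p (p + \<tau> k *\<^sub>R (e, 0)) \<subseteq> \<Omega> \<times> I \<longrightarrow>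
        u' (p + \<tau> k *\<^sub>R (e, 0)) - u' p = \<tau> k * line_int g' (\<tau> k *\<^sub>R (e, 0)) p"
    unfolding AE_all_countable using wderiv_line_scaled[OF U w'] by blast
  note lines = AE_lborel_slices[OF this]
  obtain hu where hu: "AE t in lborel. t \<in> I \<longrightarrow> (\<lambda>x. u (x, t)) \<in> L2_space (lebesgue_on \<Omega>) \<and> (LINT x|lebesgue_on \<Omega>. (u (x, t))\<^sup>2) = hu t"
    using slice_L2[OF \<Omega> I u] by blast
  obtain hg where hg: "AE t in lborel. t \<in> I \<longrightarrow> (\<lambda>x. g (x, t)) \<in> L2_space (lebesgue_on \<Omega>) \<and> (LINT x|lebesgue_on \<Omega>. (g (x, t))\<^sup>2) = hg t"
    using slice_L2[OF \<Omega> I g] by blast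
  show ?thesis
    using lines hu hg AE_lborel_slices[OF ue] AE_lborel_slices[OF ge]
  proof eventually_elim
    case (elim t)
    show ?case
    proof
      assume t: "t \<in> I"
      have ut: "AE x in lborel. x \<in> \<Omega> \<longrightarrow> u (x, t) = u' (x, t)" using elim(4) by eventually_elim (use t in auto)
      have gt: "AE x in lborel. x \<in> \<Omega> \<longrightarrow> g (x, t) = g' (x, t)" using elim(5) by eventually_elim (use t in auto)
      have lu: "loc_int \<Omega> (\<lambda>x. u' (x, t))"
        using elim(2) t L2_borel_iff(1)[OF \<Omega>b measurable_slice[OF m(1)] ut] by (intro L2_loc_int measurable_slice m) auto
      have lg: "loc_int \<Omega> (\<lambda>x. g' (x, t))"
        using elim(3) t L2_borel_iff(1)[OF \<Omega>b measurable_slice[OF m(2)] gt] by (intro L2_loc_int measurable_slice m) auto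
      have "wderiv \<Omega> e (\<lambda>x. u' (x, t)) (\<lambda>x. g' (x, t))"
      proof (rule wderiv_from_lines[OF \<Omega> lu lg _ \<tau>])
        fix k
        show "AE x in lborel. closed_segment x (x + \<tau> k *\<^sub>R e) \<subseteq> \<Omega> \<longrightarrow>
          u' (x + \<tau> k *\<^sub>R e, t) - u' (x, t) = \<tau> k * line_int (\<lambda>x. g' (x, t)) (\<tau> k *\<^sub>R e) x"
          using elim(1)
        proof eventually_elim
          case (elim x)
          from elim[rule_format, of k] show ?case
            unfolding closed_segment_slice[OF t] line_int_slice by simp
        qed
      qed
      then show "has_weak_deriv \<Omega> e (\<lambda>x. u (x, t)) (\<lambda>x. g (x, t))"
        using has_weak_deriv_iff_wderiv[OF \<Omega> measurable_slice[OF m(1)] measurable_slice[OF m(2)] ut gt] by blast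
    qed
  qed
qed

lemma Basis_space: "b \<in> Basis \<Longrightarrow> (b, 0::real) \<in> Basis" and Basis_time: "(0, 1::real) \<in> Basis"
  by (auto simp: Basis_prod_def)

lemma slice_H1:
  fixes \<Omega> :: "'a::euclidean_space set" and I :: "real set"
  assumes \<Omega>: "open \<Omega>" and I: "open I" and u: "u \<in> H1_space (\<Omega> \<times> I)"
  shows "AE t in lborel. t \<in> I \<longrightarrow> (\<lambda>x. u (x, t)) \<in> H1_space \<Omega> \<and>
    (\<forall>b\<in>Basis. has_weak_deriv \<Omega> b (\<lambda>x. u (x, t)) (\<lambda>x. weak_deriv (\<Omega> \<times> I) (b, 0) u (x, t)))"
proof -
  have U: "open (\<Omega> \<times> I)" using \<Omega> I by (rule open_Times)
  note H = H1_D[OF U u]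
  have a: "AE t in lborel. t \<in> I \<longrightarrow> (\<lambda>x. f (x, t)) \<in> L2_space (lebesgue_on \<Omega>)" if f: "f \<in> L2_space (lebesgue_on (\<Omega> \<times> I))" for f
  proof -
    obtain h where "AE t in lborel. t \<in> I \<longrightarrow> (\<lambda>x. f (x, t)) \<in> L2_space (lebesgue_on \<Omega>) \<and> (LINT x|lebesgue_on \<Omega>. (f (x, t))\<^sup>2) = h t"
      using slice_L2[OF \<Omega> I f] by blast
    then show ?thesis by eventually_elim auto
  qed
  have "AE t in lborel. \<forall>b\<in>Basis. t \<in> I \<longrightarrow> (\<lambda>x. weak_deriv (\<Omega> \<times> I) (b, 0) u (x, t)) \<in> L2_space (lebesgue_on \<Omega>) \<and>
     has_weak_deriv \<Omega> b (\<lambda>x. u (x, t)) (\<lambda>x. weak_deriv (\<Omega> \<times> I) (b, 0) u (x, t))"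
  proof (rule AE_finite_allI)
    fix b :: 'a assume "b \<in> Basis"
    then have b: "(b, 0 :: real) \<in> Basis" by (rule Basis_space)
    show "AE t in lborel. t \<in> I \<longrightarrow> (\<lambda>x. weak_deriv (\<Omega> \<times> I) (b, 0) u (x, t)) \<in> L2_space (lebesgue_on \<Omega>) \<and>
     has_weak_deriv \<Omega> b (\<lambda>x. u (x, t)) (\<lambda>x. weak_deriv (\<Omega> \<times> I) (b, 0) u (x, t))"
      using a[OF H(3)[OF b]] slice_weak_deriv[OF \<Omega> I H(2)[OF b] H(1) H(3)[OF b]] by eventually_elim auto
  qed auto
  with a[OF H(1)] show ?thesis
    by eventually_elim (auto intro!: H1_I)
qed

text \<open>The squared H1 distances of the slices integrate over time to at most the distance in
  space-time. They tend to 0 in L1 as functions of \<open>t\<close>, hence for almost every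
  \<open>t\<close> along a subsequence.\<close>

lemma slice_H1_conv:
  fixes \<Omega> :: "'a::euclidean_space set" and I :: "real set"
  assumes \<Omega>: "open \<Omega>" and I: "open I" and u: "\<And>n::nat. u n \<in> H1_space (\<Omega> \<times> I)" and v: "v \<in> H1_space (\<Omega> \<times> I)"
    and lim: "(\<lambda>n. h1d (\<Omega> \<times> I) (u n) v) \<longlonglongrightarrow> 0"
  obtains r where "strict_mono r" "AE t in lborel. t \<in> I \<longrightarrow> (\<lambda>x. v (x, t)) \<in> H1_space \<Omega> \<and>
     (\<lambda>n. h1d \<Omega> (\<lambda>x. u (r n) (x, t)) (\<lambda>x. v (x, t))) \<longlonglongrightarrow> 0"
proof -
  let ?U = "\<Omega> \<times> I"
  have U: "open ?U" using \<Omega> I by (rule open_Times)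
  note Hu = H1_D[OF U u] and Hv = H1_D[OF U v]
  \<comment> \<open>The index 0, which is not a basis vector, stands for the functions themselves,
    so that one sum over \<open>?B\<close> collects them together with their spatial
    derivatives.\<close>
  define d where "d n b p = (if b = 0 then u n p - v p else weak_deriv ?U (b, 0) (u n) p - weak_deriv ?U (b, 0) v p)" for n and b :: 'a and p
  let ?B = "insert 0 Basis :: 'a set"
  have d0: "d n 0 = (\<lambda>p. u n p - v p)" for n by (simp add: d_def[abs_def])
  have dB: "d n b = (\<lambda>p. weak_deriv ?U (b, 0) (u n) p - weak_deriv ?U (b, 0) v p)" if "b \<in> Basis" for n b
    using nonzero_Basis[OF that] by (simp add: d_def[abs_def])
  have dL2: "d n b \<in> L2_space (lebesgue_on ?U)" if "b \<in> ?B" for n b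
    using that L2_diff[OF Hu(1)[of n] Hv(1)] L2_diff[OF Hu(3)[OF Basis_space, of b n] Hv(3)[OF Basis_space, of b]]
    by (cases "b = 0") (simp_all add: d_def[abs_def])
  let ?P = "\<lambda>n b h. integrable lborel h \<and> (LINT t|lborel. h t) = (LINT p|lebesgue_on ?U. (d n b p)\<^sup>2) \<and> (\<forall>t. 0 \<le> h t) \<and>
    (AE t in lborel. t \<in> I \<longrightarrow> (LINT x|lebesgue_on \<Omega>. (d n b (x, t))\<^sup>2) = h t)"
  have "\<forall>n. \<forall>b\<in>?B. \<exists>h. ?P n b h"
  proof (intro allI ballI)
    fix n b assume b: "b \<in> ?B"
    obtain h where h: "integrable lborel h" "(LINT t|lborel. h t) = (LINT p|lebesgue_on ?U. (d n b p)\<^sup>2)" "\<And>t. 0 \<le> h t"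
      "AE t in lborel. t \<in> I \<longrightarrow> (\<lambda>x. d n b (x, t)) \<in> L2_space (lebesgue_on \<Omega>) \<and> (LINT x|lebesgue_on \<Omega>. (d n b (x, t))\<^sup>2) = h t"
      using slice_L2[OF \<Omega> I dL2[OF b]] by blast
    have "AE t in lborel. t \<in> I \<longrightarrow> (LINT x|lebesgue_on \<Omega>. (d n b (x, t))\<^sup>2) = h t"
      using h(4) by eventually_elim auto
    with h(1-3) show "\<exists>h. ?P n b h" by blast
  qed
  then have "\<forall>n. \<exists>h. \<forall>b\<in>?B. ?P n b (h b)" by (intro allI bchoice) blast
  from choice[OF this] obtain h where h: "\<forall>n. \<forall>b\<in>?B. ?P n b (h n b)" by blast
  define H where "H n t = (\<Sum>b\<in>?B. h n b t)" for n t
  have iH: "integrable lborel (H n)" for n unfolding H_def using h by (intro Bochner_Integration.integrable_sum) blast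
  have Hnn: "0 \<le> H n t" for n t unfolding H_def using h by (intro sum_nonneg) blast
  have Hle: "(LINT t|lborel. H n t) \<le> h1d ?U (u n) v" for n
  proof -
    have "(LINT t|lborel. H n t) = (\<Sum>b\<in>?B. LINT p|lebesgue_on ?U. (d n b p)\<^sup>2)"
      unfolding H_def using h by (subst Bochner_Integration.integral_sum) (auto intro: sum.cong)
    also have "\<dots> = l2d (lebesgue_on ?U) (u n) v + (\<Sum>b\<in>Basis. l2d (lebesgue_on ?U) (weak_deriv ?U (b, 0) (u n)) (weak_deriv ?U (b, 0) v))"
      unfolding l2d_def by (subst sum.insert) (auto simp: d0 dB)
    also have "(\<Sum>b\<in>Basis. l2d (lebesgue_on ?U) (weak_deriv ?U (b, 0) (u n)) (weak_deriv ?U (b, 0) v)) =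
       (\<Sum>b\<in>(\<lambda>b. (b, 0)) ` Basis. l2d (lebesgue_on ?U) (weak_deriv ?U b (u n)) (weak_deriv ?U b v))"
      by (subst sum.reindex) (auto simp: inj_on_def)
    \<comment> \<open>The full distance also contains the time derivative, which slices do not see;
      hence an inequality.\<close>
    also have "\<dots> \<le> (\<Sum>b\<in>Basis. l2d (lebesgue_on ?U) (weak_deriv ?U b (u n)) (weak_deriv ?U b v))"
      using Basis_space by (intro sum_mono2) (auto simp: l2d_nonneg)
    finally show ?thesis by (simp add: h1d_def)
  qed
  have "(\<lambda>n. LINT t|lborel. norm (H n t)) \<longlonglongrightarrow> 0"
    by (rule tendsto_squeeze_0[OF lim]) (use Hnn Hle in \<open>auto intro: integral_nonneg_AE\<close>)
  from tendsto_L1_AE_subseq[OF iH this] obtain r where r: "strict_mono r" "AE t in lborel. (\<lambda>n. H (r n) t) \<longlonglongrightarrow> 0" by blast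
  have "AE t in lborel. \<forall>n. \<forall>b\<in>?B. t \<in> I \<longrightarrow> (LINT x|lebesgue_on \<Omega>. (d n b (x, t))\<^sup>2) = h n b t"
    unfolding AE_all_countable by (intro allI AE_finite_allI) (use h in auto)
  moreover have "AE t in lborel. \<forall>n. t \<in> I \<longrightarrow> (\<lambda>x. u n (x, t)) \<in> H1_space \<Omega> \<and>
    (\<forall>b\<in>Basis. has_weak_deriv \<Omega> b (\<lambda>x. u n (x, t)) (\<lambda>x. weak_deriv ?U (b, 0) (u n) (x, t)))"
    unfolding AE_all_countable using slice_H1[OF \<Omega> I u] by blast
  ultimately have "AE t in lborel. t \<in> I \<longrightarrow> (\<lambda>x. v (x, t)) \<in> H1_space \<Omega> \<and>
     (\<lambda>n. h1d \<Omega> (\<lambda>x. u (r n) (x, t)) (\<lambda>x. v (x, t))) \<longlonglongrightarrow> 0"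
    using r(2) slice_H1[OF \<Omega> I v]
  proof eventually_elim
    case (elim t)
    show ?case
    proof
      assume t: "t \<in> I"
      have "h1d \<Omega> (\<lambda>x. u n (x, t)) (\<lambda>x. v (x, t)) = H n t" for n
      proof -
        have "h1d \<Omega> (\<lambda>x. u n (x, t)) (\<lambda>x. v (x, t)) = l2d (lebesgue_on \<Omega>) (\<lambda>x. u n (x, t)) (\<lambda>x. v (x, t)) +
          (\<Sum>b\<in>Basis. l2d (lebesgue_on \<Omega>) (\<lambda>x. weak_deriv ?U (b, 0) (u n) (x, t)) (\<lambda>x. weak_deriv ?U (b, 0) v (x, t)))"
          by (rule h1d_eq[OF \<Omega>]) (use elim(2,4) t in auto)
        also have "\<dots> = (\<Sum>b\<in>?B. LINT x|lebesgue_on \<Omega>. (d n b (x, t))\<^sup>2)"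
          unfolding l2d_def by (subst sum.insert) (auto simp: d0 dB)
        also have "\<dots> = H n t" unfolding H_def using elim(1) t by (intro sum.cong) auto
        finally show ?thesis .
      qed
      then show "(\<lambda>x. v (x, t)) \<in> H1_space \<Omega> \<and> (\<lambda>n. h1d \<Omega> (\<lambda>x. u (r n) (x, t)) (\<lambda>x. v (x, t))) \<longlonglongrightarrow> 0"
        using elim(3,4) t by simp
    qed
  qed
  with r(1) show ?thesis by (rule that)
qed

subsection \<open>Exhaustions and stationary functions\<close>

lemma incseq_compact_subset:
  fixes V :: "nat \<Rightarrow> 'a::euclidean_space set"
  assumes V: "\<And>n. open (V n)" "incseq V" and K: "compact K" "K \<subseteq> (\<Union>n. V n)"
  obtains n where "K \<subseteq> V n"
proof -
  obtain C where C: "finite C" "K \<subseteq> (\<Union>n\<in>C. V n)"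
    using compactE_image[OF K(1), of UNIV V] V(1) K(2) by auto
  have "V n \<subseteq> V (Max C)" if "n \<in> C" for n
    using incseqD[OF V(2), of n "Max C"] Max_ge[OF C(1) that] by simp
  then have "K \<subseteq> V (Max C)" using C(2) by blast
  then show ?thesis by (rule that)
qed

lemma integral_lebesgue_on_superset:
  fixes f :: "'a::euclidean_space \<Rightarrow> real"
  assumes "V \<in> sets lebesgue" "U \<in> sets lebesgue" "V \<subseteq> U" "\<And>x. x \<notin> V \<Longrightarrow> f x = 0"
  shows "(LINT x|lebesgue_on U. f x) = (LINT x|lebesgue_on V. f x)"
proof -
  have "(LINT x|lebesgue_on U. f x) = (LINT x|lebesgue. indicator U x *\<^sub>R f x)"
    using assms by (simp add: integral_restrict_space)
  also have "\<dots> = (LINT x|lebesgue. indicator V x *\<^sub>R f x)"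
    using assms by (intro Bochner_Integration.integral_cong refl) (auto split: split_indicator)
  also have "\<dots> = (LINT x|lebesgue_on V. f x)"
    using assms by (simp add: integral_restrict_space)
  finally show ?thesis .
qed

text \<open>A compact set in the union lies in a single \<open>V n\<close>, so each condition on the
  union is a condition on one of the sets.\<close>

lemma has_weak_deriv_exhaust:
  fixes V :: "nat \<Rightarrow> 'a::euclidean_space set"
  assumes V: "\<And>n. open (V n)" "incseq V" and w: "\<And>n. has_weak_deriv (V n) e u g"
  shows "has_weak_deriv (\<Union>n. V n) e u g"
  unfolding has_weak_deriv_def
proof (intro conjI allI impI)
  show "u absolutely_integrable_on K" "g absolutely_integrable_on K" if K: "compact K \<and> K \<subseteq> (\<Union>n. V n)" for K
  proof -
    obtain n where "K \<subseteq> V n" using incseq_compact_subset[OF V] K by metis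
    then show "u absolutely_integrable_on K" "g absolutely_integrable_on K"
      using w[of n] K by (auto simp: has_weak_deriv_def)
  qed
  fix \<phi> assume \<phi>: "test_function (\<Union>n. V n) \<phi>"
  obtain K where K: "compact K" "K \<subseteq> (\<Union>n. V n)" "\<And>x. x \<notin> K \<Longrightarrow> \<phi> x = 0" "\<And>x e. x \<notin> K \<Longrightarrow> frechet_derivative \<phi> (at x) e = 0"
    using test_function_support[OF \<phi>] by metis
  have "compact (closure {x. \<phi> x \<noteq> 0})" "closure {x. \<phi> x \<noteq> 0} \<subseteq> (\<Union>n. V n)" using \<phi> by (auto simp: test_function_def)
  then obtain n1 where n1: "closure {x. \<phi> x \<noteq> 0} \<subseteq> V n1" using incseq_compact_subset[OF V] by metis
  obtain n2 where n2: "K \<subseteq> V n2" using incseq_compact_subset[OF V K(1,2)] by metis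
  define n where "n = max n1 n2"
  have n: "closure {x. \<phi> x \<noteq> 0} \<subseteq> V n" "K \<subseteq> V n"
    using n1 n2 incseqD[OF V(2), of n1 n] incseqD[OF V(2), of n2 n] by (auto simp: n_def)
  have t: "test_function (V n) \<phi>" using \<phi> n(1) by (simp add: test_function_def)
  have m: "V n \<in> sets lebesgue" "(\<Union>n. V n) \<in> sets lebesgue" using V(1) by auto
  have "(LINT x|lebesgue_on (\<Union>n. V n). u x * frechet_derivative \<phi> (at x) e) = (LINT x|lebesgue_on (V n). u x * frechet_derivative \<phi> (at x) e)"
    using K(4) n(2) by (intro integral_lebesgue_on_superset m) auto
  also have "\<dots> = - (LINT x|lebesgue_on (V n). g x * \<phi> x)" using w[of n] t by (simp add: has_weak_deriv_def)
  also have "(LINT x|lebesgue_on (V n). g x * \<phi> x) = (LINT x|lebesgue_on (\<Union>n. V n). g x * \<phi> x)"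
    using K(3) n(2) by (intro integral_lebesgue_on_superset[symmetric] m) auto
  finally show "(LINT x|lebesgue_on (\<Union>n. V n). u x * frechet_derivative \<phi> (at x) e) = - (LINT x|lebesgue_on (\<Union>n. V n). g x * \<phi> x)" .
qed

lemma cylinder_Union: "(\<Union>n. \<Omega> \<times> {0<..<real (Suc n)}) = \<Omega> \<times> {0<..}"
proof -
  have "\<exists>n. t < real (Suc n)" for t :: real
    using reals_Archimedean2[of t] by (metis less_trans of_nat_less_iff lessI)
  then show ?thesis by auto
qed

text \<open>Membership in \<open>\<U>\<close> supplies a derivative on each bounded cylinder, while
  the energy uses one on the half cylinder. By uniqueness the pieces agree a.e. on overlaps.\<close>

lemma has_weak_deriv_glue:
  fixes \<Omega> :: "'a::euclidean_space set"
  assumes \<Omega>: "open \<Omega>" and w: "\<And>n. has_weak_deriv (\<Omega> \<times> {0<..<real (Suc n)}) e u (g n)"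
  obtains G where "has_weak_deriv (\<Omega> \<times> {0<..}) e u G"
proof -
  let ?V = "\<lambda>n. \<Omega> \<times> {0<..<real (Suc n)}"
  have V: "open (?V n)" for n using \<Omega> by (intro open_Times) auto
  have inc: "incseq ?V" by (auto simp: incseq_def)
  \<comment> \<open>A time t > 0 satisfies t < Suc (nat of its ceiling), so the point lies in the
    cylinder whose derivative is evaluated.\<close>
  define G where "G p = g (nat \<lceil>snd p\<rceil>) p" for p :: "'a \<times> real"
  have "has_weak_deriv (?V m) e u G" for m
  proof (rule has_weak_deriv_cong[OF V w[of m]])
    have "AE p in lborel. p \<in> ?V n \<inter> ?V m \<longrightarrow> g m p = g n p" for n
    proof -
      let ?k = "min n m"
      have "AE p in lebesgue_on (?V ?k). g m p = g n p"
        by (rule has_weak_deriv_unique[OF V has_weak_deriv_subset[OF V V _ w] has_weak_deriv_subset[OF V V _ w]]) auto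
      then show ?thesis unfolding AE_lebesgue_on_open[OF V] by eventually_elim auto
    qed
    then have "AE p in lborel. \<forall>n. (p \<in> ?V n \<inter> ?V m \<longrightarrow> g m p = g n p)" unfolding AE_all_countable by blast
    then show "AE p in lebesgue_on (?V m). g m p = G p"
      unfolding AE_lebesgue_on_open[OF V]
    proof eventually_elim
      case (elim p)
      show ?case
      proof
        assume p: "p \<in> ?V m"
        have "snd p < real (Suc (nat \<lceil>snd p\<rceil>))" by linarith
        then have "p \<in> ?V (nat \<lceil>snd p\<rceil>)" using p by auto
        then show "g m p = G p" using elim p by (auto simp: G_def)
      qed
    qed
  qed simp
  from has_weak_deriv_exhaust[OF V inc this] show ?thesis unfolding cylinder_Union by (rule that)
qed

lemma L2_fst:
  fixes \<Omega> :: "'a::euclidean_space set" and f :: "'a \<Rightarrow> real"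
  assumes \<Omega>: "open \<Omega>" and T: "T > 0" and f: "f \<in> L2_space (lebesgue_on \<Omega>)"
  shows "(\<lambda>p. f (fst p)) \<in> L2_space (lebesgue_on (\<Omega> \<times> {0<..<T}))"
    "(LINT p|lebesgue_on (\<Omega> \<times> {0<..<T}). (f (fst p))\<^sup>2) = T * (LINT x|lebesgue_on \<Omega>. (f x)\<^sup>2)"
proof -
  let ?U = "\<Omega> \<times> {0<..<T}"
  have \<Omega>b: "\<Omega> \<in> sets borel" using \<Omega> by auto
  have U: "?U \<in> sets borel" using \<Omega> by (intro borel_open open_Times) auto
  obtain f' where f': "f' \<in> borel_measurable borel" "ae_eq \<Omega> f f'"
    using lebesgue_on_borel_rep[OF \<Omega>b L2_D(1)[OF f]] by blast
  note i = L2_borel_iff[OF \<Omega>b f']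
  have fm: "(\<lambda>p :: 'a \<times> real. f' (fst p)) \<in> borel_measurable borel"
    by (rule borel_measurable_compose_continuous[OF f'(1)]) (auto intro!: continuous_intros)
  have ae: "AE p in lborel. p \<in> ?U \<longrightarrow> f (fst p) = f' (fst p)"
    using AE_lborel_fst[OF f'(2)] by eventually_elim auto
  note j = L2_borel_iff[OF U fm ae]
  let ?\<Phi> = "\<lambda>p :: 'a \<times> real. indicator ?U p * (f' (fst p))\<^sup>2"
  let ?c = "LINT x|lborel. indicator \<Omega> x * (f' x)\<^sup>2"
  have ic: "integrable lborel (\<lambda>x. indicator \<Omega> x * (f' x)\<^sup>2)" using i f by simp
  have eq: "?\<Phi> (x, t) = indicator {0<..<T} t * (indicator \<Omega> x * (f' x)\<^sup>2)" for x t by (auto split: split_indicator)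
  have \<Phi>m: "?\<Phi> \<in> borel_measurable borel" using fm U by simp
  have int: "integrable lborel ?\<Phi>"
  proof (rule integrableI_bounded)
    have m': "(\<lambda>p. ennreal (?\<Phi> p)) \<in> borel_measurable (lborel \<Otimes>\<^sub>M lborel)"
      using \<Phi>m unfolding lborel_prod by measurable
    have "(\<integral>\<^sup>+p. ennreal (norm (?\<Phi> p)) \<partial>lborel) = (\<integral>\<^sup>+p. ennreal (?\<Phi> p) \<partial>lborel)" by (intro nn_integral_cong) simp
    also have "\<dots> = (\<integral>\<^sup>+t. \<integral>\<^sup>+x. ennreal (?\<Phi> (x, t)) \<partial>lborel \<partial>lborel)"
      using lborel_pair.nn_integral_snd[OF m'] by (simp add: lborel_prod)
    also have "\<dots> = (\<integral>\<^sup>+t. ennreal ?c * indicator {0<..<T} t \<partial>lborel)"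
    proof (intro nn_integral_cong)
      fix t
      have "(\<integral>\<^sup>+x. ennreal (?\<Phi> (x, t)) \<partial>lborel) = ennreal (LINT x|lborel. ?\<Phi> (x, t))"
        unfolding eq using ic by (intro nn_integral_eq_integral) auto
      then show "(\<integral>\<^sup>+x. ennreal (?\<Phi> (x, t)) \<partial>lborel) = ennreal ?c * indicator {0<..<T} t"
        unfolding eq by (auto split: split_indicator)
    qed
    also have "\<dots> < \<infinity>" using T by (simp add: nn_integral_cmult ennreal_mult_less_top)
    finally show "(\<integral>\<^sup>+p. ennreal (norm (?\<Phi> p)) \<partial>lborel) < \<infinity>" .
  qed (use \<Phi>m in simp)
  then show "(\<lambda>p. f (fst p)) \<in> L2_space (lebesgue_on ?U)" using j(1) by simp
  have int': "integrable (lborel \<Otimes>\<^sub>M lborel) (\<lambda>(x, t). ?\<Phi> (x, t))" using int by (simp add: lborel_prod case_prod_beta')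
  have "(LINT p|lborel. ?\<Phi> p) = (LINT t|lborel. LINT x|lborel. ?\<Phi> (x, t))"
    using lborel_pair.integral_snd[OF int'] by (simp add: lborel_prod case_prod_beta')
  also have "\<dots> = (LINT t|lborel. indicator {0<..<T} t * ?c)" unfolding eq by simp
  also have "\<dots> = T * ?c" using T by simp
  finally show "(LINT p|lebesgue_on ?U. (f (fst p))\<^sup>2) = T * (LINT x|lebesgue_on \<Omega>. (f x)\<^sup>2)"
    unfolding i(2) j(2) .
qed

lemma l2d_fst:
  fixes \<Omega> :: "'a::euclidean_space set"
  assumes "open \<Omega>" "T > 0" "f \<in> L2_space (lebesgue_on \<Omega>)" "g \<in> L2_space (lebesgue_on \<Omega>)"
  shows "l2d (lebesgue_on (\<Omega> \<times> {0<..<T})) (\<lambda>p. f (fst p)) (\<lambda>p. g (fst p)) = T * l2d (lebesgue_on \<Omega>) f g"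
  unfolding l2d_def using L2_fst(2)[OF assms(1,2) L2_diff[OF assms(3,4)]] .

text \<open>The spatial line identity holds at every time, and in the time direction both sides of
  the identity are 0; \<open>wderiv_from_lines\<close> turns this into derivatives on the
  cylinder.\<close>

lemma has_weak_deriv_stationary:
  fixes \<Omega> :: "'a::euclidean_space set" and T :: real
  assumes \<Omega>: "open \<Omega>" and T: "T > 0" and w: "has_weak_deriv \<Omega> e v g"
    and L2: "v \<in> L2_space (lebesgue_on \<Omega>)" "g \<in> L2_space (lebesgue_on \<Omega>)"
  shows "has_weak_deriv (\<Omega> \<times> {0<..<T}) (e, 0) (\<lambda>p. v (fst p)) (\<lambda>p. g (fst p))"
    "has_weak_deriv (\<Omega> \<times> {0<..<T}) (0, 1) (\<lambda>p. v (fst p)) (\<lambda>p. 0)"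
proof -
  let ?U = "\<Omega> \<times> {0<..<T}"
  have U: "open ?U" using \<Omega> by (intro open_Times) auto
  then have Ub: "?U \<in> sets borel" by auto
  obtain v' g' where w': "wderiv \<Omega> e v' g'" and ve: "ae_eq \<Omega> v v'"
    and ge: "ae_eq \<Omega> g g'"
    using has_weak_deriv_borel[OF \<Omega> w] by blast
  have m: "v' \<in> borel_measurable borel" "g' \<in> borel_measurable borel" using w' by (auto simp: wderiv_def loc_int_def)
  have m': "(\<lambda>p :: 'a \<times> real. v' (fst p)) \<in> borel_measurable borel" "(\<lambda>p :: 'a \<times> real. g' (fst p)) \<in> borel_measurable borel"
    by (rule borel_measurable_compose_continuous[OF m(1)] borel_measurable_compose_continuous[OF m(2)]; auto intro!: continuous_intros)+
  have ve': "AE p in lborel. p \<in> ?U \<longrightarrow> v (fst p) = v' (fst p)" using AE_lborel_fst[OF ve] by eventually_elim auto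
  have ge': "AE p in lborel. p \<in> ?U \<longrightarrow> g (fst p) = g' (fst p)" using AE_lborel_fst[OF ge] by eventually_elim auto
  have lv: "loc_int ?U (\<lambda>p. v' (fst p))"
    using L2_fst(1)[OF \<Omega> T L2(1)] L2_borel_iff(1)[OF Ub m'(1) ve'] by (intro L2_loc_int m') auto
  have lg: "loc_int ?U (\<lambda>p. g' (fst p))"
    using L2_fst(1)[OF \<Omega> T L2(2)] L2_borel_iff(1)[OF Ub m'(2) ge'] by (intro L2_loc_int m') auto
  have l0: "loc_int ?U (\<lambda>p. 0)" by (simp add: loc_int_def set_integrable_def)
  define \<tau> where "\<tau> k = inverse (real (Suc k))" for k
  have \<tau>: "\<tau> \<longlonglongrightarrow> 0" "\<And>k. \<tau> k \<noteq> 0" unfolding \<tau>_def using LIMSEQ_inverse_real_of_nat by auto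
  have "wderiv ?U (e, 0) (\<lambda>p. v' (fst p)) (\<lambda>p. g' (fst p))"
  proof (rule wderiv_from_lines[OF U lv lg _ \<tau>])
    fix k
    show "AE p in lborel. closed_segment p (p + \<tau> k *\<^sub>R (e, 0)) \<subseteq> ?U \<longrightarrow>
       v' (fst (p + \<tau> k *\<^sub>R (e, 0))) - v' (fst p) = \<tau> k * line_int (\<lambda>p. g' (fst p)) (\<tau> k *\<^sub>R (e, 0)) p"
      using AE_lborel_fst[OF wderiv_line_scaled[OF \<Omega> w', of "\<tau> k"]]
    proof eventually_elim
      case (elim p)
      have "closed_segment p (p + \<tau> k *\<^sub>R (e, 0)) \<subseteq> ?U \<Longrightarrow> closed_segment (fst p) (fst p + \<tau> k *\<^sub>R e) \<subseteq> \<Omega>"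
        unfolding closed_segment_shift by (auto simp: image_subset_iff mem_Times_iff)
      then show ?case using elim by (simp add: line_int_def)
    qed
  qed
  then show "has_weak_deriv ?U (e, 0) (\<lambda>p. v (fst p)) (\<lambda>p. g (fst p))"
    using has_weak_deriv_iff_wderiv[OF U m' ve' ge'] by blast
  have "wderiv ?U (0, 1) (\<lambda>p. v' (fst p)) (\<lambda>p. 0)"
    by (rule wderiv_from_lines[OF U lv l0 _ \<tau>]) (simp add: line_int_def)
  then show "has_weak_deriv ?U (0, 1) (\<lambda>p. v (fst p)) (\<lambda>p. 0)"
    using has_weak_deriv_iff_wderiv[OF U m'(1) _ ve', of "\<lambda>_. 0" "\<lambda>_. 0"] by simp
qed

lemma Basis_prod_cases:
  assumes "c \<in> (Basis :: ('a::euclidean_space \<times> real) set)"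
  obtains b where "b \<in> Basis" "c = (b, 0)" | "c = (0, 1)"
  using assms by (auto simp: Basis_prod_def)

lemma H1_stationary:
  fixes \<Omega> :: "'a::euclidean_space set" and T :: real
  assumes \<Omega>: "open \<Omega>" and T: "T > 0" and v: "v \<in> H1_space \<Omega>"
  shows "(\<lambda>p. v (fst p)) \<in> H1_space (\<Omega> \<times> {0<..<T})"
    "c \<in> Basis \<Longrightarrow> has_weak_deriv (\<Omega> \<times> {0<..<T}) c (\<lambda>p. v (fst p)) (\<lambda>p. if snd c = 0 then weak_deriv \<Omega> (fst c) v (fst p) else 0)"
proof -
  note H = H1_D[OF \<Omega> v]
  show w: "has_weak_deriv (\<Omega> \<times> {0<..<T}) c (\<lambda>p. v (fst p)) (\<lambda>p. if snd c = 0 then weak_deriv \<Omega> (fst c) v (fst p) else 0)"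
    if "c \<in> Basis" for c
    using that
  proof (cases rule: Basis_prod_cases)
    case (1 b)
    then show ?thesis using has_weak_deriv_stationary(1)[OF \<Omega> T H(2) H(1) H(3), of b] by simp
  next
    case 2
    obtain b :: 'a where b: "b \<in> Basis" using nonempty_Basis by blast
    from has_weak_deriv_stationary(2)[OF \<Omega> T H(2)[OF b] H(1) H(3)[OF b]] 2 show ?thesis by simp
  qed
  have l: "(\<lambda>p. if snd c = 0 then weak_deriv \<Omega> (fst c) v (fst p) else 0) \<in> L2_space (lebesgue_on (\<Omega> \<times> {0<..<T}))"
    if "c \<in> Basis" for c :: "'a \<times> real"
    using that
  proof (cases rule: Basis_prod_cases)
    case (1 b)
    then show ?thesis using L2_fst(1)[OF \<Omega> T H(3), of b] by simp
  qed (simp add: L2_space_def)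
  show "(\<lambda>p. v (fst p)) \<in> H1_space (\<Omega> \<times> {0<..<T})"
    by (rule H1_I[OF L2_fst(1)[OF \<Omega> T H(1)] w l])
qed

text \<open>The boundary trace supplies approximations of \<open>v\<close> that are continuous up to
  the boundary. Extended constantly in time they approximate \<open>v\<close> on the cylinder, and
  at time 0 they restrict to themselves.\<close>

lemma initial_trace_stationary:
  fixes \<Omega> :: "'a::euclidean_space set" and T :: real
  assumes \<Omega>: "open \<Omega>" and T: "T > 0" and t: "boundary_trace \<Omega> v g"
  shows "initial_trace \<Omega> T (\<lambda>p. v (fst p)) v"
proof -
  let ?U = "\<Omega> \<times> {0<..<T}"
  have U: "open ?U" using \<Omega> by (intro open_Times) auto
  obtain w where w: "v \<in> H1_space \<Omega>" "\<And>n. w n \<in> H1_space \<Omega>" "\<And>n. continuous_on (closure \<Omega>) (w n)"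
    "(\<lambda>n::nat. h1d \<Omega> (w n) v) \<longlonglongrightarrow> 0"
    using has_traceE[OF \<Omega> t[unfolded boundary_trace_def]] by metis
  note Hv = H1_D[OF \<Omega> w(1)] and Hw = H1_D[OF \<Omega> w(2)]
  have l0: "(\<lambda>n. l2d (lebesgue_on \<Omega>) (w n) v) \<longlonglongrightarrow> 0"
    by (rule tendsto_squeeze_0[OF w(4) l2d_nonneg l2d_le_h1d(1)])
  have lb: "(\<lambda>n. l2d (lebesgue_on \<Omega>) (weak_deriv \<Omega> b (w n)) (weak_deriv \<Omega> b v)) \<longlonglongrightarrow> 0" if "b \<in> Basis" for b
    by (rule tendsto_squeeze_0[OF w(4) l2d_nonneg l2d_le_h1d(2)[OF that]])
  have cont: "continuous_on (closure ?U) (\<lambda>p. w n (fst p))" for n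
    by (rule continuous_on_compose2[OF w(3)]) (auto simp: closure_Times intro!: continuous_intros)
  let ?G = "\<lambda>v (c :: 'a \<times> real) p :: 'a \<times> real. if snd c = 0 then weak_deriv \<Omega> (fst c) v (fst p) else 0"
  have eq: "h1d ?U (\<lambda>p. w n (fst p)) (\<lambda>p. v (fst p)) = l2d (lebesgue_on ?U) (\<lambda>p. w n (fst p)) (\<lambda>p. v (fst p))
     + (\<Sum>c\<in>Basis. l2d (lebesgue_on ?U) (?G (w n) c) (?G v c))" for n
    by (rule h1d_eq[OF U H1_stationary(2)[OF \<Omega> T w(2)] H1_stationary(2)[OF \<Omega> T w(1)]])
  have lim: "(\<lambda>n. l2d (lebesgue_on ?U) (?G (w n) c) (?G v c)) \<longlonglongrightarrow> 0" if "c \<in> Basis" for c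
    using that
  proof (cases rule: Basis_prod_cases)
    case (1 b)
    then have "l2d (lebesgue_on ?U) (?G (w n) c) (?G v c) = T * l2d (lebesgue_on \<Omega>) (weak_deriv \<Omega> b (w n)) (weak_deriv \<Omega> b v)" for n
      using l2d_fst[OF \<Omega> T Hw(3) Hv(3), of b b n] by simp
    then show ?thesis using tendsto_mult_right_zero[OF lb[OF 1(1)], of T] by simp
  qed simp
  have "(\<lambda>n. h1d ?U (\<lambda>p. w n (fst p)) (\<lambda>p. v (fst p))) \<longlonglongrightarrow> T * 0 + (\<Sum>c\<in>(Basis :: ('a \<times> real) set). 0)"
    unfolding eq l2d_fst[OF \<Omega> T Hw(1) Hv(1)] by (intro tendsto_add tendsto_mult tendsto_const l0 tendsto_sum lim)
  then show ?thesis
    unfolding initial_trace_def using l0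
    by (intro has_traceI[OF U H1_stationary(1)[OF \<Omega> T w(1)] Hv(1) H1_stationary(1)[OF \<Omega> T w(2)] cont]) (auto simp: Hw(1))
qed

subsection \<open>Functions with vanishing trace\<close>

lemma has_weak_deriv_scale_dir:
  assumes U: "open U" and w: "has_weak_deriv U e u g"
  shows "has_weak_deriv U (a *\<^sub>R e) u (\<lambda>x. a * g x)"
proof -
  obtain u1 g1 where 1: "wderiv U e u1 g1" "ae_eq U u u1" "ae_eq U g g1"
    using has_weak_deriv_borel[OF U w] by blast
  show ?thesis
  proof (rule has_weak_deriv_cong[OF U wderiv_has_weak_deriv[OF U wderiv_scale_dir[OF 1(1)]]])
    show "AE x in lebesgue_on U. u1 x = u x"
      using 1(2) unfolding AE_lebesgue_on_open[OF U] by eventually_elim auto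
    show "AE x in lebesgue_on U. a * g1 x = a * g x"
      using 1(3) unfolding AE_lebesgue_on_open[OF U] by eventually_elim auto
  qed
qed

lemma line_int_rescale:
  assumes a: "a > 0"
  shows "a * line_int f (a *\<^sub>R e) x = (LINT \<sigma>|lborel. indicator {0..a} \<sigma> * f (x + \<sigma> *\<^sub>R e))"
proof -
  have "(LINT \<sigma>|lborel. indicator {0..a} \<sigma> * f (x + \<sigma> *\<^sub>R e)) = \<bar>a\<bar> *\<^sub>R (LINT s|lborel. indicator {0..a} (0 + a * s) * f (x + (0 + a * s) *\<^sub>R e))"
    using a by (intro lborel_integral_real_affine) auto
  also have "\<dots> = a * (LINT s|lborel. indicator {0..1} s * f (x + s *\<^sub>R a *\<^sub>R e))"
    using a by (auto simp: indicator_def zero_le_mult_iff mult.commute intro!: Bochner_Integration.integral_cong)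
  finally show ?thesis by (simp add: line_int_def)
qed

text \<open>The endpoint \<open>x + s e\<close> may lie on the boundary, where no derivative is
  available. The line identity holds a.e. for all rational lengths below \<open>s\<close> at once,
  and continuity of \<open>w\<close> on the closure carries the bound to \<open>s\<close>. The bound
  \<open>\<Gamma>\<close> integrates |g| along the whole length \<open>L\<close>, which makes it
  independent of \<open>s\<close>.\<close>

lemma segment_oscillation:
  fixes U :: "'a::euclidean_space set"
  assumes U: "open U" and w: "has_weak_deriv U e w g" and g: "integrable (lebesgue_on U) g"
    and cont: "continuous_on (closure U) w" and L: "L > 0"
  obtains \<Gamma> where "integrable lborel \<Gamma>" "\<And>x. 0 \<le> \<Gamma> x" "(LINT x|lborel. \<Gamma> x) = L * (LINT x|lebesgue_on U. \<bar>g x\<bar>)"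
    "AE x in lborel. x \<in> U \<longrightarrow> (\<forall>s. 0 < s \<and> s \<le> L \<and> (\<forall>\<sigma>. 0 \<le> \<sigma> \<and> \<sigma> < s \<longrightarrow> x + \<sigma> *\<^sub>R e \<in> U) \<longrightarrow> \<bar>w (x + s *\<^sub>R e) - w x\<bar> \<le> \<Gamma> x)"
proof -
  have Ub: "U \<in> sets borel" using U by auto
  obtain w1 g1 where 1: "wderiv U e w1 g1" and we: "ae_eq U w w1"
    and ge: "ae_eq U g g1"
    using has_weak_deriv_borel[OF U w] by blast
  have m: "w1 \<in> borel_measurable borel" "g1 \<in> borel_measurable borel" using 1 by (auto simp: wderiv_def loc_int_def)
  \<comment> \<open>Extension by 0 lets the segment of length \<open>L\<close> leave
    \<open>U\<close>, so that translation invariance gives the integral of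
    \<open>\<Gamma>\<close>.\<close>
  define h where "h x = indicator U x * \<bar>g1 x\<bar>" for x
  have h: "integrable lborel h"
    using integrable_abs[of lborel "\<lambda>x. indicator U x * g1 x"] g integrable_lebesgue_on_iff[OF Ub m(2) ge]
    by (simp add: h_def[abs_def] abs_mult)
  have ih: "(LINT x|lborel. h x) = (LINT x|lebesgue_on U. \<bar>g x\<bar>)"
    unfolding h_def
  proof (rule integral_lebesgue_on_eq[OF Ub, symmetric])
    show "(\<lambda>x. \<bar>g1 x\<bar>) \<in> borel_measurable borel" using m by simp
    show "AE x in lborel. x \<in> U \<longrightarrow> \<bar>g x\<bar> = \<bar>g1 x\<bar>" using ge by eventually_elim auto
  qed
  define \<Gamma> where "\<Gamma> x = L * line_int h (L *\<^sub>R e) x" for x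
  show thesis
  proof
    show "integrable lborel \<Gamma>" unfolding \<Gamma>_def by (intro integrable_mult_right integrable_line_int h)
    show "0 \<le> \<Gamma> x" for x unfolding \<Gamma>_def line_int_def h_def using L by (intro mult_nonneg_nonneg integral_nonneg_AE) auto
    show "(LINT x|lborel. \<Gamma> x) = L * (LINT x|lebesgue_on U. \<bar>g x\<bar>)"
      unfolding \<Gamma>_def using integral_line_int[OF h, of "L *\<^sub>R e"] ih by simp
    have "AE x in lborel. \<forall>q :: rat. closed_segment x (x + of_rat q *\<^sub>R e) \<subseteq> U \<longrightarrow>
      w1 (x + of_rat q *\<^sub>R e) - w1 x = of_rat q * line_int g1 (of_rat q *\<^sub>R e) x"
      unfolding AE_all_countable using wderiv_line_scaled[OF U 1] by blast
    \<comment> \<open>The representative must agree with \<open>w\<close> at all rational points of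
      the segment; the value q = 0 covers the starting point.\<close>
    moreover have "AE x in lborel. \<forall>q :: rat. x + of_rat q *\<^sub>R e \<in> U \<longrightarrow> w (x + of_rat q *\<^sub>R e) = w1 (x + of_rat q *\<^sub>R e)"
      unfolding AE_all_countable using AE_translate[OF we] by blast
    moreover have "AE x in lborel. integrable lborel (\<lambda>s. indicator {0..1} s * h (x + (s * L) *\<^sub>R e))"
      using strip_Fubini(4)[OF integrable_shift_strip[OF h, of L e]] by simp
    ultimately show "AE x in lborel. x \<in> U \<longrightarrow> (\<forall>s. 0 < s \<and> s \<le> L \<and> (\<forall>\<sigma>. 0 \<le> \<sigma> \<and> \<sigma> < s \<longrightarrow> x + \<sigma> *\<^sub>R e \<in> U) \<longrightarrow> \<bar>w (x + s *\<^sub>R e) - w x\<bar> \<le> \<Gamma> x)"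
    proof eventually_elim
      case (elim x)
      note lines = elim(1)[rule_format] and reps = elim(2)[rule_format]
      have iL: "integrable lborel (\<lambda>\<sigma>. indicator {0..L} \<sigma> * h (x + \<sigma> *\<^sub>R e))"
      proof -
        have "(\<lambda>s. indicator {0..L} (0 + L * s) * h (x + (0 + L * s) *\<^sub>R e)) = (\<lambda>s. indicator {0..1} s * h (x + (s * L) *\<^sub>R e))"
          using L by (auto simp: indicator_def zero_le_mult_iff mult.commute)
        then show ?thesis
          using elim(3) L lborel_integrable_real_affine_iff[of L "\<lambda>\<sigma>. indicator {0..L} \<sigma> * h (x + \<sigma> *\<^sub>R e)" 0] by simp
      qed
      have \<Gamma>eq: "\<Gamma> x = (LINT \<sigma>|lborel. indicator {0..L} \<sigma> * h (x + \<sigma> *\<^sub>R e))"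
        unfolding \<Gamma>_def by (rule line_int_rescale[OF L])
      show ?case
      proof (intro impI allI, elim conjE)
        fix s assume xU: "x \<in> U" and s: "0 < s" "s \<le> L" "\<forall>\<sigma>. 0 \<le> \<sigma> \<and> \<sigma> < s \<longrightarrow> x + \<sigma> *\<^sub>R e \<in> U"
        have rat: "\<bar>w (x + of_rat q *\<^sub>R e) - w x\<bar> \<le> \<Gamma> x" if q: "0 < (of_rat q :: real)" "of_rat q < s" for q
        proof -
          let ?\<tau> = "of_rat q :: real"
          have seg: "closed_segment x (x + ?\<tau> *\<^sub>R e) \<subseteq> U"
          proof
            fix y assume "y \<in> closed_segment x (x + ?\<tau> *\<^sub>R e)"
            then obtain \<sigma> where \<sigma>: "0 \<le> \<sigma>" "\<sigma> \<le> 1" "y = x + (\<sigma> * ?\<tau>) *\<^sub>R e" by (auto simp: closed_segment_shift)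
            have "\<sigma> * ?\<tau> \<le> 1 * ?\<tau>" using \<sigma> q by (intro mult_right_mono) auto
            moreover have "0 \<le> \<sigma> * ?\<tau>" using \<sigma> q by simp
            ultimately have "x + (\<sigma> * ?\<tau>) *\<^sub>R e \<in> U" using s(3)[rule_format, of "\<sigma> * ?\<tau>"] q by linarith
            then show "y \<in> U" using \<sigma> by simp
          qed
          have "w (x + ?\<tau> *\<^sub>R e) - w x = w1 (x + ?\<tau> *\<^sub>R e) - w1 x"
            using reps[of q] reps[of 0] s(3) q xU by simp
          also have "\<dots> = ?\<tau> * line_int g1 (?\<tau> *\<^sub>R e) x" by (rule lines[OF seg])
          also have "\<dots> = (LINT \<sigma>|lborel. indicator {0..?\<tau>} \<sigma> * g1 (x + \<sigma> *\<^sub>R e))" by (rule line_int_rescale[OF q(1)])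
          also have "\<bar>\<dots>\<bar> \<le> (LINT \<sigma>|lborel. \<bar>indicator {0..?\<tau>} \<sigma> * g1 (x + \<sigma> *\<^sub>R e)\<bar>)" by (rule integral_abs_bound)
          also have "\<dots> \<le> (LINT \<sigma>|lborel. indicator {0..L} \<sigma> * h (x + \<sigma> *\<^sub>R e))"
          proof (rule integral_mono_AE'[OF iL])
            show "AE \<sigma> in lborel. \<bar>indicator {0..?\<tau>} \<sigma> * g1 (x + \<sigma> *\<^sub>R e)\<bar> \<le> indicator {0..L} \<sigma> * h (x + \<sigma> *\<^sub>R e)"
              using s q by (intro AE_I2) (auto simp: h_def abs_mult split: split_indicator)
            show "AE \<sigma> in lborel. 0 \<le> indicator {0..L} \<sigma> * h (x + \<sigma> *\<^sub>R e)" by (auto simp: h_def)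
          qed
          finally show ?thesis unfolding \<Gamma>eq .
        qed
        have "\<exists>q :: rat. s - s * inverse (real (Suc (Suc k))) < of_rat q \<and> of_rat q < s" for k
        proof -
          have "s - s * inverse (real (Suc (Suc k))) < s" using s(1) by simp
          from Rats_dense_in_real[OF this] show ?thesis by (auto elim!: Rats_cases)
        qed
        then obtain q :: "nat \<Rightarrow> rat" where q: "\<And>k. s - s * inverse (real (Suc (Suc k))) < of_rat (q k)" "\<And>k. of_rat (q k) < s" by metis
        have qpos: "0 < (of_rat (q k) :: real)" for k
        proof -
          have "s * inverse (real (Suc (Suc k))) \<le> s * 1" using s(1) by (intro mult_left_mono) (auto simp: inverse_eq_divide)
          then show ?thesis using q(1)[of k] by linarith
        qed
        have qlim: "(\<lambda>k. of_rat (q k) :: real) \<longlonglongrightarrow> s"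
        proof (rule tendsto_sandwich)
          have "(\<lambda>k. s - s * inverse (real (Suc (Suc k)))) \<longlonglongrightarrow> s - s * 0"
            by (intro tendsto_intros LIMSEQ_Suc[OF LIMSEQ_inverse_real_of_nat])
          then show "(\<lambda>k. s - s * inverse (real (Suc (Suc k)))) \<longlonglongrightarrow> s" by simp
          show "\<forall>\<^sub>F k in sequentially. s - s * inverse (real (Suc (Suc k))) \<le> of_rat (q k)" using q(1) by (intro always_eventually allI less_imp_le)
          show "\<forall>\<^sub>F k in sequentially. of_rat (q k) \<le> s" using q(2) by (intro always_eventually allI less_imp_le)
        qed auto
        have ylim: "(\<lambda>k. x + of_rat (q k) *\<^sub>R e) \<longlonglongrightarrow> x + s *\<^sub>R e" by (intro tendsto_intros qlim)
        have inU: "x + of_rat (q k) *\<^sub>R e \<in> U" for k using s(3) qpos[of k] q(2)[of k] by auto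
        have "x + s *\<^sub>R e \<in> closure U"
          unfolding closure_sequential by (intro exI[of _ "\<lambda>k. x + of_rat (q k) *\<^sub>R e"] conjI allI inU ylim)
        then have "(\<lambda>k. w (x + of_rat (q k) *\<^sub>R e)) \<longlonglongrightarrow> w (x + s *\<^sub>R e)"
          by (rule continuous_on_tendsto_compose[OF cont ylim])
            (use inU closure_subset[of U] in \<open>auto intro!: always_eventually\<close>)
        then have "(\<lambda>k. \<bar>w (x + of_rat (q k) *\<^sub>R e) - w x\<bar>) \<longlonglongrightarrow> \<bar>w (x + s *\<^sub>R e) - w x\<bar>" by (intro tendsto_intros)
        then show "\<bar>w (x + s *\<^sub>R e) - w x\<bar> \<le> \<Gamma> x"
          by (rule LIMSEQ_le_const2) (use rat qpos q(2) in auto)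
      qed
    qed
  qed
qed

text \<open>The inequality |f| \<le> (e + f^2 / e) / 2 with \<open>e\<close> small compared to the
  total mass plays the role of Cauchy-Schwarz; the mass plus 1 in the denominator allows mass
  0.\<close>

lemma l2_imp_l1:
  fixes f :: "nat \<Rightarrow> 'a \<Rightarrow> real"
  assumes fin: "finite_measure M" and f: "\<And>n. f n \<in> L2_space M" and lim: "(\<lambda>n. LINT x|M. (f n x)\<^sup>2) \<longlonglongrightarrow> 0"
  shows "\<And>n. integrable M (f n)" "(\<lambda>n. LINT x|M. \<bar>f n x\<bar>) \<longlonglongrightarrow> 0"
proof -
  interpret finite_measure M by (rule fin)
  show i: "integrable M (f n)" for n
  proof (rule Bochner_Integration.integrable_bound)
    show "integrable M (\<lambda>x. 1 + (f n x)\<^sup>2)" using L2_D(2)[OF f] by auto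
    show "AE x in M. norm (f n x) \<le> norm (1 + (f n x)\<^sup>2)" using abs_le_one_plus_sq by (intro AE_I2) simp
  qed (use L2_D(1)[OF f] in simp)
  define m where "m = measure M (space M)"
  show "(\<lambda>n. LINT x|M. \<bar>f n x\<bar>) \<longlonglongrightarrow> 0"
  proof (rule LIMSEQ_I)
    fix r :: real assume r: "r > 0"
    have m0: "0 \<le> m" by (simp add: m_def)
    define e where "e = r / (m + 1)"
    have e: "e > 0" "e * m < r" using r m0 by (auto simp: e_def divide_simps)
    from LIMSEQ_D[OF lim, of "e * r"] e(1) r obtain N where N: "\<And>n. n \<ge> N \<Longrightarrow> (LINT x|M. (f n x)\<^sup>2) < e * r"
      by auto
    have "(LINT x|M. \<bar>f n x\<bar>) < r" if n: "n \<ge> N" for n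
    proof -
      have "(LINT x|M. \<bar>f n x\<bar>) \<le> (LINT x|M. (e + (f n x)\<^sup>2 / e) / 2)"
      proof (rule integral_mono)
        show "integrable M (\<lambda>x. \<bar>f n x\<bar>)" using i by auto
        show "integrable M (\<lambda>x. (e + (f n x)\<^sup>2 / e) / 2)" using L2_D(2)[OF f] by auto
        fix x
        have "2 * sqrt e * (\<bar>f n x\<bar> / sqrt e) \<le> (sqrt e)\<^sup>2 + (\<bar>f n x\<bar> / sqrt e)\<^sup>2" by (rule sum_squares_bound)
        then show "\<bar>f n x\<bar> \<le> (e + (f n x)\<^sup>2 / e) / 2" using e(1) by (simp add: power_divide)
      qed
      also have "\<dots> = (e * m + (LINT x|M. (f n x)\<^sup>2) / e) / 2"
        using L2_D(2)[OF f] by (simp add: m_def mult.commute)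
      also have "\<dots> < (r + r) / 2"
      proof -
        have "(LINT x|M. (f n x)\<^sup>2) / e < r" using N[OF n] e(1) by (simp add: pos_divide_less_eq mult.commute)
        then show ?thesis using e(2) by simp
      qed
      finally show ?thesis by simp
    qed
    then show "\<exists>no. \<forall>n\<ge>no. norm ((LINT x|M. \<bar>f n x\<bar>) - 0) < r" by (auto simp: integral_nonneg_AE)
  qed
qed

text \<open>From almost every point one leaves \<open>U\<close> along direction \<open>e\<close> through a boundary point where the
  approximating functions are small, and their oscillation along the way is controlled by the
  directional derivative, which tends to \<open>0\<close>.\<close>

lemma trace_zero:
  fixes U :: "'a::euclidean_space set" and u :: "'a \<Rightarrow> real"
  assumes U: "open U" and fin: "emeasure lborel U < \<infinity>"
    and t: "has_trace U M j u (\<lambda>_. 0)" and b: "b \<in> Basis" and e: "e = \<sigma> *\<^sub>R b" and w0: "has_weak_deriv U b u (\<lambda>_. 0)"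
    and L: "L > 0"
    and exit: "\<And>x. x \<in> U \<Longrightarrow> \<exists>s y. 0 < s \<and> s \<le> L \<and> (\<forall>\<sigma>. 0 \<le> \<sigma> \<and> \<sigma> < s \<longrightarrow> x + \<sigma> *\<^sub>R e \<in> U) \<and> y \<in> space M \<and> j y = x + s *\<^sub>R e"
    and small: "\<And>\<eta>. \<eta> > 0 \<Longrightarrow> \<exists>\<delta>>0. \<forall>E\<in>sets M. emeasure M E < ennreal \<delta> \<longrightarrow>
       (\<exists>S\<in>sets borel. emeasure lborel S < ennreal \<eta> \<and> (\<forall>y\<in>E. \<forall>s x. 0 \<le> s \<and> s \<le> L \<and> j y = x + s *\<^sub>R e \<longrightarrow> x \<in> S))"
  shows "AE x in lebesgue_on U. u x = 0"
proof -
  have Ub: "U \<in> sets borel" using U by auto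
  let ?M = "lebesgue_on U"
  have fm: "finite_measure ?M"
    using fin Ub by (intro finite_measureI) (simp add: emeasure_restrict_space space_restrict_space)
  obtain w where w: "u \<in> H1_space U" "\<And>n. w n \<in> H1_space U" "\<And>n. continuous_on (closure U) (w n)" "\<And>n. (\<lambda>y. w n (j y)) \<in> L2_space M"
    "(\<lambda>n::nat. h1d U (w n) u) \<longlonglongrightarrow> 0" "(\<lambda>n. l2d M (\<lambda>y. w n (j y)) (\<lambda>_. 0)) \<longlonglongrightarrow> 0"
    using has_traceE[OF U t] by metis
  note Hw = H1_D[OF U w(2)] and Hu = H1_D[OF U w(1)]
  have wd0: "AE x in ?M. weak_deriv U b u x = 0" by (rule weak_deriv_works(2)[OF U w0])
  have lb: "(\<lambda>n. l2d ?M (weak_deriv U b (w n)) (weak_deriv U b u)) \<longlonglongrightarrow> 0"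
    by (rule tendsto_squeeze_0[OF w(5) l2d_nonneg l2d_le_h1d(2)[OF b]])
  \<comment> \<open>The derivative of \<open>w n\<close> in direction \<open>e\<close>. It tends to
    0 in L2, since the derivative of the limit \<open>u\<close> in direction \<open>b\<close>
    vanishes, and then in L1 because \<open>U\<close> has finite measure.\<close>
  define g where "g n x = \<sigma> * weak_deriv U b (w n) x" for n x
  have gL2: "g n \<in> L2_space ?M" for n using L2_lin[OF Hw(3)[OF b, of n] Hw(3)[OF b, of n], of \<sigma> 0] by (simp add: g_def[abs_def])
  have gw: "has_weak_deriv U e (w n) (g n)" for n
    unfolding e g_def[abs_def] by (rule has_weak_deriv_scale_dir[OF U Hw(2)[OF b]])
  have "(LINT x|?M. (g n x)\<^sup>2) = \<sigma>\<^sup>2 * l2d ?M (weak_deriv U b (w n)) (weak_deriv U b u)" for n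
  proof -
    have "l2d ?M (weak_deriv U b (w n)) (weak_deriv U b u) = l2d ?M (weak_deriv U b (w n)) (\<lambda>_. 0)"
      by (rule l2d_cong_AE) (use L2_D(1)[OF Hw(3)[OF b]] L2_D(1)[OF Hu(3)[OF b]] wd0 in auto)
    then show ?thesis by (simp add: l2d_def g_def power_mult_distrib)
  qed
  then have "(\<lambda>n. LINT x|?M. (g n x)\<^sup>2) \<longlonglongrightarrow> 0" using tendsto_mult_right_zero[OF lb, of "\<sigma>\<^sup>2"] by simp
  note g1 = l2_imp_l1[OF fm gL2 this]
  let ?P = "\<lambda>n \<Gamma>. integrable lborel \<Gamma> \<and> (\<forall>x. 0 \<le> \<Gamma> x) \<and> (LINT x|lborel. \<Gamma> x) = L * (LINT x|lebesgue_on U. \<bar>g n x\<bar>) \<and>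
    (AE x in lborel. x \<in> U \<longrightarrow> (\<forall>s. 0 < s \<and> s \<le> L \<and> (\<forall>\<sigma>. 0 \<le> \<sigma> \<and> \<sigma> < s \<longrightarrow> x + \<sigma> *\<^sub>R e \<in> U) \<longrightarrow> \<bar>w n (x + s *\<^sub>R e) - w n x\<bar> \<le> \<Gamma> x))"
  have "\<exists>\<Gamma>. ?P n \<Gamma>" for n
    using segment_oscillation[OF U gw[of n] g1(1)[of n] w(3)[of n] L] by blast
  then have "\<forall>n. \<exists>\<Gamma>. ?P n \<Gamma>" by (rule allI)
  from choice[OF this] obtain \<Gamma> where \<Gamma>': "\<forall>n. ?P n (\<Gamma> n)" by (rule exE)
  note \<Gamma> = \<Gamma>'[rule_format, THEN conjunct1] \<Gamma>'[rule_format, THEN conjunct2, THEN conjunct1, rule_format]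
    \<Gamma>'[rule_format, THEN conjunct2, THEN conjunct2, THEN conjunct1] \<Gamma>'[THEN spec, THEN conjunct2, THEN conjunct2, THEN conjunct2]
  have \<Gamma>lim: "(\<lambda>n. LINT x|lborel. norm (\<Gamma> n x)) \<longlonglongrightarrow> 0"
    using tendsto_mult_right_zero[OF g1(2), of L] \<Gamma>(2,3) by simp
  define c where "c k = inverse (real (Suc k))" for k
  have c: "c k > 0" for k by (simp add: c_def)
  let ?S = "\<lambda>k n S. S \<in> sets borel \<and> emeasure lborel S < ennreal ((1/2) ^ k) \<and>
     (\<forall>y\<in>space M. \<forall>s x. 0 \<le> s \<and> s \<le> L \<and> j y = x + s *\<^sub>R e \<and> c k \<le> \<bar>w n (j y)\<bar> \<longrightarrow> x \<in> S)"
  \<comment> \<open>For late \<open>n\<close>, boundary points where |w n| is at least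
    \<open>c k\<close> are rare, so by \<open>small\<close> the points of \<open>U\<close> from
    which one is reached within length \<open>L\<close> fill volume below 2^(-k).\<close>
  have "\<exists>N. \<forall>n\<ge>N. \<exists>S. ?S k n S" for k :: nat
  proof -
    obtain \<delta> where \<delta>: "\<delta> > 0" "\<And>E. E \<in> sets M \<Longrightarrow> emeasure M E < ennreal \<delta> \<Longrightarrow>
       (\<exists>S\<in>sets borel. emeasure lborel S < ennreal ((1/2)^k) \<and> (\<forall>y\<in>E. \<forall>s x. 0 \<le> s \<and> s \<le> L \<and> j y = x + s *\<^sub>R e \<longrightarrow> x \<in> S))"
      using small[of "(1/2)^k"] by auto
    have "\<forall>\<^sub>F n in sequentially. l2d M (\<lambda>y. w n (j y)) (\<lambda>_. 0) < (c k)\<^sup>2 * \<delta>"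
      using order_tendstoD(2)[OF w(6), of "(c k)\<^sup>2 * \<delta>"] c[of k] \<delta>(1) by simp
    then obtain N where N: "\<And>n. n \<ge> N \<Longrightarrow> l2d M (\<lambda>y. w n (j y)) (\<lambda>_. 0) < (c k)\<^sup>2 * \<delta>"
      by (auto simp: eventually_sequentially)
    have "\<exists>S. ?S k n S" if n: "n \<ge> N" for n
    proof -
      define E where "E = {y \<in> space M. c k \<le> \<bar>w n (j y)\<bar>}"
      have [measurable]: "(\<lambda>y. w n (j y)) \<in> borel_measurable M" using L2_D(1)[OF w(4)] .
      have E: "E \<in> sets M" unfolding E_def by measurable
      \<comment> \<open>Chebyshev's inequality on the boundary: the squared distance to the trace 0
        is below c(k)^2 \<delta>.\<close>
      have "ennreal ((c k)\<^sup>2) * emeasure M E = (\<integral>\<^sup>+y. ennreal ((c k)\<^sup>2) * indicator E y \<partial>M)"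
        using E by (simp add: nn_integral_cmult_indicator)
      also have "\<dots> \<le> (\<integral>\<^sup>+y. ennreal ((w n (j y))\<^sup>2) \<partial>M)"
      proof (rule nn_integral_mono)
        fix y
        show "ennreal ((c k)\<^sup>2) * indicator E y \<le> ennreal ((w n (j y))\<^sup>2)"
          using c[of k] abs_le_square_iff[of "c k" "w n (j y)"] by (auto simp: E_def split: split_indicator intro!: ennreal_leI)
      qed
      also have "\<dots> = ennreal (l2d M (\<lambda>y. w n (j y)) (\<lambda>_. 0))"
        unfolding l2d_def using L2_D(2)[OF w(4)] by (subst nn_integral_eq_integral) auto
      also have "\<dots> < ennreal ((c k)\<^sup>2 * \<delta>)" using N[OF n] c[of k] \<delta>(1) by (intro ennreal_lessI) auto
      also have "\<dots> = ennreal ((c k)\<^sup>2) * ennreal \<delta>" using \<delta>(1) by (simp add: ennreal_mult)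
      finally have "emeasure M E < ennreal \<delta>"
        using mult_left_mono[of "ennreal \<delta>" "emeasure M E" "ennreal ((c k)\<^sup>2)"] by (meson leD leI zero_le)
      from \<delta>(2)[OF E this] show ?thesis unfolding E_def by blast
    qed
    then show ?thesis by blast
  qed
  then have "\<forall>k. \<exists>N. \<forall>n\<ge>N. \<exists>S. ?S k n S" by blast
  from choice[OF this] obtain N where N: "\<And>k n. n \<ge> N k \<Longrightarrow> \<exists>S. ?S k n S" by blast
  obtain \<rho> where \<rho>: "strict_mono \<rho>" "\<And>k. N k \<le> \<rho> k" using ex_subseq_thresholds by metis
  have "\<forall>k. \<exists>S. ?S k (\<rho> k) S" using N[OF \<rho>(2)] by blast
  from choice[OF this] obtain S where S: "\<And>k. S k \<in> sets borel" "\<And>k. emeasure lborel (S k) < ennreal ((1/2) ^ k)"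
     "\<And>k y s x. y \<in> space M \<Longrightarrow> 0 \<le> s \<Longrightarrow> s \<le> L \<Longrightarrow> j y = x + s *\<^sub>R e \<Longrightarrow> c k \<le> \<bar>w (\<rho> k) (j y)\<bar> \<Longrightarrow> x \<in> S k" by blast
  \<comment> \<open>Borel-Cantelli: almost every point lies in only finitely many of the bad
    sets.\<close>
  have bc: "AE x in lborel. \<forall>\<^sub>F k in sequentially. x \<notin> S k"
  proof -
    have fS: "emeasure lborel (S k) < \<infinity>" for k using S(2)[of k] by (auto intro: less_trans)
    have "summable (\<lambda>k. measure lborel (S k))"
    proof (rule summable_comparison_test'[of "\<lambda>k. (1/2 :: real) ^ k" 0])
      show "summable (\<lambda>k. (1/2 :: real) ^ k)" by (rule summable_geometric) simp
      fix k
      have "ennreal (measure lborel (S k)) < ennreal ((1/2) ^ k)"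
        using S(2)[of k] fS[of k] by (simp add: emeasure_eq_ennreal_measure[symmetric] less_top)
      then show "norm (measure lborel (S k)) \<le> (1/2) ^ k" by (simp add: ennreal_less_iff less_imp_le)
    qed
    from borel_cantelli_AE1[OF _ fS this] S(1) show ?thesis by simp
  qed
  have l0: "(\<lambda>n. l2d ?M (w n) u) \<longlonglongrightarrow> 0" by (rule tendsto_squeeze_0[OF w(5) l2d_nonneg l2d_le_h1d(1)])
  have l0': "(\<lambda>k. l2d ?M (w (\<rho> k)) u) \<longlonglongrightarrow> 0" using LIMSEQ_subseq_LIMSEQ[OF l0 \<rho>(1)] by (simp add: o_def)
  obtain r1 where r1: "strict_mono r1" "AE x in ?M. (\<lambda>k. w (\<rho> (r1 k)) x) \<longlonglongrightarrow> u x"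
    using l2d_AE_subseq[OF Hw(1) Hu(1) l0'] by blast
  have "strict_mono (\<rho> \<circ> r1)" by (rule strict_mono_o[OF \<rho>(1) r1(1)])
  from LIMSEQ_subseq_LIMSEQ[OF \<Gamma>lim this] have "(\<lambda>k. LINT x|lborel. norm (\<Gamma> (\<rho> (r1 k)) x)) \<longlonglongrightarrow> 0" by (simp add: o_def)
  from tendsto_L1_AE_subseq[OF \<Gamma>(1) this] obtain r2 where r2: "strict_mono r2" "AE x in lborel. (\<lambda>k. \<Gamma> (\<rho> (r1 (r2 k))) x) \<longlonglongrightarrow> 0" by blast
  define \<kappa> where "\<kappa> k = r1 (r2 k)" for k
  have \<kappa>: "strict_mono \<kappa>" using strict_mono_o[OF r1(1) r2(1)] by (simp add: \<kappa>_def[abs_def] o_def)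
  have osc: "AE x in lborel. \<forall>n. (x \<in> U \<longrightarrow> (\<forall>s. 0 < s \<and> s \<le> L \<and> (\<forall>\<sigma>. 0 \<le> \<sigma> \<and> \<sigma> < s \<longrightarrow> x + \<sigma> *\<^sub>R e \<in> U) \<longrightarrow> \<bar>w n (x + s *\<^sub>R e) - w n x\<bar> \<le> \<Gamma> n x))"
    unfolding AE_all_countable using \<Gamma>(4) by blast
  show ?thesis
    using bc r1(2) r2(2) osc unfolding AE_lebesgue_on_open[OF U]
  proof eventually_elim
    case (elim x)
    show ?case
    proof
      assume x: "x \<in> U"
      then obtain s y where s: "0 < s" "s \<le> L" "\<forall>\<sigma>. 0 \<le> \<sigma> \<and> \<sigma> < s \<longrightarrow> x + \<sigma> *\<^sub>R e \<in> U" "y \<in> space M" "j y = x + s *\<^sub>R e"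
        using exit by blast
      have "(\<lambda>k. w (\<rho> (r1 k)) x) \<longlonglongrightarrow> u x" using elim(2) x by blast
      from LIMSEQ_subseq_LIMSEQ[OF this r2(1)] have lim1: "(\<lambda>k. \<bar>w (\<rho> (\<kappa> k)) x\<bar>) \<longlonglongrightarrow> \<bar>u x\<bar>"
        by (intro tendsto_rabs) (simp add: \<kappa>_def o_def)
      have "(\<lambda>k. c (\<kappa> k)) \<longlonglongrightarrow> 0"
        using LIMSEQ_subseq_LIMSEQ[OF LIMSEQ_inverse_real_of_nat \<kappa>] by (simp add: o_def c_def)
      from tendsto_add[OF this elim(3)[folded \<kappa>_def]] have lim2: "(\<lambda>k. c (\<kappa> k) + \<Gamma> (\<rho> (\<kappa> k)) x) \<longlonglongrightarrow> 0" by simp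
      \<comment> \<open>From now on the approximant is below \<open>c\<close> at the exit point of
        \<open>x\<close>, and its change on the way there is at most \<open>\<Gamma>\<close>; both
        bounds tend to 0 along \<kappa>.\<close>
      have "\<forall>\<^sub>F k in sequentially. x \<notin> S (\<kappa> k)"
        using elim(1) filterlim_subseq[OF \<kappa>] by (rule eventually_compose_filterlim)
      then have "\<forall>\<^sub>F k in sequentially. \<bar>w (\<rho> (\<kappa> k)) x\<bar> \<le> c (\<kappa> k) + \<Gamma> (\<rho> (\<kappa> k)) x"
      proof eventually_elim
        case (elim k)
        have "\<bar>w (\<rho> (\<kappa> k)) (x + s *\<^sub>R e)\<bar> < c (\<kappa> k)"
          using S(3)[OF s(4) less_imp_le[OF s(1)] s(2,5), of "\<kappa> k"] elim s(5) by force
        moreover have "\<bar>w (\<rho> (\<kappa> k)) (x + s *\<^sub>R e) - w (\<rho> (\<kappa> k)) x\<bar> \<le> \<Gamma> (\<rho> (\<kappa> k)) x"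
          using \<open>\<forall>n. (x \<in> U \<longrightarrow> _ n)\<close>[rule_format, OF x] s(1-3) by blast
        ultimately show ?case by linarith
      qed
      from tendsto_le[OF sequentially_bot lim2 lim1 this] show "u x = 0" by simp
    qed
  qed
qed

text \<open>Cover \<open>D\<close> by sets of diameter \<rho> \<le> 1. Pulling such a set back along
  \<open>b\<close> over length \<open>L\<close> stays in a box with sides 2\<rho>, and 2\<rho> + L
  \<le> L + 2 in direction \<open>b\<close>. With d = DIM('a) - 1 its volume is at most (L + 2)
  (2\<rho>)^d = (L + 2) 4^d (\<rho>/2)^d, and dividing by the gauge gives the constant.\<close>

lemma hausdorff_sweep:
  fixes D :: "'a::euclidean_space set"
  assumes D: "hausdorff_outer (DIM('a) - 1) D < ennreal \<delta>" and b: "b \<in> Basis" and L: "L > 0"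
  obtains S where "S \<in> sets borel"
    "emeasure lborel S \<le> ennreal ((L + 2) * 4 ^ (DIM('a) - 1) / unit_ball_vol (real (DIM('a) - 1)) * \<delta>)"
    "\<And>x s. 0 \<le> s \<Longrightarrow> s \<le> L \<Longrightarrow> x + s *\<^sub>R b \<in> D \<Longrightarrow> x \<in> S"
proof -
  define d where "d = DIM('a) - 1"
  define \<kappa> where "\<kappa> = (L + 2) * 4 ^ d / unit_ball_vol (real d)"
  have ub: "unit_ball_vol (real d) > 0" by simp
  have \<kappa>: "\<kappa> > 0" using L ub by (simp add: \<kappa>_def)
  have "hausdorff_pre d 1 D \<le> hausdorff_outer d D"
    unfolding hausdorff_outer_def by (rule SUP_upper) simp
  then have "hausdorff_pre d 1 D < ennreal \<delta>" using D by (simp add: d_def)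
  then obtain C where C: "D \<subseteq> (\<Union>n. C n)" "\<And>n::nat. bounded (C n)" "\<And>n. diameter (C n) \<le> 1"
    "(\<Sum>n. hausdorff_gauge d (C n)) < ennreal \<delta>"
    unfolding hausdorff_pre_def INF_less_iff by auto
  define p where "p n = (SOME x. x \<in> C n)" for n
  define \<rho> where "\<rho> n = diameter (C n)" for n
  define lo where "lo n = (\<Sum>i\<in>Basis. (if i = b then p n \<bullet> i - \<rho> n - L else p n \<bullet> i - \<rho> n) *\<^sub>R i)" for n
  define hi where "hi n = (\<Sum>i\<in>Basis. (p n \<bullet> i + \<rho> n) *\<^sub>R i)" for n
  define B where "B n = (if C n = {} then {} else cbox (lo n) (hi n))" for n
  have \<rho>: "0 \<le> \<rho> n" "\<rho> n \<le> 1" for n using C(2,3)[of n] by (auto simp: \<rho>_def diameter_ge_0)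
  have Bm: "B n \<in> sets borel" for n by (simp add: B_def)
  have Bvol: "emeasure lborel (B n) \<le> ennreal \<kappa> * hausdorff_gauge d (C n)" for n
  proof (cases "C n = {}")
    case False
    have "(\<Prod>i\<in>Basis. (hi n - lo n) \<bullet> i) = (\<Prod>i\<in>Basis. if i = b then 2 * \<rho> n + L else 2 * \<rho> n)"
      by (intro prod.cong) (auto simp: lo_def hi_def inner_diff_left)
    also have "\<dots> = (2 * \<rho> n + L) * (\<Prod>i\<in>Basis - {b}. if i = b then 2 * \<rho> n + L else 2 * \<rho> n)"
      using b by (subst prod.remove[of _ b]) auto
    also have "(\<Prod>i\<in>Basis - {b}. if i = b then 2 * \<rho> n + L else 2 * \<rho> n) = (\<Prod>i\<in>Basis - {b}. 2 * \<rho> n)"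
      by (intro prod.cong) auto
    also have "\<dots> = (2 * \<rho> n) ^ d" using b by (simp add: d_def)
    finally have "(\<Prod>i\<in>Basis. (hi n - lo n) \<bullet> i) = (2 * \<rho> n + L) * (2 * \<rho> n) ^ d" .
    moreover have "(2 * \<rho> n + L) * (2 * \<rho> n) ^ d \<le> (L + 2) * (2 * \<rho> n) ^ d"
      using \<rho>[of n] by (intro mult_right_mono) auto
    moreover have "(L + 2) * (2 * \<rho> n) ^ d = \<kappa> * (unit_ball_vol (real d) * (\<rho> n / 2) ^ d)"
    proof -
      have "2 * \<rho> n = 4 * (\<rho> n / 2)" by simp
      then have "(2 * \<rho> n) ^ d = 4 ^ d * (\<rho> n / 2) ^ d" by (simp only: power_mult_distrib)
      moreover have "(L + 2) * (a * c) = (L + 2) * a / v * (v * c)" if "v > 0" for a c v :: real using that by simp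
      ultimately show ?thesis using ub unfolding \<kappa>_def by metis
    qed
    ultimately have le: "(\<Prod>i\<in>Basis. (hi n - lo n) \<bullet> i) \<le> \<kappa> * (unit_ball_vol (real d) * (\<rho> n / 2) ^ d)" by (simp only:)
    have "emeasure lborel (cbox (lo n) (hi n)) = ennreal (\<Prod>i\<in>Basis. (hi n - lo n) \<bullet> i)"
      using \<rho>[of n] L by (subst emeasure_lborel_cbox) (auto simp: lo_def hi_def)
    also have "\<dots> \<le> ennreal (\<kappa> * (unit_ball_vol (real d) * (\<rho> n / 2) ^ d))" by (rule ennreal_leI[OF le])
    also have "\<dots> = ennreal \<kappa> * hausdorff_gauge d (C n)"
      using False \<kappa> \<rho>[of n] ub by (simp add: hausdorff_gauge_def \<rho>_def ennreal_mult)
    finally show ?thesis using False by (simp add: B_def)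
  qed (simp add: B_def)
  show thesis
  proof (rule that[of "\<Union>n. B n"])
    show "(\<Union>n. B n) \<in> sets borel" using Bm by auto
    have "emeasure lborel (\<Union>n. B n) \<le> (\<Sum>n. emeasure lborel (B n))"
      using Bm by (intro emeasure_subadditive_countably) auto
    also have "\<dots> \<le> (\<Sum>n. ennreal \<kappa> * hausdorff_gauge d (C n))" by (intro suminf_le Bvol) auto
    also have "\<dots> = ennreal \<kappa> * (\<Sum>n. hausdorff_gauge d (C n))" by simp
    also have "\<dots> \<le> ennreal \<kappa> * ennreal \<delta>" using C(4) by (intro mult_left_mono) auto
    also have "\<dots> = ennreal (\<kappa> * \<delta>)" using \<kappa> by (simp add: ennreal_mult')
    finally show "emeasure lborel (\<Union>n. B n) \<le> ennreal ((L + 2) * 4 ^ (DIM('a) - 1) / unit_ball_vol (real (DIM('a) - 1)) * \<delta>)"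
      by (simp add: \<kappa>_def d_def)
    fix x s assume s: "0 \<le> s" "s \<le> L" "x + s *\<^sub>R b \<in> D"
    then obtain n where n: "x + s *\<^sub>R b \<in> C n" using C(1) by blast
    then have ne: "C n \<noteq> {}" by auto
    then have p: "p n \<in> C n" unfolding p_def by (simp add: some_in_eq)
    have "x \<in> cbox (lo n) (hi n)"
      unfolding mem_box
    proof
      fix i :: 'a assume i: "i \<in> Basis"
      have "\<bar>(x + s *\<^sub>R b - p n) \<bullet> i\<bar> \<le> norm (x + s *\<^sub>R b - p n)" by (rule Basis_le_norm[OF i])
      also have "\<dots> \<le> \<rho> n" using diameter_bounded_bound[OF C(2) n p] by (simp add: \<rho>_def dist_norm)
      finally have *: "\<bar>x \<bullet> i + s * (b \<bullet> i) - p n \<bullet> i\<bar> \<le> \<rho> n" by (simp add: inner_diff_left inner_add_left)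
      have bi: "b \<bullet> i = (if i = b then 1 else 0)" using inner_Basis[OF b i] by auto
      show "lo n \<bullet> i \<le> x \<bullet> i \<and> x \<bullet> i \<le> hi n \<bullet> i"
        using * s(1,2) i by (auto simp: lo_def hi_def bi abs_le_iff)
    qed
    then show "x \<in> (\<Union>n. B n)" using ne by (auto simp: B_def)
  qed
qed

text \<open>The exit time is the least element of the closed set of times t \<ge> 0 at which the ray
  is outside; the ray reaches that point through \<Omega>, so the point is in the closure.\<close>

lemma frontier_exit:
  fixes \<Omega> :: "'a::euclidean_space set"
  assumes \<Omega>: "open \<Omega>" and x: "x \<in> \<Omega>" and L: "L > 0" "x + L *\<^sub>R b \<notin> \<Omega>"
  obtains s where "0 < s" "s \<le> L" "\<And>\<sigma>. 0 \<le> \<sigma> \<Longrightarrow> \<sigma> < s \<Longrightarrow> x + \<sigma> *\<^sub>R b \<in> \<Omega>" "x + s *\<^sub>R b \<in> frontier \<Omega>"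
proof -
  define A where "A = {t. 0 \<le> t \<and> x + t *\<^sub>R b \<notin> \<Omega>}"
  have Aeq: "A = {0..} \<inter> (\<lambda>t. x + t *\<^sub>R b) -` (- \<Omega>)" by (auto simp: A_def)
  have "closed A" unfolding Aeq using \<Omega>
    by (intro closed_Int closed_vimage closed_atLeast continuous_intros) (auto simp: closed_Compl)
  moreover have LA: "L \<in> A" using L by (simp add: A_def)
  moreover have bdd: "bdd_below A" by (auto simp: A_def bdd_below_def)
  ultimately have sA: "Inf A \<in> A" by (intro closed_contains_Inf) auto
  define s where "s = Inf A"
  have s0: "0 \<le> s" "x + s *\<^sub>R b \<notin> \<Omega>" using sA by (auto simp: A_def s_def)
  have spos: "0 < s" using s0 x by (cases "s = 0") auto
  have sL: "s \<le> L" unfolding s_def by (rule cInf_lower[OF LA bdd])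
  have before: "x + \<sigma> *\<^sub>R b \<in> \<Omega>" if "0 \<le> \<sigma>" "\<sigma> < s" for \<sigma>
  proof (rule ccontr)
    assume "x + \<sigma> *\<^sub>R b \<notin> \<Omega>"
    then have "\<sigma> \<in> A" using that by (simp add: A_def)
    from cInf_lower[OF this bdd] that show False by (simp add: s_def)
  qed
  have lim: "(\<lambda>k. x + (s - s * inverse (real (Suc k))) *\<^sub>R b) \<longlonglongrightarrow> x + (s - s * 0) *\<^sub>R b"
    by (intro tendsto_intros LIMSEQ_inverse_real_of_nat)
  have "x + (s - s * inverse (real (Suc k))) *\<^sub>R b \<in> \<Omega>" for k
  proof (rule before)
    have "s * inverse (real (Suc k)) \<le> s * 1" using spos by (intro mult_left_mono) (auto simp: inverse_eq_divide)
    then show "0 \<le> s - s * inverse (real (Suc k))" by simp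
    show "s - s * inverse (real (Suc k)) < s" using spos by simp
  qed
  then have "x + s *\<^sub>R b \<in> closure \<Omega>"
    unfolding closure_sequential using lim by (intro exI[of _ "\<lambda>k. x + (s - s * inverse (real (Suc k))) *\<^sub>R b"]) simp
  then have "x + s *\<^sub>R b \<in> frontier \<Omega>" using s0 \<Omega> by (simp add: frontier_def interior_open)
  with spos sL before show ?thesis by (rule that)
qed

text \<open>Any coordinate direction leads out of the bounded set. Small sets for surface measure
  are small for Hausdorff outer measure, so \<open>hausdorff_sweep\<close> supplies the smallness
  condition of \<open>trace_zero\<close>.\<close>

lemma boundary_trace_zero:
  fixes \<Omega> :: "'a::euclidean_space set"
  assumes \<Omega>: "open \<Omega>" "bounded \<Omega>" and t: "boundary_trace \<Omega> w (\<lambda>_. 0)"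
    and w: "\<And>b. b \<in> Basis \<Longrightarrow> has_weak_deriv \<Omega> b w (\<lambda>_. 0)"
  shows "AE x in lebesgue_on \<Omega>. w x = 0"
proof -
  \<comment> \<open>With |x| \<le> R on \<Omega>, two points of \<Omega> are at distance at most 2
    R, so the length L = 2 |R| + 1 leads out of \<Omega> from every point.\<close>
  obtain b :: 'a where b: "b \<in> Basis" using nonempty_Basis by blast
  obtain R where R: "\<And>x. x \<in> \<Omega> \<Longrightarrow> norm x \<le> R" using \<Omega>(2) by (auto simp: bounded_iff)
  define L where "L = 2 * \<bar>R\<bar> + 1"
  have L: "L > 0" by (simp add: L_def)
  have out: "x + L *\<^sub>R b \<notin> \<Omega>" if "x \<in> \<Omega>" for x
  proof
    assume "x + L *\<^sub>R b \<in> \<Omega>"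
    from R[OF this] have "norm (L *\<^sub>R b) \<le> R + R"
      using R[OF that] norm_triangle_ineq4[of "x + L *\<^sub>R b" x] by simp
    then show False using b L by (simp add: L_def)
  qed
  show ?thesis
  proof (rule trace_zero[OF \<Omega>(1) _ t[unfolded boundary_trace_def] b _ w[OF b] L, of "1 *\<^sub>R b" 1])
    show "emeasure lborel \<Omega> < \<infinity>" using emeasure_bounded_finite[OF \<Omega>(2)] by simp
    show "\<exists>s y. 0 < s \<and> s \<le> L \<and> (\<forall>\<sigma>. 0 \<le> \<sigma> \<and> \<sigma> < s \<longrightarrow> x + \<sigma> *\<^sub>R 1 *\<^sub>R b \<in> \<Omega>) \<and> y \<in> space (surface_measure \<Omega>) \<and> y = x + s *\<^sub>R 1 *\<^sub>R b"
      if "x \<in> \<Omega>" for x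
      using frontier_exit[OF \<Omega>(1) that L out[OF that]] by (metis scaleR_one space_surface_measure)
    fix \<eta> :: real assume \<eta>: "\<eta> > 0"
    define c where "c = (L + 2) * 4 ^ (DIM('a) - 1) / unit_ball_vol (real (DIM('a) - 1))"
    have c: "c > 0" using L by (simp add: c_def)
    show "\<exists>\<delta>>0. \<forall>E\<in>sets (surface_measure \<Omega>). emeasure (surface_measure \<Omega>) E < ennreal \<delta> \<longrightarrow>
       (\<exists>S\<in>sets borel. emeasure lborel S < ennreal \<eta> \<and> (\<forall>y\<in>E. \<forall>s x. 0 \<le> s \<and> s \<le> L \<and> y = x + s *\<^sub>R 1 *\<^sub>R b \<longrightarrow> x \<in> S))"
    \<comment> \<open>The factor 2 turns the weak bound of \<open>hausdorff_sweep\<close> into the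
      strict one required.\<close>
    proof (intro exI[of _ "\<eta> / (2 * c)"] conjI ballI impI)
      show "0 < \<eta> / (2 * c)" using \<eta> c by simp
      fix E assume E: "E \<in> sets (surface_measure \<Omega>)" "emeasure (surface_measure \<Omega>) E < ennreal (\<eta> / (2 * c))"
      have "emeasure (surface_measure \<Omega>) E = hausdorff_outer (DIM('a) - 1) E"
        using E(1) by (intro emeasure_surface_measure) (simp add: sets_surface_measure)
      with E(2) have "hausdorff_outer (DIM('a) - 1) E < ennreal (\<eta> / (2 * c))" by simp
      from hausdorff_sweep[OF this b L] obtain S where S: "S \<in> sets borel"
        "emeasure lborel S \<le> ennreal (c * (\<eta> / (2 * c)))" "\<And>x s. 0 \<le> s \<Longrightarrow> s \<le> L \<Longrightarrow> x + s *\<^sub>R b \<in> E \<Longrightarrow> x \<in> S"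
        unfolding c_def by blast
      have "ennreal (c * (\<eta> / (2 * c))) < ennreal \<eta>" using c \<eta> by (intro ennreal_lessI) auto
      with S(2) have "emeasure lborel S < ennreal \<eta>" by (rule le_less_trans)
      with S show "\<exists>S\<in>sets borel. emeasure lborel S < ennreal \<eta> \<and> (\<forall>y\<in>E. \<forall>s x. 0 \<le> s \<and> s \<le> L \<and> y = x + s *\<^sub>R 1 *\<^sub>R b \<longrightarrow> x \<in> S)"
        by (intro bexI[of _ S]) auto
    qed
  qed simp
qed

text \<open>Here the path runs backwards in time, so the exit from \<open>(x, t)\<close> takes place
  at \<open>(x, 0)\<close> after length \<open>t\<close>. The points that reach \<open>E\<close> in
  this way lie in \<open>E\<close> times [0, T].\<close>

lemma initial_trace_zero:
  fixes \<Omega> :: "'a::euclidean_space set"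
  assumes \<Omega>: "open \<Omega>" "bounded \<Omega>" and T: "T > 0" and t: "initial_trace \<Omega> T w (\<lambda>_. 0)"
    and w: "has_weak_deriv (\<Omega> \<times> {0<..<T}) (0, 1) w (\<lambda>_. 0)"
  shows "AE p in lebesgue_on (\<Omega> \<times> {0<..<T}). w p = 0"
proof (rule trace_zero[OF _ _ t[unfolded initial_trace_def] Basis_time _ w T, of "(-1) *\<^sub>R (0, 1)" "-1"])
  have bd: "bounded (\<Omega> \<times> {0<..<T})" using \<Omega>(2) by (intro bounded_Times) auto
  show "open (\<Omega> \<times> {0<..<T})" using \<Omega> by (intro open_Times) auto
  show "emeasure lborel (\<Omega> \<times> {0<..<T}) < \<infinity>" using emeasure_bounded_finite[OF bd] by simp
  show "\<exists>s y. 0 < s \<and> s \<le> T \<and> (\<forall>\<sigma>. 0 \<le> \<sigma> \<and> \<sigma> < s \<longrightarrow> p + \<sigma> *\<^sub>R (-1) *\<^sub>R (0, 1) \<in> \<Omega> \<times> {0<..<T}) \<and> y \<in> space (lebesgue_on \<Omega>) \<and> (y, 0) = p + s *\<^sub>R (-1) *\<^sub>R (0, 1)"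
    if "p \<in> \<Omega> \<times> {0<..<T}" for p
    using that by (intro exI[of _ "snd p"] exI[of _ "fst p"]) (auto simp: mem_Times_iff prod_eq_iff space_restrict_space)
  fix \<eta> :: real assume \<eta>: "\<eta> > 0"
  show "\<exists>\<delta>>0. \<forall>E\<in>sets (lebesgue_on \<Omega>). emeasure (lebesgue_on \<Omega>) E < ennreal \<delta> \<longrightarrow>
     (\<exists>S\<in>sets (borel :: ('a \<times> real) measure). emeasure lborel S < ennreal \<eta> \<and> (\<forall>y\<in>E. \<forall>s p. 0 \<le> s \<and> s \<le> T \<and> (y, 0) = p + s *\<^sub>R (-1) *\<^sub>R (0, 1) \<longrightarrow> p \<in> S))"
  proof (intro exI[of _ "\<eta> / T"] conjI ballI impI)
    show "0 < \<eta> / T" using \<eta> T by simp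
    fix E assume E: "E \<in> sets (lebesgue_on \<Omega>)" "emeasure (lebesgue_on \<Omega>) E < ennreal (\<eta> / T)"
    have \<Omega>l: "\<Omega> \<in> sets lebesgue" using \<Omega>(1) by auto
    have El: "E \<in> sets lebesgue" "E \<subseteq> \<Omega>" using E(1) \<Omega>l by (auto simp: sets_restrict_space_iff)
    have "emeasure lebesgue E < ennreal (\<eta> / T)"
      using E(2) El \<Omega>l by (simp add: emeasure_restrict_space)
    \<comment> \<open>The set \<open>E\<close> is only Lebesgue measurable; its Borel hull of equal
      measure makes the swept set Borel.\<close>
    moreover obtain E' where E': "E' \<in> sets lborel" "E \<subseteq> E'" "emeasure lebesgue E = emeasure lborel E'"
      using completion_upper[OF El(1)] by blast
    ultimately have less: "emeasure lborel E' < ennreal (\<eta> / T)" by simp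
    have "emeasure (lborel \<Otimes>\<^sub>M lborel) (E' \<times> {0..T}) = emeasure lborel E' * emeasure lborel {0..T}"
      using E' by (intro lborel.emeasure_pair_measure_Times) auto
    then have "emeasure lborel (E' \<times> {0..T}) = emeasure lborel E' * ennreal T" using T by (simp add: lborel_prod)
    also have "\<dots> < ennreal (\<eta> / T) * ennreal T"
      using less T by (intro ennreal_mult_strict_right_mono) auto
    also have "\<dots> = ennreal \<eta>" using T \<eta> by (simp add: ennreal_mult[symmetric])
    finally have "emeasure lborel (E' \<times> {0..T}) < ennreal \<eta>" .
    moreover have "E' \<times> {0..T} \<in> sets borel" using E'(1) by (intro borel_Times) auto
    moreover have "p \<in> E' \<times> {0..T}" if "y \<in> E" "0 \<le> s" "s \<le> T" "(y, 0) = p + s *\<^sub>R (-1) *\<^sub>R (0, 1)" for y s p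
    proof -
      have "p = (y, s)" using that(4) by (auto simp: prod_eq_iff)
      then show ?thesis using that E'(2) by auto
    qed
    ultimately show "\<exists>S\<in>sets (borel :: ('a \<times> real) measure). emeasure lborel S < ennreal \<eta> \<and> (\<forall>y\<in>E. \<forall>s p. 0 \<le> s \<and> s \<le> T \<and> (y, 0) = p + s *\<^sub>R (-1) *\<^sub>R (0, 1) \<longrightarrow> p \<in> S)"
      by blast
  qed
qed simp

subsection \<open>Admissible classes\<close>

definition stationary :: "('k \<Rightarrow> 'a \<Rightarrow> real) \<Rightarrow> 'k \<Rightarrow> 'a \<times> real \<Rightarrow> real" where
  "stationary v0 i p = v0 i (fst p)"

definition midpoint_fun :: "('k \<Rightarrow> 'p \<Rightarrow> real) \<Rightarrow> ('k \<Rightarrow> 'p \<Rightarrow> real) \<Rightarrow> 'k \<Rightarrow> 'p \<Rightarrow> real" where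
  "midpoint_fun v w i p = (1/2) * v i p + (1/2) * w i p"

definition truncate :: "('k \<Rightarrow> 'p \<Rightarrow> real) \<Rightarrow> 'k \<Rightarrow> 'p \<Rightarrow> real" where
  "truncate v i p = clamp01 (v i p)"

text \<open>The only properties of the three classes that the variational argument uses.\<close>

definition admissible :: "'a::euclidean_space set \<Rightarrow> ('k \<Rightarrow> 'a \<Rightarrow> real) \<Rightarrow> ('k \<Rightarrow> 'a \<times> real \<Rightarrow> real) set \<Rightarrow> bool" where
  "admissible \<Omega> v0 W \<longleftrightarrow> W \<subseteq> \<U> \<Omega> \<and> stationary v0 \<in> W \<and>
    (\<forall>v\<in>W. \<forall>w\<in>W. midpoint_fun v w \<in> W) \<and> (\<forall>v\<in>W. truncate v \<in> W) \<and>
    (\<forall>y v. (\<forall>n::nat. y n \<in> W) \<longrightarrow> v \<in> \<U> \<Omega> \<longrightarrow>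
       (\<forall>T>0. \<forall>i. (\<lambda>n. h1d (\<Omega> \<times> {0<..<T}) (y n i) (v i)) \<longlonglongrightarrow> 0) \<longrightarrow> v \<in> W) \<and>
    (\<forall>v\<in>W. \<forall>i. (\<forall>c\<in>Basis. has_weak_deriv (\<Omega> \<times> {0<..}) c (\<lambda>p. v i p - truncate v i p) (\<lambda>_. 0)) \<longrightarrow>
       (AE p in lborel. p \<in> \<Omega> \<times> {0<..} \<longrightarrow> v i p = truncate v i p))"

lemma open_cylinder: "open \<Omega> \<Longrightarrow> open (\<Omega> \<times> {0<..<T::real})" "open \<Omega> \<Longrightarrow> open (\<Omega> \<times> {0::real<..})"
  by (auto intro: open_Times)

lemma \<U>_D: "v \<in> \<U> \<Omega> \<Longrightarrow> T > 0 \<Longrightarrow> v i \<in> H1_space (\<Omega> \<times> {0<..<T})"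
  by (simp add: \<U>_def)

lemma stationary_\<U>:
  assumes "open \<Omega>" "\<And>i. v0 i \<in> H1_space \<Omega>" shows "stationary v0 \<in> \<U> \<Omega>"
  unfolding \<U>_def stationary_def[abs_def] using H1_stationary(1)[OF assms(1) _ assms(2)] by auto

lemma midpoint_\<U>:
  assumes "open \<Omega>" "v \<in> \<U> \<Omega>" "w \<in> \<U> \<Omega>" shows "midpoint_fun v w \<in> \<U> \<Omega>"
  unfolding \<U>_def midpoint_fun_def[abs_def]
  using H1_lin(1)[OF open_cylinder(1)[OF assms(1)] \<U>_D[OF assms(2)] \<U>_D[OF assms(3)]] by blast

lemma truncate_\<U>:
  assumes "open \<Omega>" "v \<in> \<U> \<Omega>" shows "truncate v \<in> \<U> \<Omega>"
  unfolding \<U>_def truncate_def[abs_def]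
  using H1_clamp01(1)[OF open_cylinder(1)[OF assms(1)] \<U>_D[OF assms(2)]] by blast

lemma AE_cylinderI:
  assumes "\<And>n. AE p in lborel. p \<in> \<Omega> \<times> {0<..<real (Suc n)} \<longrightarrow> P p"
  shows "AE p in lborel. p \<in> \<Omega> \<times> {0<..} \<longrightarrow> P p"
proof -
  have "AE p in lborel. \<forall>n. (p \<in> \<Omega> \<times> {0<..<real (Suc n)} \<longrightarrow> P p)"
    unfolding AE_all_countable using assms by blast
  then show ?thesis unfolding cylinder_Union[symmetric] by eventually_elim blast
qed

lemma half_half: "(1/2) * x + (1/2) * x = (x::real)" by simp

text \<open>The stationary extension of \<open>v0\<close> has trace \<open>v0\<close> and values in
  [0, 1], so it serves as the reference function that makes truncation preserve the trace. For the
  last condition the time derivative alone is used, separately on each bounded cylinder.\<close>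

lemma admissible_initial:
  fixes \<Omega> :: "'a::euclidean_space set"
  assumes \<Omega>: "open \<Omega>" "bounded \<Omega>" and v0: "\<And>i. v0 i \<in> H1_space \<Omega>"
    and v01: "\<And>i. AE x in lebesgue_on \<Omega>. 0 \<le> v0 i x \<and> v0 i x \<le> 1" and g0: "\<And>i. boundary_trace \<Omega> (v0 i) (g0 i)"
  shows "admissible \<Omega> v0 (\<U>_initial \<Omega> v0)"
  unfolding admissible_def
proof (intro conjI ballI allI impI)
  have st: "initial_trace \<Omega> T (stationary v0 i) (v0 i)" if "T > 0" for T i
    using initial_trace_stationary[OF \<Omega>(1) that g0[of i]] by (simp add: stationary_def[abs_def])
  have st01: "AE p in lebesgue_on (\<Omega> \<times> {0<..<T}). 0 \<le> stationary v0 i p \<and> stationary v0 i p \<le> 1" for T i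
    using AE_lborel_fst[OF v01[of i, unfolded AE_lebesgue_on_open[OF \<Omega>(1)]]]
    unfolding AE_lebesgue_on_open[OF open_cylinder(1)[OF \<Omega>(1)]] by eventually_elim (auto simp: stationary_def)
  show "\<U>_initial \<Omega> v0 \<subseteq> \<U> \<Omega>" by (auto simp: \<U>_initial_def)
  show "stationary v0 \<in> \<U>_initial \<Omega> v0"
    using stationary_\<U>[OF \<Omega>(1) v0] st by (simp add: \<U>_initial_def)
  show "midpoint_fun v w \<in> \<U>_initial \<Omega> v0" if "v \<in> \<U>_initial \<Omega> v0" "w \<in> \<U>_initial \<Omega> v0" for v w
  proof -
    have "initial_trace \<Omega> T (midpoint_fun v w i) (v0 i)" if T: "T > 0" for T i
    proof -
      have "has_trace (\<Omega> \<times> {0<..<T}) (lebesgue_on \<Omega>) (\<lambda>x. (x, 0)) (\<lambda>p. (1/2) * v i p + (1/2) * w i p) (\<lambda>y. (1/2) * v0 i y + (1/2) * v0 i y)"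
        by (rule has_trace_lin[OF open_cylinder(1)[OF \<Omega>(1)]])
          (use \<open>v \<in> _\<close> \<open>w \<in> _\<close> T in \<open>auto simp: \<U>_initial_def initial_trace_def\<close>)
      then show ?thesis unfolding half_half by (simp add: initial_trace_def midpoint_fun_def[abs_def])
    qed
    then show ?thesis using that midpoint_\<U>[OF \<Omega>(1)] by (auto simp: \<U>_initial_def)
  qed
  have tr: "initial_trace \<Omega> T (truncate v i) (v0 i)" "initial_trace \<Omega> T (\<lambda>p. v i p - truncate v i p) (\<lambda>_. 0)"
    if v: "v \<in> \<U>_initial \<Omega> v0" and T: "T > 0" for v T i
  proof -
    have t: "has_trace (\<Omega> \<times> {0<..<T}) (lebesgue_on \<Omega>) (\<lambda>x. (x, 0)) (v i) (v0 i)"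
      using v T by (auto simp: \<U>_initial_def initial_trace_def)
    note c = has_trace_clamp01_same[OF open_cylinder(1)[OF \<Omega>(1)] t st[OF T, unfolded initial_trace_def] st01]
    show "initial_trace \<Omega> T (truncate v i) (v0 i)" "initial_trace \<Omega> T (\<lambda>p. v i p - truncate v i p) (\<lambda>_. 0)"
      using c by (simp_all add: initial_trace_def truncate_def[abs_def])
  qed
  show "truncate v \<in> \<U>_initial \<Omega> v0" if "v \<in> \<U>_initial \<Omega> v0" for v
    using tr(1)[OF that] truncate_\<U>[OF \<Omega>(1), of v] that by (auto simp: \<U>_initial_def)
  show "v \<in> \<U>_initial \<Omega> v0" if y: "\<forall>n. y n \<in> \<U>_initial \<Omega> v0" and v: "v \<in> \<U> \<Omega>"
    and lim: "\<forall>T>0. \<forall>i. (\<lambda>n. h1d (\<Omega> \<times> {0<..<T}) (y n i) (v i)) \<longlonglongrightarrow> 0" for y v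
  proof -
    have "initial_trace \<Omega> T (v i) (v0 i)" if T: "T > 0" for T i
      unfolding initial_trace_def
      by (rule has_trace_closed[OF open_cylinder(1)[OF \<Omega>(1)] _ \<U>_D[OF v T] lim[rule_format, OF T]])
        (use y T in \<open>auto simp: \<U>_initial_def initial_trace_def\<close>)
    then show ?thesis using v by (simp add: \<U>_initial_def)
  qed
  show "AE p in lborel. p \<in> \<Omega> \<times> {0<..} \<longrightarrow> v i p = truncate v i p"
    if v: "v \<in> \<U>_initial \<Omega> v0" and w: "\<forall>c\<in>Basis. has_weak_deriv (\<Omega> \<times> {0<..}) c (\<lambda>p. v i p - truncate v i p) (\<lambda>_. 0)" for v i
  proof (rule AE_cylinderI)
    fix n
    have "has_weak_deriv (\<Omega> \<times> {0<..<real (Suc n)}) (0, 1) (\<lambda>p. v i p - truncate v i p) (\<lambda>_. 0)"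
      by (rule has_weak_deriv_subset[OF open_cylinder(2,1)[OF \<Omega>(1)] _ bspec[OF w Basis_time]]) auto
    from initial_trace_zero[OF \<Omega> _ tr(2)[OF v] this]
    show "AE p in lborel. p \<in> \<Omega> \<times> {0<..<real (Suc n)} \<longrightarrow> v i p = truncate v i p"
      unfolding AE_lebesgue_on_open[OF open_cylinder(1)[OF \<Omega>(1)]] by simp
  qed
qed

text \<open>Membership is a condition on almost every time slice, so each property is checked on
  slices, with \<open>v0\<close> itself as the reference function for truncation.\<close>

lemma admissible_boundary:
  fixes \<Omega> :: "'a::euclidean_space set" and v0 g0 :: "'k::finite \<Rightarrow> 'a \<Rightarrow> real"
  assumes \<Omega>: "open \<Omega>" "bounded \<Omega>" and v0: "\<And>i. v0 i \<in> H1_space \<Omega>"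
    and v01: "\<And>i. AE x in lebesgue_on \<Omega>. 0 \<le> v0 i x \<and> v0 i x \<le> 1" and g0: "\<And>i. boundary_trace \<Omega> (v0 i) (g0 i)"
  shows "admissible \<Omega> v0 (\<U>_boundary \<Omega> g0)"
  unfolding admissible_def
proof (intro conjI ballI allI impI)
  have D: "AE t in lborel. t > 0 \<longrightarrow> (\<forall>i. boundary_trace \<Omega> (\<lambda>x. v i (x, t)) (g0 i))" if "v \<in> \<U>_boundary \<Omega> g0" for v
    using that by (simp add: \<U>_boundary_def AE_completion_iff)
  have I: "v \<in> \<U>_boundary \<Omega> g0" if "v \<in> \<U> \<Omega>" "AE t in lborel. t > 0 \<longrightarrow> (\<forall>i. boundary_trace \<Omega> (\<lambda>x. v i (x, t)) (g0 i))" for v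
    using that by (simp add: \<U>_boundary_def AE_completion_iff)
  show sub: "\<U>_boundary \<Omega> g0 \<subseteq> \<U> \<Omega>" by (auto simp: \<U>_boundary_def)
  show "stationary v0 \<in> \<U>_boundary \<Omega> g0"
    by (rule I[OF stationary_\<U>[OF \<Omega>(1) v0]]) (simp add: stationary_def g0)
  show "midpoint_fun v w \<in> \<U>_boundary \<Omega> g0" if v: "v \<in> \<U>_boundary \<Omega> g0" and w: "w \<in> \<U>_boundary \<Omega> g0" for v w
  proof (rule I)
    show "midpoint_fun v w \<in> \<U> \<Omega>" using midpoint_\<U>[OF \<Omega>(1)] v w sub by auto
    show "AE t in lborel. t > 0 \<longrightarrow> (\<forall>i. boundary_trace \<Omega> (\<lambda>x. midpoint_fun v w i (x, t)) (g0 i))"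
      using D[OF v] D[OF w]
    proof eventually_elim
      case (elim t)
      show ?case
      proof (intro impI allI)
        fix i assume "t > 0"
        then have "has_trace \<Omega> (surface_measure \<Omega>) (\<lambda>x. x) (\<lambda>x. (1/2) * v i (x, t) + (1/2) * w i (x, t)) (\<lambda>y. (1/2) * g0 i y + (1/2) * g0 i y)"
          using elim by (intro has_trace_lin[OF \<Omega>(1)]) (auto simp: boundary_trace_def)
        then show "boundary_trace \<Omega> (\<lambda>x. midpoint_fun v w i (x, t)) (g0 i)"
          unfolding half_half by (simp add: boundary_trace_def midpoint_fun_def)
      qed
    qed
  qed
  have tr: "boundary_trace \<Omega> (\<lambda>x. clamp01 (f x)) (g0 i)" "boundary_trace \<Omega> (\<lambda>x. f x - clamp01 (f x)) (\<lambda>_. 0)"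
    if "boundary_trace \<Omega> f (g0 i)" for f i
    using has_trace_clamp01_same[OF \<Omega>(1) that[unfolded boundary_trace_def] g0[unfolded boundary_trace_def] v01]
    by (simp_all add: boundary_trace_def)
  show "truncate v \<in> \<U>_boundary \<Omega> g0" if v: "v \<in> \<U>_boundary \<Omega> g0" for v
  proof (rule I)
    show "truncate v \<in> \<U> \<Omega>" using truncate_\<U>[OF \<Omega>(1)] v sub by auto
    show "AE t in lborel. t > 0 \<longrightarrow> (\<forall>i. boundary_trace \<Omega> (\<lambda>x. truncate v i (x, t)) (g0 i))"
      using D[OF v] by eventually_elim (auto simp: truncate_def intro: tr(1))
  qed
  show "v \<in> \<U>_boundary \<Omega> g0" if y: "\<forall>n. y n \<in> \<U>_boundary \<Omega> g0" and v: "v \<in> \<U> \<Omega>"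
    and lim: "\<forall>T>0. \<forall>i. (\<lambda>n. h1d (\<Omega> \<times> {0<..<T}) (y n i) (v i)) \<longlonglongrightarrow> 0" for y v
  proof (rule I[OF v])
    have yt: "AE t in lborel. \<forall>n. t > 0 \<longrightarrow> (\<forall>i. boundary_trace \<Omega> (\<lambda>x. y n i (x, t)) (g0 i))"
      unfolding AE_all_countable using D y by blast
    \<comment> \<open>Convergence of slices is available only along a subsequence depending on
      \<open>m\<close> and \<open>i\<close>. This suffices, since every term of the sequence has the
      same trace \<open>g0 i\<close>.\<close>
    have "AE t in lborel. t \<in> {0<..<real (Suc m)} \<longrightarrow> boundary_trace \<Omega> (\<lambda>x. v i (x, t)) (g0 i)" for m i
    proof -
      have T: "real (Suc m) > 0" by simp
      have yU: "y n i \<in> H1_space (\<Omega> \<times> {0<..<real (Suc m)})" for n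
        using \<U>_D[OF subsetD[OF sub spec[OF y]] T] .
      obtain r where r: "strict_mono r" "AE t in lborel. t \<in> {0<..<real (Suc m)} \<longrightarrow> (\<lambda>x. v i (x, t)) \<in> H1_space \<Omega> \<and>
        (\<lambda>n. h1d \<Omega> (\<lambda>x. y (r n) i (x, t)) (\<lambda>x. v i (x, t))) \<longlonglongrightarrow> 0"
        using slice_H1_conv[OF \<Omega>(1) open_greaterThanLessThan yU \<U>_D[OF v T] lim[rule_format, OF T]] by blast
      from r(2) yt show ?thesis
      proof eventually_elim
        case (elim t)
        show ?case
        proof
          assume t: "t \<in> {0<..<real (Suc m)}"
          have "has_trace \<Omega> (surface_measure \<Omega>) (\<lambda>x. x) (\<lambda>x. y (r n) i (x, t)) (g0 i)" for n
            using elim(2)[rule_format, of "r n" i] t by (simp add: boundary_trace_def)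
          from has_trace_closed[where v = "\<lambda>n x. y (r n) i (x, t)", OF \<Omega>(1) this] elim(1) t
          show "boundary_trace \<Omega> (\<lambda>x. v i (x, t)) (g0 i)"
            unfolding boundary_trace_def by blast
        qed
      qed
    qed
    then have "AE t in lborel. \<forall>m. \<forall>i. t \<in> {0<..<real (Suc m)} \<longrightarrow> boundary_trace \<Omega> (\<lambda>x. v i (x, t)) (g0 i)"
      unfolding AE_all_countable by blast
    then show "AE t in lborel. t > 0 \<longrightarrow> (\<forall>i. boundary_trace \<Omega> (\<lambda>x. v i (x, t)) (g0 i))"
    proof eventually_elim
      case (elim t)
      obtain m where "t < real (Suc m)" using reals_Archimedean2[of t] by (metis less_trans of_nat_less_iff lessI)
      then show ?case using elim by auto
    qed
  qed
  show "AE p in lborel. p \<in> \<Omega> \<times> {0<..} \<longrightarrow> v i p = truncate v i p"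
    if v: "v \<in> \<U>_boundary \<Omega> g0" and w: "\<forall>c\<in>Basis. has_weak_deriv (\<Omega> \<times> {0<..}) c (\<lambda>p. v i p - truncate v i p) (\<lambda>_. 0)" for v i
  proof (rule AE_cylinderI)
    fix n
    let ?I = "{0<..<real (Suc n)}"
    let ?w = "\<lambda>p. v i p - truncate v i p"
    have Uo: "open (\<Omega> \<times> ?I)" by (rule open_cylinder(1)[OF \<Omega>(1)])
    then have Ub: "\<Omega> \<times> ?I \<in> sets borel" by auto
    have H: "v i \<in> H1_space (\<Omega> \<times> ?I)" "truncate v i \<in> H1_space (\<Omega> \<times> ?I)"
      using v sub truncate_\<U>[OF \<Omega>(1), of v] by (auto intro!: \<U>_D)
    have wL2: "?w \<in> L2_space (lebesgue_on (\<Omega> \<times> ?I))" by (rule L2_diff[OF H1_D(1)[OF Uo H(1)] H1_D(1)[OF Uo H(2)]])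
    have z: "(\<lambda>_. 0) \<in> L2_space (lebesgue_on (\<Omega> \<times> ?I))" by (simp add: L2_space_def)
    have sl: "AE t in lborel. \<forall>b\<in>Basis. t \<in> ?I \<longrightarrow> has_weak_deriv \<Omega> b (\<lambda>x. ?w (x, t)) (\<lambda>x. 0)"
    proof (rule AE_finite_allI)
      fix b :: 'a assume "b \<in> Basis"
      then have bb: "(b, 0 :: real) \<in> Basis" by (rule Basis_space)
      have "has_weak_deriv (\<Omega> \<times> ?I) (b, 0) ?w (\<lambda>_. 0)"
        by (rule has_weak_deriv_subset[OF open_cylinder(2,1)[OF \<Omega>(1)] _ bspec[OF w bb]]) auto
      from slice_weak_deriv[OF \<Omega>(1) open_greaterThanLessThan this wL2 z]
      show "AE t in lborel. t \<in> ?I \<longrightarrow> has_weak_deriv \<Omega> b (\<lambda>x. ?w (x, t)) (\<lambda>x. 0)" .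
    qed simp
    \<comment> \<open>Vanishing on almost every slice gives vanishing a.e. only for a measurable
      exceptional set, hence the Borel representative.\<close>
    obtain w' where w': "w' \<in> borel_measurable borel" "ae_eq (\<Omega> \<times> ?I) ?w w'"
      using lebesgue_on_borel_rep[OF Ub L2_D(1)[OF wL2]] by blast
    have "AE p in lborel. p \<in> \<Omega> \<times> ?I \<longrightarrow> w' p = 0"
    proof (rule AE_lborel_from_slices)
      have "{p. \<not> (p \<in> \<Omega> \<times> ?I \<longrightarrow> w' p = 0)} = (\<Omega> \<times> ?I) \<inter> w' -` (- {0})" by auto
      moreover have "w' -` (- {0}) \<in> sets borel" using measurable_sets[OF w'(1), of "- {0}"] by simp
      ultimately show "{p. \<not> (p \<in> \<Omega> \<times> ?I \<longrightarrow> w' p = 0)} \<in> sets borel" using Ub by simp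
      show "AE t in lborel. AE x in lborel. (x, t) \<in> \<Omega> \<times> ?I \<longrightarrow> w' (x, t) = 0"
        using sl D[OF v] AE_lborel_slices[OF w'(2)]
      proof eventually_elim
        case (elim t)
        show ?case
        proof (cases "t \<in> ?I")
          case True
          have "boundary_trace \<Omega> (\<lambda>x. ?w (x, t)) (\<lambda>_. 0)"
            using elim(2) True tr(2)[of "\<lambda>x. v i (x, t)" i] by (simp add: truncate_def)
          from boundary_trace_zero[OF \<Omega> this] elim(1) True have "AE x in lebesgue_on \<Omega>. ?w (x, t) = 0" by blast
          with elim(3) show ?thesis unfolding AE_lebesgue_on_open[OF \<Omega>(1)] by eventually_elim auto
        next
          case False
          then have "(x, t) \<notin> \<Omega> \<times> ?I" for x by simp
          then show ?thesis by (intro AE_I2) blast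
        qed
      qed
    qed
    with w'(2) show "ae_eq (\<Omega> \<times> ?I) (v i) (truncate v i)" by eventually_elim auto
  qed
qed

lemma admissible_Int:
  assumes a: "admissible \<Omega> v0 V" and b: "admissible \<Omega> v0 W"
  shows "admissible \<Omega> v0 (V \<inter> W)"
  unfolding admissible_def
proof (intro conjI ballI allI impI)
  note a' = a[unfolded admissible_def] and b' = b[unfolded admissible_def]
  show "V \<inter> W \<subseteq> \<U> \<Omega>" "stationary v0 \<in> V \<inter> W" using a' b' by auto
  show "midpoint_fun v w \<in> V \<inter> W" if "v \<in> V \<inter> W" "w \<in> V \<inter> W" for v w using that a' b' by simp
  show "truncate v \<in> V \<inter> W" if "v \<in> V \<inter> W" for v using that a' b' by simp
  show "v \<in> V \<inter> W" if "\<forall>n. y n \<in> V \<inter> W" "v \<in> \<U> \<Omega>"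
    "\<forall>T>0. \<forall>i. (\<lambda>n. h1d (\<Omega> \<times> {0<..<T}) (y n i) (v i)) \<longlonglongrightarrow> 0" for y v
  proof
    show "v \<in> V" using a'[THEN conjunct2, THEN conjunct2, THEN conjunct2, THEN conjunct2, THEN conjunct1, rule_format, of y v] that by auto
    show "v \<in> W" using b'[THEN conjunct2, THEN conjunct2, THEN conjunct2, THEN conjunct2, THEN conjunct1, rule_format, of y v] that by auto
  qed
  show "AE p in lborel. p \<in> \<Omega> \<times> {0<..} \<longrightarrow> v i p = truncate v i p" if "v \<in> V \<inter> W"
    "\<forall>c\<in>Basis. has_weak_deriv (\<Omega> \<times> {0<..}) c (\<lambda>p. v i p - truncate v i p) (\<lambda>_. 0)" for v i
    using a'[THEN conjunct2, THEN conjunct2, THEN conjunct2, THEN conjunct2, THEN conjunct2, rule_format, of v i] that by auto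
qed

subsection \<open>The energy\<close>

text \<open>Monotonicity outside [0, 1] enters through \<open>F_left\<close> and
  \<open>F_right\<close>: outside the interval \<open>F i\<close> does not exceed its value at the
  nearer endpoint, so truncation cannot decrease it.\<close>

locale energy_setting =
  fixes \<Omega> :: "'a::euclidean_space set" and A :: "real^'k^'k" and F :: "'k::finite \<Rightarrow> real \<Rightarrow> real" and \<epsilon> \<beta> :: real
  assumes open_\<Omega>: "open \<Omega>" and bounded_\<Omega>: "bounded \<Omega>" and A_nonneg: "\<And>i j. 0 \<le> A $ i $ j"
    and F_cont: "\<And>i. continuous_on UNIV (F i)" and F_left: "\<And>i s. s < 0 \<Longrightarrow> F i s \<le> F i 0"
    and F_right: "\<And>i s. 1 < s \<Longrightarrow> F i s \<le> F i 1" and \<epsilon>: "0 < \<epsilon>" "\<epsilon> < 1" and \<beta>: "0 < \<beta>"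
begin

abbreviation "Q \<equiv> \<Omega> \<times> {0::real<..}"
abbreviation "M \<equiv> lebesgue_on Q"
abbreviation "QT T \<equiv> \<Omega> \<times> {0::real<..<T}"
abbreviation "\<E> \<equiv> energy \<Omega> A F \<epsilon> \<beta>"
abbreviation "\<I> \<equiv> energy_integrand \<Omega> A F \<epsilon> \<beta>"

definition wt :: "'a \<times> real \<Rightarrow> real" where "wt p = exp (- snd p / \<epsilon>) / \<epsilon>"

text \<open>The coefficient of the squared derivative in direction \<open>c\<close>: basis vectors
  with second component 0 are spatial, and the remaining one is the time direction. It merges both
  kinds of derivatives into one sum over \<open>Basis\<close>.\<close>

definition \<kappa> :: "'a \<times> real \<Rightarrow> real" where "\<kappa> c = (if snd c = 0 then 1 else \<epsilon>)"

definition grad_density :: "('k \<Rightarrow> 'a \<times> real \<Rightarrow> real) \<Rightarrow> 'a \<times> real \<Rightarrow> real" where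
  "grad_density v p = (\<Sum>i\<in>UNIV. \<Sum>c\<in>Basis. \<kappa> c * (weak_deriv Q c (v i) p)\<^sup>2)"

definition pot :: "('k \<Rightarrow> 'a \<times> real \<Rightarrow> real) \<Rightarrow> 'a \<times> real \<Rightarrow> real" where
  "pot v p = \<beta> / 2 * (\<Sum>i\<in>UNIV. \<Sum>j\<in>UNIV. A $ i $ j * (v i p)\<^sup>2 * (v j p)\<^sup>2) - 2 * (\<Sum>i\<in>UNIV. F i (v i p))"

lemma open_Q: "open Q" and open_QT: "open (QT T)"
  using open_\<Omega> by (rule open_cylinder)+

lemma Q_borel: "Q \<in> sets borel" and QT_borel: "QT T \<in> sets borel"
  using open_Q open_QT by auto

lemma wt_pos: "0 < wt p" using \<epsilon> by (simp add: wt_def)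

lemma \<kappa>_bounds: "\<epsilon> \<le> \<kappa> c" "0 < \<kappa> c" using \<epsilon> by (auto simp: \<kappa>_def)

lemma sum_Basis_prod: "(\<Sum>c\<in>(Basis :: ('a \<times> real) set). f c) = (\<Sum>b\<in>Basis. f (b, 0)) + f (0, 1)"
proof -
  have "(\<Sum>c\<in>(\<lambda>b. (b, 0)) ` (Basis :: 'a set) \<union> {(0, 1)}. f c) = (\<Sum>c\<in>(\<lambda>b. (b, 0)) ` (Basis :: 'a set). f c) + (\<Sum>c\<in>{(0, 1)}. f c)"
    by (intro sum.union_disjoint) auto
  also have "(\<Sum>c\<in>(\<lambda>b. (b, 0)) ` (Basis :: 'a set). f c) = (\<Sum>b\<in>Basis. f (b, 0))"
    by (subst sum.reindex) (auto simp: inj_on_def)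
  finally show ?thesis by (simp add: Basis_prod_def)
qed

lemma integrand_eq: "\<I> v p = wt p * grad_density v p + wt p * pot v p"
  unfolding energy_integrand_def wt_def grad_density_def pot_def sum_Basis_prod time_deriv_def grad_sq_def
  by (simp add: \<kappa>_def sum.distrib sum_distrib_left algebra_simps)

lemma grad_density_nonneg: "0 \<le> grad_density v p"
  unfolding grad_density_def using \<kappa>_bounds(2) by (intro sum_nonneg mult_nonneg_nonneg) (auto intro: less_imp_le)

lemma wt_measurable: "wt \<in> borel_measurable borel"
  unfolding wt_def using \<epsilon> by (intro borel_measurable_continuous_onI) (auto intro!: continuous_intros)

lemma borel_imp_M:
  fixes f :: "'a \<times> real \<Rightarrow> real"
  assumes "f \<in> borel_measurable borel" shows "f \<in> borel_measurable M"
  by (rule lebesgue_on_measurable_cong_AE[OF Q_borel assms]) auto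

text \<open>By Tonelli the integral splits, and the weight has integral 1 over positive times, with
  primitive - exp (- t / \<epsilon>).\<close>

lemma wt_integrable_fst:
  fixes g :: "'a \<Rightarrow> real"
  assumes g: "integrable (lebesgue_on \<Omega>) g"
  shows "integrable M (\<lambda>p. wt p * g (fst p))"
proof -
  have \<Omega>b: "\<Omega> \<in> sets borel" using open_\<Omega> by auto
  obtain g' where g': "g' \<in> borel_measurable borel" "ae_eq \<Omega> g g'"
    using lebesgue_on_borel_rep[OF \<Omega>b borel_measurable_integrable[OF g]] by blast
  have ig: "integrable lborel (\<lambda>x. indicator \<Omega> x * g' x)" using g integrable_lebesgue_on_iff[OF \<Omega>b g'] by simp
  have fm: "(\<lambda>p :: 'a \<times> real. g' (fst p)) \<in> borel_measurable borel"
    by (rule measurable_compose[OF _ g'(1)]) (simp add: borel_measurable_continuous_onI continuous_on_fst)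
  then have m: "(\<lambda>p. wt p * g' (fst p)) \<in> borel_measurable borel" using wt_measurable by simp
  let ?\<Phi> = "\<lambda>p. indicator Q p * (wt p * g' (fst p))"
  let ?e = "\<lambda>t. ennreal (exp (- t / \<epsilon>) / \<epsilon>) * indicator {0..} t" and ?c = "\<integral>\<^sup>+x. ennreal (indicator \<Omega> x * \<bar>g' x\<bar>) \<partial>lborel"
  have "integrable lborel ?\<Phi>"
  proof (rule integrableI_bounded)
    have m': "(\<lambda>p. ennreal (norm (?\<Phi> p))) \<in> borel_measurable (lborel \<Otimes>\<^sub>M lborel)"
      using m Q_borel unfolding lborel_prod by simp
    have "(\<integral>\<^sup>+p. ennreal (norm (?\<Phi> p)) \<partial>lborel) = (\<integral>\<^sup>+t. \<integral>\<^sup>+x. ennreal (norm (?\<Phi> (x, t))) \<partial>lborel \<partial>lborel)"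
      using lborel_pair.nn_integral_snd[OF m'] by (simp add: lborel_prod)
    also have "\<dots> \<le> (\<integral>\<^sup>+t. ?e t * ?c \<partial>lborel)"
    proof (intro nn_integral_mono)
      fix t :: real
      have "(\<integral>\<^sup>+x. ennreal (norm (?\<Phi> (x, t))) \<partial>lborel) \<le> (\<integral>\<^sup>+x. ?e t * ennreal (indicator \<Omega> x * \<bar>g' x\<bar>) \<partial>lborel)"
        using \<epsilon> by (intro nn_integral_mono) (auto simp: wt_def abs_mult ennreal_mult[symmetric] split: split_indicator)
      also have "\<dots> = ?e t * ?c" using g' \<Omega>b by (intro nn_integral_cmult) simp
      finally show "(\<integral>\<^sup>+x. ennreal (norm (?\<Phi> (x, t))) \<partial>lborel) \<le> ?e t * ?c" .
    qed
    also have "\<dots> = (\<integral>\<^sup>+t. ?e t \<partial>lborel) * ?c"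
      by (intro nn_integral_multc) measurable
    also have "(\<integral>\<^sup>+t. ?e t \<partial>lborel) = ennreal (0 - (- exp (- 0 / \<epsilon>)))"
    proof (rule nn_integral_FTC_atLeast)
      show "((\<lambda>t. - exp (- t / \<epsilon>)) has_real_derivative exp (- t / \<epsilon>) / \<epsilon>) (at t)" for t
        using \<epsilon> by (auto intro!: derivative_eq_intros)
      have "LIM t at_top. - t / \<epsilon> :> at_bot"
        using filterlim_tendsto_neg_mult_at_bot[OF tendsto_const[of "- (1/\<epsilon>)"] _ filterlim_ident] \<epsilon> by simp
      then have "((\<lambda>t. - exp (- t / \<epsilon>)) \<longlongrightarrow> - 0) at_top"
        by (intro tendsto_minus filterlim_compose[OF exp_at_bot])
      then show "((\<lambda>t. - exp (- t / \<epsilon>)) \<longlongrightarrow> 0) at_top" by simp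
    qed (use \<epsilon> in auto)
    also have "ennreal (0 - (- exp (- 0 / \<epsilon>))) * ?c < \<infinity>"
      using ig by (simp add: integrable_iff_bounded abs_mult ennreal_mult_less_top)
    finally show "(\<integral>\<^sup>+p. ennreal (norm (?\<Phi> p)) \<partial>lborel) < \<infinity>" .
  qed (use m Q_borel in simp)
  moreover have "AE p in lborel. p \<in> Q \<longrightarrow> wt p * g (fst p) = wt p * g' (fst p)"
    using AE_lborel_fst[OF g'(2)] by eventually_elim auto
  ultimately show ?thesis using integrable_lebesgue_on_iff[OF Q_borel m] by simp
qed

lemma wt_integrable: "integrable M wt"
proof -
  have "integrable (lebesgue_on \<Omega>) (\<lambda>_. 1 :: real)"
    using integrable_lebesgue_on_iff[of \<Omega> "\<lambda>_. 1" "\<lambda>_. 1"] open_\<Omega> emeasure_bounded_finite[OF bounded_\<Omega>] by simp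
  from wt_integrable_fst[OF this] show ?thesis by simp
qed

text \<open>Functions in \<open>\<U>\<close> have derivatives on bounded cylinders; gluing them
  shows that the choice made by \<open>weak_deriv\<close> on the half cylinder is a genuine
  derivative.\<close>

lemma deriv_works:
  assumes v: "v \<in> \<U> \<Omega>" and c: "c \<in> Basis"
  shows "has_weak_deriv Q c (v i) (weak_deriv Q c (v i))"
proof -
  have "has_weak_deriv (QT (real (Suc n))) c (v i) (weak_deriv (QT (real (Suc n))) c (v i))" for n
    using H1_D(2)[OF open_QT \<U>_D[OF v] c] by simp
  from has_weak_deriv_glue[OF open_\<Omega> this] obtain G where "has_weak_deriv Q c (v i) G" by blast
  from weak_deriv_works(1)[OF open_Q this] show ?thesis .
qed

lemma deriv_QT:
  assumes v: "v \<in> \<U> \<Omega>" and c: "c \<in> Basis" and T: "T > 0"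
  shows "has_weak_deriv (QT T) c (v i) (weak_deriv Q c (v i))" "weak_deriv Q c (v i) \<in> L2_space (lebesgue_on (QT T))"
proof -
  show w: "has_weak_deriv (QT T) c (v i) (weak_deriv Q c (v i))"
    by (rule has_weak_deriv_subset[OF open_Q open_QT _ deriv_works[OF v c]]) auto
  show "weak_deriv Q c (v i) \<in> L2_space (lebesgue_on (QT T))"
    by (rule L2_cong_AE[OF H1_D(3)[OF open_QT \<U>_D[OF v T] c] has_weak_deriv_measurable(2)[OF open_QT w] weak_deriv_works(2)[OF open_QT w]])
qed

lemma v_measurable: "v \<in> \<U> \<Omega> \<Longrightarrow> v i \<in> borel_measurable M"
  by (rule has_weak_deriv_measurable(1)[OF open_Q deriv_works[OF _ Basis_time]])

lemma deriv_measurable: "v \<in> \<U> \<Omega> \<Longrightarrow> c \<in> Basis \<Longrightarrow> weak_deriv Q c (v i) \<in> borel_measurable M"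
  by (rule has_weak_deriv_measurable(2)[OF open_Q deriv_works])

lemma F_measurable: "F i \<in> borel_measurable borel"
  using F_cont by (rule borel_measurable_continuous_onI)

lemma grad_density_measurable: "v \<in> \<U> \<Omega> \<Longrightarrow> grad_density v \<in> borel_measurable M"
  unfolding grad_density_def[abs_def] using deriv_measurable
  by (intro borel_measurable_sum borel_measurable_times borel_measurable_power borel_measurable_const) auto

lemma pot_measurable_gen: "(\<And>i. v i \<in> borel_measurable M) \<Longrightarrow> pot v \<in> borel_measurable M"
  unfolding pot_def[abs_def]
  by (intro borel_measurable_sum borel_measurable_times borel_measurable_power borel_measurable_const borel_measurable_diff
      measurable_compose[OF _ F_measurable])

lemma pot_measurable: "v \<in> \<U> \<Omega> \<Longrightarrow> pot v \<in> borel_measurable M"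
  using v_measurable by (rule pot_measurable_gen)

lemma integrand_measurable: "v \<in> \<U> \<Omega> \<Longrightarrow> \<I> v \<in> borel_measurable M"
  unfolding integrand_eq[abs_def] using grad_density_measurable pot_measurable borel_imp_M[OF wt_measurable] by simp

lemma F_bound_ex: "\<exists>B\<ge>0. \<forall>i. \<forall>s\<in>{0..1}. \<bar>F i s\<bar> \<le> B"
proof -
  have "\<exists>B. \<forall>s\<in>{0..1}. \<bar>F i s\<bar> \<le> B" for i
    using compact_imp_bounded[OF compact_continuous_image[OF continuous_on_subset[OF F_cont[of i] subset_UNIV] compact_Icc[of 0 1]]]
    by (auto simp: bounded_iff)
  then obtain B where B: "\<And>i s. s \<in> {0..1} \<Longrightarrow> \<bar>F i s\<bar> \<le> B i" by metis
  have "B i \<le> (\<Sum>i\<in>UNIV. \<bar>B i\<bar>)" for i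
    using member_le_sum[of i UNIV "\<lambda>i. \<bar>B i\<bar>"] by simp
  then show ?thesis using B by (intro exI[of _ "\<Sum>i\<in>UNIV. \<bar>B i\<bar>"] conjI sum_nonneg allI ballI) (auto intro: order_trans[OF B])
qed

definition Fm :: real where "Fm = (SOME B. B \<ge> 0 \<and> (\<forall>i. \<forall>s\<in>{0..1}. \<bar>F i s\<bar> \<le> B))"

lemma Fm: "0 \<le> Fm" "s \<in> {0..1} \<Longrightarrow> \<bar>F i s\<bar> \<le> Fm"
  using someI_ex[OF F_bound_ex] unfolding Fm_def by blast+

lemma F_clamp: "F i s \<le> F i (clamp01 s)"
  using F_left[of s i] F_right[of s i] by (auto simp: clamp01_def min_def max_def)

lemma F_le: "F i s \<le> Fm"
  using F_clamp[of i s] Fm(2)[of "clamp01 s" i] by (auto simp: clamp01_def)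

definition C0 :: real where "C0 = 2 * (real CARD('k) * Fm)"

lemma C0_nonneg: "0 \<le> C0" using Fm(1) by (simp add: C0_def)

lemma A_sum_nonneg: "0 \<le> (\<Sum>i\<in>UNIV. \<Sum>j\<in>UNIV. A $ i $ j * (x i)\<^sup>2 * (x j)\<^sup>2)"
  using A_nonneg by (intro sum_nonneg) auto

lemma pot_lower: "- C0 \<le> pot v p"
proof -
  have "(\<Sum>i\<in>UNIV. F i (v i p)) \<le> (\<Sum>i\<in>(UNIV :: 'k set). Fm)" by (intro sum_mono F_le)
  moreover have "0 \<le> \<beta> / 2 * (\<Sum>i\<in>UNIV. \<Sum>j\<in>UNIV. A $ i $ j * (v i p)\<^sup>2 * (v j p)\<^sup>2)"
    using \<beta> by (intro mult_nonneg_nonneg A_sum_nonneg) simp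
  ultimately show ?thesis unfolding pot_def C0_def by simp
qed

definition C1 :: real where "C1 = C0 + \<beta> / 2 * (\<Sum>i\<in>UNIV. \<Sum>j\<in>UNIV. A $ i $ j)"

lemma pot_upper:
  assumes "\<And>i. 0 \<le> v i p \<and> v i p \<le> 1"
  shows "\<bar>pot v p\<bar> \<le> C1"
proof -
  have sq: "0 \<le> (v i p)\<^sup>2 \<and> (v i p)\<^sup>2 \<le> 1" for i using assms[of i] by (simp add: power_le_one)
  have "(\<Sum>i\<in>UNIV. \<Sum>j\<in>UNIV. A $ i $ j * (v i p)\<^sup>2 * (v j p)\<^sup>2) \<le> (\<Sum>i\<in>UNIV. \<Sum>j\<in>UNIV. A $ i $ j)"
  proof (intro sum_mono)
    fix i j
    have "A $ i $ j * ((v i p)\<^sup>2 * (v j p)\<^sup>2) \<le> A $ i $ j * 1"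
      using A_nonneg sq by (intro mult_left_mono mult_le_one) auto
    then show "A $ i $ j * (v i p)\<^sup>2 * (v j p)\<^sup>2 \<le> A $ i $ j" by (simp add: mult.assoc)
  qed
  then have "\<beta> / 2 * (\<Sum>i\<in>UNIV. \<Sum>j\<in>UNIV. A $ i $ j * (v i p)\<^sup>2 * (v j p)\<^sup>2) \<le> \<beta> / 2 * (\<Sum>i\<in>UNIV. \<Sum>j\<in>UNIV. A $ i $ j)"
    using \<beta> by (intro mult_left_mono) auto
  moreover have "0 \<le> \<beta> / 2 * (\<Sum>i\<in>UNIV. \<Sum>j\<in>UNIV. A $ i $ j)"
    using \<beta> A_nonneg by (intro mult_nonneg_nonneg sum_nonneg) auto
  moreover have "- Fm * real CARD('k) \<le> (\<Sum>i\<in>UNIV. F i (v i p))"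
  proof -
    have "(\<Sum>i\<in>(UNIV :: 'k set). - Fm) \<le> (\<Sum>i\<in>UNIV. F i (v i p))"
      using Fm(2) assms by (intro sum_mono) (auto simp: abs_le_iff minus_le_iff)
    then show ?thesis by (simp add: mult.commute)
  qed
  ultimately have "pot v p \<le> C1" unfolding pot_def C1_def C0_def by (simp add: algebra_simps)
  moreover have "- C1 \<le> pot v p" using pot_lower[of v p] \<open>0 \<le> \<beta> / 2 * _\<close> by (simp add: C1_def)
  ultimately show ?thesis by simp
qed

lemma pot_integrable:
  assumes m: "\<And>i. v i \<in> borel_measurable M" and b: "AE p in M. \<forall>i. 0 \<le> v i p \<and> v i p \<le> 1"
  shows "integrable M (\<lambda>p. wt p * pot v p)"
proof (rule Bochner_Integration.integrable_bound)
  show "integrable M (\<lambda>p. C1 * wt p)" using wt_integrable by auto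
  show "(\<lambda>p. wt p * pot v p) \<in> borel_measurable M"
    using pot_measurable_gen[OF m] borel_imp_M[OF wt_measurable] by simp
  show "AE p in M. norm (wt p * pot v p) \<le> norm (C1 * wt p)"
    using b
  proof eventually_elim
    case (elim p)
    have "\<bar>pot v p\<bar> \<le> C1" using elim by (intro pot_upper) auto
    then have "wt p * \<bar>pot v p\<bar> \<le> wt p * \<bar>C1\<bar>" using wt_pos[of p] by (intro mult_left_mono) auto
    then show ?case using wt_pos[of p] by (simp add: abs_mult mult.commute)
  qed
qed

text \<open>The quadratic part is nonnegative and the potential is at least -C0, so -C0 times the
  integrable weight bounds the integrand from below. The energy is therefore a genuine difference
  for every argument.\<close>

lemma neg_part_finite:
  "(\<integral>\<^sup>+p. ennreal (- \<I> v p) \<partial>M) \<le> ennreal (C0 * (LINT p|M. wt p))"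
proof -
  have "(\<integral>\<^sup>+p. ennreal (- \<I> v p) \<partial>M) \<le> (\<integral>\<^sup>+p. ennreal (C0 * wt p) \<partial>M)"
  proof (intro nn_integral_mono ennreal_leI)
    fix p
    have "wt p * (- C0) \<le> wt p * pot v p" using wt_pos[of p] by (intro mult_left_mono pot_lower) simp
    moreover have "0 \<le> wt p * grad_density v p" using wt_pos[of p] grad_density_nonneg[of v p] by simp
    ultimately show "- \<I> v p \<le> C0 * wt p" unfolding integrand_eq by (simp add: mult.commute)
  qed
  also have "\<dots> = ennreal (LINT p|M. C0 * wt p)"
    using wt_integrable wt_pos C0_nonneg by (intro nn_integral_eq_integral AE_I2 mult_nonneg_nonneg less_imp_le[OF wt_pos]) auto
  finally show ?thesis using wt_integrable by simp
qed

lemma energy_integrable: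
  assumes "integrable M (\<I> v)"
  shows "\<E> v = ereal (LINT p|M. \<I> v p)"
proof -
  have f: "(\<integral>\<^sup>+p. ennreal (\<I> v p) \<partial>M) < \<infinity>" "(\<integral>\<^sup>+p. ennreal (- \<I> v p) \<partial>M) < \<infinity>"
    using assms by (auto simp: real_integrable_def less_top)
  have e: "enn2ereal x = ereal (enn2real x)" if "x < \<infinity>" for x
    using that by (cases x) (auto simp: enn2ereal_ennreal)
  show ?thesis
    unfolding energy_def real_lebesgue_integral_def[OF assms] e[OF f(1)] e[OF f(2)] by simp
qed

lemma energy_finiteD:
  assumes v: "v \<in> \<U> \<Omega>" and f: "\<E> v < \<infinity>"
  shows "integrable M (\<I> v)"
  unfolding real_integrable_def
proof (intro conjI integrand_measurable[OF v])
  have n: "(\<integral>\<^sup>+p. ennreal (- \<I> v p) \<partial>M) < \<infinity>" using neg_part_finite[of v] by (auto intro: le_less_trans)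
  then show "(\<integral>\<^sup>+p. ennreal (- \<I> v p) \<partial>M) \<noteq> \<infinity>" by simp
  show "(\<integral>\<^sup>+p. ennreal (\<I> v p) \<partial>M) \<noteq> \<infinity>"
  proof
    assume "(\<integral>\<^sup>+p. ennreal (\<I> v p) \<partial>M) = \<infinity>"
    moreover obtain r where "(\<integral>\<^sup>+p. ennreal (- \<I> v p) \<partial>M) = ennreal r" "r \<ge> 0"
      using n by (cases "\<integral>\<^sup>+p. ennreal (- \<I> v p) \<partial>M") auto
    ultimately have "\<E> v = \<infinity>" unfolding energy_def by (simp add: enn2ereal_ennreal)
    with f show False by simp
  qed
qed

lemma energy_mono:
  assumes "AE p in M. \<I> w p \<le> \<I> v p"
  shows "\<E> w \<le> \<E> v"
proof -
  have "(\<integral>\<^sup>+p. ennreal (\<I> w p) \<partial>M) \<le> (\<integral>\<^sup>+p. ennreal (\<I> v p) \<partial>M)"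
    by (rule nn_integral_mono_AE) (use assms in \<open>eventually_elim, auto intro: ennreal_leI\<close>)
  moreover have "(\<integral>\<^sup>+p. ennreal (- \<I> v p) \<partial>M) \<le> (\<integral>\<^sup>+p. ennreal (- \<I> w p) \<partial>M)"
    by (rule nn_integral_mono_AE) (use assms in \<open>eventually_elim, auto intro: ennreal_leI\<close>)
  ultimately show ?thesis unfolding energy_def by (intro ereal_minus_mono) (auto simp: less_eq_ennreal.rep_eq)
qed

lemma energy_lower: "ereal (- (C0 * (LINT p|M. wt p))) \<le> \<E> v"
proof -
  have nn: "0 \<le> C0 * (LINT p|M. wt p)" using C0_nonneg wt_pos by (intro mult_nonneg_nonneg integral_nonneg_AE AE_I2 less_imp_le[OF wt_pos])
  have "enn2ereal (\<integral>\<^sup>+p. ennreal (- \<I> v p) \<partial>M) \<le> ereal (C0 * (LINT p|M. wt p))"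
    using neg_part_finite[of v] nn by (simp add: less_eq_ennreal.rep_eq enn2ereal_ennreal)
  then have "0 - ereal (C0 * (LINT p|M. wt p)) \<le> \<E> v"
    unfolding energy_def by (intro ereal_minus_mono) (auto simp: enn2ereal_nonneg)
  then show ?thesis by simp
qed

lemma truncate_deriv:
  assumes v: "v \<in> \<U> \<Omega>" and c: "c \<in> Basis"
  shows "AE p in M. weak_deriv Q c (truncate v i) p = (if 0 < v i p \<and> v i p < 1 then weak_deriv Q c (v i) p else 0)"
  using weak_deriv_works(2)[OF open_Q has_weak_deriv_clamp01[OF open_Q deriv_works[OF v c]]]
  by (simp add: truncate_def[abs_def])

lemma truncate_derivs:
  fixes v :: "'k \<Rightarrow> 'a \<times> real \<Rightarrow> real"
  assumes v: "v \<in> \<U> \<Omega>"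
  shows "AE p in M. \<forall>i. \<forall>c\<in>Basis. weak_deriv Q c (truncate v i) p = (if 0 < v i p \<and> v i p < 1 then weak_deriv Q c (v i) p else 0)"
proof -
  have "AE p in M. \<forall>c\<in>Basis. weak_deriv Q c (truncate v i) p = (if 0 < v i p \<and> v i p < 1 then weak_deriv Q c (v i) p else 0)" for i
    by (intro AE_finite_allI finite_Basis truncate_deriv[OF v])
  then have "AE p in M. \<forall>i\<in>UNIV. \<forall>c\<in>Basis. weak_deriv Q c (truncate v i) p = (if 0 < v i p \<and> v i p < 1 then weak_deriv Q c (v i) p else 0)"
    by (rule AE_finite_allI[OF finite])
  then show ?thesis by simp
qed

lemma pot_truncate: "pot (truncate v) p \<le> pot v p"
proof -
  have sq: "(clamp01 s)\<^sup>2 \<le> s\<^sup>2" for s using abs_clamp01_le(1)[of s] by (simp add: abs_le_square_iff)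
  have "(\<Sum>i\<in>UNIV. \<Sum>j\<in>UNIV. A $ i $ j * (truncate v i p)\<^sup>2 * (truncate v j p)\<^sup>2) \<le> (\<Sum>i\<in>UNIV. \<Sum>j\<in>UNIV. A $ i $ j * (v i p)\<^sup>2 * (v j p)\<^sup>2)"
    unfolding truncate_def using A_nonneg sq by (intro sum_mono mult_mono) auto
  then have "\<beta> / 2 * (\<Sum>i\<in>UNIV. \<Sum>j\<in>UNIV. A $ i $ j * (truncate v i p)\<^sup>2 * (truncate v j p)\<^sup>2) \<le> \<beta> / 2 * (\<Sum>i\<in>UNIV. \<Sum>j\<in>UNIV. A $ i $ j * (v i p)\<^sup>2 * (v j p)\<^sup>2)"
    using \<beta> by (intro mult_left_mono) auto
  moreover have "(\<Sum>i\<in>UNIV. F i (v i p)) \<le> (\<Sum>i\<in>UNIV. F i (truncate v i p))"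
    unfolding truncate_def by (intro sum_mono F_clamp)
  ultimately show ?thesis unfolding pot_def by linarith
qed

text \<open>Each term of the sum either stays the same or becomes 0. Equality of the sums thus
  forces every term that was set to 0 to have been 0 before; strict positivity of \<kappa> then
  gives the derivative.\<close>

lemma grad_density_truncate:
  assumes "\<forall>i. \<forall>c\<in>Basis. weak_deriv Q c (truncate v i) p = (if 0 < v i p \<and> v i p < 1 then weak_deriv Q c (v i) p else 0)"
  shows "grad_density (truncate v) p \<le> grad_density v p"
    "grad_density (truncate v) p = grad_density v p \<Longrightarrow> c \<in> Basis \<Longrightarrow> \<not> (0 < v i p \<and> v i p < 1) \<Longrightarrow> weak_deriv Q c (v i) p = 0"
proof -
  have le: "\<kappa> c * (weak_deriv Q c (truncate v i) p)\<^sup>2 \<le> \<kappa> c * (weak_deriv Q c (v i) p)\<^sup>2" if "c \<in> Basis" for i c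
    using assms that \<kappa>_bounds(2)[of c] by auto
  then show "grad_density (truncate v) p \<le> grad_density v p" unfolding grad_density_def by (intro sum_mono) auto
  assume eq: "grad_density (truncate v) p = grad_density v p" and c: "c \<in> Basis" and n: "\<not> (0 < v i p \<and> v i p < 1)"
  show "weak_deriv Q c (v i) p = 0"
  proof (rule ccontr)
    assume "weak_deriv Q c (v i) p \<noteq> 0"
    then have less: "\<kappa> c * (weak_deriv Q c (truncate v i) p)\<^sup>2 < \<kappa> c * (weak_deriv Q c (v i) p)\<^sup>2"
      using assms c n \<kappa>_bounds(2)[of c] by auto
    have "grad_density (truncate v) p < grad_density v p"
      unfolding grad_density_def
    proof (rule sum_strict_mono_ex1)
      show "\<forall>i\<in>UNIV. (\<Sum>c\<in>Basis. \<kappa> c * (weak_deriv Q c (truncate v i) p)\<^sup>2) \<le> (\<Sum>c\<in>Basis. \<kappa> c * (weak_deriv Q c (v i) p)\<^sup>2)"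
        using le by (intro ballI sum_mono) auto
      show "\<exists>i\<in>UNIV. (\<Sum>c\<in>Basis. \<kappa> c * (weak_deriv Q c (truncate v i) p)\<^sup>2) < (\<Sum>c\<in>Basis. \<kappa> c * (weak_deriv Q c (v i) p)\<^sup>2)"
        using le less c by (intro bexI[of _ i] sum_strict_mono_ex1) auto
    qed simp
    with eq show False by simp
  qed
qed

lemma integrand_truncate:
  assumes v: "v \<in> \<U> \<Omega>" shows "AE p in M. \<I> (truncate v) p \<le> \<I> v p"
  using truncate_derivs[OF v]
proof eventually_elim
  case (elim p)
  show ?case unfolding integrand_eq
    using wt_pos[of p] by (intro add_mono mult_left_mono grad_density_truncate(1)[OF elim] pot_truncate) auto
qed

text \<open>A competitor of finite energy excludes an infinite minimum, for which equality of
  energies would say nothing. For finite equal energies the ordered integrands agree a.e.; as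
  gradient and potential both do not increase under truncation, the gradients agree separately. So
  the derivative of \<open>v i\<close> vanishes wherever truncation acts, which makes
  \<open>v i - truncate v i\<close> a function of gradient 0.\<close>

lemma minimizer_bounds:
  assumes W: "admissible \<Omega> v0 W" and fin: "\<exists>u\<in>W. \<E> u < \<infinity>" and min: "is_arg_min \<E> (\<lambda>w. w \<in> W) v"
  shows "AE p in M. 0 \<le> v i p \<and> v i p \<le> 1"
proof -
  have vW: "v \<in> W" and mn: "\<And>u. u \<in> W \<Longrightarrow> \<not> \<E> u < \<E> v" using min by (auto simp: is_arg_min_def)
  have v: "v \<in> \<U> \<Omega>" and tW: "truncate v \<in> W" and t: "truncate v \<in> \<U> \<Omega>" using W vW by (auto simp: admissible_def)
  obtain u where "u \<in> W" "\<E> u < \<infinity>" using fin by blast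
  then have fv: "\<E> v < \<infinity>" using mn[of u] by (auto simp: not_less)
  have le: "\<E> (truncate v) \<le> \<E> v" by (rule energy_mono[OF integrand_truncate[OF v]])
  with mn[OF tW] have eq: "\<E> (truncate v) = \<E> v" by (auto simp: not_less)
  have iv: "integrable M (\<I> v)" by (rule energy_finiteD[OF v fv])
  have it: "integrable M (\<I> (truncate v))" by (rule energy_finiteD[OF t]) (use eq fv in simp)
  have "(LINT p|M. \<I> v p - \<I> (truncate v) p) = 0"
    using eq iv it unfolding energy_integrable[OF iv] energy_integrable[OF it] by simp
  then have "AE p in M. \<I> v p - \<I> (truncate v) p = 0"
    using integral_nonneg_eq_0_iff_AE[of M "\<lambda>p. \<I> v p - \<I> (truncate v) p"] iv it integrand_truncate[OF v] by simp
  then have z: "AE p in M. \<forall>i. \<forall>c\<in>Basis. \<not> (0 < v i p \<and> v i p < 1) \<longrightarrow> weak_deriv Q c (v i) p = 0"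
    using truncate_derivs[OF v]
  proof eventually_elim
    case (elim p)
    have "wt p * (grad_density v p - grad_density (truncate v) p) + wt p * (pot v p - pot (truncate v) p) = 0"
      using elim(1) unfolding integrand_eq by (simp add: algebra_simps)
    moreover have "0 \<le> wt p * (grad_density v p - grad_density (truncate v) p)" "0 \<le> wt p * (pot v p - pot (truncate v) p)"
      using wt_pos[of p] grad_density_truncate(1)[OF elim(2)] pot_truncate[of v p] by (auto intro: mult_nonneg_nonneg)
    ultimately have "wt p * (grad_density v p - grad_density (truncate v) p) = 0" by linarith
    then have "grad_density (truncate v) p = grad_density v p" using wt_pos[of p] by simp
    from grad_density_truncate(2)[OF elim(2) this] show ?case by blast
  qed
  have "has_weak_deriv Q c (\<lambda>p. v i p - truncate v i p) (\<lambda>_. 0)" if c: "c \<in> Basis" for c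
  proof (rule has_weak_deriv_cong[OF open_Q has_weak_deriv_diff[OF open_Q deriv_works[OF v c] has_weak_deriv_clamp01[OF open_Q deriv_works[OF v c]]]])
    show "AE p in M. v i p - clamp01 (v i p) = v i p - truncate v i p" by (simp add: truncate_def)
    show "AE p in M. weak_deriv Q c (v i) p - (if 0 < v i p \<and> v i p < 1 then weak_deriv Q c (v i) p else 0) = 0"
      using z by eventually_elim (use c in auto)
  qed
  then have "ae_eq Q (v i) (truncate v i)"
    using W vW unfolding admissible_def by blast
  then show ?thesis unfolding AE_lebesgue_on_open[OF open_Q]
    by eventually_elim (metis clamp01_def max.cobounded1 max.bounded_iff max_def min.cobounded2 truncate_def zero_le_one)
qed

end

subsection \<open>Existence of minimizers\<close>

text \<open>Mazur's lemma for a quadratic functional: near-minimizers of \<open>q\<close> over the tails \<open>C n\<close> form a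
  Cauchy sequence by the parallelogram identity.\<close>

lemma almost_minimal_Cauchy:
  fixes C :: "nat \<Rightarrow> 'v set" and q :: "'v \<Rightarrow> real" and d :: "'v \<Rightarrow> 'v \<Rightarrow> real"
  assumes dec: "\<And>m n. m \<le> n \<Longrightarrow> C n \<subseteq> C m" and q: "\<And>x. 0 \<le> q x"
    and mid: "\<And>n x y. x \<in> C n \<Longrightarrow> y \<in> C n \<Longrightarrow> \<exists>z\<in>C n. q z \<le> q x / 2 + q y / 2 - d x y / 4"
    and L: "\<And>e. e > 0 \<Longrightarrow> \<exists>N. \<forall>n\<ge>N. \<exists>x\<in>C n. q x < L + e"
  obtains y where "\<And>n. y n \<in> C n" "\<And>n. q (y n) \<le> L + inverse (real (Suc n))"
    "\<And>e. e > 0 \<Longrightarrow> \<exists>N. \<forall>k\<ge>N. \<forall>l\<ge>N. d (y k) (y l) < e"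
proof -
  define \<alpha> where "\<alpha> n = Inf (q ` C n)" for n
  have ne: "q ` C n \<noteq> {}" for n
    using L[of 1] dec by (metis empty_iff image_is_empty le_cases subset_empty zero_less_one)
  have bdd: "bdd_below (q ` C n)" for n using q by (auto simp: bdd_below_def)
  have inc: "incseq \<alpha>" unfolding \<alpha>_def incseq_def
    using dec by (intro allI impI cInf_superset_mono ne bdd image_mono)
  have low: "\<alpha> n \<le> q x" if "x \<in> C n" for n x
    unfolding \<alpha>_def using that by (intro cInf_lower bdd) simp
  have \<alpha>L: "\<alpha> n \<le> L" for n
  proof (rule field_le_epsilon)
    fix e :: real assume "e > 0"
    then obtain N where "\<forall>n\<ge>N. \<exists>x\<in>C n. q x < L + e" using L by blast
    then obtain x where x: "x \<in> C (max n N)" "q x < L + e" by (metis max.cobounded2)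
    have "\<alpha> n \<le> \<alpha> (max n N)" using inc by (simp add: incseq_def)
    with low[OF x(1)] x(2) show "\<alpha> n \<le> L + e" by simp
  qed
  have "\<exists>x\<in>C n. q x < \<alpha> n + inverse (real (Suc n))" for n
    using cInf_lessD[OF ne, of n "\<alpha> n + inverse (real (Suc n))"] by (auto simp: \<alpha>_def)
  then obtain y where y: "\<And>n. y n \<in> C n" "\<And>n. q (y n) < \<alpha> n + inverse (real (Suc n))" by metis
  obtain a where a: "\<alpha> \<longlonglongrightarrow> a" "\<And>n. \<alpha> n \<le> a" using incseq_convergent[OF inc, of L] \<alpha>L by blast
  show thesis
  proof
    show "y n \<in> C n" for n by (rule y)
    show "q (y n) \<le> L + inverse (real (Suc n))" for n using y(2)[of n] \<alpha>L[of n] by simp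
    fix e :: real assume e: "e > 0"
    \<comment> \<open>For indices beyond \<open>N\<close>, one quarter of \<open>d\<close> is at
      most the mean of two values of \<open>q\<close>, each at most a + 1/(N+1), minus the value at
      a midpoint, which is at least \<open>\<alpha> N\<close>.\<close>
    have "(\<lambda>n. 4 * (a + inverse (real (Suc n)) - \<alpha> n)) \<longlonglongrightarrow> 4 * (a + 0 - a)"
      by (intro tendsto_intros a LIMSEQ_inverse_real_of_nat)
    then have "\<forall>\<^sub>F n in sequentially. 4 * (a + inverse (real (Suc n)) - \<alpha> n) < e"
      using e by (intro order_tendstoD) auto
    then obtain N where N: "4 * (a + inverse (real (Suc N)) - \<alpha> N) < e" by (auto simp: eventually_sequentially)
    have "d (y k) (y l) < e" if kl: "k \<ge> N" "l \<ge> N" for k l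
    proof -
      have q': "q (y n) \<le> a + inverse (real (Suc N))" if "n \<ge> N" for n
      proof -
        have "inverse (real (Suc n)) \<le> inverse (real (Suc N))" using that by (intro le_imp_inverse_le) auto
        with y(2)[of n] a(2)[of n] show ?thesis by linarith
      qed
      obtain z where z: "z \<in> C N" "q z \<le> q (y k) / 2 + q (y l) / 2 - d (y k) (y l) / 4"
        using mid[of "y k" N "y l"] y(1) dec kl by blast
      define I where "I = inverse (real (Suc N))"
      from low[OF z(1)] z(2) q'[OF kl(1)] q'[OF kl(2)] N show ?thesis unfolding I_def[symmetric] by argo
    qed
    then show "\<exists>N. \<forall>k\<ge>N. \<forall>l\<ge>N. d (y k) (y l) < e" by blast
  qed
qed

text \<open>Dyadic convex combinations of a tail. Midpoints are all that the parallelogram identity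
  uses, and admissibility, bounds and pointwise limits pass to them by induction.\<close>

inductive_set midpoints :: "(nat \<Rightarrow> 'k \<Rightarrow> 'p \<Rightarrow> real) \<Rightarrow> nat \<Rightarrow> ('k \<Rightarrow> 'p \<Rightarrow> real) set"
  for v :: "nat \<Rightarrow> 'k \<Rightarrow> 'p \<Rightarrow> real" and n :: nat where
  base: "n \<le> m \<Longrightarrow> v m \<in> midpoints v n"
| step: "x \<in> midpoints v n \<Longrightarrow> y \<in> midpoints v n \<Longrightarrow> midpoint_fun x y \<in> midpoints v n"

lemma midpoints_antimono: "m \<le> n \<Longrightarrow> midpoints v n \<subseteq> midpoints v m"
proof
  fix x assume "m \<le> n" "x \<in> midpoints v n"
  from this(2,1) show "x \<in> midpoints v m"
    by induction (auto intro: midpoints.intros)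
qed

text \<open>An interval around the limit is convex, so once it contains a tail of the sequence it
  contains all iterated midpoints of that tail.\<close>

lemma midpoints_tendsto:
  assumes y: "\<And>n. y n \<in> midpoints v n" and lim: "(\<lambda>n. v n i p) \<longlonglongrightarrow> l"
  shows "(\<lambda>n. y n i p) \<longlonglongrightarrow> l"
proof (rule LIMSEQ_I)
  fix e :: real assume "e > 0"
  then obtain N where N: "\<And>n. n \<ge> N \<Longrightarrow> norm (v n i p - l) < e" using LIMSEQ_D[OF lim] by blast
  have "norm (x i p - l) < e" if "x \<in> midpoints v n" "n \<ge> N" for x n
    using that
  proof induction
    case (step x y)
    have "midpoint_fun x y i p - l = (1/2) * (x i p - l) + (1/2) * (y i p - l)" by (simp add: midpoint_fun_def field_simps)
    moreover have "\<bar>x i p - l\<bar> < e" "\<bar>y i p - l\<bar> < e" using step by auto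
    ultimately show ?case unfolding real_norm_def by argo
  qed (use N in auto)
  then show "\<exists>N. \<forall>n\<ge>N. norm (y n i p - l) < e" using y by blast
qed

text \<open>The finitely many components are treated one after another. The hypothesis is stated for
  every subsequence so that it can be applied again after each refinement.\<close>

lemma common_convergent_subseq:
  fixes v :: "nat \<Rightarrow> 'k::finite \<Rightarrow> 'p \<Rightarrow> real"
  assumes "\<And>i (s :: nat \<Rightarrow> nat). strict_mono s \<Longrightarrow> \<exists>r :: nat \<Rightarrow> nat. strict_mono r \<and> (AE p in M. convergent (\<lambda>k. v (s (r k)) i p))"
  obtains r :: "nat \<Rightarrow> nat" where "strict_mono r" "AE p in M. \<forall>i. convergent (\<lambda>k. v (r k) i p)"
proof -
  have "\<exists>r :: nat \<Rightarrow> nat. strict_mono r \<and> (AE p in M. \<forall>i\<in>I. convergent (\<lambda>k. v (r k) i p))" if "finite I" for I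
    using that
  proof induction
    case empty
    show ?case by (intro exI[of _ id]) (auto simp: strict_mono_def)
  next
    case (insert j I)
    then obtain s :: "nat \<Rightarrow> nat" where s: "strict_mono s" "AE p in M. \<forall>i\<in>I. convergent (\<lambda>k. v (s k) i p)" by blast
    from assms[OF s(1), of j] obtain r where r: "strict_mono r" "AE p in M. convergent (\<lambda>k. v (s (r k)) j p)" by blast
    have "AE p in M. \<forall>i\<in>insert j I. convergent (\<lambda>k. v ((s \<circ> r) k) i p)"
      using s(2) r(2)
    proof eventually_elim
      case (elim p)
      have "convergent (\<lambda>k. v (s (r k)) i p)" if "i \<in> I" for i
        using convergent_subseq_convergent[of "\<lambda>k. v (s k) i p" r] elim(1) that r(1) by (auto simp: comp_def)
      with elim(2) show ?case by auto
    qed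
    with strict_mono_o[OF s(1) r(1)] show ?case by blast
  qed
  from this[OF finite[of UNIV]] that show ?thesis by auto
qed

context energy_setting
begin

text \<open>With the root of the weight as a factor, the quadratic part of the energy becomes a
  combination of squared L2 norms on \<open>M\<close>, where completeness and the parallelogram
  identity are available.\<close>

definition wD :: "('k \<Rightarrow> 'a \<times> real \<Rightarrow> real) \<Rightarrow> 'k \<Rightarrow> 'a \<times> real \<Rightarrow> 'a \<times> real \<Rightarrow> real" where
  "wD v i c p = sqrt (wt p) * weak_deriv Q c (v i) p"

text \<open>On this class the energy splits into two finite integrals: values in [0, 1] make the
  potential integrable, and the weighted derivatives are square integrable.\<close>

definition bounded_finite :: "('k \<Rightarrow> 'a \<times> real \<Rightarrow> real) \<Rightarrow> bool" where
  "bounded_finite v \<longleftrightarrow> v \<in> \<U> \<Omega> \<and> (AE p in M. \<forall>i. 0 \<le> v i p \<and> v i p \<le> 1) \<and> (\<forall>i. \<forall>c\<in>Basis. wD v i c \<in> L2_space M)"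

definition grad_energy :: "('k \<Rightarrow> 'a \<times> real \<Rightarrow> real) \<Rightarrow> real" where
  "grad_energy v = (\<Sum>i\<in>UNIV. \<Sum>c\<in>Basis. \<kappa> c * (LINT p|M. (wD v i c p)\<^sup>2))"

definition grad_dist :: "('k \<Rightarrow> 'a \<times> real \<Rightarrow> real) \<Rightarrow> ('k \<Rightarrow> 'a \<times> real \<Rightarrow> real) \<Rightarrow> real" where
  "grad_dist v w = (\<Sum>i\<in>UNIV. \<Sum>c\<in>Basis. \<kappa> c * l2d M (wD v i c) (wD w i c))"

definition pot_energy :: "('k \<Rightarrow> 'a \<times> real \<Rightarrow> real) \<Rightarrow> real" where "pot_energy v = (LINT p|M. wt p * pot v p)"

lemma wD_sq: "(wD v i c p)\<^sup>2 = wt p * (weak_deriv Q c (v i) p)\<^sup>2"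
  using wt_pos[of p] by (simp add: wD_def power_mult_distrib)

lemma wt_grad_density: "wt p * grad_density v p = (\<Sum>i\<in>UNIV. \<Sum>c\<in>Basis. \<kappa> c * (wD v i c p)\<^sup>2)"
  unfolding grad_density_def wD_sq by (simp add: sum_distrib_left mult.left_commute)

lemma wD_measurable: "v \<in> \<U> \<Omega> \<Longrightarrow> c \<in> Basis \<Longrightarrow> wD v i c \<in> borel_measurable M"
  unfolding wD_def[abs_def]
  by (intro borel_measurable_times measurable_compose[OF borel_imp_M[OF wt_measurable] borel_measurable_sqrt] deriv_measurable)

lemma grad_energy_nonneg: "0 \<le> grad_energy v"
  unfolding grad_energy_def by (intro sum_nonneg mult_nonneg_nonneg less_imp_le[OF \<kappa>_bounds(2)]) auto

lemma energy_bounded_finite: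
  assumes "bounded_finite v" shows "integrable M (\<I> v)" "\<E> v = ereal (grad_energy v + pot_energy v)"
proof -
  have v: "v \<in> \<U> \<Omega>" and b: "AE p in M. \<forall>i. 0 \<le> v i p \<and> v i p \<le> 1" and l: "\<And>i c. c \<in> Basis \<Longrightarrow> wD v i c \<in> L2_space M"
    using assms by (auto simp: bounded_finite_def)
  note ip = pot_integrable[of v, OF v_measurable[OF v] b]
  have ig: "integrable M (\<lambda>p. wt p * grad_density v p)" unfolding wt_grad_density using L2_D(2)[OF l] by auto
  show i: "integrable M (\<I> v)" unfolding integrand_eq[abs_def] using ip ig by auto
  have "(LINT p|M. wt p * grad_density v p) = grad_energy v" unfolding wt_grad_density grad_energy_def using L2_D(2)[OF l] by simp
  then show "\<E> v = ereal (grad_energy v + pot_energy v)"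
    unfolding energy_integrable[OF i] unfolding integrand_eq[abs_def] pot_energy_def using ip ig by simp
qed

lemma bounded_finiteI:
  assumes v: "v \<in> \<U> \<Omega>" and b: "AE p in M. \<forall>i. 0 \<le> v i p \<and> v i p \<le> 1" and i: "integrable M (\<lambda>p. wt p * grad_density v p)"
  shows "bounded_finite v"
  unfolding bounded_finite_def
proof (intro conjI v b allI ballI)
  fix i and c :: "'a \<times> real" assume c: "c \<in> Basis"
  have le: "\<kappa> c * (wD v i c p)\<^sup>2 \<le> wt p * grad_density v p" for p
  proof -
    have nn: "0 \<le> \<kappa> c * (wD v i c p)\<^sup>2" for i c using less_imp_le[OF \<kappa>_bounds(2)] by simp
    have "\<kappa> c * (wD v i c p)\<^sup>2 \<le> (\<Sum>c\<in>Basis. \<kappa> c * (wD v i c p)\<^sup>2)" using c nn by (intro member_le_sum) auto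
    also have "\<dots> \<le> (\<Sum>i\<in>UNIV. \<Sum>c\<in>Basis. \<kappa> c * (wD v i c p)\<^sup>2)" using nn by (intro member_le_sum sum_nonneg) auto
    finally show ?thesis unfolding wt_grad_density .
  qed
  have "integrable M (\<lambda>p. \<kappa> c * (wD v i c p)\<^sup>2)"
  proof (rule Bochner_Integration.integrable_bound[OF i])
    show "AE p in M. norm (\<kappa> c * (wD v i c p)\<^sup>2) \<le> norm (wt p * grad_density v p)"
      using le less_imp_le[OF \<kappa>_bounds(2)] by (intro AE_I2) (smt (verit) mult_nonneg_nonneg real_norm_def zero_le_power2)
  qed (use wD_measurable[OF v c] in simp)
  then have "integrable M (\<lambda>p. (wD v i c p)\<^sup>2)" using \<kappa>_bounds(2)[of c] by simp
  then show "wD v i c \<in> L2_space M" using wD_measurable[OF v c] by (simp add: L2_space_def)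
qed

lemma bounded_finite_if_energy:
  assumes v: "v \<in> \<U> \<Omega>" and b: "AE p in M. \<forall>i. 0 \<le> v i p \<and> v i p \<le> 1" and f: "\<E> v < \<infinity>"
  shows "bounded_finite v"
proof (rule bounded_finiteI[OF v b])
  have "integrable M (\<lambda>p. \<I> v p - wt p * pot v p)"
    using energy_finiteD[OF v f] pot_integrable[of v, OF v_measurable[OF v] b] by auto
  then show "integrable M (\<lambda>p. wt p * grad_density v p)" by (simp add: integrand_eq)
qed

text \<open>The second claim is the parallelogram identity applied to each weighted derivative,
  since the derivative of the midpoint is a.e. the midpoint of the derivatives.\<close>

lemma bounded_finite_midpoint:
  assumes x: "bounded_finite x" and y: "bounded_finite y"
  shows "bounded_finite (midpoint_fun x y)" "grad_energy (midpoint_fun x y) = grad_energy x / 2 + grad_energy y / 2 - grad_dist x y / 4"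
proof -
  let ?z = "midpoint_fun x y"
  have xU: "x \<in> \<U> \<Omega>" and yU: "y \<in> \<U> \<Omega>" using x y by (auto simp: bounded_finite_def)
  note zU = midpoint_\<U>[OF open_\<Omega> xU yU]
  have l: "wD x i c \<in> L2_space M" "wD y i c \<in> L2_space M" if "c \<in> Basis" for i c using x y that by (auto simp: bounded_finite_def)
  have ae: "AE p in M. (1/2) * wD x i c p + (1/2) * wD y i c p = wD ?z i c p" if c: "c \<in> Basis" for i c
    using weak_deriv_works(2)[OF open_Q has_weak_deriv_lin[OF open_Q deriv_works[OF xU c, of i] deriv_works[OF yU c, of i], of "1/2" "1/2"]]
    by eventually_elim (simp add: wD_def midpoint_fun_def[abs_def] algebra_simps)
  have lz: "wD ?z i c \<in> L2_space M" if c: "c \<in> Basis" for i c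
    by (rule L2_cong_AE[OF L2_lin[OF l[OF c]] wD_measurable[OF zU c] ae[OF c]])
  have bz: "AE p in M. \<forall>i. 0 \<le> ?z i p \<and> ?z i p \<le> 1"
  proof -
    have "AE p in M. \<forall>i. 0 \<le> x i p \<and> x i p \<le> 1" "AE p in M. \<forall>i. 0 \<le> y i p \<and> y i p \<le> 1" using x y by (auto simp: bounded_finite_def)
    then show ?thesis
    proof eventually_elim
      case (elim p)
      show ?case
      proof
        fix i show "0 \<le> ?z i p \<and> ?z i p \<le> 1" using elim(1)[rule_format, of i] elim(2)[rule_format, of i] by (auto simp: midpoint_fun_def)
      qed
    qed
  qed
  show "bounded_finite ?z" using zU lz bz by (simp add: bounded_finite_def)
  have k: "(LINT p|M. (wD ?z i c p)\<^sup>2) = (LINT p|M. (wD x i c p)\<^sup>2) / 2 + (LINT p|M. (wD y i c p)\<^sup>2) / 2 - l2d M (wD x i c) (wD y i c) / 4"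
    if c: "c \<in> Basis" for i c
  proof -
    note i = L2_D(2)[OF l(1)[OF c, of i]] L2_D(2)[OF l(2)[OF c, of i]] L2_D(2)[OF L2_diff[OF l[OF c, of i]]]
    have "(LINT p|M. (wD ?z i c p)\<^sup>2) = (LINT p|M. (wD x i c p)\<^sup>2 / 2 + (wD y i c p)\<^sup>2 / 2 - (wD x i c p - wD y i c p)\<^sup>2 / 4)"
    proof (rule integral_cong_AE)
      show "AE p in M. (wD ?z i c p)\<^sup>2 = (wD x i c p)\<^sup>2 / 2 + (wD y i c p)\<^sup>2 / 2 - (wD x i c p - wD y i c p)\<^sup>2 / 4"
        using ae[OF c, of i]
      proof eventually_elim
        case (elim p)
        show ?case unfolding elim[symmetric] by (simp add: power2_eq_square field_simps)
      qed
    qed (use i L2_D(1)[OF lz[OF c]] in auto)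
    then show ?thesis using i by (simp add: l2d_def)
  qed
  have e: "\<kappa> c * (LINT p|M. (wD ?z i c p)\<^sup>2) = \<kappa> c * (LINT p|M. (wD x i c p)\<^sup>2) / 2 + \<kappa> c * (LINT p|M. (wD y i c p)\<^sup>2) / 2
      - \<kappa> c * l2d M (wD x i c) (wD y i c) / 4" if "c \<in> Basis" for i c
    unfolding k[OF that] by (simp add: algebra_simps)
  show "grad_energy ?z = grad_energy x / 2 + grad_energy y / 2 - grad_dist x y / 4"
    unfolding grad_energy_def grad_dist_def sum_divide_distrib sum.distrib[symmetric] sum_subtractf[symmetric] by (intro sum.cong refl e)
qed

text \<open>At times below \<open>T\<close> the weight is at least exp (- T / \<epsilon>), so a
  weighted integral over the half cylinder controls the plain integral over any part of the bounded
  cylinder.\<close>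

lemma restrict_QT:
  assumes f: "f \<in> borel_measurable M" and i: "integrable M (\<lambda>p. wt p * f p)" and nn: "AE p in M. 0 \<le> f p"
    and V: "V \<subseteq> QT T" "V \<in> sets lebesgue"
  shows "integrable (lebesgue_on V) f" "(LINT p|lebesgue_on V. f p) \<le> exp (T / \<epsilon>) * (LINT p|M. wt p * f p)"
proof -
  have VQ: "V \<subseteq> Q" using V by auto
  have r: "lebesgue_on V = restrict_space M V" using VQ V(2) Q_borel by (simp add: restrict_restrict_space Int_absorb1)
  have VM: "V \<inter> space M \<in> sets M" using VQ V(2) Q_borel by (auto simp: sets_restrict_space_iff Int_absorb2)
  have le: "indicator V p * f p \<le> exp (T / \<epsilon>) * (wt p * f p)" if "0 \<le> f p" for p
  proof (cases "p \<in> V")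
    case True
    then have "snd p < T" using V(1) by auto
    then have "1 \<le> exp (T / \<epsilon>) * exp (- snd p / \<epsilon>)" using \<epsilon> by (simp add: exp_add[symmetric] divide_right_mono)
    \<comment> \<open>Dividing by \<epsilon> increases a positive number because \<epsilon> <
      1.\<close>
    also have "\<dots> \<le> exp (T / \<epsilon>) * exp (- snd p / \<epsilon>) / \<epsilon>" using \<epsilon> by (simp add: le_divide_eq mult_left_le)
    finally have "1 * f p \<le> exp (T / \<epsilon>) * wt p * f p" using that by (intro mult_right_mono) (auto simp: wt_def)
    then show ?thesis using True by (simp add: mult.assoc)
  qed (use wt_pos[of p] that in \<open>simp add: mult_nonneg_nonneg less_imp_le\<close>)
  have ii: "integrable M (\<lambda>p. indicator V p * f p)"
  proof (rule Bochner_Integration.integrable_bound[OF integrable_mult_right[OF i, of "exp (T / \<epsilon>)"]])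
    show "AE p in M. norm (indicator V p * f p) \<le> norm (exp (T / \<epsilon>) * (wt p * f p))"
      using nn by eventually_elim (use le wt_pos in \<open>smt (verit) indicator_pos_le mult_nonneg_nonneg real_norm_def\<close>)
    show "(\<lambda>p. indicator V p * f p) \<in> borel_measurable M" 
      using f VM VQ by (intro borel_measurable_times borel_measurable_indicator) (auto simp: Int_absorb2)
  qed
  show "integrable (lebesgue_on V) f" unfolding r using ii VM by (simp add: integrable_restrict_space)
  have "(LINT p|lebesgue_on V. f p) = (LINT p|M. indicator V p * f p)" unfolding r using VM by (simp add: integral_restrict_space)
  also have "\<dots> \<le> (LINT p|M. exp (T / \<epsilon>) * (wt p * f p))"
    using i ii by (intro integral_mono_AE) (use nn le in \<open>auto elim: eventually_mono\<close>)
  finally show "(LINT p|lebesgue_on V. f p) \<le> exp (T / \<epsilon>) * (LINT p|M. wt p * f p)" by simp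
qed

lemma QT_sets: "QT T \<in> sets lebesgue" using QT_borel by auto

lemma restrict_QT_L2:
  assumes f: "f \<in> borel_measurable M" and i: "integrable M (\<lambda>p. wt p * (f p)\<^sup>2)"
  shows "f \<in> L2_space (lebesgue_on (QT T))" "(LINT p|lebesgue_on (QT T). (f p)\<^sup>2) \<le> exp (T / \<epsilon>) * (LINT p|M. wt p * (f p)\<^sup>2)"
proof -
  note r = restrict_QT[of "\<lambda>p. (f p)\<^sup>2", OF _ i _ _ QT_sets, of T T]
  have "f \<in> borel_measurable (lebesgue_on (QT T))"
  proof -
    have "lebesgue_on (QT T) = restrict_space M (QT T)"
      using Q_borel QT_borel Int_absorb1[of "QT T" Q] by (simp add: restrict_restrict_space subset_iff)
    then show ?thesis using measurable_restrict_space1[OF f] by simp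
  qed
  then show "f \<in> L2_space (lebesgue_on (QT T))" using r(1) f by (simp add: L2_space_def)
  show "(LINT p|lebesgue_on (QT T). (f p)\<^sup>2) \<le> exp (T / \<epsilon>) * (LINT p|M. wt p * (f p)\<^sup>2)" using r(2) f by simp
qed

text \<open>The time derivative is 0, the spatial gradient is that of \<open>v0\<close> at every
  time and integrates against the weight, and the potential is bounded on values in [0, 1].\<close>

lemma stationary_finite_energy:
  assumes v0: "\<And>i. v0 i \<in> H1_space \<Omega>" and v01: "\<And>i. AE x in lebesgue_on \<Omega>. 0 \<le> v0 i x \<and> v0 i x \<le> 1"
  shows "\<E> (stationary v0) < \<infinity>"
proof -
  let ?v = "stationary v0" and ?D = "\<lambda>i c p. if snd c = 0 then weak_deriv \<Omega> (fst c) (v0 i) (fst p) else 0"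
  have vU: "?v \<in> \<U> \<Omega>" by (rule stationary_\<U>[OF open_\<Omega> v0])
  have w: "has_weak_deriv Q c (?v i) (?D i c)" if c: "c \<in> Basis" for i and c :: "'a \<times> real"
    unfolding cylinder_Union[symmetric] stationary_def[abs_def]
    by (rule has_weak_deriv_exhaust[OF open_QT]) (auto simp: incseq_def intro: H1_stationary(2)[OF open_\<Omega> _ v0 c])
  have d: "integrable M (\<lambda>p. wt p * (weak_deriv Q c (?v i) p)\<^sup>2)" if c: "c \<in> Basis" for i and c :: "'a \<times> real"
  proof -
    have "integrable M (\<lambda>p. wt p * (?D i c p)\<^sup>2)"
      using c
    proof (cases rule: Basis_prod_cases)
      case (1 b)
      then show ?thesis using wt_integrable_fst[OF L2_D(2)[OF H1_D(3)[OF open_\<Omega> v0 1(1), of i]]] by simp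
    qed simp
    moreover have "integrable M (\<lambda>p. wt p * (weak_deriv Q c (?v i) p)\<^sup>2) \<longleftrightarrow> integrable M (\<lambda>p. wt p * (?D i c p)\<^sup>2)"
    proof (rule integrable_cong_AE)
      show "AE p in M. wt p * (weak_deriv Q c (?v i) p)\<^sup>2 = wt p * (?D i c p)\<^sup>2"
        using weak_deriv_works(2)[OF open_Q w[OF c, of i]] by eventually_elim simp
    qed (use has_weak_deriv_measurable(2)[OF open_Q w[OF c, of i]] deriv_measurable[OF vU c] borel_imp_M[OF wt_measurable] in
        \<open>auto intro!: borel_measurable_times borel_measurable_power\<close>)
    ultimately show ?thesis by blast
  qed
  have b: "AE p in M. \<forall>i. 0 \<le> ?v i p \<and> ?v i p \<le> 1"
  proof -
    have "AE p in M. \<forall>i\<in>UNIV. 0 \<le> ?v i p \<and> ?v i p \<le> 1"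
    proof (rule AE_finite_allI[OF finite])
      show "AE p in M. 0 \<le> ?v i p \<and> ?v i p \<le> 1" for i
        using AE_lborel_fst[OF v01[of i, unfolded AE_lebesgue_on_open[OF open_\<Omega>]]]
        unfolding AE_lebesgue_on_open[OF open_Q] by eventually_elim (auto simp: stationary_def)
    qed
    then show ?thesis by simp
  qed
  have "bounded_finite ?v"
  proof (rule bounded_finiteI[OF vU b])
    show "integrable M (\<lambda>p. wt p * grad_density ?v p)" unfolding wt_grad_density wD_sq using d by auto
  qed
  then show ?thesis using energy_bounded_finite(2)[of ?v] by simp
qed

lemma wD_le_grad_energy: "c \<in> Basis \<Longrightarrow> \<epsilon> * (LINT p|M. (wD v i c p)\<^sup>2) \<le> grad_energy v"
  and l2d_le_grad_dist: "c \<in> Basis \<Longrightarrow> \<epsilon> * l2d M (wD v i c) (wD w i c) \<le> grad_dist v w"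
proof -
  have *: "\<epsilon> * f i c \<le> (\<Sum>i\<in>UNIV. \<Sum>c\<in>Basis. \<kappa> c * f i c)" if c: "c \<in> Basis" and f: "\<And>i c. 0 \<le> f i c" for f :: "'k \<Rightarrow> 'a \<times> real \<Rightarrow> real"
  proof -
    have nn: "0 \<le> \<kappa> c * f i c" for i c using less_imp_le[OF \<kappa>_bounds(2)] f by simp
    have "\<epsilon> * f i c \<le> \<kappa> c * f i c" using \<kappa>_bounds(1) f by (rule mult_right_mono)
    also have "\<dots> \<le> (\<Sum>c\<in>Basis. \<kappa> c * f i c)" using c nn by (intro member_le_sum) auto
    also have "\<dots> \<le> (\<Sum>i\<in>UNIV. \<Sum>c\<in>Basis. \<kappa> c * f i c)" using nn by (intro member_le_sum sum_nonneg) auto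
    finally show ?thesis .
  qed
  show "c \<in> Basis \<Longrightarrow> \<epsilon> * (LINT p|M. (wD v i c p)\<^sup>2) \<le> grad_energy v" unfolding grad_energy_def by (rule *) auto
  show "c \<in> Basis \<Longrightarrow> \<epsilon> * l2d M (wD v i c) (wD w i c) \<le> grad_dist v w" unfolding grad_dist_def by (rule *) (auto simp: l2d_nonneg)
qed

text \<open>A compact set lies below some time R + 1, and |D| \<le> 1 + D^2 turns the weighted L2
  bound into an L1 bound on \<open>K\<close>. The constant depends on \<open>K\<close> alone and not
  on \<open>v\<close>, as Rellich's theorem demands.\<close>

lemma compact_gradient_bound:
  assumes K: "compact K" "K \<subseteq> Q"
  shows "\<exists>C\<ge>0. \<forall>v i. \<forall>c\<in>Basis. bounded_finite v \<longrightarrow> (LINT p|lebesgue_on K. \<bar>weak_deriv Q c (v i) p\<bar>) \<le> C * ((LINT p|M. wt p) + grad_energy v / \<epsilon>)"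
proof -
  obtain R where R: "\<And>p. p \<in> K \<Longrightarrow> norm p \<le> R" using compact_imp_bounded[OF K(1)] by (auto simp: bounded_iff)
  have KQ: "K \<subseteq> QT (R + 1)"
  proof
    fix p assume p: "p \<in> K"
    have "\<bar>snd p\<bar> \<le> norm p" using norm_snd_le[of "snd p" "fst p"] by simp
    with R[OF p] K(2) p show "p \<in> QT (R + 1)" by (auto simp: mem_Times_iff)
  qed
  have Kl: "K \<in> sets lebesgue" using compact_imp_closed[OF K(1)] by auto
  have "(LINT p|lebesgue_on K. \<bar>weak_deriv Q c (v i) p\<bar>) \<le> exp ((R + 1) / \<epsilon>) * ((LINT p|M. wt p) + grad_energy v / \<epsilon>)"
    if v: "bounded_finite v" and c: "c \<in> Basis" for v i c
  proof -
    let ?D = "weak_deriv Q c (v i)"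
    have vU: "v \<in> \<U> \<Omega>" and l: "wD v i c \<in> L2_space M" using v c by (auto simp: bounded_finite_def)
    have eq: "wt p * (1 + (?D p)\<^sup>2) = wt p + (wD v i c p)\<^sup>2" for p unfolding wD_sq by (simp add: algebra_simps)
    have i: "integrable M (\<lambda>p. wt p * (1 + (?D p)\<^sup>2))" unfolding eq using wt_integrable L2_D(2)[OF l] by auto
    have "(\<lambda>p. 1 + (?D p)\<^sup>2) \<in> borel_measurable M" using deriv_measurable[OF vU c] by simp
    note r = restrict_QT[OF this i _ KQ Kl]
    have "(LINT p|lebesgue_on K. \<bar>?D p\<bar>) \<le> (LINT p|lebesgue_on K. 1 + (?D p)\<^sup>2)"
    proof (rule integral_mono_AE')
      show "AE p in lebesgue_on K. \<bar>?D p\<bar> \<le> 1 + (?D p)\<^sup>2" by (intro AE_I2 abs_le_one_plus_sq)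
    qed (use r(1) in auto)
    also have "\<dots> \<le> exp ((R + 1) / \<epsilon>) * (LINT p|M. wt p + (wD v i c p)\<^sup>2)" using r(2) unfolding eq by simp
    also have "\<dots> \<le> exp ((R + 1) / \<epsilon>) * ((LINT p|M. wt p) + grad_energy v / \<epsilon>)"
      using wt_integrable L2_D(2)[OF l] wD_le_grad_energy[OF c, of v i] \<epsilon> by (simp add: le_divide_eq mult.commute)
    finally show ?thesis .
  qed
  then show ?thesis by (intro exI[of _ "exp ((R + 1) / \<epsilon>)"]) auto
qed

text \<open>The infimum is taken over the functions of class \<open>bounded_finite\<close> in
  \<open>W\<close>; truncation shows that these compete as well as all of \<open>W\<close>. The
  stationary function makes this set nonempty.\<close>

lemma minimizer_exists:
  assumes W: "admissible \<Omega> v0 W" and fin: "\<E> (stationary v0) < \<infinity>"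
  obtains V where "is_arg_min \<E> (\<lambda>w. w \<in> W) V"
proof -
  have WU: "W \<subseteq> \<U> \<Omega>" and st: "stationary v0 \<in> W" and mid: "\<And>v w. v \<in> W \<Longrightarrow> w \<in> W \<Longrightarrow> midpoint_fun v w \<in> W"
    and tr: "\<And>v. v \<in> W \<Longrightarrow> truncate v \<in> W" using W by (auto simp: admissible_def)
  have cl: "v \<in> W" if "\<And>n::nat. y n \<in> W" "v \<in> \<U> \<Omega>" "\<And>T i. T > 0 \<Longrightarrow> (\<lambda>n. h1d (QT T) (y n i) (v i)) \<longlonglongrightarrow> 0" for y v
    using W that unfolding admissible_def by blast
  have trunc: "bounded_finite (truncate w)" "\<E> (truncate w) \<le> \<E> w" if w: "w \<in> W" "\<E> w < \<infinity>" for w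
  proof -
    have wU: "w \<in> \<U> \<Omega>" using w WU by auto
    show le: "\<E> (truncate w) \<le> \<E> w" by (rule energy_mono[OF integrand_truncate[OF wU]])
    show "bounded_finite (truncate w)"
    proof (rule bounded_finite_if_energy[OF truncate_\<U>[OF open_\<Omega> wU]])
      show "AE p in M. \<forall>i. 0 \<le> truncate w i p \<and> truncate w i p \<le> 1" by (auto simp: truncate_def clamp01_def)
      show "\<E> (truncate w) < \<infinity>" using le w(2) by (rule le_less_trans)
    qed
  qed
  define J where "J v = grad_energy v + pot_energy v" for v
  let ?R = "J ` {v \<in> W. bounded_finite v}"
  have ne: "?R \<noteq> {}" using trunc(1)[OF st fin] tr[OF st] by blast
  have bdd: "bdd_below ?R"
  proof (rule bdd_belowI2[of _ "- (C0 * (LINT p|M. wt p))"])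
    fix v assume "v \<in> {v \<in> W. bounded_finite v}"
    then have "\<E> v = ereal (J v)" using energy_bounded_finite(2) by (simp add: J_def)
    with energy_lower[of v] show "- (C0 * (LINT p|M. wt p)) \<le> J v" by simp
  qed
  define m where "m = Inf ?R"
  have m_le: "m \<le> J v" if "v \<in> W" "bounded_finite v" for v unfolding m_def using that by (intro cInf_lower bdd) auto
  have "\<exists>v. v \<in> W \<and> bounded_finite v \<and> J v < m + inverse (real (Suc n))" for n
    using cInf_lessD[OF ne, of "m + inverse (real (Suc n))"] by (auto simp: m_def)
  then obtain u where u: "\<And>n. u n \<in> W" "\<And>n. bounded_finite (u n)" "\<And>n. J (u n) < m + inverse (real (Suc n))" by metis
  have ip: "integrable M (\<lambda>p. wt p * pot v p)" if "bounded_finite v" for v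
    using that by (intro pot_integrable v_measurable) (auto simp: bounded_finite_def)
  \<comment> \<open>The potential part is at least -C0 times the integral of the weight, so an
    almost minimal total energy bounds the quadratic part uniformly.\<close>
  have grad_energy_u: "grad_energy (u n) \<le> m + 1 + C0 * (LINT p|M. wt p)" for n
  proof -
    have "(LINT p|M. - C0 * wt p) \<le> pot_energy (u n)"
      unfolding pot_energy_def
    proof (rule integral_mono[OF _ ip[OF u(2)]])
      show "- C0 * wt p \<le> wt p * pot (u n) p" for p
        using mult_left_mono[OF pot_lower[of "u n" p] less_imp_le[OF wt_pos[of p]]] by (simp add: mult.commute)
    qed (use wt_integrable in auto)
    moreover have "inverse (real (Suc n)) \<le> 1" by (simp add: inverse_eq_divide)
    ultimately show ?thesis using u(3)[of n] by (simp add: J_def)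
  qed
  obtain r :: "nat \<Rightarrow> nat" where r: "strict_mono r" "AE p in M. \<forall>i. convergent (\<lambda>k. u (r k) i p)"
  proof (rule common_convergent_subseq[where M = M and v = u])
    fix i and s :: "nat \<Rightarrow> nat"
    obtain r where "strict_mono r" "AE p in M. convergent (\<lambda>k. u (s (r k)) i p)"
    proof (rule rellich_weak_deriv[OF open_Q, of "\<lambda>n. u (s n) i" "\<lambda>n c. weak_deriv Q c (u (s n) i)"])
      show "has_weak_deriv Q c (u (s n) i) (weak_deriv Q c (u (s n) i))" if "c \<in> Basis" for n c
        using u(2) that by (intro deriv_works) (auto simp: bounded_finite_def)
      show "AE p in M. 0 \<le> u (s n) i p \<and> u (s n) i p \<le> 1" for n
        using u(2)[of "s n"] unfolding bounded_finite_def by (auto elim: eventually_mono)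
      fix K assume K: "compact K" "K \<subseteq> Q"
      obtain C where C: "C \<ge> 0" "\<forall>v i. \<forall>c\<in>Basis. bounded_finite v \<longrightarrow> (LINT p|lebesgue_on K. \<bar>weak_deriv Q c (v i) p\<bar>) \<le> C * ((LINT p|M. wt p) + grad_energy v / \<epsilon>)"
        using compact_gradient_bound[OF K] by blast
      have "(LINT p|lebesgue_on K. \<bar>weak_deriv Q c (u (s n) i) p\<bar>) \<le> C * ((LINT p|M. wt p) + (m + 1 + C0 * (LINT p|M. wt p)) / \<epsilon>)"
        if c: "c \<in> Basis" for n c
      proof -
        have "(LINT p|lebesgue_on K. \<bar>weak_deriv Q c (u (s n) i) p\<bar>) \<le> C * ((LINT p|M. wt p) + grad_energy (u (s n)) / \<epsilon>)"
          using C(2) c u(2) by blast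
        also have "\<dots> \<le> C * ((LINT p|M. wt p) + (m + 1 + C0 * (LINT p|M. wt p)) / \<epsilon>)"
          using C(1) \<epsilon> grad_energy_u by (intro mult_left_mono add_left_mono divide_right_mono) auto
        finally show ?thesis .
      qed
      then show "\<exists>C. \<forall>n. \<forall>c\<in>Basis. (LINT p|lebesgue_on K. \<bar>weak_deriv Q c (u (s n) i) p\<bar>) \<le> C" by blast
    qed
    then show "\<exists>r :: nat \<Rightarrow> nat. strict_mono r \<and> (AE p in M. convergent (\<lambda>k. u (s (r k)) i p))" by blast
  qed
  define v where "v n = u (r n)" for n
  have v: "v n \<in> W" "bounded_finite (v n)" for n using u by (auto simp: v_def)
  \<comment> \<open>A subsequence satisfies \<open>r n \<ge> n\<close>, so the rate 1/(n+1) is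
    kept.\<close>
  have Jv: "J (v n) < m + inverse (real (Suc n))" for n
  proof -
    have "inverse (real (Suc (r n))) \<le> inverse (real (Suc n))"
      using seq_suble[OF r(1), of n] by (intro le_imp_inverse_le) auto
    with u(3)[of "r n"] show ?thesis unfolding v_def by linarith
  qed
  have vm: "v n i \<in> borel_measurable M" for n i using v(2)[of n] by (intro v_measurable) (auto simp: bounded_finite_def)
  have vb: "AE p in M. \<forall>n. \<forall>i. 0 \<le> v n i p \<and> v n i p \<le> 1"
    using v(2) unfolding bounded_finite_def AE_all_countable by blast
  \<comment> \<open>At this stage \<open>V\<close> is only a measurable pointwise limit; its
    derivatives come from the strong limit of the midpoints below.\<close>
  define V where "V i p = lim (\<lambda>n. v n i p)" for i p
  have conv: "AE p in M. \<forall>i. (\<lambda>n. v n i p) \<longlonglongrightarrow> V i p"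
    using r(2) by eventually_elim (auto simp: V_def v_def convergent_LIMSEQ_iff)
  have Vm: "V i \<in> borel_measurable M" for i unfolding V_def[abs_def] by (rule borel_measurable_lim_metric[OF vm])
  have Vb: "AE p in M. \<forall>i. 0 \<le> V i p \<and> V i p \<le> 1"
    using conv vb
  proof eventually_elim
    case (elim p)
    show ?case using elim LIMSEQ_le_const[of "\<lambda>n. v n _ p"] LIMSEQ_le_const2[of "\<lambda>n. v n _ p"] by blast
  qed
  have pot_energy_lim: "(\<lambda>n. pot_energy (v n)) \<longlonglongrightarrow> pot_energy V"
    unfolding pot_energy_def
  proof (rule integral_dominated_convergence[where w = "\<lambda>p. C1 * wt p"])
    show "(\<lambda>p. wt p * pot V p) \<in> borel_measurable M"
      using pot_measurable_gen[OF Vm] borel_imp_M[OF wt_measurable] by simp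
    show "(\<lambda>p. wt p * pot (v n) p) \<in> borel_measurable M" for n using ip[OF v(2)] by simp
    show "integrable M (\<lambda>p. C1 * wt p)" using wt_integrable by auto
    show "AE p in M. (\<lambda>n. wt p * pot (v n) p) \<longlonglongrightarrow> wt p * pot V p"
      using conv
    proof eventually_elim
      case (elim p)
      have F: "isCont (F i) x" for i x using F_cont[of i] by (simp add: continuous_on_eq_continuous_at)
      show ?case unfolding pot_def by (intro tendsto_intros isCont_tendsto_compose[OF F] elim[rule_format])
    qed
    show "AE p in M. norm (wt p * pot (v n) p) \<le> C1 * wt p" for n
      using vb
    proof eventually_elim
      case (elim p)
      have "\<bar>pot (v n) p\<bar> \<le> C1" using elim by (intro pot_upper) auto
      then show ?case using wt_pos[of p] by (simp add: abs_mult mult.commute)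
    qed
  qed
  have C: "x \<in> W \<and> bounded_finite x" if "x \<in> midpoints v n" for x n
    using that by induction (auto simp: v mid bounded_finite_midpoint(1))
  \<comment> \<open>What the infimum leaves for the quadratic part once the potential is that of
    \<open>V\<close>.\<close>
  define L where "L = m - pot_energy V"
  obtain y where y: "\<And>n. y n \<in> midpoints v n" "\<And>n. grad_energy (y n) \<le> L + inverse (real (Suc n))"
    "\<And>e. e > 0 \<Longrightarrow> \<exists>N. \<forall>k\<ge>N. \<forall>l\<ge>N. grad_dist (y k) (y l) < e"
  proof (rule almost_minimal_Cauchy[of "midpoints v" grad_energy grad_dist L])
    show "\<exists>z\<in>midpoints v n. grad_energy z \<le> grad_energy x / 2 + grad_energy y / 2 - grad_dist x y / 4" if "x \<in> midpoints v n" "y \<in> midpoints v n" for n x y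
      using bounded_finite_midpoint(2)[of x y] C[OF that(1)] C[OF that(2)] midpoints.step[OF that] by (intro bexI[of _ "midpoint_fun x y"]) auto
    fix e :: real assume e: "e > 0"
    \<comment> \<open>The quadratic part of \<open>v n\<close> is \<open>J (v n)\<close> minus its
      potential part, and the latter converges to the potential part of \<open>V\<close>.\<close>
    have "(\<lambda>n. m + inverse (real (Suc n)) - pot_energy (v n)) \<longlonglongrightarrow> m + 0 - pot_energy V"
      by (intro tendsto_intros LIMSEQ_inverse_real_of_nat pot_energy_lim)
    then have "\<forall>\<^sub>F n in sequentially. m + inverse (real (Suc n)) - pot_energy (v n) < L + e"
      using e by (intro order_tendstoD) (auto simp: L_def)
    then obtain N where N: "\<And>n. n \<ge> N \<Longrightarrow> m + inverse (real (Suc n)) - pot_energy (v n) < L + e" by (auto simp: eventually_sequentially)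
    have "grad_energy (v n) < L + e" if "n \<ge> N" for n using N[OF that] Jv[of n] unfolding J_def by linarith
    then show "\<exists>N. \<forall>n\<ge>N. \<exists>x\<in>midpoints v n. grad_energy x < L + e" using midpoints.base[of _ _ v] by blast
  qed (auto simp: grad_energy_nonneg dest: midpoints_antimono)
  have yW: "y n \<in> W" and yg: "bounded_finite (y n)" and yU: "y n \<in> \<U> \<Omega>" for n using C[OF y(1)[of n]] by (auto simp: bounded_finite_def)
  have yb: "AE p in M. \<forall>n. \<forall>i. 0 \<le> y n i p \<and> y n i p \<le> 1"
    using yg unfolding bounded_finite_def AE_all_countable by blast
  have yconv: "AE p in M. \<forall>i. (\<lambda>n. y n i p) \<longlonglongrightarrow> V i p"
    using conv by eventually_elim (auto intro: midpoints_tendsto[OF y(1)])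
  have yl: "wD (y n) i c \<in> L2_space M" if "c \<in> Basis" for n i c using yg[of n] that by (auto simp: bounded_finite_def)
  \<comment> \<open>The L2 limits of the weighted derivatives of the midpoints. They exist by
    completeness, since \<open>grad_dist\<close> controls each single distance up to the factor
    \<epsilon>.\<close>
  define H where "H i c = (SOME h. h \<in> L2_space M \<and> (\<lambda>n. l2d M (wD (y n) i c) h) \<longlonglongrightarrow> 0)" for i c
  have H: "H i c \<in> L2_space M" "(\<lambda>n. l2d M (wD (y n) i c) (H i c)) \<longlonglongrightarrow> 0" if c: "c \<in> Basis" for i c
  proof -
    obtain h where "h \<in> L2_space M" "(\<lambda>n. l2d M (wD (y n) i c) h) \<longlonglongrightarrow> 0"
    proof (rule L2_complete[OF yl[OF c]])
      fix e :: real assume "e > 0"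
      then obtain N where N: "\<And>k l. k \<ge> N \<Longrightarrow> l \<ge> N \<Longrightarrow> grad_dist (y k) (y l) < \<epsilon> * e" using y(3)[of "\<epsilon> * e"] \<epsilon> by auto
      have "l2d M (wD (y k) i c) (wD (y l) i c) < e" if "k \<ge> N" "l \<ge> N" for k l
        using le_less_trans[OF l2d_le_grad_dist[OF c] N[OF that]] \<epsilon> by simp
      then show "\<exists>N. \<forall>k\<ge>N. \<forall>l\<ge>N. l2d M (wD (y k) i c) (wD (y l) i c) < e" by blast
    qed
    then have "\<exists>h. h \<in> L2_space M \<and> (\<lambda>n. l2d M (wD (y n) i c) h) \<longlonglongrightarrow> 0" by blast
    from someI_ex[OF this] show "H i c \<in> L2_space M" "(\<lambda>n. l2d M (wD (y n) i c) (H i c)) \<longlonglongrightarrow> 0" by (auto simp: H_def)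
  qed
  \<comment> \<open>Removing the root of the weight gives the candidate for the derivative of
    \<open>V i\<close> in direction \<open>c\<close>.\<close>
  define G where "G i c p = H i c p / sqrt (wt p)" for i c p
  have Gm: "G i c \<in> borel_measurable M" if "c \<in> Basis" for i c
    unfolding G_def[abs_def] using L2_D(1)[OF H(1)[OF that]]
    by (intro borel_measurable_divide measurable_compose[OF borel_imp_M[OF wt_measurable] borel_measurable_sqrt])
  have Gsq: "wt p * (G i c p)\<^sup>2 = (H i c p)\<^sup>2" for i c p using wt_pos[of p] by (simp add: G_def power_divide)
  have DG: "wt p * (weak_deriv Q c (y n i) p - G i c p)\<^sup>2 = (wD (y n) i c p - H i c p)\<^sup>2" for n i c p
  proof -
    have "wD (y n) i c p - H i c p = sqrt (wt p) * (weak_deriv Q c (y n i) p - G i c p)"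
      using wt_pos[of p] by (simp add: wD_def G_def right_diff_distrib)
    then show ?thesis using wt_pos[of p] by (simp add: power_mult_distrib)
  qed
  have GL2: "G i c \<in> L2_space (lebesgue_on (QT T))" if "c \<in> Basis" for i c T
    by (rule restrict_QT_L2(1)[OF Gm[OF that]]) (use L2_D(2)[OF H(1)[OF that]] in \<open>simp add: Gsq\<close>)
  have VL2: "V i \<in> L2_space (lebesgue_on (QT T))" for i T
  proof (rule restrict_QT_L2(1)[OF Vm])
    show "integrable M (\<lambda>p. wt p * (V i p)\<^sup>2)"
    proof (rule Bochner_Integration.integrable_bound[OF wt_integrable])
      show "AE p in M. norm (wt p * (V i p)\<^sup>2) \<le> norm (wt p)"
        using Vb by eventually_elim (use wt_pos in \<open>auto simp: abs_mult less_imp_le power_le_one mult_left_le\<close>)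
    qed (use Vm borel_imp_M[OF wt_measurable] in simp)
  qed
  have lD: "(\<lambda>n. l2d (lebesgue_on (QT T)) (weak_deriv Q c (y n i)) (G i c)) \<longlonglongrightarrow> 0" if c: "c \<in> Basis" for i c T
  proof (rule tendsto_squeeze_0[OF _ l2d_nonneg])
    show "(\<lambda>n. exp (T / \<epsilon>) * l2d M (wD (y n) i c) (H i c)) \<longlonglongrightarrow> 0" by (rule tendsto_mult_right_zero[OF H(2)[OF c]])
    show "l2d (lebesgue_on (QT T)) (weak_deriv Q c (y n i)) (G i c) \<le> exp (T / \<epsilon>) * l2d M (wD (y n) i c) (H i c)" for n
      unfolding l2d_def DG[symmetric]
      by (rule restrict_QT_L2(2)) (use deriv_measurable[OF yU c] Gm[OF c] L2_D(2)[OF L2_diff[OF yl[OF c] H(1)[OF c]]] in \<open>simp_all add: DG\<close>)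
  qed
  \<comment> \<open>The functions themselves converge in L2 because values in [0, 1] allow the
    weight as majorant of the weighted squared differences.\<close>
  have ly: "(\<lambda>n. l2d (lebesgue_on (QT T)) (y n i) (V i)) \<longlonglongrightarrow> 0" for i T
  proof (rule tendsto_squeeze_0[OF _ l2d_nonneg])
    let ?f = "\<lambda>n p. wt p * (y n i p - V i p)\<^sup>2"
    have m: "?f n \<in> borel_measurable M" for n using v_measurable[OF yU] Vm borel_imp_M[OF wt_measurable] by simp
    have dom: "AE p in M. norm (?f n p) \<le> wt p" for n
      using yb Vb
    proof eventually_elim
      case (elim p)
      have "\<bar>y n i p - V i p\<bar> \<le> 1" using elim(1)[rule_format, of n i] elim(2)[rule_format, of i] by linarith
      then have "(y n i p - V i p)\<^sup>2 \<le> 1" by (simp add: abs_square_le_1)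
      then show ?case using wt_pos[of p] by (simp add: abs_mult mult_left_le)
    qed
    have i: "integrable M (?f n)" for n
      by (rule Bochner_Integration.integrable_bound[OF wt_integrable m]) (use dom[of n] wt_pos in \<open>auto elim!: eventually_mono simp: less_imp_le\<close>)
    have "(\<lambda>n. LINT p|M. ?f n p) \<longlonglongrightarrow> (LINT p|M. 0)"
    proof (rule integral_dominated_convergence[OF _ m wt_integrable _ dom])
      show "AE p in M. (\<lambda>n. ?f n p) \<longlonglongrightarrow> 0"
        using yconv
      proof eventually_elim
        case (elim p)
        have "(\<lambda>n. ?f n p) \<longlonglongrightarrow> wt p * (V i p - V i p)\<^sup>2" by (intro tendsto_intros elim[rule_format])
        then show ?case by simp
      qed
    qed simp
    then show "(\<lambda>n. exp (T / \<epsilon>) * (LINT p|M. ?f n p)) \<longlonglongrightarrow> 0" by (intro tendsto_mult_right_zero) simp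
    show "l2d (lebesgue_on (QT T)) (y n i) (V i) \<le> exp (T / \<epsilon>) * (LINT p|M. ?f n p)" for n
      unfolding l2d_def by (rule restrict_QT_L2(2)[OF _ i]) (use v_measurable[OF yU] Vm in simp)
  qed
  have wT: "has_weak_deriv (QT T) c (V i) (G i c)" if c: "c \<in> Basis" and T: "T > 0" for i c T
    by (rule has_weak_deriv_closed[OF open_QT deriv_QT(1)[OF yU c T] H1_D(1)[OF open_QT \<U>_D[OF yU T]] deriv_QT(2)[OF yU c T] VL2 GL2[OF c] ly lD[OF c]])
  have VU: "V \<in> \<U> \<Omega>" unfolding \<U>_def using H1_I[OF VL2 wT GL2] by blast
  have VW: "V \<in> W"
  proof (rule cl[OF yW VU])
    fix T :: real and i assume T: "T > 0"
    have "h1d (QT T) (y n i) (V i) = l2d (lebesgue_on (QT T)) (y n i) (V i) + (\<Sum>c\<in>Basis. l2d (lebesgue_on (QT T)) (weak_deriv Q c (y n i)) (G i c))" for n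
      by (rule h1d_eq[OF open_QT deriv_QT(1)[OF yU _ T] wT[OF _ T]])
    moreover have "(\<lambda>n. l2d (lebesgue_on (QT T)) (y n i) (V i) + (\<Sum>c\<in>Basis. l2d (lebesgue_on (QT T)) (weak_deriv Q c (y n i)) (G i c))) \<longlonglongrightarrow> 0 + (\<Sum>c\<in>(Basis :: ('a \<times> real) set). 0)"
      by (intro tendsto_add tendsto_sum ly lD)
    ultimately show "(\<lambda>n. h1d (QT T) (y n i) (V i)) \<longlonglongrightarrow> 0" by simp
  qed
  have wQ: "has_weak_deriv Q c (V i) (G i c)" if "c \<in> Basis" for i c
    unfolding cylinder_Union[symmetric] by (rule has_weak_deriv_exhaust[OF open_QT]) (auto simp: incseq_def intro: wT[OF that])
  have VH: "AE p in M. H i c p = wD V i c p" if c: "c \<in> Basis" for i c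
    using weak_deriv_works(2)[OF open_Q wQ[OF c, of i]] by eventually_elim (use wt_pos in \<open>simp add: wD_def G_def less_imp_neq[symmetric]\<close>)
  have Vl: "wD V i c \<in> L2_space M" if c: "c \<in> Basis" for i c
    by (rule L2_cong_AE[OF H(1)[OF c] wD_measurable[OF VU c] VH[OF c]])
  have gV: "bounded_finite V" using VU Vb Vl by (simp add: bounded_finite_def)
  have VH': "(LINT p|M. (wD V i c p)\<^sup>2) = (LINT p|M. (H i c p)\<^sup>2)" if c: "c \<in> Basis" for i c
  proof (rule integral_cong_AE)
    show "AE p in M. (wD V i c p)\<^sup>2 = (H i c p)\<^sup>2" using VH[OF c, of i] by eventually_elim simp
  qed (use L2_D(1)[OF H(1)[OF c]] L2_D(1)[OF Vl[OF c]] in auto)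
  \<comment> \<open>Strong convergence of the weighted derivatives makes the quadratic parts
    converge, so the bound \<open>L\<close> passes to \<open>V\<close>.\<close>
  have "(\<lambda>n. grad_energy (y n)) \<longlonglongrightarrow> grad_energy V"
    unfolding grad_energy_def by (intro tendsto_sum tendsto_mult tendsto_const) (simp add: VH' L2_norm_tendsto[OF yl H])
  moreover have "(\<lambda>n. L + inverse (real (Suc n))) \<longlonglongrightarrow> L + 0" by (intro tendsto_intros LIMSEQ_inverse_real_of_nat)
  ultimately have "grad_energy V \<le> L + 0" by (rule LIMSEQ_le) (use y(2) in auto)
  then have JV: "J V \<le> m" by (simp add: J_def L_def)
  \<comment> \<open>A competitor of finite energy is first truncated, which puts it into the class
    over which \<open>m\<close> is the infimum.\<close>
  have "\<E> V \<le> \<E> w" if w: "w \<in> W" for w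
  proof (cases "\<E> w < \<infinity>")
    case True
    have "\<E> V = ereal (J V)" using energy_bounded_finite(2)[OF gV] by (simp add: J_def)
    also have "\<dots> \<le> ereal (J (truncate w))" using JV m_le[OF tr[OF w] trunc(1)[OF w True]] by simp
    also have "\<dots> = \<E> (truncate w)" using energy_bounded_finite(2)[OF trunc(1)[OF w True]] by (simp add: J_def)
    also have "\<dots> \<le> \<E> w" by (rule trunc(2)[OF w True])
    finally show ?thesis .
  qed auto
  then show thesis using VW by (intro that[of V]) (auto simp: is_arg_min_def not_less)
qed

end

text \<open>Monotonicity is known on the open half-line only; continuity carries the inequality to
  its endpoint.\<close>

lemma mono_on_le_endpoint:
  fixes f :: "real \<Rightarrow> real"
  assumes f: "continuous_on UNIV f" and m: "mono_on {..<a} f" and s: "s < a"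
  shows "f s \<le> f a"
proof (rule tendsto_lowerbound)
  have "isCont f a" using f by (simp add: continuous_on_eq_continuous_at)
  then show "(f \<longlongrightarrow> f a) (at_left a)" unfolding isCont_def by (rule tendsto_mono[OF at_le, rotated]) simp
  show "\<forall>\<^sub>F x in at_left a. f s \<le> f x"
    unfolding eventually_at_left[OF s] using m s by (intro exI[of _ s]) (auto simp: mono_on_def)
qed simp

lemma antimono_on_le_endpoint:
  fixes f :: "real \<Rightarrow> real"
  assumes f: "continuous_on UNIV f" and m: "antimono_on {a<..} f" and s: "a < s"
  shows "f s \<le> f a"
proof (rule tendsto_lowerbound)
  have "isCont f a" using f by (simp add: continuous_on_eq_continuous_at)
  then show "(f \<longlongrightarrow> f a) (at_right a)" unfolding isCont_def by (rule tendsto_mono[OF at_le, rotated]) simp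
  show "\<forall>\<^sub>F x in at_right a. f s \<le> f x"
    unfolding eventually_at_right[OF s] using m s by (intro exI[of _ s]) (auto simp: monotone_on_def)
qed simp

theorem theorem2p1:
  fixes \<Omega> :: "'a::euclidean_space set"
    and A :: "real^'k^'k"
    and F :: "'k::finite \<Rightarrow> real \<Rightarrow> real"
    and v0 g0 :: "'k \<Rightarrow> 'a \<Rightarrow> real"
    and U0 :: "('k \<Rightarrow> 'a \<times> real \<Rightarrow> real) set"
  assumes "bounded_smooth_domain \<Omega>"
    and "CARD('k) \<ge> 2"
    and "transpose A = A"
    and "\<And>i. A $ i $ i = 0"
    and "\<And>i j. i \<noteq> j \<Longrightarrow> A $ i $ j > 0"
    and "\<And>i. continuous_on UNIV (F i)"
    and "\<And>i. F i differentiable_on {0..<1}"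
    and "\<And>i. mono_on {..<0} (F i)"
    and "\<And>i. antimono_on {1<..} (F i)"
    and "\<And>i. (F i has_real_derivative 0) (at 0 within {0..<1})"
    and "\<And>i. v0 i \<in> H1_space \<Omega>"
    and "\<And>i. AE x in lebesgue_on \<Omega>. 0 \<le> v0 i x \<and> v0 i x \<le> 1"
    and "\<And>i j. i \<noteq> j \<Longrightarrow> AE x in lebesgue_on \<Omega>. v0 i x * v0 j x = 0"
    and "\<And>i. boundary_trace \<Omega> (v0 i) (g0 i)"
    and "U0 \<in> {\<U>_initial \<Omega> v0 \<inter> \<U>_boundary \<Omega> g0, \<U>_initial \<Omega> v0, \<U>_boundary \<Omega> g0}"
  shows "\<forall>\<epsilon>\<in>{0<..<1}. \<forall>\<beta>>0.
    (\<exists>v. is_arg_min (energy \<Omega> A F \<epsilon> \<beta>) (\<lambda>w. w \<in> U0) v) \<and>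
    (\<forall>v. is_arg_min (energy \<Omega> A F \<epsilon> \<beta>) (\<lambda>w. w \<in> U0) v \<longrightarrow>
       (\<forall>i. AE p in lebesgue_on (\<Omega> \<times> {0<..}). 0 \<le> v i p \<and> v i p \<le> 1))"
proof (intro ballI allI impI)
  fix \<epsilon> \<beta> :: real assume \<epsilon>: "\<epsilon> \<in> {0<..<1}" and \<beta>: "\<beta> > 0"
  have \<Omega>: "open \<Omega>" "bounded \<Omega>" using assms(1) by (auto simp: bounded_smooth_domain_def)
  interpret energy_setting \<Omega> A F \<epsilon> \<beta>
  proof (rule energy_setting.intro)
    show "0 \<le> A $ i $ j" for i j using assms(4)[of i] assms(5)[of i j] by (cases "i = j") auto
    show "F i s \<le> F i 0" if "s < 0" for i s by (rule mono_on_le_endpoint[OF assms(6,8) that])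
    show "F i s \<le> F i 1" if "1 < s" for i s by (rule antimono_on_le_endpoint[OF assms(6,9) that])
    show "0 < \<epsilon>" "\<epsilon> < 1" "0 < \<beta>" using \<epsilon> \<beta> by auto
    show "open \<Omega>" "bounded \<Omega>" by (fact \<Omega>)+
    show "continuous_on UNIV (F i)" for i by (fact assms(6))
  qed
  have I: "admissible \<Omega> v0 (\<U>_initial \<Omega> v0)" by (rule admissible_initial[OF \<Omega> assms(11,12,14)])
  have B: "admissible \<Omega> v0 (\<U>_boundary \<Omega> g0)" by (rule admissible_boundary[OF \<Omega> assms(11,12,14)])
  have W: "admissible \<Omega> v0 U0"
    using assms(15) by (elim insertE emptyE) (simp_all only: I B admissible_Int[OF I B])
  have fin: "\<E> (stationary v0) < \<infinity>" by (rule stationary_finite_energy[OF assms(11,12)])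
  obtain V where V: "is_arg_min \<E> (\<lambda>w. w \<in> U0) V" by (rule minimizer_exists[OF W fin])
  \<comment> \<open>The stationary function is the competitor of finite energy that the bound on
    minimizers asks for.\<close>
  have U: "\<exists>u\<in>U0. \<E> u < \<infinity>" using W fin unfolding admissible_def by blast
  show "(\<exists>v. is_arg_min \<E> (\<lambda>w. w \<in> U0) v) \<and>
    (\<forall>v. is_arg_min \<E> (\<lambda>w. w \<in> U0) v \<longrightarrow> (\<forall>i. AE p in M. 0 \<le> v i p \<and> v i p \<le> 1))"
    by (intro conjI exI[of _ V] V allI impI minimizer_bounds[OF W U])
qed

end
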